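(* Let $(X,\omega)$ be a symplectic manifold of dimension $2n$, let $L$ be an oriented manifold of dimension $n$, and let $d\in H_n(X)$. Let $\beta$ be a closed $n$-form on $X$ with $\omega\wedge\beta=0$ (and $\int_d\beta=0$ if $L$ is compact). Suppose there exist forms $\lambda,\gamma$ on $X$ and a constant $c\neq-1$ such that $$d\lambda=\omega,\qquad d\gamma=\beta,\qquad \lambda\wedge\beta=-c\,\omega\wedge\gamma .$$ Let $\Lambda=\{\Lambda_t\}_{t\in[0,1]}$ be an exact compactly supported Lagrangian path in $\mathcal{L}(X,L,d)$ with associated family of Hamiltonian functions $h_t:\Lambda_t\to\mathbb{R}$, $\frac{d}{dt}\Lambda_t=dh_t$, where $h_t$ is taken with compact support if $L$ is non-compact, and let $\mathcal{C}(\Lambda)=\int_0^1dt\int_{\Lambda_t}h_t\beta$. Then $$\mathcal{C}(\Lambda)=\frac{1}{c+1}\left(\int_{\Lambda_0}\lambda\wedge\gamma-\int_{\Lambda_1}\lambda\wedge\gamma\right).$$ So $\mathcal{C}(\Lambda)$ depends only on $\Lambda_0$ and $\Lambda_1$.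
   Context: Space of Lagrangians: $\mathcal{X}(X,L,d)$ is the set of Lagrangian embeddings $f:L\to X$ ($f^*\omega=0$) which, if $L$ is compact, represent $d$; if $L$ is non-compact, all $f\in\mathcal{X}$ are required to agree with a given $f_0$ outside a compact subset of $L$. $\mathcal{G}$ is the group of orientation preserving compactly supported diffeomorphisms of $L$, acting by $f\mapsto f\circ\psi$, and $\mathcal{L}(X,L,d)=\mathcal{X}/\mathcal{G}$; the class $[f]$ is identified with the oriented Lagrangian submanifold $f(L)\subset X$. A path $\Lambda:[0,1]\to\mathcal{L}$ is smooth if it has a lifting $f:[0,1]\to\mathcal{X}$ with $(t,p)\mapsto f_t(p)$ smooth; all paths are smooth. Derivative: for a smooth path $\Lambda_t$ with lifting $f_t$ and $v_t=\frac{d}{dt}f_t$, define $\frac{d}{dt}\Lambda_t=(f_t)_*(i_{v_t}\omega)\in A^1(\Lambda_t)$, where $(i_{v_t}\omega)(\xi)|_p=\omega(v_t(p),df_t(\xi(p)))$; it is a closed 1-form on $\Lambda_t$ independent of the lifting. A path is exact if for each $t$ there is $h_t:\Lambda_t\to\mathbb{R}$ with $\frac{d}{dt}\Lambda_t=dh_t$ (an associated family of Hamiltonian functions); it is compactly supported if an associated family of compactly supported functions exists. If $L$ is non-compact, $\Lambda_0$ and $\Lambda_1$ coincide outside a compact set, and the difference of integrals is understood as the difference over a compact part outside which they coincide: if $f_0,f_1\in\mathcal{X}$ represent $\Lambda_0,\Lambda_1$ and agree outside a compact $K\subset L$, it is $\int_K f_0^*(\lambda\wedge\gamma)-\int_K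 f_1^*(\lambda\wedge\gamma)$.
   Formalization: For non-compact L, a smooth path is also required to have a lifting whose maps f_t all agree outside one compact subset of L independent of t; without this a bump of fixed area coming in from infinity violates the formula. *)

theory Defs
  imports "HOL-Analysis.Analysis" "HOL-Homology.Homology"
begin

section \<open>Smooth functions on subsets of Euclidean spaces\<close>

(* C^k functions on an open set S. *)
primrec C_k :: "nat \<Rightarrow> 'a::euclidean_space set \<Rightarrow> ('a \<Rightarrow> 'b::real_normed_vector) \<Rightarrow> bool" where
  "C_k 0 S f \<longleftrightarrow> continuous_on S f"
| "C_k (Suc k) S f \<longleftrightarrow>
     f differentiable_on S \<and> (\<forall>b\<in>Basis. C_k k S (\<lambda>x. frechet_derivative f (at x) b))"

(* For arbitrary S: local C^infinity extensions to open sets.  Sets that are not open occur for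
   families parametrised by the closed interval and for singular simplices. *)
definition smooth_on :: "'a::euclidean_space set \<Rightarrow> ('a \<Rightarrow> 'b::real_normed_vector) \<Rightarrow> bool" where
  "smooth_on S f \<longleftrightarrow>
     (\<forall>x\<in>S. \<exists>U g. open U \<and> x \<in> U \<and> (\<forall>k. C_k k U g) \<and> (\<forall>y\<in>S \<inter> U. g y = f y))"


section \<open>Manifolds\<close>

type_synonym ('a, 'e) chart = "'a set \<times> ('a \<Rightarrow> 'e)"

record ('a, 'e) manifold =
  top_of :: "'a topology"
  atlas_of :: "('a, 'e) chart set"

abbreviation points :: "('a, 'e) manifold \<Rightarrow> 'a set" where
  "points M \<equiv> topspace (top_of M)"

definition chart_image :: "('a, 'e) chart \<Rightarrow> 'e set" where
  "chart_image c = snd c ` fst c"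

definition chart_inv :: "('a, 'e) chart \<Rightarrow> 'e \<Rightarrow> 'a" where
  "chart_inv c = inv_into (fst c) (snd c)"

definition is_chart :: "'a topology \<Rightarrow> ('a, 'e::euclidean_space) chart \<Rightarrow> bool" where
  "is_chart T c \<longleftrightarrow> openin T (fst c) \<and> open (chart_image c) \<and>
     homeomorphic_map (subtopology T (fst c)) (top_of_set (chart_image c)) (snd c)"

definition smoothly_compatible ::
    "('a, 'e::euclidean_space) chart \<Rightarrow> ('a, 'e) chart \<Rightarrow> bool" where
  "smoothly_compatible c c' \<longleftrightarrow>
     smooth_on (snd c ` (fst c \<inter> fst c')) (snd c' \<circ> chart_inv c) \<and>
     smooth_on (snd c' ` (fst c \<inter> fst c')) (snd c \<circ> chart_inv c')"

definition orientedly_compatible ::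
    "('a, real^'n) chart \<Rightarrow> ('a, real^'n) chart \<Rightarrow> bool" where
  "orientedly_compatible c c' \<longleftrightarrow> smoothly_compatible c c' \<and>
     (\<forall>p\<in>fst c \<inter> fst c'.
        0 < det (matrix (frechet_derivative (snd c' \<circ> chart_inv c) (at (snd c p)))))"

definition manifold_with ::
    "(('a, 'e) chart \<Rightarrow> ('a, 'e) chart \<Rightarrow> bool) \<Rightarrow> ('a, 'e::euclidean_space) manifold \<Rightarrow> bool" where
  "manifold_with R M \<longleftrightarrow>
     Hausdorff_space (top_of M) \<and> second_countable (top_of M) \<and>
     (\<forall>c\<in>atlas_of M. is_chart (top_of M) c) \<and>
     (\<Union>c\<in>atlas_of M. fst c) = points M \<and>
     (\<forall>c\<in>atlas_of M. \<forall>c'\<in>atlas_of M. R c c') \<and>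
     (\<forall>c. is_chart (top_of M) c \<and> (\<forall>c'\<in>atlas_of M. R c c') \<longrightarrow> c \<in> atlas_of M)"

abbreviation smooth_manifold :: "('a, 'e::euclidean_space) manifold \<Rightarrow> bool" where
  "smooth_manifold \<equiv> manifold_with smoothly_compatible"

(* The atlas of an oriented manifold consists of the positively oriented charts only. *)
abbreviation oriented_manifold :: "('a, real^'n) manifold \<Rightarrow> bool" where
  "oriented_manifold \<equiv> manifold_with orientedly_compatible"

definition smooth_function :: "('a, 'e::euclidean_space) manifold \<Rightarrow> ('a \<Rightarrow> real) \<Rightarrow> bool" where
  "smooth_function M h \<longleftrightarrow> (\<forall>c\<in>atlas_of M. smooth_on (chart_image c) (h \<circ> chart_inv c))"

definition smooth_map ::
    "('a, 'd::euclidean_space) manifold \<Rightarrow> ('b, 'e::euclidean_space) manifold \<Rightarrow> ('a \<Rightarrow> 'b) \<Rightarrow> bool" where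
  "smooth_map M N f \<longleftrightarrow> continuous_map (top_of M) (top_of N) f \<and>
     (\<forall>c\<in>atlas_of M. \<forall>c'\<in>atlas_of N.
        smooth_on (snd c ` {p \<in> fst c. f p \<in> fst c'}) (snd c' \<circ> f \<circ> chart_inv c))"


section \<open>Tangent vectors\<close>

(* A tangent vector at p is the family of its components in the charts around p, transforming by
   the derivatives of the transition maps, and 0 on all other pairs. *)
type_synonym ('a, 'e) tangent = "('a, 'e) chart \<Rightarrow> 'e"

(* The image under dg(x) of the vector w, for g a map from a Euclidean space to M. *)
definition push_vector ::
    "('a, 'e::euclidean_space) manifold \<Rightarrow> ('d::euclidean_space \<Rightarrow> 'a) \<Rightarrow> 'd \<Rightarrow> 'd \<Rightarrow> ('a, 'e) tangent" where
  "push_vector M g x w = (\<lambda>c. if c \<in> atlas_of M \<and> g x \<in> fst c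
     then frechet_derivative (\<lambda>y. snd c (g y)) (at x) w else 0)"

definition tangent_space ::
    "('a, 'e::euclidean_space) manifold \<Rightarrow> 'a \<Rightarrow> ('a, 'e) tangent set" where
  "tangent_space M p = {v. \<forall>c\<in>atlas_of M. p \<in> fst c \<longrightarrow>
     v = push_vector M (chart_inv c) (snd c p) (v c)}"

definition chart_at :: "('a, 'e) manifold \<Rightarrow> 'a \<Rightarrow> ('a, 'e) chart" where
  "chart_at M p = (SOME c. c \<in> atlas_of M \<and> p \<in> fst c)"

definition tangent_map ::
    "('a, 'd::euclidean_space) manifold \<Rightarrow> ('b, 'e::euclidean_space) manifold \<Rightarrow> ('a \<Rightarrow> 'b) \<Rightarrow>
     'a \<Rightarrow> ('a, 'd) tangent \<Rightarrow> ('b, 'e) tangent" where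
  "tangent_map M N f p v =
     (let c = chart_at M p in push_vector N (f \<circ> chart_inv c) (snd c p) (v c))"

definition smooth_embedding ::
    "('a, 'd::euclidean_space) manifold \<Rightarrow> ('b, 'e::euclidean_space) manifold \<Rightarrow> ('a \<Rightarrow> 'b) \<Rightarrow> bool" where
  "smooth_embedding M N f \<longleftrightarrow> smooth_map M N f \<and> embedding_map (top_of M) (top_of N) f \<and>
     (\<forall>p\<in>points M. inj_on (tangent_map M N f p) (tangent_space M p))"


section \<open>Differential forms\<close>

(* A k-form takes a point and a list of k tangent vectors at that point; its values on anything
   else carry no meaning, and forms are compared by form_eq. *)
type_synonym ('a, 'e) form = "'a \<Rightarrow> ('a, 'e) tangent list \<Rightarrow> real"

definition form_eq ::
    "('a, 'e::euclidean_space) manifold \<Rightarrow> nat \<Rightarrow> ('a, 'e) form \<Rightarrow> ('a, 'e) form \<Rightarrow> bool" where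
  "form_eq M k \<alpha> \<beta> \<longleftrightarrow>
     (\<forall>p\<in>points M. \<forall>vs. length vs = k \<and> set vs \<subseteq> tangent_space M p \<longrightarrow> \<alpha> p vs = \<beta> p vs)"

abbreviation zero_form :: "('a, 'e) form" where
  "zero_form \<equiv> (\<lambda>p vs. 0)"

abbreviation scale_form :: "('a \<Rightarrow> real) \<Rightarrow> ('a, 'e) form \<Rightarrow> ('a, 'e) form" where
  "scale_form h \<alpha> \<equiv> (\<lambda>p vs. h p * \<alpha> p vs)"

abbreviation function_form :: "('a \<Rightarrow> real) \<Rightarrow> ('a, 'e) form" where
  "function_form h \<equiv> (\<lambda>p vs. h p)"

definition local_form ::
    "('a, 'e::euclidean_space) manifold \<Rightarrow> ('a, 'e) form \<Rightarrow> ('a, 'e) chart \<Rightarrow> 'e \<Rightarrow> 'e list \<Rightarrow> real" where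
  "local_form M \<alpha> c x ws = \<alpha> (chart_inv c x) (map (push_vector M (chart_inv c) x) ws)"

definition alternating_multilinear :: "nat \<Rightarrow> ('e::euclidean_space list \<Rightarrow> real) \<Rightarrow> bool" where
  "alternating_multilinear k A \<longleftrightarrow>
     (\<forall>us vs. length us + length vs + 1 = k \<longrightarrow> linear (\<lambda>w. A (us @ w # vs))) \<and>
     (\<forall>ws i j. length ws = k \<and> i < j \<and> j < k \<and> ws ! i = ws ! j \<longrightarrow> A ws = 0)"

definition differential_form ::
    "('a, 'e::euclidean_space) manifold \<Rightarrow> nat \<Rightarrow> ('a, 'e) form \<Rightarrow> bool" where
  "differential_form M k \<alpha> \<longleftrightarrow> (\<forall>c\<in>atlas_of M.
     (\<forall>x\<in>chart_image c. alternating_multilinear k (local_form M \<alpha> c x)) \<and>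
     (\<forall>ws. length ws = k \<longrightarrow> smooth_on (chart_image c) (\<lambda>x. local_form M \<alpha> c x ws)))"

definition pullback ::
    "('a, 'd::euclidean_space) manifold \<Rightarrow> ('b, 'e::euclidean_space) manifold \<Rightarrow> ('a \<Rightarrow> 'b) \<Rightarrow>
     ('b, 'e) form \<Rightarrow> ('a, 'd) form" where
  "pullback M N f \<alpha> p vs = \<alpha> (f p) (map (tangent_map M N f p) vs)"

(* Normalised so that (a \<and> b)(u,v) = a(u) b(v) - a(v) b(u) for 1-forms. *)
definition wedge :: "nat \<Rightarrow> nat \<Rightarrow> ('a, 'e) form \<Rightarrow> ('a, 'e) form \<Rightarrow> ('a, 'e) form" where
  "wedge k l \<alpha> \<beta> p vs =
     (\<Sum>\<pi> | \<pi> permutes {..<k + l}. of_int (sign \<pi>) *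
        \<alpha> p (map (\<lambda>i. vs ! \<pi> i) [0..<k]) * \<beta> p (map (\<lambda>i. vs ! \<pi> i) [k..<k + l])) /
     (fact k * fact l)"

definition drop_nth :: "nat \<Rightarrow> 'a list \<Rightarrow> 'a list" where
  "drop_nth i ws = take i ws @ drop (Suc i) ws"

(* The invariant formula for d, evaluated on the constant vector fields of a chart (so that the
   bracket terms vanish); normalised so that (da)(u,v) = u(a(v)) - v(a(u)) for 1-forms. *)
definition exterior_derivative ::
    "('a, 'e::euclidean_space) manifold \<Rightarrow> ('a, 'e) form \<Rightarrow> ('a, 'e) form" where
  "exterior_derivative M \<alpha> p vs =
     (let c = chart_at M p; ws = map (\<lambda>v. v c) vs in
      \<Sum>i<length ws. (-1) ^ i *
        frechet_derivative (\<lambda>x. local_form M \<alpha> c x (drop_nth i ws)) (at (snd c p)) (ws ! i))"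

definition closed_form ::
    "('a, 'e::euclidean_space) manifold \<Rightarrow> nat \<Rightarrow> ('a, 'e) form \<Rightarrow> bool" where
  "closed_form M k \<alpha> \<longleftrightarrow> differential_form M k \<alpha> \<and>
     form_eq M (Suc k) (exterior_derivative M \<alpha>) zero_form"

definition symplectic_manifold ::
    "('a, 'e::euclidean_space) manifold \<Rightarrow> ('a, 'e) form \<Rightarrow> bool" where
  "symplectic_manifold X \<omega> \<longleftrightarrow> smooth_manifold X \<and> closed_form X 2 \<omega> \<and>
     (\<forall>p\<in>points X. \<forall>v\<in>tangent_space X p.
        (\<forall>w\<in>tangent_space X p. \<omega> p [v, w] = 0) \<longrightarrow> v = (\<lambda>c. 0))"


section \<open>Integration of top degree forms\<close>

(* The index type is ordered; its order fixes the standard orientation of real^'n. *)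
definition coord_index :: "'n::{finite,wellorder} \<Rightarrow> nat" where
  "coord_index i = card {j. j < i}"

definition standard_frame :: "(real^'n::{finite,wellorder}) list" where
  "standard_frame = map (\<lambda>i. axis i 1) (sorted_list_of_set UNIV)"

definition function_support :: "('a, 'e) manifold \<Rightarrow> ('a \<Rightarrow> real) \<Rightarrow> 'a set" where
  "function_support M h = top_of M closure_of {p \<in> points M. h p \<noteq> 0}"

definition form_support ::
    "('a, 'e::euclidean_space) manifold \<Rightarrow> nat \<Rightarrow> ('a, 'e) form \<Rightarrow> 'a set" where
  "form_support M k \<alpha> = top_of M closure_of
     {p \<in> points M. \<exists>vs. length vs = k \<and> set vs \<subseteq> tangent_space M p \<and> \<alpha> p vs \<noteq> 0}"

definition partition_of_unity_on ::
    "('a, 'e::euclidean_space) manifold \<Rightarrow> 'a set \<Rightarrow> (('a, 'e) chart \<times> ('a \<Rightarrow> real)) set \<Rightarrow> bool" where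
  "partition_of_unity_on M K P \<longleftrightarrow> finite P \<and>
     (\<forall>(c, \<rho>)\<in>P. c \<in> atlas_of M \<and> smooth_function M \<rho> \<and> (\<forall>p\<in>points M. 0 \<le> \<rho> p) \<and>
        compactin (top_of M) (function_support M \<rho>) \<and> function_support M \<rho> \<subseteq> fst c) \<and>
     (\<forall>p\<in>K. (\<Sum>(c, \<rho>)\<in>P. \<rho> p) = 1)"

(* The integral over a compact subset K of an oriented n-manifold; the value does not depend on
   the partition of unity. *)
definition form_integral_over ::
    "('a, real^'n::{finite,wellorder}) manifold \<Rightarrow> 'a set \<Rightarrow> ('a, real^'n::_) form \<Rightarrow> real" where
  "form_integral_over M K \<eta> =
     (let P = (SOME P. partition_of_unity_on M K P) in
      \<Sum>(c, \<rho>)\<in>P. integral (chart_image c)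
        (\<lambda>x. if chart_inv c x \<in> K
             then \<rho> (chart_inv c x) * local_form M \<eta> c x standard_frame else 0))"

(* The integral of a compactly supported n-form. *)
definition form_integral ::
    "('a, real^'n::{finite,wellorder}) manifold \<Rightarrow> ('a, real^'n::_) form \<Rightarrow> real" where
  "form_integral M \<eta> = form_integral_over M (form_support M CARD('n) \<eta>) \<eta>"


section \<open>Homology\<close>

(* The fundamental class restricts, at each point p, to the generator of H_n(L, L - p) given by a
   positively oriented affine simplex around p in a positively oriented chart. *)
definition fundamental_class ::
    "('a, real^'n::{finite,wellorder}) manifold \<Rightarrow> 'a chain set \<Rightarrow> bool" where
  "fundamental_class L \<mu> \<longleftrightarrow>
     \<mu> \<in> carrier (homology_group (int CARD('n)) (top_of L)) \<and>
     (\<forall>c\<in>atlas_of L. \<forall>v :: nat \<Rightarrow> real^'n::_. \<forall>x.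
        0 < det (\<chi> i j. (v (Suc (coord_index j)) - v 0) $ i) \<and>
        convex hull (v ` {..CARD('n)}) \<subseteq> chart_image c \<and>
        x \<in> interior (convex hull (v ` {..CARD('n)})) \<longrightarrow>
        (let S = points L - {chart_inv c x};
             \<sigma> = (\<lambda>t\<in>standard_simplex CARD('n). chart_inv c (\<Sum>j\<le>CARD('n). t j *\<^sub>R v j)) in
         hom_induced (int CARD('n)) (top_of L) {} (top_of L) S id \<mu> =
         homologous_rel_set CARD('n) (top_of L) S (frag_of \<sigma>)))"

definition represents_class ::
    "('a, real^'n::{finite,wellorder}) manifold \<Rightarrow> ('b, 'e::euclidean_space) manifold \<Rightarrow>
     ('a \<Rightarrow> 'b) \<Rightarrow> 'b chain set \<Rightarrow> bool" where
  "represents_class L X f d \<longleftrightarrow> (\<exists>\<mu>. fundamental_class L \<mu> \<and>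
     hom_induced (int CARD('n)) (top_of L) {} (top_of X) {} f \<mu> = d)"

(* Parametrisation of the standard n-simplex (barycentric coordinates indexed by 0, ..., n) by
   the coordinates number 1, ..., n. *)
definition corner :: "(real^'n) set" where
  "corner = {y. (\<forall>i. 0 \<le> y $ i) \<and> (\<Sum>i\<in>UNIV. y $ i) \<le> 1}"

definition barycentric :: "real^'n::{finite,wellorder} \<Rightarrow> nat \<Rightarrow> real" where
  "barycentric y j = (if j = 0 then 1 - (\<Sum>i\<in>UNIV. y $ i)
                      else (\<Sum>i | Suc (coord_index i) = j. y $ i))"

definition smooth_simplex ::
    "'n::{finite,wellorder} itself \<Rightarrow> ('a, 'e::euclidean_space) manifold \<Rightarrow> ((nat \<Rightarrow> real) \<Rightarrow> 'a) \<Rightarrow> bool" where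
  "smooth_simplex TYPE('n) X \<sigma> \<longleftrightarrow> singular_simplex CARD('n) (top_of X) \<sigma> \<and>
     (\<forall>c\<in>atlas_of X. smooth_on {y \<in> (corner :: (real^'n::_) set). \<sigma> (barycentric y) \<in> fst c}
        (\<lambda>y. snd c (\<sigma> (barycentric y))))"

definition simplex_integral ::
    "'n::{finite,wellorder} itself \<Rightarrow> ('a, 'e::euclidean_space) manifold \<Rightarrow> ((nat \<Rightarrow> real) \<Rightarrow> 'a) \<Rightarrow>
     ('a, 'e) form \<Rightarrow> real" where
  "simplex_integral TYPE('n) X \<sigma> \<beta> =
     integral (interior (corner :: (real^'n::_) set))
       (\<lambda>y. \<beta> (\<sigma> (barycentric y))
          (map (push_vector X (\<lambda>z. \<sigma> (barycentric z)) y) standard_frame))"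

(* The pairing of d in H_n(X) with a closed n-form: integrate over a smooth cycle in the class d.
   Existence of such a cycle and independence of the choice are part of de Rham's theorem. *)
definition class_integral ::
    "'n::{finite,wellorder} itself \<Rightarrow> ('a, 'e::euclidean_space) manifold \<Rightarrow> 'a chain set \<Rightarrow>
     ('a, 'e) form \<Rightarrow> real" where
  "class_integral TYPE('n) X d \<beta> =
     (let z = (SOME z. singular_relcycle CARD('n) (top_of X) {} z \<and>
                 (\<forall>\<sigma>\<in>Poly_Mapping.keys z. smooth_simplex TYPE('n) X \<sigma>) \<and>
                 homologous_rel_set CARD('n) (top_of X) {} z = d) in
      \<Sum>\<sigma>\<in>Poly_Mapping.keys z.
        of_int (Poly_Mapping.lookup z \<sigma>) * simplex_integral TYPE('n) X \<sigma> \<beta>)"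


section \<open>The space of Lagrangians\<close>

definition agree_off_compact :: "('a, 'e) manifold \<Rightarrow> ('a \<Rightarrow> 'b) \<Rightarrow> ('a \<Rightarrow> 'b) \<Rightarrow> bool" where
  "agree_off_compact L f g \<longleftrightarrow> (\<exists>K. compactin (top_of L) K \<and> (\<forall>p\<in>points L - K. f p = g p))"

(* f0 is the reference map for non-compact L; for compact L it is not used. *)
definition lagrangian_embeddings ::
    "('x, 'm::euclidean_space) manifold \<Rightarrow> ('x, 'm) form \<Rightarrow> ('l, real^'n::{finite,wellorder}) manifold \<Rightarrow>
     'x chain set \<Rightarrow> ('l \<Rightarrow> 'x) \<Rightarrow> ('l \<Rightarrow> 'x) set" where
  "lagrangian_embeddings X \<omega> L d f0 =
     {f. smooth_embedding L X f \<and> form_eq L 2 (pullback L X f \<omega>) zero_form \<and>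
         (if compact_space (top_of L) then represents_class L X f d
          else agree_off_compact L f f0)}"

definition reparametrizations :: "('l, real^'n) manifold \<Rightarrow> ('l \<Rightarrow> 'l) set" where
  "reparametrizations L =
     {\<psi>. homeomorphic_map (top_of L) (top_of L) \<psi> \<and>
         smooth_map L L \<psi> \<and> smooth_map L L (inv_into (points L) \<psi>) \<and>
         (\<forall>c\<in>atlas_of L. \<forall>c'\<in>atlas_of L. \<forall>p\<in>fst c. \<psi> p \<in> fst c' \<longrightarrow>
            0 < det (matrix (frechet_derivative (snd c' \<circ> \<psi> \<circ> chart_inv c) (at (snd c p))))) \<and>
         agree_off_compact L \<psi> id}"

definition lagrangian_space ::
    "('x, 'm::euclidean_space) manifold \<Rightarrow> ('x, 'm) form \<Rightarrow> ('l, real^'n::{finite,wellorder}) manifold \<Rightarrow>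
     'x chain set \<Rightarrow> ('l \<Rightarrow> 'x) \<Rightarrow> ('l \<Rightarrow> 'x) set set" where
  "lagrangian_space X \<omega> L d f0 =
     lagrangian_embeddings X \<omega> L d f0 //
       {(f, g). f \<in> lagrangian_embeddings X \<omega> L d f0 \<and> g \<in> lagrangian_embeddings X \<omega> L d f0 \<and>
          (\<exists>\<psi>\<in>reparametrizations L. \<forall>p\<in>points L. g p = f (\<psi> p))}"

(* The oriented submanifold f(L) of X, with the oriented atlas transported by f. *)
definition image_manifold ::
    "('x, 'm) manifold \<Rightarrow> ('l, 'e) manifold \<Rightarrow> ('l \<Rightarrow> 'x) \<Rightarrow> ('x, 'e) manifold" where
  "image_manifold X L f =
     \<lparr> top_of = subtopology (top_of X) (f ` points L),
       atlas_of = {c. fst c \<subseteq> f ` points L \<and>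
                      ({p \<in> points L. f p \<in> fst c}, snd c \<circ> f) \<in> atlas_of L} \<rparr>"

(* Independent of the chosen representative, the oriented atlas of L being maximal. *)
definition submanifold_of_class ::
    "('x, 'm) manifold \<Rightarrow> ('l, 'e) manifold \<Rightarrow> ('l \<Rightarrow> 'x) set \<Rightarrow> ('x, 'e) manifold" where
  "submanifold_of_class X L A = image_manifold X L (SOME f. f \<in> A)"

(* The compact set in the last clause is uniform in t: a smooth path in a space of maps that agree
   outside compact sets is supported in [0,1] \<times> K.  The map of [0,1] \<times> L being smooth does not
   imply this, since a perturbation can come in from infinity at some time t. *)
definition smooth_lifting ::
    "('x, 'm::euclidean_space) manifold \<Rightarrow> ('l, 'e::euclidean_space) manifold \<Rightarrow>
     (real \<Rightarrow> ('l \<Rightarrow> 'x) set) \<Rightarrow> (real \<Rightarrow> 'l \<Rightarrow> 'x) \<Rightarrow> bool" where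
  "smooth_lifting X L \<Lambda> f \<longleftrightarrow>
     (\<forall>t\<in>{0..1}. f t \<in> \<Lambda> t) \<and>
     continuous_map (prod_topology (top_of_set {0..1}) (top_of L)) (top_of X) (\<lambda>(t, p). f t p) \<and>
     (\<forall>c\<in>atlas_of L. \<forall>c'\<in>atlas_of X.
        smooth_on {(t, x). t \<in> {0..1} \<and> x \<in> chart_image c \<and> f t (chart_inv c x) \<in> fst c'}
          (\<lambda>(t, x). snd c' (f t (chart_inv c x)))) \<and>
     (\<exists>K. compactin (top_of L) K \<and> (\<forall>t\<in>{0..1}. \<forall>p\<in>points L - K. f t p = f 0 p))"

definition lagrangian_path ::
    "('x, 'm::euclidean_space) manifold \<Rightarrow> ('x, 'm) form \<Rightarrow> ('l, real^'n::{finite,wellorder}) manifold \<Rightarrow>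
     'x chain set \<Rightarrow> ('l \<Rightarrow> 'x) \<Rightarrow> (real \<Rightarrow> ('l \<Rightarrow> 'x) set) \<Rightarrow> bool" where
  "lagrangian_path X \<omega> L d f0 \<Lambda> \<longleftrightarrow>
     (\<forall>t\<in>{0..1}. \<Lambda> t \<in> lagrangian_space X \<omega> L d f0) \<and> (\<exists>f. smooth_lifting X L \<Lambda> f)"

(* v_t(p) = d/dt f_t(p), one-sided at the ends of the interval. *)
definition velocity ::
    "('x, 'm::euclidean_space) manifold \<Rightarrow> (real \<Rightarrow> 'l \<Rightarrow> 'x) \<Rightarrow> real \<Rightarrow> 'l \<Rightarrow> ('x, 'm) tangent" where
  "velocity X f t p = (\<lambda>c. if c \<in> atlas_of X \<and> f t p \<in> fst c
     then vector_derivative (\<lambda>s. snd c (f s p)) (at t within {0..1}) else 0)"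

(* The 1-form i_{v_t} \<omega> on L. *)
definition velocity_form ::
    "('x, 'm::euclidean_space) manifold \<Rightarrow> ('x, 'm) form \<Rightarrow> ('l, 'e::euclidean_space) manifold \<Rightarrow>
     (real \<Rightarrow> 'l \<Rightarrow> 'x) \<Rightarrow> real \<Rightarrow> ('l, 'e) form" where
  "velocity_form X \<omega> L f t p vs =
     \<omega> (f t p) (velocity X f t p # map (tangent_map L X (f t) p) vs)"

(* The 1-form (f_t)_*(i_{v_t} \<omega>) on the submanifold at time t, independent of the lifting. *)
definition path_derivative ::
    "('x, 'm::euclidean_space) manifold \<Rightarrow> ('x, 'm) form \<Rightarrow> ('l, 'e::euclidean_space) manifold \<Rightarrow>
     (real \<Rightarrow> ('l \<Rightarrow> 'x) set) \<Rightarrow> real \<Rightarrow> ('x, 'e) form" where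
  "path_derivative X \<omega> L \<Lambda> t =
     (let f = (SOME f. smooth_lifting X L \<Lambda> f) in
      pullback (submanifold_of_class X L (\<Lambda> t)) L (inv_into (points L) (f t))
        (velocity_form X \<omega> L f t))"

(* Compactness of the support is automatic if L is compact. *)
definition associated_hamiltonians ::
    "('x, 'm::euclidean_space) manifold \<Rightarrow> ('x, 'm) form \<Rightarrow> ('l, 'e::euclidean_space) manifold \<Rightarrow>
     (real \<Rightarrow> ('l \<Rightarrow> 'x) set) \<Rightarrow> (real \<Rightarrow> 'x \<Rightarrow> real) \<Rightarrow> bool" where
  "associated_hamiltonians X \<omega> L \<Lambda> h \<longleftrightarrow>
     (\<forall>t\<in>{0..1}. let N = submanifold_of_class X L (\<Lambda> t) in
        smooth_function N (h t) \<and>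
        compactin (top_of N) (function_support N (h t)) \<and>
        form_eq N 1 (path_derivative X \<omega> L \<Lambda> t) (exterior_derivative N (function_form (h t))))"

definition calabi ::
    "('x, 'm::euclidean_space) manifold \<Rightarrow> ('l, real^'n::{finite,wellorder}) manifold \<Rightarrow>
     ('x, 'm) form \<Rightarrow> (real \<Rightarrow> ('l \<Rightarrow> 'x) set) \<Rightarrow> (real \<Rightarrow> 'x \<Rightarrow> real) \<Rightarrow> real" where
  "calabi X L \<beta> \<Lambda> h =
     integral {0..1} (\<lambda>t. let N = submanifold_of_class X L (\<Lambda> t) in
       form_integral N (scale_form (h t) (pullback N X (\<lambda>q. q) \<beta>)))"

(* The difference of the integrals of \<eta> over two Lagrangians that coincide outside a compact set;
   the value does not depend on f, g, K.  For compact L one may take K to be all of L. *)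
definition integral_difference ::
    "('x, 'm::euclidean_space) manifold \<Rightarrow> ('l, real^'n::{finite,wellorder}) manifold \<Rightarrow>
     ('x, 'm) form \<Rightarrow> ('l \<Rightarrow> 'x) set \<Rightarrow> ('l \<Rightarrow> 'x) set \<Rightarrow> real" where
  "integral_difference X L \<eta> A B =
     (THE r. \<exists>f\<in>A. \<exists>g\<in>B. \<exists>K. compactin (top_of L) K \<and> (\<forall>p\<in>points L - K. f p = g p) \<and>
        r = form_integral_over L K (pullback L X f \<eta>) - form_integral_over L K (pullback L X g \<eta>))"

end

theory Submission
  imports Defs "HOL-Computational_Algebra.Polynomial"
begin

text \<open>Put \<open>\<eta> = \<lambda> \<and> \<gamma>\<close>. The hypotheses give \<open>d\<eta> = (1 + c) \<omega> \<and> \<gamma>\<close>. Let \<open>f\<^sub>t\<close> lift the path, with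
  velocity \<open>v\<^sub>t\<close>, and let \<open>H\<^sub>t = h\<^sub>t \<circ> f\<^sub>t\<close>. Since \<open>f\<^sub>t\<close> pulls \<open>\<omega>\<close> back to \<open>0\<close> and \<open>i\<^sub>v \<omega>\<close> to \<open>dH\<^sub>t\<close>,
  Cartan's formula says that the pullback \<open>f\<^sub>t* \<eta>\<close> has the time derivative
  \<open>d(f\<^sub>t* i\<^sub>v \<eta>) + (1 + c) (d(H\<^sub>t f\<^sub>t* \<gamma>) - H\<^sub>t f\<^sub>t* \<beta>)\<close>. For each fixed \<open>t\<close> the two exact terms have compact support
  and integrate to \<open>0\<close> over \<open>L\<close> by Stokes' theorem, so that integration over \<open>t\<close> gives the claim.
  Because \<open>H\<^sub>t\<close> enters for one \<open>t\<close> at a time only, \<open>h\<^sub>t\<close> need not depend regularly on \<open>t\<close>.\<close>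

section \<open>Smooth functions on open sets\<close>

text \<open>Cartan's formula needs no flow here. In charts the lifting is one map \<open>g\<close>
  of the pair (t, x), so the pullback by f_t is a time slice of the pullback by \<open>g\<close>,
  and inserting the velocity is contraction with (1, 0). The formula becomes the expansion of d on
  (t, x)-space along its first argument, combined with the naturality of d, which rests on the
  symmetry of second derivatives.

  Most of the remaining work is forced by choices. The lifting, the representative of a class, the
  chart at a point and the partition of unity are all picked by \<open>SOME\<close>, and the two
  sides of the claim integrate over different manifolds with unrelated partitions. Integrals are
  therefore computed with the more flexible \<open>weights\<close>, which move along homeomorphisms
  and restrict to smaller sets, so that one independence theorem serves everywhere.

  Two compact sets have to be kept apart: the one off which the lifting is stationary, uniform in t,
  and the support of H_t, which may move with t. The first need not contain the second, so Stokes'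
  theorem is applied on their union, separately for each t.\<close>

lemma frechet_derivative_eq: "(f has_derivative f') (at x) \<Longrightarrow> frechet_derivative f (at x) v = f' v"
  using frechet_derivative_at by metis

lemma C_k_cong:
  assumes "open S" "\<And>x. x \<in> S \<Longrightarrow> f x = g x" "C_k k S f"
  shows "C_k k S g"
  using assms(2,3)
proof (induction k arbitrary: f g)
  case 0
  then show ?case using continuous_on_cong by fastforce
next
  case (Suc k)
  have d: "\<And>x. x \<in> S \<Longrightarrow> f differentiable at x"
    using Suc.prems(2) assms(1) by (simp add: differentiable_on_eq_differentiable_at)
  have "g differentiable at x" if "x \<in> S" for x
    using d[OF that] assms(1) that Suc.prems(1)
    by (metis differentiable_def has_derivative_transform_within_open)
  moreover have "frechet_derivative f (at x) = frechet_derivative g (at x)" if "x \<in> S" for x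
    using frechet_derivative_transform_within_open[OF d[OF that] assms(1) that] Suc.prems(1) by blast
  moreover have "C_k k S (\<lambda>x. frechet_derivative g (at x) b)" if "b \<in> Basis" for b
  proof (rule Suc.IH)
    show "C_k k S (\<lambda>x. frechet_derivative f (at x) b)" using Suc.prems(2) that by simp
  qed (simp add: calculation)
  ultimately show ?case using assms(1) by (simp add: differentiable_on_eq_differentiable_at)
qed

lemma C_k_subset: "C_k k S f \<Longrightarrow> T \<subseteq> S \<Longrightarrow> C_k k T f"
  by (induction k arbitrary: f) (auto intro: continuous_on_subset differentiable_on_subset)

lemma C_k_local:
  assumes "open S" "\<And>x. x \<in> S \<Longrightarrow> \<exists>U. open U \<and> x \<in> U \<and> C_k k U f"
  shows "C_k k S f"
  using assms(2)
proof (induction k arbitrary: f)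
  case 0
  then have "isCont f x" if "x \<in> S" for x
    using that by (fastforce simp: continuous_on_eq_continuous_at)
  then show ?case using assms(1) by (simp add: continuous_on_eq_continuous_at)
next
  case (Suc k)
  have "f differentiable at x" if "x \<in> S" for x
    using Suc.prems[OF that] by (auto simp: differentiable_on_eq_differentiable_at)
  moreover have "C_k k S (\<lambda>x. frechet_derivative f (at x) b)" if "b \<in> Basis" for b
    using Suc.prems that by (intro Suc.IH) fastforce
  ultimately show ?case using assms(1) by (auto simp: differentiable_on_eq_differentiable_at)
qed

lemma C_k_Suc_imp: "C_k (Suc k) S f \<Longrightarrow> C_k k S f"
proof (induction k arbitrary: f)
  case 0
  then show ?case by (simp add: differentiable_imp_continuous_on)
next
  case (Suc k)
  have "C_k k S (\<lambda>x. frechet_derivative f (at x) b)" if "b \<in> Basis" for b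
    using Suc.prems that by (intro Suc.IH) auto
  with Suc.prems show ?case by simp
qed

lemma C_k_const [simp]: "C_k k S (\<lambda>x. c)"
  by (induction k arbitrary: c) auto

lemma C_k_bounded_linear:
  assumes "bounded_linear h" shows "C_k k S h"
proof (cases k)
  case 0
  then show ?thesis using assms by (simp add: linear_continuous_on)
next
  case (Suc k)
  have "frechet_derivative h (at x) = h" for x
    using bounded_linear_imp_has_derivative[OF assms] frechet_derivative_at by metis
  then show ?thesis
    using assms Suc by (simp add: bounded_linear_imp_differentiable_on)
qed

lemma C_k_add:
  assumes "open S" "C_k k S f" "C_k k S g" shows "C_k k S (\<lambda>x. f x + g x)"
  using assms(2,3)
proof (induction k arbitrary: f g)
  case 0
  then show ?case by (simp add: continuous_on_add)
next
  case (Suc k)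
  have D: "((\<lambda>x. f x + g x) has_derivative
      (\<lambda>v. frechet_derivative f (at x) v + frechet_derivative g (at x) v)) (at x)" if "x \<in> S" for x
    using Suc.prems that assms(1)
    by (intro has_derivative_add)
       (simp_all add: differentiable_on_eq_differentiable_at frechet_derivative_works)
  have "C_k k S (\<lambda>x. frechet_derivative (\<lambda>x. f x + g x) (at x) b)" if "b \<in> Basis" for b
  proof (rule C_k_cong[OF assms(1)])
    show "C_k k S (\<lambda>x. frechet_derivative f (at x) b + frechet_derivative g (at x) b)"
      using Suc that by simp
    show "frechet_derivative f (at x) b + frechet_derivative g (at x) b
          = frechet_derivative (\<lambda>x. f x + g x) (at x) b" if "x \<in> S" for x
      by (rule frechet_derivative_eq[OF D[OF that], symmetric])
  qed
  with Suc.prems show ?case by (auto intro: differentiable_on_add)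
qed

lemma C_k_bounded_linear_comp:
  assumes "open S" "bounded_linear h" "C_k k S f" shows "C_k k S (\<lambda>x. h (f x))"
  using assms(3)
proof (induction k arbitrary: f)
  case 0
  then show ?case using bounded_linear.continuous_on[OF assms(2)] by simp
next
  case (Suc k)
  have d: "((\<lambda>x. h (f x)) has_derivative (\<lambda>v. h (frechet_derivative f (at x) v))) (at x)"
    if "x \<in> S" for x
    using Suc.prems that assms(1)
    by (intro bounded_linear.has_derivative[OF assms(2)])
       (simp add: differentiable_on_eq_differentiable_at frechet_derivative_works)
  have "C_k k S (\<lambda>x. frechet_derivative (\<lambda>x. h (f x)) (at x) b)" if "b \<in> Basis" for b
  proof (rule C_k_cong[OF assms(1)])
    show "C_k k S (\<lambda>x. h (frechet_derivative f (at x) b))" using Suc that by simp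
    show "h (frechet_derivative f (at x) b) = frechet_derivative (\<lambda>x. h (f x)) (at x) b"
      if "x \<in> S" for x by (rule frechet_derivative_eq[OF d[OF that], symmetric])
  qed
  moreover have "(\<lambda>x. h (f x)) differentiable_on S"
    using d assms(1) by (auto simp: differentiable_on_eq_differentiable_at differentiable_def)
  ultimately show ?case by simp
qed

lemma C_k_scaleR:
  fixes f :: "'a::euclidean_space \<Rightarrow> real" and g :: "'a \<Rightarrow> 'b::real_normed_vector"
  assumes "open S" "C_k k S f" "C_k k S g" shows "C_k k S (\<lambda>x. f x *\<^sub>R g x)"
  using assms(2,3)
proof (induction k arbitrary: f g)
  case 0
  then show ?case by (simp add: continuous_on_scaleR)
next
  case (Suc k)
  have D: "((\<lambda>x. f x *\<^sub>R g x) has_derivative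
      (\<lambda>v. f x *\<^sub>R frechet_derivative g (at x) v + frechet_derivative f (at x) v *\<^sub>R g x)) (at x)"
    if "x \<in> S" for x
    using Suc.prems that assms(1)
    by (intro has_derivative_scaleR)
       (simp_all add: differentiable_on_eq_differentiable_at frechet_derivative_works)
  have "C_k k S (\<lambda>x. frechet_derivative (\<lambda>x. f x *\<^sub>R g x) (at x) b)" if "b \<in> Basis" for b
  proof (rule C_k_cong[OF assms(1)])
    show "C_k k S (\<lambda>x. f x *\<^sub>R frechet_derivative g (at x) b + frechet_derivative f (at x) b *\<^sub>R g x)"
      using Suc.prems that C_k_Suc_imp[OF Suc.prems(1)] C_k_Suc_imp[OF Suc.prems(2)]
      by (intro C_k_add[OF assms(1)] Suc.IH) auto
    show "f x *\<^sub>R frechet_derivative g (at x) b + frechet_derivative f (at x) b *\<^sub>R g x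
        = frechet_derivative (\<lambda>x. f x *\<^sub>R g x) (at x) b"
      if "x \<in> S" for x by (rule frechet_derivative_eq[OF D[OF that], symmetric])
  qed
  moreover have "(\<lambda>x. f x *\<^sub>R g x) differentiable_on S"
    using D assms(1) by (auto simp: differentiable_on_eq_differentiable_at differentiable_def)
  ultimately show ?case by simp
qed

lemma C_k_sum:
  assumes "open S" "\<And>i. i \<in> I \<Longrightarrow> C_k k S (f i)" shows "C_k k S (\<lambda>x. \<Sum>i\<in>I. f i x)"
  using assms(2) by (induction I rule: infinite_finite_induct) (auto intro: C_k_add[OF assms(1)])

lemma C_k_compose:
  fixes f :: "'a::euclidean_space \<Rightarrow> 'b::real_normed_vector" and g :: "'c::euclidean_space \<Rightarrow> 'a"
  assumes "open S" "open T" "C_k k S g" "C_k k T f" "g ` S \<subseteq> T"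
  shows "C_k k S (\<lambda>x. f (g x))"
  using assms(3,4)
proof (induction k arbitrary: f)
  case 0
  then show ?case using assms(5) continuous_on_compose2 by (metis C_k.simps(1))
next
  case (Suc k)
  have dg: "g differentiable at x" if "x \<in> S" for x
    using Suc.prems(1) that assms(1) by (simp add: differentiable_on_eq_differentiable_at)
  have df: "f differentiable at y" if "y \<in> T" for y
    using Suc.prems(2) that assms(2) by (simp add: differentiable_on_eq_differentiable_at)
  have D: "((\<lambda>x. f (g x)) has_derivative
      (\<lambda>v. frechet_derivative f (at (g x)) (frechet_derivative g (at x) v))) (at x)" if "x \<in> S" for x
    using that assms(5) dg df diff_chain_at[of g _ x f, unfolded o_def]
    by (simp add: frechet_derivative_works image_subset_iff)
  have "C_k k S (\<lambda>x. frechet_derivative (\<lambda>x. f (g x)) (at x) b)" if b: "b \<in> Basis" for b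
  proof (rule C_k_cong[OF assms(1)])
    have "C_k k S (\<lambda>x. frechet_derivative g (at x) b \<bullet> e)" for e
      using Suc.prems(1) b by (intro C_k_bounded_linear_comp[OF assms(1) bounded_linear_inner_left]) simp
    moreover have "C_k k S (\<lambda>x. frechet_derivative f (at (g x)) e)" if "e \<in> Basis" for e
      using Suc.prems that C_k_Suc_imp[OF Suc.prems(1)] by (intro Suc.IH) auto
    \<comment> \<open>\<open>C_k\<close> speaks about derivatives along fixed basis vectors, but by
      the chain rule f is differentiated along a direction that varies with x. Expanding this
      direction in \<open>Basis\<close> puts the variation into scalar coefficients.\<close>
    ultimately show "C_k k S (\<lambda>x. \<Sum>e\<in>Basis. (frechet_derivative g (at x) b \<bullet> e) *\<^sub>R
        frechet_derivative f (at (g x)) e)"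
      by (intro C_k_sum C_k_scaleR assms(1))
    show "(\<Sum>e\<in>Basis. (frechet_derivative g (at x) b \<bullet> e) *\<^sub>R frechet_derivative f (at (g x)) e)
        = frechet_derivative (\<lambda>x. f (g x)) (at x) b" if x: "x \<in> S" for x
    proof -
      have l: "linear (frechet_derivative f (at (g x)))"
        using df x assms(5) linear_frechet_derivative by blast
      have "frechet_derivative (\<lambda>x. f (g x)) (at x) b
          = frechet_derivative f (at (g x)) (frechet_derivative g (at x) b)"
        by (rule frechet_derivative_eq[OF D[OF x]])
      also have "\<dots> = frechet_derivative f (at (g x))
          (\<Sum>e\<in>Basis. (frechet_derivative g (at x) b \<bullet> e) *\<^sub>R e)"
        by (simp add: euclidean_representation)
      finally show ?thesis using l by (simp add: linear_sum linear_scale)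
    qed
  qed
  moreover have "(\<lambda>x. f (g x)) differentiable_on S"
    using D assms(1) by (auto simp: differentiable_on_eq_differentiable_at differentiable_def)
  ultimately show ?case by simp
qed

text \<open>Openness is bundled in so that \<open>frechet_derivative\<close> at every point of the
  set is an honest two-sided derivative and the closure rules carry no separate condition on the
  domain.\<close>

definition smooth_open :: "'a::euclidean_space set \<Rightarrow> ('a \<Rightarrow> 'b::real_normed_vector) \<Rightarrow> bool" where
  "smooth_open S f \<longleftrightarrow> open S \<and> (\<forall>k. C_k k S f)"

lemma smooth_openD: "smooth_open S f \<Longrightarrow> open S" "smooth_open S f \<Longrightarrow> C_k k S f"
  by (auto simp: smooth_open_def)

text \<open>For open S a local extension agrees with f on a whole neighbourhood of the point, so f
  inherits its derivatives there and the local statements glue.\<close>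

lemma smooth_on_iff_smooth_open:
  assumes "open S" shows "smooth_on S f \<longleftrightarrow> smooth_open S f"
proof
  assume L: "smooth_on S f"
  have "C_k k S f" for k
  proof (rule C_k_local[OF assms])
    fix x assume "x \<in> S"
    with L obtain U g where U: "open U" "x \<in> U" "\<forall>k. C_k k U g" "\<forall>y\<in>S \<inter> U. g y = f y"
      unfolding smooth_on_def by blast
    have "C_k k (S \<inter> U) f"
      using U assms C_k_subset[of k U g "S \<inter> U"] by (intro C_k_cong[of "S \<inter> U" g f]) auto
    then show "\<exists>U. open U \<and> x \<in> U \<and> C_k k U f"
      using U assms \<open>x \<in> S\<close> by (intro exI[of _ "S \<inter> U"]) auto
  qed
  then show "smooth_open S f" using assms by (simp add: smooth_open_def)
next
  assume "smooth_open S f" then show "smooth_on S f"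
    unfolding smooth_on_def smooth_open_def by blast
qed

lemma smooth_on_local:
  assumes "\<And>x. x \<in> S \<Longrightarrow> \<exists>U g. x \<in> U \<and> smooth_open U g \<and> (\<forall>y\<in>S \<inter> U. g y = f y)"
  shows "smooth_on S f"
  unfolding smooth_on_def using assms by (meson smooth_open_def)

lemma smooth_onE:
  assumes "smooth_on S f" "x \<in> S"
  obtains U g where "x \<in> U" "smooth_open U g" "\<And>y. y \<in> S \<Longrightarrow> y \<in> U \<Longrightarrow> g y = f y"
  using assms unfolding smooth_on_def smooth_open_def by (metis IntI)

lemma smooth_on_subset:
  assumes "smooth_on S f" "T \<subseteq> S" shows "smooth_on T f"
proof (rule smooth_on_local)
  fix x assume "x \<in> T"
  with assms(2) have "x \<in> S" by blast
  from smooth_onE[OF assms(1) this] obtain U g where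
    "x \<in> U" "smooth_open U g" "\<And>y. y \<in> S \<Longrightarrow> y \<in> U \<Longrightarrow> g y = f y" by blast
  then show "\<exists>U g. x \<in> U \<and> smooth_open U g \<and> (\<forall>y\<in>T \<inter> U. g y = f y)"
    using assms(2) by (intro exI[of _ U] exI[of _ g]) auto
qed

lemma smooth_on_cong:
  assumes "smooth_on S f" "\<And>x. x \<in> S \<Longrightarrow> f x = g x" shows "smooth_on S g"
proof (rule smooth_on_local)
  fix x assume "x \<in> S"
  from smooth_onE[OF assms(1) this] obtain U h where
    "x \<in> U" "smooth_open U h" "\<And>y. y \<in> S \<Longrightarrow> y \<in> U \<Longrightarrow> h y = f y" by blast
  then show "\<exists>U h. x \<in> U \<and> smooth_open U h \<and> (\<forall>y\<in>S \<inter> U. h y = g y)"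
    using assms(2) by (intro exI[of _ U] exI[of _ h]) auto
qed

lemma smooth_open_subset: "smooth_open S f \<Longrightarrow> T \<subseteq> S \<Longrightarrow> open T \<Longrightarrow> smooth_open T f"
  by (meson C_k_subset smooth_open_def)

lemma smooth_open_local:
  assumes "open S" "\<And>x. x \<in> S \<Longrightarrow> \<exists>U. x \<in> U \<and> smooth_open U f"
  shows "smooth_open S f"
  unfolding smooth_open_def
proof (intro conjI allI assms(1) C_k_local[OF assms(1)])
  fix k x assume "x \<in> S"
  then show "\<exists>U. open U \<and> x \<in> U \<and> C_k k U f"
    using assms(2) smooth_openD by metis
qed

lemma smooth_open_cong:
  "smooth_open S f \<Longrightarrow> (\<And>x. x \<in> S \<Longrightarrow> f x = g x) \<Longrightarrow> smooth_open S g"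
  unfolding smooth_open_def using C_k_cong by blast

lemma smooth_open_differentiable: "smooth_open S f \<Longrightarrow> x \<in> S \<Longrightarrow> f differentiable at x"
  using smooth_openD(2)[of S f "Suc 0"] smooth_openD(1)[of S f]
  by (simp add: differentiable_on_eq_differentiable_at)

lemma smooth_open_has_derivative:
  "smooth_open S f \<Longrightarrow> x \<in> S \<Longrightarrow> (f has_derivative frechet_derivative f (at x)) (at x)"
  using smooth_open_differentiable frechet_derivative_works by blast

lemma smooth_open_continuous_on: "smooth_open S f \<Longrightarrow> continuous_on S f"
  using smooth_openD(2)[of S f 0] by simp

lemma smooth_open_const: "open S \<Longrightarrow> smooth_open S (\<lambda>x. c)"
  by (simp add: smooth_open_def)

lemma smooth_open_bounded_linear: "bounded_linear h \<Longrightarrow> open S \<Longrightarrow> smooth_open S h"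
  by (simp add: smooth_open_def C_k_bounded_linear)

lemma smooth_open_add:
  "smooth_open S f \<Longrightarrow> smooth_open S g \<Longrightarrow> smooth_open S (\<lambda>x. f x + g x)"
  by (simp add: smooth_open_def C_k_add)

lemma smooth_open_scaleR:
  fixes f :: "'a::euclidean_space \<Rightarrow> real"
  shows "smooth_open S f \<Longrightarrow> smooth_open S g \<Longrightarrow> smooth_open S (\<lambda>x. f x *\<^sub>R g x)"
  by (simp add: smooth_open_def C_k_scaleR)

lemma smooth_open_mult:
  fixes f :: "'a::euclidean_space \<Rightarrow> real"
  shows "smooth_open S f \<Longrightarrow> smooth_open S g \<Longrightarrow> smooth_open S (\<lambda>x. f x * g x)"
  using smooth_open_scaleR[of S f g] by simp

lemma smooth_open_sum:
  "open S \<Longrightarrow> (\<And>i. i \<in> I \<Longrightarrow> smooth_open S (f i)) \<Longrightarrow> smooth_open S (\<lambda>x. \<Sum>i\<in>I. f i x)"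
  by (simp add: smooth_open_def C_k_sum)

lemma smooth_open_bounded_linear_comp:
  "bounded_linear h \<Longrightarrow> smooth_open S f \<Longrightarrow> smooth_open S (\<lambda>x. h (f x))"
  by (simp add: smooth_open_def C_k_bounded_linear_comp)

lemma smooth_open_compose:
  "smooth_open S g \<Longrightarrow> smooth_open T f \<Longrightarrow> (\<And>x. x \<in> S \<Longrightarrow> g x \<in> T) \<Longrightarrow> smooth_open S (\<lambda>x. f (g x))"
  unfolding smooth_open_def using C_k_compose[of S T] by (metis image_subsetI)

lemma smooth_open_Pair:
  assumes "smooth_open S f" "smooth_open S g" shows "smooth_open S (\<lambda>x. (f x, g x))"
proof -
  have "bounded_linear (\<lambda>x. (x, 0 :: 'c))" "bounded_linear (\<lambda>y. (0 :: 'b, y))"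
    by (intro bounded_linear_Pair bounded_linear_ident bounded_linear_zero)+
  then have "smooth_open S (\<lambda>x. (f x, 0 :: 'c) + (0 :: 'b, g x))"
    by (intro smooth_open_add smooth_open_bounded_linear_comp[of "\<lambda>x. (x, 0 :: 'c)" S f]
        smooth_open_bounded_linear_comp[of "\<lambda>x. (0 :: 'b, x)" S g] assms)
  then show ?thesis by simp
qed

text \<open>The direction \<open>w\<close> may vary with the point; its expansion in
  \<open>Basis\<close> has smooth coefficients and leaves derivatives along constant
  vectors.\<close>

lemma smooth_open_frechet_derivative:
  fixes f :: "'a::euclidean_space \<Rightarrow> 'b::real_normed_vector"
  assumes "smooth_open S f" "smooth_open S w"
  shows "smooth_open S (\<lambda>x. frechet_derivative f (at x) (w x))"
proof (rule smooth_open_cong)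
  have "smooth_open S (\<lambda>x. frechet_derivative f (at x) b)" if "b \<in> Basis" for b
    using smooth_openD(2)[OF assms(1), of "Suc _"] smooth_openD(1)[OF assms(1)] that
    by (simp add: smooth_open_def)
  then show "smooth_open S (\<lambda>x. \<Sum>b\<in>Basis. (w x \<bullet> b) *\<^sub>R frechet_derivative f (at x) b)"
    using assms smooth_openD(1)
    by (intro smooth_open_sum smooth_open_scaleR
        smooth_open_bounded_linear_comp[OF bounded_linear_inner_left]) auto
  show "(\<Sum>b\<in>Basis. (w x \<bullet> b) *\<^sub>R frechet_derivative f (at x) b) = frechet_derivative f (at x) (w x)"
    if "x \<in> S" for x
  proof -
    have l: "linear (frechet_derivative f (at x))"
      using smooth_open_differentiable[OF assms(1) that] linear_frechet_derivative by blast
    have "frechet_derivative f (at x) (w x) = frechet_derivative f (at x) (\<Sum>b\<in>Basis. (w x \<bullet> b) *\<^sub>R b)"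
      by (simp add: euclidean_representation)
    then show ?thesis using l by (simp add: linear_sum linear_scale)
  qed
qed

lemma smooth_open_inverse:
  fixes f :: "'a::euclidean_space \<Rightarrow> real"
  assumes "smooth_open S f" "\<And>x. x \<in> S \<Longrightarrow> f x \<noteq> 0"
  shows "smooth_open S (\<lambda>x. inverse (f x))"
proof -
  have o: "open (- {0::real})" by (rule open_Compl) simp
  have D: "(inverse has_derivative (\<lambda>h. - (inverse x * h * inverse x))) (at x)" if "x \<noteq> (0::real)" for x
    using has_derivative_inverse'[of x UNIV] that by simp
  have "C_k k (- {0}) (inverse :: real \<Rightarrow> real)" for k
  proof (induction k)
    case 0
    then show ?case by (simp add: continuous_on_inverse)
  next
    case (Suc k)
    \<comment> \<open>The derivative of 1/x is a constant multiple of the product of 1/x with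
      itself, so the induction closes.\<close>
    have "C_k k (- {0}) (\<lambda>x::real. frechet_derivative inverse (at x) b)" for b
    proof (rule C_k_cong[OF o])
      show "C_k k (- {0}) (\<lambda>x::real. (- b) *\<^sub>R (inverse x *\<^sub>R inverse x))"
        by (intro C_k_scaleR o Suc C_k_const)
      show "(- b) *\<^sub>R (inverse x *\<^sub>R inverse x) = frechet_derivative inverse (at x) b"
        if "x \<in> - {0}" for x
        using frechet_derivative_eq[OF D[of x], of b] that by simp
    qed
    moreover have "inverse differentiable_on (- {0 :: real})"
      using D o by (auto simp: differentiable_on_eq_differentiable_at differentiable_def)
    ultimately show ?case by simp
  qed
  then have "smooth_open (- {0}) (inverse :: real \<Rightarrow> real)" using o by (simp add: smooth_open_def)
  from smooth_open_compose[OF assms(1) this] assms(2) show ?thesis by simp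
qed

section \<open>Symmetry of second derivatives\<close>

lemma has_real_derivative_along_line:
  fixes f :: "'a::euclidean_space \<Rightarrow> real"
  assumes "smooth_open S f" "p + s *\<^sub>R u \<in> S"
  shows "((\<lambda>s. f (p + s *\<^sub>R u)) has_real_derivative frechet_derivative f (at (p + s *\<^sub>R u)) u) (at s)"
proof -
  have "((\<lambda>s. p + s *\<^sub>R u) has_derivative (\<lambda>h. h *\<^sub>R u)) (at s)"
    by (auto intro!: derivative_eq_intros)
  from diff_chain_at[OF this smooth_open_has_derivative[OF assms]]
  have D: "((\<lambda>s. f (p + s *\<^sub>R u)) has_derivative
      (\<lambda>h. frechet_derivative f (at (p + s *\<^sub>R u)) (h *\<^sub>R u))) (at s)"
    by (simp add: o_def)
  have "linear (frechet_derivative f (at (p + s *\<^sub>R u)))"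
    using smooth_open_differentiable[OF assms] linear_frechet_derivative by blast
  then have "frechet_derivative f (at (p + s *\<^sub>R u)) (h *\<^sub>R u) = frechet_derivative f (at (p + s *\<^sub>R u)) u * h" for h
    by (simp add: linear_scale)
  with D show ?thesis unfolding has_field_derivative_def by simp
qed

text \<open>The mean value theorem is used twice: along u for the difference in direction v, then
  along v for the derivative in direction u. The point is that the left-hand side is symmetric in u
  and v while the right-hand side is not.\<close>

lemma second_difference_mvt:
  fixes f :: "'a::euclidean_space \<Rightarrow> real"
  assumes f: "smooth_open S f" and S: "ball x d \<subseteq> S" and h: "0 < h" "h * (norm u + norm v) < d"
  shows "\<exists>\<xi>\<in>ball x d. f (x + h *\<^sub>R u + h *\<^sub>R v) - f (x + h *\<^sub>R u) - f (x + h *\<^sub>R v) + f x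
    = h\<^sup>2 * frechet_derivative (\<lambda>y. frechet_derivative f (at y) u) (at \<xi>) v"
proof -
  have inb: "x + s *\<^sub>R u + t *\<^sub>R v \<in> ball x d" if "0 \<le> s" "s \<le> h" "0 \<le> t" "t \<le> h" for s t
  proof -
    have "norm (s *\<^sub>R u + t *\<^sub>R v) \<le> s * norm u + t * norm v"
      using that norm_triangle_ineq[of "s *\<^sub>R u" "t *\<^sub>R v"] by simp
    also have "\<dots> \<le> h * norm u + h * norm v" using that by (intro add_mono mult_right_mono) auto
    finally have "norm (s *\<^sub>R u + t *\<^sub>R v) < d" using h(2) by (simp add: distrib_left)
    moreover have "dist x (x + s *\<^sub>R u + t *\<^sub>R v) = norm (s *\<^sub>R u + t *\<^sub>R v)"
      by (metis add.assoc dist_commute dist_norm add_diff_cancel_left')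
    ultimately show ?thesis by simp
  qed
  define \<phi> where "\<phi> s = f ((x + h *\<^sub>R v) + s *\<^sub>R u) - f (x + s *\<^sub>R u)" for s
  have "DERIV \<phi> s :> frechet_derivative f (at ((x + h *\<^sub>R v) + s *\<^sub>R u)) u - frechet_derivative f (at (x + s *\<^sub>R u)) u"
    if "0 \<le> s" "s \<le> h" for s
    unfolding \<phi>_def
    using inb[of s h] inb[of s 0] that h S
    by (intro DERIV_diff has_real_derivative_along_line[OF f]) (auto simp: algebra_simps)
  from MVT2[of 0 h \<phi>, OF h(1) this]
  obtain s where s: "0 < s" "s < h" and 1: "\<phi> h - \<phi> 0 = h * (frechet_derivative f (at ((x + h *\<^sub>R v) + s *\<^sub>R u)) u
      - frechet_derivative f (at (x + s *\<^sub>R u)) u)"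
    by auto
  define g where "g y = frechet_derivative f (at y) u" for y
  have g: "smooth_open S g"
    unfolding g_def using smooth_open_frechet_derivative[OF f smooth_open_const] smooth_openD(1)[OF f] by blast
  define \<psi> where "\<psi> t = g ((x + s *\<^sub>R u) + t *\<^sub>R v)" for t
  have "DERIV \<psi> t :> frechet_derivative g (at ((x + s *\<^sub>R u) + t *\<^sub>R v)) v" if "0 \<le> t" "t \<le> h" for t
    unfolding \<psi>_def using inb[of s t] s that h S
    by (intro has_real_derivative_along_line[OF g]) auto
  from MVT2[of 0 h \<psi>, OF h(1) this]
  obtain t where t: "0 < t" "t < h" and 2: "\<psi> h - \<psi> 0 = h * frechet_derivative g (at ((x + s *\<^sub>R u) + t *\<^sub>R v)) v"
    by auto
  have "f (x + h *\<^sub>R u + h *\<^sub>R v) - f (x + h *\<^sub>R u) - f (x + h *\<^sub>R v) + f x = \<phi> h - \<phi> 0"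
    by (simp add: \<phi>_def algebra_simps)
  also have "\<dots> = h * (\<psi> h - \<psi> 0)" unfolding 1 by (simp add: \<psi>_def g_def algebra_simps)
  also have "\<dots> = h\<^sup>2 * frechet_derivative g (at (x + s *\<^sub>R u + t *\<^sub>R v)) v"
    unfolding 2 by (simp add: power2_eq_square)
  finally show ?thesis using inb[of s t] s t unfolding g_def by fastforce
qed

text \<open>The same second difference is h^2 times one mixed derivative at some \<xi> and h^2 times
  the other at some \<xi>', both close to x. If the two mixed derivatives differed at x, continuity
  would keep each within half the gap, and they could not share a value.\<close>

lemma second_derivative_symmetric_real:
  fixes f :: "'a::euclidean_space \<Rightarrow> real"
  assumes f: "smooth_open S f" and x: "x \<in> S"
  shows "frechet_derivative (\<lambda>y. frechet_derivative f (at y) u) (at x) v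
       = frechet_derivative (\<lambda>y. frechet_derivative f (at y) v) (at x) u"
proof (rule ccontr)
  define a where "a u v y = frechet_derivative (\<lambda>y. frechet_derivative f (at y) u) (at y) v" for u v y
  have o: "open S" using f smooth_openD(1) by blast
  have cont: "isCont (a u v) x" for u v
  proof -
    have "smooth_open S (a u v)"
      unfolding a_def by (intro smooth_open_frechet_derivative smooth_open_const f o)
    then show ?thesis
      using smooth_open_continuous_on x o continuous_on_eq_continuous_at by blast
  qed
  assume "\<not> ?thesis"
  then have e: "0 < \<bar>a u v x - a v u x\<bar> / 2" (is "0 < ?e") by (simp add: a_def)
  have "\<forall>\<^sub>F y in nhds x. dist (a u v y) (a u v x) < ?e \<and> dist (a v u y) (a v u x) < ?e \<and> y \<in> S"
    using tendstoD[OF cont[of u v, unfolded isCont_def tendsto_at_iff_tendsto_nhds] e]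
      tendstoD[OF cont[of v u, unfolded isCont_def tendsto_at_iff_tendsto_nhds] e]
      eventually_nhds_in_open[OF o x]
    by (simp add: eventually_conj_iff)
  then obtain d where d: "0 < d" and dd: "\<And>y. dist y x < d \<Longrightarrow>
      dist (a u v y) (a u v x) < ?e \<and> dist (a v u y) (a v u x) < ?e \<and> y \<in> S"
    unfolding eventually_nhds_metric by blast
  \<comment> \<open>The summand 1 keeps N positive when u = v = 0; with h = d / (2 N) the whole
    parallelogram spanned by h u and h v stays in the ball.\<close>
  define N where "N = norm u + norm v + 1"
  define h where "h = d / (2 * N)"
  have pos: "0 < N" by (simp add: N_def add_nonneg_pos)
  have h: "0 < h" "h * (norm u + norm v) < d"
  proof -
    show "0 < h" using d pos by (simp add: h_def)
    have "h * (norm u + norm v) \<le> h * N" using \<open>0 < h\<close> by (simp add: N_def)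
    also have "\<dots> = d / 2" using pos by (simp add: h_def)
    finally show "h * (norm u + norm v) < d" using d by simp
  qed
  have S: "ball x d \<subseteq> S" using dd by (auto simp: dist_commute)
  obtain \<xi> where 1: "\<xi> \<in> ball x d"
    "f (x + h *\<^sub>R u + h *\<^sub>R v) - f (x + h *\<^sub>R u) - f (x + h *\<^sub>R v) + f x = h\<^sup>2 * a u v \<xi>"
    using second_difference_mvt[OF f S h] unfolding a_def by blast
  obtain \<xi>' where 2: "\<xi>' \<in> ball x d"
    "f (x + h *\<^sub>R v + h *\<^sub>R u) - f (x + h *\<^sub>R v) - f (x + h *\<^sub>R u) + f x = h\<^sup>2 * a v u \<xi>'"
    using second_difference_mvt[OF f S, of h v u] h unfolding a_def by (auto simp: add.commute)
  have "h\<^sup>2 * a u v \<xi> = h\<^sup>2 * a v u \<xi>'"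
    using 1(2) 2(2) by (simp add: algebra_simps)
  then have eq: "a u v \<xi> = a v u \<xi>'" using h by simp
  have "dist (a u v \<xi>) (a u v x) < ?e" "dist (a v u \<xi>') (a v u x) < ?e"
    using dd 1(1) 2(1) by (auto simp: dist_commute)
  then have "dist (a u v \<xi>) (a u v x) < ?e" "dist (a u v \<xi>) (a v u x) < ?e"
    unfolding eq by -
  moreover have "dist (a u v x) (a v u x) \<le> dist (a u v \<xi>) (a u v x) + dist (a u v \<xi>) (a v u x)"
    by (rule dist_triangle3)
  ultimately have "dist (a u v x) (a v u x) < ?e + ?e" by linarith
  then show False by (simp add: dist_real_def)
qed

lemma second_derivative_symmetric:
  fixes f :: "'a::euclidean_space \<Rightarrow> 'b::euclidean_space"
  assumes f: "smooth_open S f" and x: "x \<in> S"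
  shows "frechet_derivative (\<lambda>y. frechet_derivative f (at y) u) (at x) v
       = frechet_derivative (\<lambda>y. frechet_derivative f (at y) v) (at x) u"
proof (rule euclidean_eqI)
  fix b :: 'b
  have o: "open S" using f smooth_openD(1) by blast
  define fb where "fb y = f y \<bullet> b" for y
  have fb: "smooth_open S fb"
    unfolding fb_def by (intro smooth_open_bounded_linear_comp[OF bounded_linear_inner_left] f)
  have 1: "frechet_derivative fb (at y) w = frechet_derivative f (at y) w \<bullet> b" if "y \<in> S" for y w
    unfolding fb_def
    using bounded_linear.has_derivative[OF bounded_linear_inner_left smooth_open_has_derivative[OF f that]]
    by (rule frechet_derivative_eq)
  have 2: "frechet_derivative (\<lambda>y. frechet_derivative fb (at y) w) (at x) z
      = frechet_derivative (\<lambda>y. frechet_derivative f (at y) w) (at x) z \<bullet> b" for w z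
  proof (rule frechet_derivative_eq)
    have s: "smooth_open S (\<lambda>y. frechet_derivative f (at y) w)"
      by (intro smooth_open_frechet_derivative smooth_open_const f o)
    have "((\<lambda>y. frechet_derivative f (at y) w \<bullet> b) has_derivative
      (\<lambda>z. frechet_derivative (\<lambda>y. frechet_derivative f (at y) w) (at x) z \<bullet> b)) (at x)"
      using bounded_linear.has_derivative[OF bounded_linear_inner_left smooth_open_has_derivative[OF s x]] .
    then show "((\<lambda>y. frechet_derivative fb (at y) w) has_derivative
      (\<lambda>z. frechet_derivative (\<lambda>y. frechet_derivative f (at y) w) (at x) z \<bullet> b)) (at x)"
      by (rule has_derivative_transform_within_open[OF _ o x]) (simp add: 1)
  qed
  show "frechet_derivative (\<lambda>y. frechet_derivative f (at y) u) (at x) v \<bullet> b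
     = frechet_derivative (\<lambda>y. frechet_derivative f (at y) v) (at x) u \<bullet> b"
    using second_derivative_symmetric_real[OF fb x, of u v] unfolding 2 .
qed

section \<open>Bump functions\<close>

text \<open>The polynomial factor makes this family closed under differentiation.\<close>
definition flat_exp :: "real poly \<Rightarrow> real \<Rightarrow> real" where
  "flat_exp p x = (if x > 0 then poly p (inverse x) * exp (- inverse x) else 0)"

lemma poly_exp_tendsto_0: "((\<lambda>y. poly p y * exp (- y)) \<longlongrightarrow> (0::real)) at_top"
proof -
  have "((\<lambda>y. \<Sum>i\<le>Polynomial.degree p. Polynomial.coeff p i * (y ^ i / exp y)) \<longlongrightarrow> (0::real)) at_top"
    by (intro tendsto_null_sum tendsto_mult_right_zero tendsto_power_div_exp_0)
  moreover have "(\<lambda>y. \<Sum>i\<le>Polynomial.degree p. Polynomial.coeff p i * (y ^ i / exp y)) = (\<lambda>y. poly p y * exp (- y))"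
    by (simp add: poly_altdef sum_distrib_right exp_minus divide_inverse mult.assoc fun_eq_iff)
  ultimately show ?thesis by simp
qed

text \<open>With y = 1/x the function is p(y) exp(-y), and dy/dx = - y^2 turns its derivative into
  y^2 (p(y) - p'(y)) exp(-y), which explains the new polynomial. At 0 the right-hand difference
  quotient is of the same kind and tends to 0.\<close>

lemma flat_exp_has_derivative:
  "(flat_exp p has_real_derivative flat_exp (Polynomial.monom 1 2 * (p - pderiv p)) x) (at x)"
proof (cases x "0::real" rule: linorder_cases)
  case less
  have "((\<lambda>x. 0) has_real_derivative 0) (at x)" by simp
  then have "(flat_exp p has_real_derivative 0) (at x)"
    by (rule has_field_derivative_transform_within_open[where S = "{..<0}"])
       (use less in \<open>auto simp: flat_exp_def\<close>)
  then show ?thesis using less by (simp add: flat_exp_def)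
next
  case greater
  have i: "(inverse has_real_derivative - (inverse x * inverse x)) (at x)"
    using DERIV_inverse[of x UNIV] greater by simp
  have e: "((\<lambda>x. exp (- inverse x)) has_real_derivative exp (- inverse x) * (- (- (inverse x * inverse x)))) (at x)"
    by (rule DERIV_chain2[OF DERIV_exp DERIV_minus[OF i]])
  have "((\<lambda>x. poly p (inverse x) * exp (- inverse x)) has_real_derivative
     flat_exp (Polynomial.monom 1 2 * (p - pderiv p)) x) (at x)"
    using DERIV_mult[OF DERIV_chain2[OF poly_DERIV i] e] greater
    by (simp add: flat_exp_def Polynomial.poly_monom power2_eq_square algebra_simps)
  then show ?thesis
    by (rule has_field_derivative_transform_within_open[where S = "{0<..}"])
       (use greater in \<open>auto simp: flat_exp_def\<close>)
next
  case equal
  have "((\<lambda>h. (flat_exp p h - 0) / h) \<longlongrightarrow> 0) (at 0)"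
  proof (rule filterlim_split_at_real)
    have "\<forall>\<^sub>F h in at_left 0. 0 = (flat_exp p h - 0) / h"
      by (auto simp: eventually_at_filter flat_exp_def)
    from tendsto_cong[THEN iffD1, OF this] show "((\<lambda>h. (flat_exp p h - 0) / h) \<longlongrightarrow> 0) (at_left 0)" by simp
    \<comment> \<open>The division by h in the difference quotient is a further factor y = 1/h,
      absorbed into the polynomial by \<open>[:0, 1:]\<close>.\<close>
    have "((\<lambda>h. poly ([:0, 1:] * p) (inverse h) * exp (- inverse h)) \<longlongrightarrow> 0) (at_right (0::real))"
      by (rule filterlim_compose[OF poly_exp_tendsto_0 filterlim_inverse_at_top_right])
    moreover have "\<forall>\<^sub>F h in at_right 0. poly ([:0, 1:] * p) (inverse h) * exp (- inverse h) = (flat_exp p h - 0) / h"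
      by (auto simp: eventually_at_filter flat_exp_def divide_inverse)
    ultimately show "((\<lambda>h. (flat_exp p h - 0) / h) \<longlongrightarrow> 0) (at_right 0)"
      using tendsto_cong by force
  qed
  then show ?thesis using equal by (simp add: DERIV_def flat_exp_def)
qed

lemma C_k_flat_exp: "C_k k UNIV (flat_exp p)"
proof (induction k arbitrary: p)
  case 0
  show ?case
    using DERIV_isCont[OF flat_exp_has_derivative] by (simp add: continuous_at_imp_continuous_on)
next
  case (Suc k)
  have D: "(flat_exp p has_derivative (\<lambda>v. flat_exp (Polynomial.monom 1 2 * (p - pderiv p)) x * v)) (at x)" for x
    using flat_exp_has_derivative has_field_derivative_def by fastforce
  then have "frechet_derivative (flat_exp p) (at x) 1 = flat_exp (Polynomial.monom 1 2 * (p - pderiv p)) x" for x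
    using frechet_derivative_eq[OF D] by simp
  then show ?case using Suc D by (auto simp: differentiable_on_def differentiable_def)
qed

definition smooth_step :: "real \<Rightarrow> real" where
  "smooth_step x = flat_exp 1 x * inverse (flat_exp 1 x + flat_exp 1 (1 - x))"

lemma flat_exp_1: "flat_exp 1 x \<ge> 0" "x \<le> 0 \<Longrightarrow> flat_exp 1 x = 0" "x > 0 \<Longrightarrow> flat_exp 1 x > 0"
  by (auto simp: flat_exp_def)

text \<open>The numbers x and 1 - x are never both nonpositive, so at least one of the two
  nonnegative summands is positive.\<close>

lemma smooth_step_denominator: "flat_exp 1 x + flat_exp 1 (1 - x) > 0"
  using flat_exp_1(1)[of x] flat_exp_1(1)[of "1 - x"] flat_exp_1(3)[of x] flat_exp_1(3)[of "1 - x"]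
  by (cases "x > 0") (auto intro: add_pos_nonneg add_nonneg_pos)

lemma smooth_step_bounds: "0 \<le> smooth_step x" "smooth_step x \<le> 1"
  "x \<le> 0 \<Longrightarrow> smooth_step x = 0" "1 \<le> x \<Longrightarrow> smooth_step x = 1"
  using smooth_step_denominator[of x] flat_exp_1[of x] flat_exp_1[of "1 - x"]
  by (auto simp: smooth_step_def field_simps)

lemma smooth_open_smooth_step: "smooth_open UNIV smooth_step"
proof -
  have e: "smooth_open UNIV (flat_exp 1)" by (simp add: smooth_open_def C_k_flat_exp)
  have "smooth_open UNIV (\<lambda>x::real. 1 + (- 1) *\<^sub>R x)"
    by (intro smooth_open_add smooth_open_const smooth_open_bounded_linear bounded_linear_scaleR_right) auto
  then have "smooth_open UNIV (\<lambda>x. flat_exp 1 (1 + (- 1) *\<^sub>R x))"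
    by (rule smooth_open_compose[OF _ e]) auto
  then have "smooth_open UNIV (\<lambda>x. flat_exp 1 (1 - x))" by simp
  then show ?thesis unfolding smooth_step_def
    using smooth_step_denominator
    by (intro smooth_open_mult smooth_open_inverse smooth_open_add e) (auto simp: less_imp_neq[symmetric])
qed

lemma smooth_bump:
  fixes a :: "'a::euclidean_space"
  assumes "0 < r"
  obtains b :: "'a \<Rightarrow> real" where "smooth_open UNIV b" "\<And>x. 0 \<le> b x" "\<And>x. b x \<le> 1"
    "\<And>x. x \<in> cball a r \<Longrightarrow> b x = 1" "\<And>x. x \<notin> cball a (2 * r) \<Longrightarrow> b x = 0"
proof
  \<comment> \<open>A polynomial in the coordinates is smooth, whereas the distance to
    \<open>a\<close> is not smooth at \<open>a\<close>. The argument is 2 - (dist a x / r)^2: at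
    least 1 on the ball of radius r, and at most 0 from distance sqrt 2 * r on, hence outside the
    ball of radius 2 r.\<close>
  define b where "b x = smooth_step (2 + (- inverse (r\<^sup>2)) *\<^sub>R (\<Sum>i\<in>Basis. ((x \<bullet> i + - (a \<bullet> i)) * (x \<bullet> i + - (a \<bullet> i)))))"
    for x :: 'a
  have b: "b x = smooth_step (2 - (dist a x)\<^sup>2 / r\<^sup>2)" for x
  proof -
    have "(dist a x)\<^sup>2 = (a - x) \<bullet> (a - x)"
      by (simp add: dist_norm power2_norm_eq_inner)
    also have "\<dots> = (\<Sum>i\<in>Basis. ((a - x) \<bullet> i) * ((a - x) \<bullet> i))"
      by (rule euclidean_inner)
    also have "\<dots> = (\<Sum>i\<in>Basis. ((x \<bullet> i + - (a \<bullet> i)) * (x \<bullet> i + - (a \<bullet> i))))"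
      by (rule sum.cong) (simp_all add: inner_diff_left algebra_simps)
    finally show ?thesis by (simp add: b_def divide_inverse mult.commute)
  qed
  show "smooth_open UNIV b"
    unfolding b_def
    by (rule smooth_open_compose[OF _ smooth_open_smooth_step])
       (intro smooth_open_add smooth_open_const[OF open_UNIV] smooth_open_sum open_UNIV smooth_open_mult
         smooth_open_bounded_linear_comp[OF bounded_linear_scaleR_right]
         smooth_open_bounded_linear[OF bounded_linear_inner_left] UNIV_I)+
  show "0 \<le> b x" "b x \<le> 1" for x by (simp_all add: b smooth_step_bounds)
  show "b x = 1" if "x \<in> cball a r" for x
  proof -
    have "(dist a x)\<^sup>2 / r\<^sup>2 \<le> 1" using that assms by (simp add: power_mono)
    then show ?thesis by (simp add: b smooth_step_bounds)
  qed
  show "b x = 0" if "x \<notin> cball a (2 * r)" for x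
  proof -
    have "(2 * r)\<^sup>2 \<le> (dist a x)\<^sup>2" using that assms by (intro power_mono) auto
    then have "4 * r\<^sup>2 \<le> (dist a x)\<^sup>2" by (simp add: power_mult_distrib)
    moreover have "2 * r\<^sup>2 \<le> 4 * r\<^sup>2" by simp
    ultimately have "2 * r\<^sup>2 \<le> (dist a x)\<^sup>2" by linarith
    then have "2 \<le> (dist a x)\<^sup>2 / r\<^sup>2" using assms by (simp add: pos_le_divide_eq)
    then show ?thesis by (simp add: b smooth_step_bounds)
  qed
qed

section \<open>Alternating multilinear forms\<close>

definition multilinear :: "nat \<Rightarrow> ('e::euclidean_space list \<Rightarrow> real) \<Rightarrow> bool" where
  "multilinear k A \<longleftrightarrow> (\<forall>us vs. length us + length vs + 1 = k \<longrightarrow> linear (\<lambda>w. A (us @ w # vs)))"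

text \<open>Antisymmetrisation without a normalising factor: on a form that is already alternating
  it multiplies by \<open>fact m\<close>. This keeps the expansion along the first slot free of
  denominators; the factorials enter only with wedge products and d.\<close>

definition alternate :: "nat \<Rightarrow> ('v list \<Rightarrow> real) \<Rightarrow> 'v list \<Rightarrow> real" where
  "alternate m B vs =
     (\<Sum>\<pi> | \<pi> permutes {..<m}. of_int (sign \<pi>) * B (map (\<lambda>i. vs ! \<pi> i) [0..<m]))"

lemma multilinearD: "multilinear k A \<Longrightarrow> length us + length vs + 1 = k \<Longrightarrow> linear (\<lambda>w. A (us @ w # vs))"
  by (simp add: multilinear_def)

lemma multilinear_update:
  assumes "multilinear k A" "length ws = k" "i < k"
  shows "linear (\<lambda>w. A (ws[i := w]))"
  using multilinearD[OF assms(1), of "take i ws" "drop (Suc i) ws"] assms(2,3)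
  by (simp add: upd_conv_take_nth_drop)

lemma multilinearI_update:
  assumes "\<And>ws i. length ws = k \<Longrightarrow> i < k \<Longrightarrow> linear (\<lambda>w. A (ws[i := w]))"
  shows "multilinear k A"
  unfolding multilinear_def
proof (intro allI impI)
  fix us vs :: "'a list" assume "length us + length vs + 1 = k"
  then show "linear (\<lambda>w. A (us @ w # vs))"
    using assms[of "us @ 0 # vs" "length us"] by simp
qed

lemma alternating_multilinear_iff:
  "alternating_multilinear k A \<longleftrightarrow> multilinear k A \<and>
     (\<forall>ws i j. length ws = k \<and> i < j \<and> j < k \<and> ws ! i = ws ! j \<longrightarrow> A ws = 0)"
  by (simp add: alternating_multilinear_def multilinear_def)

lemma alternate_cong:
  assumes "\<And>us. length us = m \<Longrightarrow> set us \<subseteq> set vs \<Longrightarrow> B us = C us" "length vs = m"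
  shows "alternate m B vs = alternate m C vs"
  unfolding alternate_def
proof (rule sum.cong[OF refl])
  fix \<pi> assume "\<pi> \<in> {\<pi>. \<pi> permutes {..<m}}"
  then have "\<pi> i < m" if "i < m" for i using that permutes_in_image[of \<pi> "{..<m}" i] by simp
  then have "set (map (\<lambda>i. vs ! \<pi> i) [0..<m]) \<subseteq> set vs" using assms(2) by auto
  then show "of_int (sign \<pi>) * B (map (\<lambda>i. vs ! \<pi> i) [0..<m]) = of_int (sign \<pi>) * C (map (\<lambda>i. vs ! \<pi> i) [0..<m])"
    using assms(1) by simp
qed

lemma alternate_add: "alternate m (\<lambda>us. B us + C us) vs = alternate m B vs + alternate m C vs"
  by (simp add: alternate_def sum.distrib algebra_simps)

lemma alternate_cmult: "alternate m (\<lambda>us. c * B us) vs = c * alternate m B vs"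
  by (simp add: alternate_def sum_distrib_left mult.left_commute)

lemma alternate_diff: "alternate m (\<lambda>us. B us - C us) vs = alternate m B vs - alternate m C vs"
  by (simp add: alternate_def sum_subtractf algebra_simps)

lemma alternate_zero [simp]: "alternate m (\<lambda>us. 0) vs = 0"
  by (simp add: alternate_def)

lemma alternate_sum: "alternate m (\<lambda>us. \<Sum>j\<in>J. B j us) vs = (\<Sum>j\<in>J. alternate m (B j) vs)"
  by (induction J rule: infinite_finite_induct) (simp_all add: alternate_add)

lemma alternate_map:
  assumes "length vs = m" shows "alternate m B (map f vs) = alternate m (\<lambda>us. B (map f us)) vs"
  unfolding alternate_def
proof (rule sum.cong[OF refl])
  fix \<pi> assume "\<pi> \<in> {\<pi>. \<pi> permutes {..<m}}"
  then have "\<pi> i < m" if "i < m" for i using that permutes_in_image[of \<pi> "{..<m}" i] by simp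
  then have "map (\<lambda>i. map f vs ! \<pi> i) [0..<m] = map f (map (\<lambda>i. vs ! \<pi> i) [0..<m])"
    using assms by simp
  then show "of_int (sign \<pi>) * B (map (\<lambda>i. map f vs ! \<pi> i) [0..<m]) =
      of_int (sign \<pi>) * B (map f (map (\<lambda>i. vs ! \<pi> i) [0..<m]))" by (simp only:)
qed

lemma alternate_permute:
  assumes "\<sigma> permutes {..<m}"
  shows "alternate m B (map (\<lambda>i. vs ! \<sigma> i) [0..<m]) = of_int (sign \<sigma>) * alternate m B vs"
proof -
  let ?P = "{\<pi>. \<pi> permutes {..<m}}"
  have s: "sign (\<sigma> \<circ> \<pi>) = sign \<sigma> * sign \<pi>" if "\<pi> \<in> ?P" for \<pi>
    using that assms by (intro sign_compose) (auto intro: permutation_permutes[THEN iffD2])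
  have "of_int (sign \<sigma>) * alternate m B vs =
      of_int (sign \<sigma>) * (\<Sum>\<pi>\<in>?P. of_int (sign (\<sigma> \<circ> \<pi>)) * B (map (\<lambda>i. vs ! (\<sigma> \<circ> \<pi>) i) [0..<m]))"
    unfolding alternate_def by (subst setum_permutations_compose_left[OF assms]) (rule refl)
  also have "\<dots> = (\<Sum>\<pi>\<in>?P. of_int (sign \<pi>) * B (map (\<lambda>i. vs ! \<sigma> (\<pi> i)) [0..<m]))"
    unfolding sum_distrib_left
    by (rule sum.cong) (simp_all add: s mult.assoc[symmetric] flip: of_int_mult)
  also have "\<dots> = alternate m B (map (\<lambda>i. vs ! \<sigma> i) [0..<m])"
    unfolding alternate_def
  proof (rule sum.cong[OF refl])
    fix \<pi> assume "\<pi> \<in> ?P"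
    then have "\<pi> i < m" if "i < m" for i using that permutes_in_image[of \<pi> "{..<m}" i] by simp
    then show "of_int (sign \<pi>) * B (map (\<lambda>i. vs ! \<sigma> (\<pi> i)) [0..<m]) =
       of_int (sign \<pi>) * B (map (\<lambda>i. map (\<lambda>i. vs ! \<sigma> i) [0..<m] ! \<pi> i) [0..<m])"
      by (auto intro!: arg_cong[where f=B])
  qed
  finally show ?thesis by simp
qed

text \<open>Here \<sigma> rearranges the slots of B and not the given vectors, so it is composed
  with the summation variable on the right instead of on the left.\<close>

lemma alternate_permuted_argument:
  assumes "\<sigma> permutes {..<m}"
  shows "alternate m (\<lambda>us. B (map (\<lambda>i. us ! \<sigma> i) [0..<m])) vs = of_int (sign \<sigma>) * alternate m B vs"
proof -
  let ?P = "{\<pi>. \<pi> permutes {..<m}}"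
  have s: "sign (\<pi> \<circ> \<sigma>) = sign \<pi> * sign \<sigma>" if "\<pi> \<in> ?P" for \<pi>
    using that assms by (intro sign_compose) (auto intro: permutation_permutes[THEN iffD2])
  have \<sigma>: "\<sigma> i < m" if "i < m" for i using that permutes_in_image[OF assms, of i] by simp
  have "of_int (sign \<sigma>) * alternate m B vs =
      of_int (sign \<sigma>) * (\<Sum>\<pi>\<in>?P. of_int (sign (\<pi> \<circ> \<sigma>)) * B (map (\<lambda>i. vs ! (\<pi> \<circ> \<sigma>) i) [0..<m]))"
    unfolding alternate_def by (subst sum_permutations_compose_right[OF assms]) (rule refl)
  also have "\<dots> = (\<Sum>\<pi>\<in>?P. of_int (sign \<pi>) * B (map (\<lambda>i. map (\<lambda>i. vs ! \<pi> i) [0..<m] ! \<sigma> i) [0..<m]))"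
    unfolding sum_distrib_left
  proof (rule sum.cong[OF refl])
    fix \<pi> assume \<pi>: "\<pi> \<in> ?P"
    have "map (\<lambda>i. vs ! (\<pi> \<circ> \<sigma>) i) [0..<m] = map (\<lambda>i. map (\<lambda>i. vs ! \<pi> i) [0..<m] ! \<sigma> i) [0..<m]"
      using \<sigma> by simp
    moreover have "of_int (sign \<sigma>) * (of_int (sign (\<pi> \<circ> \<sigma>)) * x) = (of_int (sign \<pi>) :: real) * x" for x
      unfolding s[OF \<pi>] sign_def[of \<sigma>] sign_def[of \<pi>] by simp
    ultimately show "of_int (sign \<sigma>) * (of_int (sign (\<pi> \<circ> \<sigma>)) * B (map (\<lambda>i. vs ! (\<pi> \<circ> \<sigma>) i) [0..<m])) =
       of_int (sign \<pi>) * B (map (\<lambda>i. map (\<lambda>i. vs ! \<pi> i) [0..<m] ! \<sigma> i) [0..<m])" by (simp only:)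
  qed
  finally show ?thesis unfolding alternate_def by simp
qed

lemma transpose_permutes_lessThan: "i < m \<Longrightarrow> j < m \<Longrightarrow> Transposition.transpose i j permutes {..<m}"
  by (rule permutes_swap_id) auto

lemma map_nth_transpose:
  assumes "length vs = m" "i < m" "j < m"
  shows "map (\<lambda>k. vs ! Transposition.transpose i j k) [0..<m] = vs[i := vs ! j, j := vs ! i]"
  using assms by (intro nth_equalityI) (auto simp: Transposition.transpose_def nth_list_update)

text \<open>Exchanging two slots of B costs a sign, so symmetry in these slots makes the sum equal
  to its own negative. This is the mechanism that removes second derivatives from the pullback of
  d.\<close>

lemma alternate_swap_eq_0:
  assumes "length vs = m" "i < m" "j < m" "i \<noteq> j"
    and "\<And>us. length us = m \<Longrightarrow> B (us[i := us ! j, j := us ! i]) = B us"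
  shows "alternate m B vs = 0"
proof -
  have "alternate m B vs = alternate m (\<lambda>us. B (map (\<lambda>k. us ! Transposition.transpose i j k) [0..<m])) vs"
    by (rule alternate_cong[OF _ assms(1)]) (use assms in \<open>simp add: map_nth_transpose\<close>)
  also have "\<dots> = - alternate m B vs"
    using assms by (subst alternate_permuted_argument) (simp_all add: transpose_permutes_lessThan sign_swap_id)
  finally show ?thesis by simp
qed

lemma alternate_swap:
  assumes "length vs = m" "i < m" "j < m" "i \<noteq> j"
  shows "alternate m (\<lambda>us. B (us[i := us ! j, j := us ! i])) vs = - alternate m B vs"
proof -
  have "alternate m (\<lambda>us. B (us[i := us ! j, j := us ! i])) vs = alternate m (\<lambda>us. B (map (\<lambda>k. us ! Transposition.transpose i j k) [0..<m])) vs"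
    by (rule alternate_cong[OF _ assms(1)]) (use assms in \<open>simp add: map_nth_transpose\<close>)
  also have "\<dots> = - alternate m B vs"
    using assms by (subst alternate_permuted_argument) (simp_all add: transpose_permutes_lessThan sign_swap_id)
  finally show ?thesis .
qed

text \<open>Polarisation: the form vanishes when the same vector a + b stands in both slots, and so
  do the two pure terms, which leaves the mixed terms with sum 0.\<close>

lemma alternating_swap:
  assumes A: "alternating_multilinear m A" and l: "length ws = m" and ij: "i < m" "j < m" "i \<noteq> j"
  shows "A (ws[i := ws ! j, j := ws ! i]) = - A ws"
proof -
  have ml: "multilinear m A" using A by (simp add: alternating_multilinear_iff)
  have z: "A us = 0" if "length us = m" "us ! i = us ! j" for us
    using A that ij unfolding alternating_multilinear_iff by (metis linorder_neqE_nat)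
  define f where "f a b = A (ws[i := a, j := b])" for a b
  have lj: "linear (f a)" for a
    unfolding f_def by (rule multilinear_update[OF ml]) (use l ij in auto)
  have li: "linear (\<lambda>a. f a b)" for b
    using multilinear_update[OF ml, of "ws[j := b]" i] l ij
    by (simp add: f_def list_update_swap[of j i])
  have zz: "f a a = 0" for a using z[of "ws[i := a, j := a]"] l ij by (simp add: f_def)
  have "f (a + b) (a + b) = f a a + f a b + f b a + f b b" for a b
    using linear_add[OF lj, of "a + b" a b] linear_add[OF li] by simp
  then have "f a b = - f b a" for a b using zz by (metis add.left_neutral add.right_neutral eq_neg_iff_add_eq_0)
  from this[of "ws ! j" "ws ! i"] show ?thesis by (simp add: f_def)
qed

lemma alternating_permute:
  assumes A: "alternating_multilinear m A" and l: "length ws = m" and \<sigma>: "\<sigma> permutes {..<m}"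
  shows "A (map (\<lambda>i. ws ! \<sigma> i) [0..<m]) = of_int (sign \<sigma>) * A ws"
  using \<sigma> finite_lessThan[of m] l
proof (induction \<sigma> arbitrary: ws rule: permutes_induct)
  case id
  have "map ((!) ws) [0..<m] = ws" using \<open>length ws = m\<close> map_nth by blast
  then show ?case by simp
next
  case (swap a b p)
  have "permutation p"
    using swap.hyps by (auto intro: permutation_permutes[THEN iffD2] finite_lessThan)
  then have sgn: "sign (Transposition.transpose a b \<circ> p) = - sign p"
    using swap.hyps by (subst sign_compose) (auto simp: sign_swap_id permutation_swap_id)
  let ?ws = "ws[a := ws ! b, b := ws ! a]"
  have p: "p i < m" if "i < m" for i using that permutes_in_image[OF swap.hyps(4), of i] by simp
  have "map (\<lambda>i. ws ! (Transposition.transpose a b \<circ> p) i) [0..<m] = map (\<lambda>i. ?ws ! p i) [0..<m]"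
    using swap.hyps swap.prems p
    by (auto simp: Transposition.transpose_def nth_list_update)
  then have "A (map (\<lambda>i. ws ! (Transposition.transpose a b \<circ> p) i) [0..<m]) = of_int (sign p) * A ?ws"
    using swap.IH[of ?ws] swap.prems by (simp only: length_list_update)
  also have "A ?ws = - A ws"
    using alternating_swap[OF A swap.prems, of a b] swap.hyps by simp
  finally show ?case unfolding sgn by simp
qed

lemma alternate_alternating:
  assumes A: "alternating_multilinear m A" and l: "length ws = m"
  shows "alternate m A ws = fact m * A ws"
proof -
  have "of_int (sign \<pi>) * A (map (\<lambda>i. ws ! \<pi> i) [0..<m]) = A ws" if "\<pi> permutes {..<m}" for \<pi>
    using alternating_permute[OF A l that] by (simp add: sign_def)
  then show ?thesis by (simp add: alternate_def card_permutations)
qed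

lemma alternating_alternate:
  assumes "multilinear m B" shows "alternating_multilinear m (alternate m B)"
  unfolding alternating_multilinear_iff
proof (intro conjI allI impI)
  show "multilinear m (alternate m B)"
  proof (rule multilinearI_update)
    fix ws :: "'a list" and i assume l: "length ws = m" "i < m"
    show "linear (\<lambda>w. alternate m B (ws[i := w]))"
      unfolding alternate_def
    proof (intro linear_compose_sum ballI)
      fix \<pi> assume "\<pi> \<in> {\<pi>. \<pi> permutes {..<m}}"
      then have \<pi>: "\<pi> permutes {..<m}" by simp
      have p: "\<pi> k < m" if "k < m" for k using that permutes_in_image[OF \<pi>, of k] by simp
      \<comment> \<open>The updated vector ends up in the slot that \<pi> sends to i; linearity of B
        is used in that slot.\<close>
      have q: "inv_into UNIV \<pi> i < m" using l permutes_in_image[OF permutes_inv[OF \<pi>], of i] by simp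
      have "map (\<lambda>k. ws[i := w] ! \<pi> k) [0..<m] = (map (\<lambda>k. ws ! \<pi> k) [0..<m])[inv_into UNIV \<pi> i := w]" for w
        using l p q permutes_inverses[OF \<pi>]
        by (intro nth_equalityI) (auto simp: nth_list_update)
      moreover have "linear (\<lambda>w. B ((map (\<lambda>k. ws ! \<pi> k) [0..<m])[inv_into UNIV \<pi> i := w]))"
        by (rule multilinear_update[OF assms]) (use q in auto)
      ultimately have "linear (\<lambda>w. B (map (\<lambda>k. ws[i := w] ! \<pi> k) [0..<m]))" by simp
      from linear_compose_scale_right[OF this, of "of_int (sign \<pi>)"]
      show "linear (\<lambda>w. of_int (sign \<pi>) * B (map (\<lambda>k. ws[i := w] ! \<pi> k) [0..<m]))" by simp
    qed
  qed
next
  fix ws :: "'a list" and i j assume h: "length ws = m \<and> i < j \<and> j < m \<and> ws ! i = ws ! j"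
  then have "map (\<lambda>k. ws ! Transposition.transpose i j k) [0..<m] = ws"
    by (subst map_nth_transpose) (auto, metis list_update_id)
  then have "alternate m B ws = - alternate m B ws"
    using alternate_permute[of "Transposition.transpose i j" m B ws] h
    by (simp add: transpose_permutes_lessThan sign_swap_id)
  then show "alternate m B ws = 0" by simp
qed

section \<open>Expansion of the antisymmetrisation along the first slot\<close>

lemma length_drop_nth: "i < length ws \<Longrightarrow> length (drop_nth i ws) = length ws - 1"
  by (simp add: drop_nth_def)

lemma nth_drop_nth:
  "i < length ws \<Longrightarrow> k < length ws - 1 \<Longrightarrow> drop_nth i ws ! k = ws ! (if k < i then k else Suc k)"
  by (auto simp: drop_nth_def nth_append min_def)

lemma map_drop_nth: "map f (drop_nth i ws) = drop_nth i (map f ws)"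
  by (simp add: drop_nth_def take_map drop_map)

lemma set_drop_nth_subset: "set (drop_nth i ws) \<subseteq> set ws"
  by (auto simp: drop_nth_def dest: in_set_takeD in_set_dropD)

lemma drop_nth_Cons: "drop_nth 0 (v # ws) = ws" "drop_nth (Suc i) (v # ws) = v # drop_nth i ws"
  by (simp_all add: drop_nth_def)

text \<open>A list read through this cycle becomes its entry i followed by the list with entry i
  removed.\<close>

definition front_cycle :: "nat \<Rightarrow> nat \<Rightarrow> nat" where
  "front_cycle i x = (if x = 0 then i else if x \<le> i then x - 1 else x)"

text \<open>The permutation p acting on the entries behind the first one, as needed once
  \<open>front_cycle\<close> has settled which entry comes first.\<close>

definition shift_perm :: "(nat \<Rightarrow> nat) \<Rightarrow> nat \<Rightarrow> nat" where
  "shift_perm p x = (case x of 0 \<Rightarrow> 0 | Suc k \<Rightarrow> Suc (p k))"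

text \<open>Passing from i to i + 1 composes with one further adjacent transposition, so the sign
  alternates.\<close>

lemma front_cycle: "i < Suc m \<Longrightarrow> front_cycle i permutes {..<Suc m} \<and> sign (front_cycle i) = (-1) ^ i"
proof (induction i)
  case 0
  have "front_cycle 0 = id" by (auto simp: front_cycle_def)
  then show ?case using permutes_id[of "{..<Suc m}"] by (simp only: sign_id power_0 simp_thms)
next
  case (Suc i)
  then have IH: "front_cycle i permutes {..<Suc m}" "sign (front_cycle i) = (-1) ^ i" by auto
  have e: "front_cycle (Suc i) = Transposition.transpose i (Suc i) \<circ> front_cycle i"
    by (auto simp: front_cycle_def Transposition.transpose_def fun_eq_iff)
  have t: "Transposition.transpose i (Suc i) permutes {..<Suc m}"
    using Suc.prems by (intro transpose_permutes_lessThan) auto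
  show ?case
    unfolding e using IH t permutes_compose[OF IH(1) t]
      sign_compose[OF permutation_permutes[THEN iffD2] permutation_permutes[THEN iffD2], of _ "front_cycle i"]
    by (subst sign_compose) (auto simp: sign_swap_id permutation_swap_id permutation_permutes)
qed

lemma shift_perm:
  assumes "p permutes {..<m}"
  shows "shift_perm p permutes {..<Suc m} \<and> sign (shift_perm p) = sign p"
  using assms finite_lessThan[of m]
proof (induction p rule: permutes_induct)
  case id
  have "shift_perm id = id" by (auto simp: shift_perm_def fun_eq_iff split: nat.split)
  then show ?case using permutes_id[of "{..<Suc m}"] by (simp only: simp_thms)
next
  case (swap a b p)
  have e: "shift_perm (Transposition.transpose a b \<circ> p) = Transposition.transpose (Suc a) (Suc b) \<circ> shift_perm p"
    by (auto simp: shift_perm_def Transposition.transpose_def fun_eq_iff split: nat.split)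
  have t: "Transposition.transpose (Suc a) (Suc b) permutes {..<Suc m}"
    using swap.hyps by (intro transpose_permutes_lessThan) auto
  have 1: "permutation p" "permutation (shift_perm p)"
    using swap by (auto intro: permutation_permutes[THEN iffD2] finite_lessThan)
  have "sign (Transposition.transpose (Suc a) (Suc b) \<circ> shift_perm p) = - sign (shift_perm p)"
    using swap.hyps 1 by (subst sign_compose) (auto simp: sign_swap_id permutation_swap_id)
  moreover have "sign (Transposition.transpose a b \<circ> p) = - sign p"
    using swap.hyps 1 by (subst sign_compose) (auto simp: sign_swap_id permutation_swap_id)
  moreover have "shift_perm (Transposition.transpose a b \<circ> p) permutes {..<Suc m}"
    unfolding e by (rule permutes_compose[OF _ t]) (use swap.IH in blast)
  ultimately show ?case
    using swap.IH unfolding e by (simp only: simp_thms)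
qed

text \<open>The composite sends 0 to i, so i can be recovered, and then p; this is injectivity.
  Surjectivity follows by counting, since (m + 1) times m! is (m + 1)!.\<close>

lemma permutations_split_first:
  "bij_betw (\<lambda>(i, p). front_cycle i \<circ> shift_perm p) ({..<Suc m} \<times> {p. p permutes {..<m}})
     {p. p permutes {..<Suc m}}"
proof -
  let ?f = "\<lambda>(i, p). front_cycle i \<circ> shift_perm p"
  let ?A = "{..<Suc m} \<times> {p. p permutes {..<m}}"
  have inj: "inj_on ?f ?A"
  proof (rule inj_onI)
    fix x y assume x: "x \<in> ?A" and y: "y \<in> ?A" and eq: "?f x = ?f y"
    obtain i p j q where xy: "x = (i, p)" "y = (j, q)" by force
    have "?f x 0 = ?f y 0" using eq by simp
    then have ij: "i = j" using xy by (simp add: front_cycle_def shift_perm_def)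
    have "bij (front_cycle i)" using x xy front_cycle permutes_bij by auto
    then have "inj (front_cycle i)" by (rule bij_is_inj)
    moreover have "front_cycle i (shift_perm p k) = front_cycle i (shift_perm q k)" for k
      using fun_cong[OF eq, of k] xy ij by simp
    ultimately have "shift_perm p k = shift_perm q k" for k by (simp add: inj_eq)
    from this[of "Suc _"] have "p = q" by (auto simp: shift_perm_def)
    then show "x = y" using xy ij by simp
  qed
  have sub: "?f ` ?A \<subseteq> {p. p permutes {..<Suc m}}"
    using front_cycle shift_perm by (auto intro: permutes_compose)
  have "card (?f ` ?A) = card {p. p permutes {..<Suc m}}"
    using card_image[OF inj] by (simp add: card_permutations card_cartesian_product)
  then have "?f ` ?A = {p. p permutes {..<Suc m}}"
    using sub by (intro card_subset_eq finite_permutations) auto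
  then show ?thesis using inj by (simp add: bij_betw_def)
qed

text \<open>Grouping the permutations by the vector placed in the first slot yields an alternating
  sum over a removed entry, the shape of the exterior derivative. This identity translates between
  d, wedge products of low degree and antisymmetrisation.\<close>

lemma alternate_Suc:
  assumes "length vs = Suc m"
  shows "alternate (Suc m) B vs = (\<Sum>i<Suc m. (-1) ^ i * alternate m (\<lambda>ws. B (vs ! i # ws)) (drop_nth i vs))"
proof -
  have "alternate (Suc m) B vs = (\<Sum>(i, p)\<in>{..<Suc m} \<times> {p. p permutes {..<m}}.
      of_int (sign (front_cycle i \<circ> shift_perm p)) * B (map (\<lambda>k. vs ! (front_cycle i \<circ> shift_perm p) k) [0..<Suc m]))"
    unfolding alternate_def sum.reindex_bij_betw[OF permutations_split_first, symmetric]
    by (simp add: case_prod_unfold)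
  also have "\<dots> = (\<Sum>(i, p)\<in>{..<Suc m} \<times> {p. p permutes {..<m}}.
      (-1) ^ i * (of_int (sign p) * B (vs ! i # map (\<lambda>k. drop_nth i vs ! p k) [0..<m])))"
  proof (rule sum.cong[OF refl], clarify)
    fix i p assume i: "i < Suc m" and p: "p permutes {..<m}"
    have p': "p k < m" if "k < m" for k using that permutes_in_image[OF p, of k] by simp
    have "sign (front_cycle i \<circ> shift_perm p) = (-1) ^ i * sign p"
      using front_cycle[OF i] shift_perm[OF p]
      by (subst sign_compose) (auto intro: permutation_permutes[THEN iffD2])
    moreover have "map (\<lambda>k. vs ! (front_cycle i \<circ> shift_perm p) k) [0..<Suc m]
        = vs ! i # map (\<lambda>k. drop_nth i vs ! p k) [0..<m]"
      unfolding upt_conv_Cons[OF zero_less_Suc] map_Suc_upt[symmetric]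
      using assms i p' by (auto simp: front_cycle_def shift_perm_def nth_drop_nth)
    ultimately show "of_int (sign (front_cycle i \<circ> shift_perm p)) * B (map (\<lambda>k. vs ! (front_cycle i \<circ> shift_perm p) k) [0..<Suc m]) =
       (-1) ^ i * (of_int (sign p) * B (vs ! i # map (\<lambda>k. drop_nth i vs ! p k) [0..<m]))"
      by (simp add: mult.assoc)
  qed
  also have "\<dots> = (\<Sum>i<Suc m. (-1) ^ i * alternate m (\<lambda>ws. B (vs ! i # ws)) (drop_nth i vs))"
    unfolding alternate_def sum_distrib_left sum.cartesian_product[symmetric] by simp
  finally show ?thesis .
qed

lemma wedge_eq_alternate:
  "wedge k l \<alpha> \<beta> p vs = alternate (k + l) (\<lambda>us. \<alpha> p (take k us) * \<beta> p (drop k us)) vs / (fact k * fact l)"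
proof -
  have "take k (map f [0..<k + l]) = map f [0..<k]" "drop k (map f [0..<k + l]) = map f [k..<k + l]" for f :: "nat \<Rightarrow> ('a, 'b) tangent"
    by (simp_all add: take_map drop_map)
  then show ?thesis by (simp add: wedge_def alternate_def mult.assoc)
qed

section \<open>The exterior derivative on open sets\<close>

definition ext_d :: "('e::euclidean_space \<Rightarrow> 'e list \<Rightarrow> real) \<Rightarrow> 'e \<Rightarrow> 'e list \<Rightarrow> real" where
  "ext_d \<alpha> x vs = (\<Sum>i<length vs. (-1) ^ i * frechet_derivative (\<lambda>y. \<alpha> y (drop_nth i vs)) (at x) (vs ! i))"

definition smooth_form :: "'e::euclidean_space set \<Rightarrow> nat \<Rightarrow> ('e \<Rightarrow> 'e list \<Rightarrow> real) \<Rightarrow> bool" where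
  "smooth_form S k \<alpha> \<longleftrightarrow> open S \<and> (\<forall>x\<in>S. alternating_multilinear k (\<alpha> x)) \<and>
     (\<forall>ws. length ws = k \<longrightarrow> smooth_open S (\<lambda>x. \<alpha> x ws))"

definition pull :: "('d::euclidean_space \<Rightarrow> 'e::euclidean_space) \<Rightarrow> ('e \<Rightarrow> 'e list \<Rightarrow> real) \<Rightarrow> 'd \<Rightarrow> 'd list \<Rightarrow> real" where
  "pull g \<alpha> y ws = \<alpha> (g y) (map (frechet_derivative g (at y)) ws)"

definition list_wedge :: "nat \<Rightarrow> nat \<Rightarrow> ('e list \<Rightarrow> real) \<Rightarrow> ('e list \<Rightarrow> real) \<Rightarrow> 'e list \<Rightarrow> real" where
  "list_wedge k l a b vs = alternate (k + l) (\<lambda>us. a (take k us) * b (drop k us)) vs / (fact k * fact l)"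

lemma smooth_formD:
  assumes "smooth_form S k \<alpha>"
  shows "open S" "x \<in> S \<Longrightarrow> alternating_multilinear k (\<alpha> x)" "x \<in> S \<Longrightarrow> multilinear k (\<alpha> x)"
    "length ws = k \<Longrightarrow> smooth_open S (\<lambda>x. \<alpha> x ws)"
    "length ws = k \<Longrightarrow> x \<in> S \<Longrightarrow> (\<lambda>x. \<alpha> x ws) differentiable at x"
  using assms smooth_open_differentiable[of S "\<lambda>x. \<alpha> x ws" x]
  by (auto simp: smooth_form_def alternating_multilinear_iff)

lemma linear_basis_sum:
  fixes g :: "'e::euclidean_space \<Rightarrow> real"
  assumes "linear g" shows "g w = (\<Sum>b\<in>Basis. (w \<bullet> b) * g b)"
proof -
  have "g w = g (\<Sum>b\<in>Basis. (w \<bullet> b) *\<^sub>R b)" by (simp add: euclidean_representation)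
  then show ?thesis using assms by (simp add: linear_sum linear_scale)
qed

lemma has_derivative_frechet: "f differentiable at x \<Longrightarrow> (f has_derivative frechet_derivative f (at x)) (at x)"
  using frechet_derivative_works by blast

lemma multilinear_derivative:
  fixes A :: "'d::euclidean_space \<Rightarrow> 'e::euclidean_space list \<Rightarrow> real"
  assumes S: "open S" "x \<in> S" and A: "\<And>y. y \<in> S \<Longrightarrow> multilinear k (A y)"
    and d: "\<And>ws. length ws = k \<Longrightarrow> (\<lambda>y. A y ws) differentiable at x"
  shows "multilinear k (\<lambda>ws. frechet_derivative (\<lambda>y. A y ws) (at x) v)"
  unfolding multilinear_def
proof (intro allI impI linearI)
  fix us vs :: "'e list" and w w' :: 'e and r :: real
  assume l: "length us + length vs + 1 = k"
  have h: "((\<lambda>y. A y (us @ w # vs)) has_derivative frechet_derivative (\<lambda>y. A y (us @ w # vs)) (at x)) (at x)" for w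
    using l by (intro has_derivative_frechet d) simp
  have "((\<lambda>y. A y (us @ (w + w') # vs)) has_derivative (\<lambda>v. frechet_derivative (\<lambda>y. A y (us @ w # vs)) (at x) v
      + frechet_derivative (\<lambda>y. A y (us @ w' # vs)) (at x) v)) (at x)"
    using linear_add[OF multilinearD[OF A l]]
    by (intro has_derivative_transform_within_open[OF has_derivative_add[OF h h] S]) simp
  then show "frechet_derivative (\<lambda>y. A y (us @ (w + w') # vs)) (at x) v = frechet_derivative (\<lambda>y. A y (us @ w # vs)) (at x) v
      + frechet_derivative (\<lambda>y. A y (us @ w' # vs)) (at x) v"
    by (rule frechet_derivative_eq)
  have "((\<lambda>y. A y (us @ (r *\<^sub>R w) # vs)) has_derivative (\<lambda>v. r *\<^sub>R frechet_derivative (\<lambda>y. A y (us @ w # vs)) (at x) v)) (at x)"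
    using linear_scale[OF multilinearD[OF A l]]
    by (intro has_derivative_transform_within_open[OF has_derivative_scaleR_right[OF h] S]) simp
  then show "frechet_derivative (\<lambda>y. A y (us @ (r *\<^sub>R w) # vs)) (at x) v = r *\<^sub>R frechet_derivative (\<lambda>y. A y (us @ w # vs)) (at x) v"
    by (rule frechet_derivative_eq)
qed

lemma alternating_derivative:
  fixes A :: "'d::euclidean_space \<Rightarrow> 'e::euclidean_space list \<Rightarrow> real"
  assumes S: "open S" "x \<in> S" and A: "\<And>y. y \<in> S \<Longrightarrow> alternating_multilinear k (A y)"
    and d: "\<And>ws. length ws = k \<Longrightarrow> (\<lambda>y. A y ws) differentiable at x"
  shows "alternating_multilinear k (\<lambda>ws. frechet_derivative (\<lambda>y. A y ws) (at x) v)"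
  unfolding alternating_multilinear_iff
proof (intro conjI allI impI)
  show "multilinear k (\<lambda>ws. frechet_derivative (\<lambda>y. A y ws) (at x) v)"
    using A by (intro multilinear_derivative[OF S _ d]) (auto simp: alternating_multilinear_iff)
  fix ws :: "'e list" and i j
  assume h: "length ws = k \<and> i < j \<and> j < k \<and> ws ! i = ws ! j"
  have "((\<lambda>y. A y ws) has_derivative (\<lambda>v. 0)) (at x)"
    using A h by (intro has_derivative_transform_within_open[OF has_derivative_const[of 0] S])
      (metis alternating_multilinear_iff)
  then show "frechet_derivative (\<lambda>y. A y ws) (at x) v = 0" by (rule frechet_derivative_eq)
qed

text \<open>Leibniz rule for a form whose first arguments move with the point. The fixed tail
  \<open>cs\<close> carries the induction from the right: the last moving argument is expanded in
  \<open>Basis\<close>, after which a constant basis vector joins the tail. The derivative splits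
  into the one of the form with frozen arguments and one term per moving argument.\<close>

lemma multilinear_moving:
  fixes A :: "'d::euclidean_space \<Rightarrow> 'e::euclidean_space list \<Rightarrow> real"
  assumes S: "open S" and A: "\<And>y. y \<in> S \<Longrightarrow> multilinear k (A y)"
    and sm: "\<And>cs. length cs = k \<Longrightarrow> smooth_open S (\<lambda>y. A y cs)"
    and us: "\<forall>w\<in>set us. smooth_open S w" "length us + length cs = k"
  shows "smooth_open S (\<lambda>y. A y (map (\<lambda>w. w y) us @ cs)) \<and>
    (\<forall>x\<in>S. frechet_derivative (\<lambda>y. A y (map (\<lambda>w. w y) us @ cs)) (at x) v =
       frechet_derivative (\<lambda>y. A y (map (\<lambda>w. w x) us @ cs)) (at x) v +
       (\<Sum>j<length us. A x ((map (\<lambda>w. w x) us)[j := frechet_derivative (us ! j) (at x) v] @ cs)))"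
  using us
proof (induction us arbitrary: cs rule: rev_induct)
  case Nil
  then show ?case using sm by simp
next
  case (snoc w us)
  have w: "smooth_open S w" using snoc.prems by simp
  define F where "F b y = A y (map (\<lambda>w. w y) us @ b # cs)" for b y
  have IH: "smooth_open S (F b)"
    "x \<in> S \<Longrightarrow> frechet_derivative (F b) (at x) v = frechet_derivative (\<lambda>y. A y (map (\<lambda>w. w x) us @ b # cs)) (at x) v +
       (\<Sum>j<length us. A x ((map (\<lambda>w. w x) us)[j := frechet_derivative (us ! j) (at x) v] @ b # cs))" for x b
    using snoc.IH[of "b # cs"] snoc.prems unfolding F_def by auto
  define G where "G y = A y (map (\<lambda>w. w y) (us @ [w]) @ cs)" for y
  have G: "G y = (\<Sum>b\<in>Basis. (w y \<bullet> b) * F b y)" if "y \<in> S" for y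
    using linear_basis_sum[OF multilinearD[OF A[OF that]], of "map (\<lambda>w. w y) us" cs "w y"] snoc.prems
    by (simp add: G_def F_def)
  have wb: "smooth_open S (\<lambda>y. w y \<bullet> b)" for b
    by (rule smooth_open_bounded_linear_comp[OF bounded_linear_inner_left w])
  have "smooth_open S (\<lambda>y. \<Sum>b\<in>Basis. (w y \<bullet> b) * F b y)"
    by (intro smooth_open_sum S smooth_open_mult wb IH)
  then have sG: "smooth_open S G" by (rule smooth_open_cong) (simp add: G)
  moreover have "frechet_derivative G (at x) v = frechet_derivative (\<lambda>y. A y (map (\<lambda>w. w x) (us @ [w]) @ cs)) (at x) v +
       (\<Sum>j<length (us @ [w]). A x ((map (\<lambda>w. w x) (us @ [w]))[j := frechet_derivative ((us @ [w]) ! j) (at x) v] @ cs))"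
    if x: "x \<in> S" for x
  proof -
    let ?u = "map (\<lambda>w. w x) us" and ?dw = "frechet_derivative w (at x) v"
    have "((\<lambda>y. w y \<bullet> b) has_derivative (\<lambda>v. frechet_derivative w (at x) v \<bullet> b)) (at x)" for b
      using bounded_linear.has_derivative[OF bounded_linear_inner_left smooth_open_has_derivative[OF w x]] .
    from has_derivative_mult[OF this smooth_open_has_derivative[OF IH(1) x]]
    have "((\<lambda>y. \<Sum>b\<in>Basis. (w y \<bullet> b) * F b y) has_derivative
      (\<lambda>v. \<Sum>b\<in>Basis. (w x \<bullet> b) * frechet_derivative (F b) (at x) v + (frechet_derivative w (at x) v \<bullet> b) * F b x)) (at x)"
      by (intro has_derivative_sum) auto
    then have "(G has_derivative
      (\<lambda>v. \<Sum>b\<in>Basis. (w x \<bullet> b) * frechet_derivative (F b) (at x) v + (frechet_derivative w (at x) v \<bullet> b) * F b x)) (at x)"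
      by (rule has_derivative_transform_within_open[OF _ S x]) (simp add: G)
    then have "frechet_derivative G (at x) v =
      (\<Sum>b\<in>Basis. (w x \<bullet> b) * frechet_derivative (F b) (at x) v + (?dw \<bullet> b) * F b x)"
      by (rule frechet_derivative_eq)
    also have "\<dots> = (\<Sum>b\<in>Basis. (w x \<bullet> b) * frechet_derivative (\<lambda>y. A y (?u @ b # cs)) (at x) v) +
        (\<Sum>j<length us. \<Sum>b\<in>Basis. (w x \<bullet> b) * A x (?u[j := frechet_derivative (us ! j) (at x) v] @ b # cs)) +
        (\<Sum>b\<in>Basis. (?dw \<bullet> b) * F b x)"
      unfolding sum.swap[of "\<lambda>j b. (w x \<bullet> b) * A x (?u[j := frechet_derivative (us ! j) (at x) v] @ b # cs)"]
      by (simp add: IH(2)[OF x] sum.distrib distrib_left sum_distrib_left)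
    also have "(\<Sum>b\<in>Basis. (w x \<bullet> b) * frechet_derivative (\<lambda>y. A y (?u @ b # cs)) (at x) v)
        = frechet_derivative (\<lambda>y. A y (?u @ w x # cs)) (at x) v"
      using snoc.prems smooth_open_differentiable[OF sm x]
      by (intro linear_basis_sum[symmetric] multilinearD[OF multilinear_derivative[OF S x A]]) auto
    also have "(\<Sum>j<length us. \<Sum>b\<in>Basis. (w x \<bullet> b) * A x (?u[j := frechet_derivative (us ! j) (at x) v] @ b # cs))
        = (\<Sum>j<length us. A x (?u[j := frechet_derivative (us ! j) (at x) v] @ w x # cs))"
      using snoc.prems by (intro sum.cong[OF refl] linear_basis_sum[symmetric] multilinearD[OF A[OF x]]) auto
    also have "(\<Sum>b\<in>Basis. (?dw \<bullet> b) * F b x) = A x (?u @ ?dw # cs)"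
      unfolding F_def
      using snoc.prems by (intro linear_basis_sum[symmetric] multilinearD[OF A[OF x]]) auto
    finally show ?thesis
      by (simp add: list_update_append nth_append)
  qed
  ultimately show ?case unfolding G_def by blast
qed

lemma alternating_map:
  assumes "alternating_multilinear k A" "linear f"
  shows "alternating_multilinear k (\<lambda>ws. A (map f ws))"
  unfolding alternating_multilinear_def
proof (intro conjI allI impI)
  fix us vs :: "'b list" assume "length us + length vs + 1 = k"
  then have "linear (\<lambda>w. A (map f us @ w # map f vs))"
    using assms(1) unfolding alternating_multilinear_def by simp
  from linear_compose[OF assms(2) this] show "linear (\<lambda>w. A (map f (us @ w # vs)))"
    by (simp add: o_def)
next
  fix ws :: "'b list" and i j assume h: "length ws = k \<and> i < j \<and> j < k \<and> ws ! i = ws ! j"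
  then have "length (map f ws) = k \<and> i < j \<and> j < k \<and> map f ws ! i = map f ws ! j" by simp
  then show "A (map f ws) = 0" using assms(1) unfolding alternating_multilinear_def by blast
qed

lemma smooth_form_pull:
  fixes g :: "'d::euclidean_space \<Rightarrow> 'e::euclidean_space"
  assumes \<alpha>: "smooth_form T k \<alpha>" and g: "smooth_open S g" and gT: "\<And>x. x \<in> S \<Longrightarrow> g x \<in> T"
  shows "smooth_form S k (pull g \<alpha>)"
  unfolding smooth_form_def
proof (intro conjI ballI allI impI)
  show S: "open S" using g smooth_openD by blast
  show "alternating_multilinear k (pull g \<alpha> x)" if "x \<in> S" for x
    unfolding pull_def
    using smooth_formD(2)[OF \<alpha> gT[OF that]] linear_frechet_derivative[OF smooth_open_differentiable[OF g that]]
    by (rule alternating_map)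
  fix ws :: "'d list" assume l: "length ws = k"
  have "smooth_open S (\<lambda>y. \<alpha> (g y) (map (\<lambda>w. w y) (map (\<lambda>v y. frechet_derivative g (at y) v) ws) @ []))"
    using multilinear_moving[OF S, of k "\<lambda>y. \<alpha> (g y)" "map (\<lambda>v y. frechet_derivative g (at y) v) ws" "[]"]
      smooth_formD[OF \<alpha>] gT smooth_open_compose[OF g smooth_formD(4)[OF \<alpha>]] l
      smooth_open_frechet_derivative[OF g smooth_open_const[OF S]]
    by auto
  then show "smooth_open S (\<lambda>y. pull g \<alpha> y ws)" by (simp add: pull_def o_def)
qed

text \<open>The derivative of \<alpha> is already alternating in its k form slots, so
  antisymmetrising over all k + 1 slots repeats each term of the defining sum k! times.\<close>

lemma ext_d_eq_alternate:
  assumes \<alpha>: "smooth_form S k \<alpha>" and x: "x \<in> S" and l: "length vs = Suc k"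
  shows "ext_d \<alpha> x vs = alternate (Suc k) (\<lambda>us. frechet_derivative (\<lambda>y. \<alpha> y (tl us)) (at x) (hd us)) vs / fact k"
proof -
  have "alternate k (\<lambda>ws. frechet_derivative (\<lambda>y. \<alpha> y ws) (at x) v) ws
      = fact k * frechet_derivative (\<lambda>y. \<alpha> y ws) (at x) v" if "length ws = k" for v ws
    using smooth_formD[OF \<alpha>] x that
    by (intro alternate_alternating alternating_derivative[of S]) auto
  then show ?thesis
    using l by (simp add: alternate_Suc ext_d_def length_drop_nth sum_divide_distrib del: sum.lessThan_Suc)
qed

lemma alternating_cong:
  assumes "\<And>ws. length ws = k \<Longrightarrow> A ws = B ws"
  shows "alternating_multilinear k A = alternating_multilinear k B"
proof -
  have *: "(\<lambda>w. A (us @ w # vs)) = (\<lambda>w. B (us @ w # vs))" if "length us + length vs + 1 = k" for us vs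
    using assms that by auto
  show ?thesis
    unfolding alternating_multilinear_def using assms * by (auto simp: *)
qed

lemma linear_frechet_smooth_form:
  "smooth_form S k \<alpha> \<Longrightarrow> x \<in> S \<Longrightarrow> length ws = k \<Longrightarrow> linear (frechet_derivative (\<lambda>y. \<alpha> y ws) (at x))"
  using linear_frechet_derivative smooth_formD(5) by blast

lemma alternating_ext_d:
  assumes \<alpha>: "smooth_form S k \<alpha>" and x: "x \<in> S"
  shows "alternating_multilinear (Suc k) (ext_d \<alpha> x)"
proof -
  have "multilinear (Suc k) (\<lambda>us. frechet_derivative (\<lambda>y. \<alpha> y (tl us)) (at x) (hd us))"
    unfolding multilinear_def
  proof (intro allI impI)
    fix us vs :: "'a list" assume l: "length us + length vs + 1 = Suc k"
    have m: "multilinear k (\<lambda>ws. frechet_derivative (\<lambda>y. \<alpha> y ws) (at x) v)" for v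
      using smooth_formD[OF \<alpha>] x by (intro multilinear_derivative[of S]) auto
    show "linear (\<lambda>w. frechet_derivative (\<lambda>y. \<alpha> y (tl (us @ w # vs))) (at x) (hd (us @ w # vs)))"
    proof (cases us)
      case Nil
      then show ?thesis using linear_frechet_smooth_form[OF \<alpha> x, of vs] l by simp
    next
      case (Cons a us')
      then show ?thesis using multilinearD[OF m, of us' vs a] l by simp
    qed
  qed
  from alternating_alternate[OF this]
  have "alternating_multilinear (Suc k) (\<lambda>vs. alternate (Suc k) (\<lambda>us. frechet_derivative (\<lambda>y. \<alpha> y (tl us)) (at x) (hd us)) vs * inverse (fact k))"
    unfolding alternating_multilinear_def
    by (simp add: linear_iff algebra_simps)
  then show ?thesis
    by (subst alternating_cong) (auto simp: ext_d_eq_alternate[OF \<alpha> x] divide_inverse)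
qed

text \<open>Naturality of d. Differentiating the pullback also differentiates the vectors Dg(y) u,
  which produces terms with the second derivative of g. Each is symmetric in the direction of
  differentiation and one form slot, so the antisymmetrisation kills it, and only the chain rule
  term survives.\<close>

lemma ext_d_pull:
  fixes g :: "'d::euclidean_space \<Rightarrow> 'e::euclidean_space"
  assumes \<alpha>: "smooth_form T k \<alpha>" and g: "smooth_open S g" and gT: "\<And>x. x \<in> S \<Longrightarrow> g x \<in> T"
    and x: "x \<in> S" and l: "length vs = Suc k"
  shows "ext_d (pull g \<alpha>) x vs = ext_d \<alpha> (g x) (map (frechet_derivative g (at x)) vs)"
proof -
  have S: "open S" using g smooth_openD by blast
  let ?D = "frechet_derivative g (at x)"
  define D2 where "D2 u v = frechet_derivative (\<lambda>y. frechet_derivative g (at y) u) (at x) v" for u v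
  have sym: "D2 u v = D2 v u" for u v unfolding D2_def by (rule second_derivative_symmetric[OF g x])
  have D\<alpha>: "frechet_derivative (\<lambda>y. \<alpha> (g y) cs) (at x) v = frechet_derivative (\<lambda>z. \<alpha> z cs) (at (g x)) (?D v)"
    if "length cs = k" for cs v
    using diff_chain_at[OF smooth_open_has_derivative[OF g x] has_derivative_frechet[OF smooth_formD(5)[OF \<alpha> that gT[OF x]]]]
    by (intro frechet_derivative_eq) (simp add: o_def)
  have P: "frechet_derivative (\<lambda>y. pull g \<alpha> y us) (at x) v =
     frechet_derivative (\<lambda>z. \<alpha> z (map ?D us)) (at (g x)) (?D v) +
     (\<Sum>j<k. \<alpha> (g x) ((map ?D us)[j := D2 (us ! j) v]))" if lu: "length us = k" for us v
  proof -
    have "frechet_derivative (\<lambda>y. \<alpha> (g y) (map (\<lambda>w. w y) (map (\<lambda>v y. frechet_derivative g (at y) v) us) @ [])) (at x) v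
      = frechet_derivative (\<lambda>y. \<alpha> (g y) (map (\<lambda>w. w x) (map (\<lambda>v y. frechet_derivative g (at y) v) us) @ [])) (at x) v +
       (\<Sum>j<length (map (\<lambda>v y. frechet_derivative g (at y) v) us). \<alpha> (g x) ((map (\<lambda>w. w x) (map (\<lambda>v y. frechet_derivative g (at y) v) us))[j := frechet_derivative (map (\<lambda>v y. frechet_derivative g (at y) v) us ! j) (at x) v] @ []))"
      using multilinear_moving[OF S, of k "\<lambda>y. \<alpha> (g y)" "map (\<lambda>v y. frechet_derivative g (at y) v) us" "[]" v]
        smooth_formD[OF \<alpha>] gT smooth_open_compose[OF g smooth_formD(4)[OF \<alpha>]] lu x
        smooth_open_frechet_derivative[OF g smooth_open_const[OF S]]
      by auto
    then show ?thesis using D\<alpha>[of "map ?D us"] lu by (simp add: pull_def o_def D2_def)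
  qed
  have "ext_d (pull g \<alpha>) x vs =
      alternate (Suc k) (\<lambda>us. frechet_derivative (\<lambda>y. pull g \<alpha> y (tl us)) (at x) (hd us)) vs / fact k"
    by (rule ext_d_eq_alternate[OF smooth_form_pull[OF \<alpha> g gT] x l])
  also have "alternate (Suc k) (\<lambda>us. frechet_derivative (\<lambda>y. pull g \<alpha> y (tl us)) (at x) (hd us)) vs =
     alternate (Suc k) (\<lambda>us. frechet_derivative (\<lambda>z. \<alpha> z (map ?D (tl us))) (at (g x)) (?D (hd us)) +
     (\<Sum>j<k. \<alpha> (g x) ((map ?D (tl us))[j := D2 (tl us ! j) (hd us)]))) vs"
    by (rule alternate_cong[OF _ l]) (simp add: P)
  also have "\<dots> = alternate (Suc k) (\<lambda>us. frechet_derivative (\<lambda>z. \<alpha> z (map ?D (tl us))) (at (g x)) (?D (hd us))) vs +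
     (\<Sum>j<k. alternate (Suc k) (\<lambda>us. \<alpha> (g x) ((map ?D (tl us))[j := D2 (tl us ! j) (hd us)])) vs)"
    by (simp add: alternate_add alternate_sum)
  also have "(\<Sum>j<k. alternate (Suc k) (\<lambda>us. \<alpha> (g x) ((map ?D (tl us))[j := D2 (tl us ! j) (hd us)])) vs) = 0"
  proof (intro sum.neutral ballI)
    fix j assume "j \<in> {..<k}"
    then have j: "j < k" by simp
    show "alternate (Suc k) (\<lambda>us. \<alpha> (g x) ((map ?D (tl us))[j := D2 (tl us ! j) (hd us)])) vs = 0"
    proof (rule alternate_swap_eq_0[OF l, of 0 "Suc j"])
      fix us :: "'d list" assume "length us = Suc k"
      then obtain a r where us: "us = a # r" "length r = k" by (cases us) auto
      show "\<alpha> (g x) ((map ?D (tl (us[0 := us ! Suc j, Suc j := us ! 0])))[j := D2 (tl (us[0 := us ! Suc j, Suc j := us ! 0]) ! j)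
           (hd (us[0 := us ! Suc j, Suc j := us ! 0]))]) = \<alpha> (g x) ((map ?D (tl us))[j := D2 (tl us ! j) (hd us)])"
        using us j by (simp add: map_update sym[of a])
    qed (use j in auto)
  qed
  also have "alternate (Suc k) (\<lambda>us. frechet_derivative (\<lambda>z. \<alpha> z (map ?D (tl us))) (at (g x)) (?D (hd us))) vs
    = alternate (Suc k) (\<lambda>us. frechet_derivative (\<lambda>z. \<alpha> z (tl us)) (at (g x)) (hd us)) (map ?D vs)"
    unfolding alternate_map[OF l]
    by (rule alternate_cong[OF _ l]) (metis length_0_conv list.map_sel map_tl nat.distinct(1))
  finally show ?thesis
    using ext_d_eq_alternate[OF \<alpha> gT[OF x], of "map ?D vs"] l by simp
qed

section \<open>Product rules and contraction\<close>

lemma list_wedge_1: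
  assumes g: "alternating_multilinear l g" and us: "length us = Suc l"
  shows "list_wedge 1 l a g us = (\<Sum>i<Suc l. (-1) ^ i * (a [us ! i] * g (drop_nth i us)))"
proof -
  have "alternate l (\<lambda>ws. a [us ! i] * g ws) (drop_nth i us) = fact l * (a [us ! i] * g (drop_nth i us))"
    if "i < Suc l" for i
    using alternate_alternating[OF g, of "drop_nth i us"] that us
    by (simp add: alternate_cmult length_drop_nth)
  then show ?thesis
    using us by (simp add: list_wedge_def alternate_Suc sum_divide_distrib del: sum.lessThan_Suc)
qed

lemma ext_d_scale:
  assumes \<gamma>: "smooth_form S l \<gamma>" and H: "smooth_open S H" and x: "x \<in> S" and us: "length us = Suc l"
  shows "ext_d (\<lambda>y ws. H y * \<gamma> y ws) x us =
     list_wedge 1 l (\<lambda>ws. frechet_derivative H (at x) (hd ws)) (\<gamma> x) us + H x * ext_d \<gamma> x us"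
proof -
  have "frechet_derivative (\<lambda>y. H y * \<gamma> y ws) (at x) v =
      frechet_derivative H (at x) v * \<gamma> x ws + H x * frechet_derivative (\<lambda>y. \<gamma> y ws) (at x) v"
    if "length ws = l" for ws v
    using has_derivative_mult[OF smooth_open_has_derivative[OF H x] has_derivative_frechet[OF smooth_formD(5)[OF \<gamma> that x]]]
    by (intro frechet_derivative_eq) (simp add: add.commute)
  then show ?thesis
    unfolding list_wedge_1[OF smooth_formD(2)[OF \<gamma> x] us] using us
    by (simp add: ext_d_def length_drop_nth distrib_left sum.distrib sum_distrib_left mult.left_commute)
qed

text \<open>The exchange of the first two vectors. In the product rule it is responsible both for a
  factor 2 that cancels \<open>fact 2\<close> and for the minus sign of the second term.\<close>

lemma alternate_drop_2:
  assumes vs: "length vs = Suc (Suc l)"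
  shows "alternate (Suc (Suc l)) (\<lambda>us. f (us ! 1) (us ! 0) (drop 2 us)) vs
      = - alternate (Suc (Suc l)) (\<lambda>us. f (us ! 0) (us ! 1) (drop 2 us)) vs"
proof -
  have "alternate (Suc (Suc l)) (\<lambda>us. f (us ! 1) (us ! 0) (drop 2 us)) vs =
    alternate (Suc (Suc l)) (\<lambda>us. f (us[0 := us ! 1, 1 := us ! 0] ! 0) (us[0 := us ! 1, 1 := us ! 0] ! 1) (drop 2 (us[0 := us ! 1, 1 := us ! 0]))) vs"
    by (rule alternate_cong[OF _ vs]) simp
  also have "\<dots> = - alternate (Suc (Suc l)) (\<lambda>us. f (us ! 0) (us ! 1) (drop 2 us)) vs"
    by (rule alternate_swap[OF vs, where B = "\<lambda>us. f (us ! 0) (us ! 1) (drop 2 us)"]) auto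
  finally show ?thesis .
qed

lemma frechet_derivative_alternate:
  assumes "\<And>us. length us = m \<Longrightarrow> (\<lambda>y. B y us) differentiable at x"
  shows "frechet_derivative (\<lambda>y. alternate m (B y) ws) (at x) v = alternate m (\<lambda>us. frechet_derivative (\<lambda>y. B y us) (at x) v) ws"
  unfolding alternate_def
  by (rule frechet_derivative_eq)
     (intro has_derivative_sum has_derivative_mult_right has_derivative_frechet assms, simp)

text \<open>All three terms are written as antisymmetrisations of \<open>?E\<close> and
  \<open>?F\<close>, in which slot 0 holds the direction of differentiation and slot 1 the argument
  of \<open>lam\<close>. The two halves of d(lam) contribute \<open>?E\<close> twice. In lam \<and>
  d(gam) the argument of \<open>lam\<close> comes first, so matching \<open>?F\<close> takes one
  exchange and hence a sign.\<close>

lemma ext_d_list_wedge: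
  assumes lam: "smooth_form S 1 lam" and gam: "smooth_form S l gam" and x: "x \<in> S" and vs: "length vs = Suc (Suc l)"
  shows "ext_d (\<lambda>y. list_wedge 1 l (lam y) (gam y)) x vs =
     list_wedge 2 l (ext_d lam x) (gam x) vs - list_wedge 1 (Suc l) (lam x) (ext_d gam x) vs"
proof -
  define Dl where "Dl v w = frechet_derivative (\<lambda>y. lam y [w]) (at x) v" for v w
  define Dg where "Dg v us = frechet_derivative (\<lambda>y. gam y us) (at x) v" for v us
  let ?E = "\<lambda>us. Dl (us ! 0) (us ! 1) * gam x (drop 2 us)"
  let ?F = "\<lambda>us. lam x [us ! 1] * Dg (us ! 0) (drop 2 us)"
  have split: "\<exists>a b r. us = a # b # r \<and> length r = l" if "length us = Suc (Suc l)" for us :: "'a list"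
    using that by (cases us; cases "tl us") auto
  have 1: "frechet_derivative (\<lambda>y. list_wedge 1 l (lam y) (gam y) ws) (at x) v =
     alternate (Suc l) (\<lambda>us. Dl v (us ! 0) * gam x (drop 1 us) + lam x [us ! 0] * Dg v (drop 1 us)) ws / fact l"
    if ws: "length ws = Suc l" for ws v
  proof -
    have h: "((\<lambda>y. lam y (take 1 us) * gam y (drop 1 us)) has_derivative
       (\<lambda>v. lam x [us ! 0] * Dg v (drop 1 us) + Dl v (us ! 0) * gam x (drop 1 us))) (at x)" if "length us = Suc l" for us
      using has_derivative_mult[OF has_derivative_frechet[OF smooth_formD(5)[OF lam _ x, of "take 1 us"]]
          has_derivative_frechet[OF smooth_formD(5)[OF gam _ x, of "drop 1 us"]]] that
      by (cases us) (auto simp: Dl_def Dg_def)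
    have dd: "(\<lambda>y. alternate (Suc l) (\<lambda>us. lam y (take 1 us) * gam y (drop 1 us)) ws) differentiable at x"
      unfolding alternate_def
      by (intro differentiable_sum ballI differentiable_mult[OF differentiable_const] differentiableI[OF h])
         (simp_all add: finite_permutations)
    have "frechet_derivative (\<lambda>y. list_wedge 1 l (lam y) (gam y) ws) (at x) v =
       frechet_derivative (\<lambda>y. alternate (Suc l) (\<lambda>us. lam y (take 1 us) * gam y (drop 1 us)) ws) (at x) v / fact l"
      using has_derivative_mult_left[OF has_derivative_frechet[OF dd], of "inverse (fact l)"]
      by (intro frechet_derivative_eq) (simp add: list_wedge_def divide_inverse)
    also have "frechet_derivative (\<lambda>y. alternate (Suc l) (\<lambda>us. lam y (take 1 us) * gam y (drop 1 us)) ws) (at x) v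
      = alternate (Suc l) (\<lambda>us. frechet_derivative (\<lambda>y. lam y (take 1 us) * gam y (drop 1 us)) (at x) v) ws"
      by (rule frechet_derivative_alternate) (use h in \<open>blast intro: differentiableI\<close>)
    also have "\<dots> = alternate (Suc l) (\<lambda>us. Dl v (us ! 0) * gam x (drop 1 us) + lam x [us ! 0] * Dg v (drop 1 us)) ws"
      by (rule alternate_cong[OF _ ws]) (subst frechet_derivative_eq[OF h], simp_all)
    finally show ?thesis .
  qed
  have L: "ext_d (\<lambda>y. list_wedge 1 l (lam y) (gam y)) x vs = alternate (Suc (Suc l)) (\<lambda>us. ?E us + ?F us) vs / fact l"
    unfolding alternate_Suc[OF vs] ext_d_def vs sum_divide_distrib
  proof (rule sum.cong[OF refl])
    fix i assume "i \<in> {..<Suc (Suc l)}"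
    then have "length (drop_nth i vs) = Suc l" using vs by (simp add: length_drop_nth)
    from 1[OF this] show "(-1) ^ i * frechet_derivative (\<lambda>y. list_wedge 1 l (lam y) (gam y) (drop_nth i vs)) (at x) (vs ! i) =
      (-1) ^ i * alternate (Suc l) (\<lambda>ws. ?E (vs ! i # ws) + ?F (vs ! i # ws)) (drop_nth i vs) / fact l"
      by (simp add: numeral_2_eq_2)
  qed
  have el: "ext_d lam x [a, b] = Dl a b - Dl b a" for a b
    by (simp add: ext_d_def Dl_def drop_nth_def)
  have "alternate (Suc (Suc l)) (\<lambda>us. ext_d lam x (take 2 us) * gam x (drop 2 us)) vs
     = alternate (Suc (Suc l)) (\<lambda>us. ?E us - Dl (us ! 1) (us ! 0) * gam x (drop 2 us)) vs"
    by (rule alternate_cong[OF _ vs], drule split) (auto simp: el algebra_simps)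
  also have "\<dots> = 2 * alternate (Suc (Suc l)) ?E vs"
    using alternate_drop_2[OF vs, of "\<lambda>a b r. Dl a b * gam x r"] by (simp add: alternate_diff)
  finally have R1: "list_wedge 2 l (ext_d lam x) (gam x) vs = alternate (Suc (Suc l)) ?E vs / fact l"
    by (simp add: list_wedge_def)
  have "list_wedge 1 (Suc l) (lam x) (ext_d gam x) vs = (\<Sum>i<Suc (Suc l). (-1) ^ i * (lam x [vs ! i] * ext_d gam x (drop_nth i vs)))"
    by (rule list_wedge_1[OF alternating_ext_d[OF gam x] vs])
  also have "\<dots> = alternate (Suc (Suc l)) (\<lambda>us. lam x [us ! 0] * Dg (us ! 1) (drop 2 us)) vs / fact l"
    unfolding alternate_Suc[OF vs] sum_divide_distrib
  proof (rule sum.cong[OF refl])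
    fix i assume "i \<in> {..<Suc (Suc l)}"
    then have lw: "length (drop_nth i vs) = Suc l" using vs by (simp add: length_drop_nth)
    have "ext_d gam x (drop_nth i vs) = alternate (Suc l) (\<lambda>us. Dg (us ! 0) (drop 1 us)) (drop_nth i vs) / fact l"
      unfolding ext_d_eq_alternate[OF gam x lw] Dg_def
      by (rule arg_cong[where f = "\<lambda>z. z / _"], rule alternate_cong[OF _ lw]) (auto simp: hd_conv_nth drop_Suc length_Suc_conv)
    then show "(-1) ^ i * (lam x [vs ! i] * ext_d gam x (drop_nth i vs)) =
      (-1) ^ i * alternate (Suc l) (\<lambda>ws. lam x [(vs ! i # ws) ! 0] * Dg ((vs ! i # ws) ! 1) (drop 2 (vs ! i # ws))) (drop_nth i vs) / fact l"
      by (simp add: alternate_cmult numeral_2_eq_2)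
  qed
  also have "alternate (Suc (Suc l)) (\<lambda>us. lam x [us ! 0] * Dg (us ! 1) (drop 2 us)) vs = - alternate (Suc (Suc l)) ?F vs"
    using alternate_drop_2[OF vs, of "\<lambda>a b r. lam x [b] * Dg a r"] by simp
  finally show ?thesis unfolding L R1 by (simp add: alternate_add add_divide_distrib)
qed

text \<open>The contraction of w \<and> g with v has the further term w \<and> (contraction of g),
  in which w only sees vectors of \<open>us\<close>; this term vanishes by the isotropy assumption
  \<open>z\<close>, which will be the Lagrangian condition. What remains has v in the first or in
  the second slot of w. By skewness both placements contribute the same, which cancels the 2 in the
  normalisation.\<close>

lemma list_wedge_2_contract:
  assumes us: "length us = Suc l" and skew: "\<And>a b. w [a, b] = - w [b, a]"
    and z: "\<And>a b. a \<in> set us \<Longrightarrow> b \<in> set us \<Longrightarrow> w [a, b] = 0"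
  shows "list_wedge 2 l w g (v # us) = list_wedge 1 l (\<lambda>ws. w (v # ws)) g us"
proof -
  let ?B = "\<lambda>us. w (take 2 us) * g (drop 2 us)"
  have l2: "length (v # us) = Suc (Suc l)" using us by simp
  let ?A = "alternate (Suc l) (\<lambda>ws. w (v # take 1 ws) * g (drop 1 ws)) us"
  have t: "alternate (Suc l) (\<lambda>ws. ?B (us ! i # ws)) (v # drop_nth i us) = - alternate l (\<lambda>ws. w [v, us ! i] * g ws) (drop_nth i us)"
    if i: "i < Suc l" for i
  proof -
    have lw: "length (v # drop_nth i us) = Suc l" using us i by (simp add: length_drop_nth)
    have "alternate (Suc l) (\<lambda>ws. ?B (us ! i # ws)) (v # drop_nth i us) =
       alternate l (\<lambda>ws. ?B (us ! i # v # ws)) (drop_nth i us) +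
       (\<Sum>j<l. (-1) ^ Suc j * alternate l (\<lambda>ws. ?B (us ! i # drop_nth i us ! j # ws)) (drop_nth (Suc j) (v # drop_nth i us)))"
      unfolding alternate_Suc[OF lw] by (subst sum.lessThan_Suc_shift) (simp add: drop_nth_Cons)
    also have "(\<Sum>j<l. (-1) ^ Suc j * alternate l (\<lambda>ws. ?B (us ! i # drop_nth i us ! j # ws)) (drop_nth (Suc j) (v # drop_nth i us))) = 0"
    proof (intro sum.neutral ballI)
      fix j assume "j \<in> {..<l}"
      then have "drop_nth i us ! j \<in> set us"
        using us i set_drop_nth_subset[of i us] by (metis length_drop_nth diff_Suc_1 lessThan_iff nth_mem subsetD)
      then show "(-1) ^ Suc j * alternate l (\<lambda>ws. ?B (us ! i # drop_nth i us ! j # ws)) (drop_nth (Suc j) (v # drop_nth i us)) = 0"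
        using z[of "us ! i"] us i by (simp add: numeral_2_eq_2)
    qed
    also have "(\<lambda>ws. ?B (us ! i # v # ws)) = (\<lambda>ws. (-1) * (w [v, us ! i] * g ws))"
      using skew[of "us ! i" v] by (simp add: numeral_2_eq_2)
    finally show ?thesis using alternate_cmult[of l "-1"] by simp
  qed
  have "alternate (Suc (Suc l)) ?B (v # us) = ?A + (\<Sum>i<Suc l. (-1) ^ Suc i * alternate (Suc l) (\<lambda>ws. ?B (us ! i # ws)) (v # drop_nth i us))"
    unfolding alternate_Suc[OF l2] by (subst sum.lessThan_Suc_shift) (simp add: drop_nth_Cons numeral_2_eq_2)
  also have "(\<Sum>i<Suc l. (-1) ^ Suc i * alternate (Suc l) (\<lambda>ws. ?B (us ! i # ws)) (v # drop_nth i us))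
      = (\<Sum>i<Suc l. (-1) ^ i * alternate l (\<lambda>ws. w [v, us ! i] * g ws) (drop_nth i us))"
    by (rule sum.cong[OF refl], simp only: t lessThan_iff) simp
  also have "\<dots> = ?A" unfolding alternate_Suc[OF us] by simp
  finally show ?thesis by (simp add: list_wedge_def)
qed

lemma smooth_form_list_wedge:
  assumes a: "smooth_form S k a" and b: "smooth_form S l b"
  shows "smooth_form S (k + l) (\<lambda>y. list_wedge k l (a y) (b y))"
  unfolding smooth_form_def
proof (intro conjI ballI allI impI)
  show S: "open S" using a smooth_formD by blast
  fix x assume x: "x \<in> S"
  have "multilinear (k + l) (\<lambda>us. a x (take k us) * b x (drop k us))"
  proof (rule multilinearI_update)
    fix ws :: "'a list" and i assume h: "length ws = k + l" "i < k + l"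
    show "linear (\<lambda>w. a x (take k (ws[i := w])) * b x (drop k (ws[i := w])))"
    proof (cases "i < k")
      case True
      have "linear (\<lambda>w. a x ((take k ws)[i := w]) * b x (drop k ws))"
        using multilinear_update[OF smooth_formD(3)[OF a x], of "take k ws" i] True h
        by (simp add: linear_iff algebra_simps)
      then show ?thesis using True by (simp add: take_update_swap)
    next
      case False
      have "linear (\<lambda>w. a x (take k ws) * b x ((drop k ws)[i - k := w]))"
        using multilinear_update[OF smooth_formD(3)[OF b x], of "drop k ws" "i - k"] False h
        by (simp add: linear_iff algebra_simps)
      then show ?thesis using False by (simp add: drop_update_swap)
    qed
  qed
  from alternating_alternate[OF this]
  show "alternating_multilinear (k + l) (list_wedge k l (a x) (b x))"
    unfolding alternating_multilinear_def list_wedge_def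
    by (auto simp: linear_iff add_divide_distrib)
next
  fix ws :: "'a list" assume "length ws = k + l"
  have o: "open S" using a smooth_formD by blast
  have "smooth_open S (\<lambda>x. inverse (fact k * fact l) * alternate (k + l) (\<lambda>us. a x (take k us) * b x (drop k us)) ws)"
    unfolding alternate_def
    by (intro smooth_open_mult smooth_open_sum smooth_open_const o smooth_formD(4)[OF a] smooth_formD(4)[OF b]) auto
  then show "smooth_open S (\<lambda>x. list_wedge k l (a x) (b x) ws)"
    by (simp add: list_wedge_def divide_inverse mult.commute)
qed

section \<open>Top degree forms and determinants\<close>

lemma multilinear_eq_0:
  assumes A: "multilinear k A" and z: "\<And>bs. length bs = k \<Longrightarrow> set bs \<subseteq> Basis \<Longrightarrow> A bs = 0"
    and ws: "length ws = k"
  shows "A ws = 0"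
proof -
  have "A (us @ bs) = 0" if "length us + length bs = k" "set bs \<subseteq> Basis" for us bs
    using that
  proof (induction us arbitrary: bs rule: rev_induct)
    case Nil
    then show ?case using z by simp
  next
    case (snoc w us)
    then have l: "linear (\<lambda>w. A (us @ w # bs))" by (intro multilinearD[OF A]) simp
    have "A (us @ w # bs) = A (us @ (\<Sum>b\<in>Basis. (w \<bullet> b) *\<^sub>R b) # bs)" by (simp add: euclidean_representation)
    also have "\<dots> = (\<Sum>b\<in>Basis. (w \<bullet> b) *\<^sub>R A (us @ b # bs))"
      unfolding linear_sum[OF l] linear_scale[OF l] ..
    also have "\<dots> = 0" using snoc by (intro sum.neutral ballI) simp
    finally show ?case by simp
  qed
  from this[of ws "[]"] ws show ?thesis by simp
qed

lemma length_standard_frame [simp]: "length (standard_frame :: (real^'n::{finite,wellorder}) list) = CARD('n)"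
  by (simp add: standard_frame_def)

lemma distinct_standard_frame: "distinct (standard_frame :: (real^'n::{finite,wellorder}) list)"
  by (simp add: standard_frame_def distinct_map inj_on_def axis_eq_axis)

lemma set_standard_frame: "set (standard_frame :: (real^'n::{finite,wellorder}) list) = Basis"
  by (auto simp: standard_frame_def Basis_vec_def)

text \<open>By multilinearity only lists of basis vectors matter. Such a list either repeats a
  vector, where both forms vanish, or is a permutation of the frame, where both are determined up to
  the same sign.\<close>

lemma alternating_eq_on_standard_frame:
  fixes A B :: "(real^'n::{finite,wellorder}) list \<Rightarrow> real"
  assumes A: "alternating_multilinear CARD('n) A" and B: "alternating_multilinear CARD('n) B"
    and eq: "A standard_frame = B standard_frame" and ws: "length ws = CARD('n)"
  shows "A ws = B ws"
proof -
  define C where "C ws = A ws - B ws" for ws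
  have C: "alternating_multilinear CARD('n) C"
    using A B unfolding C_def alternating_multilinear_def by (auto simp: linear_iff algebra_simps)
  have "C ws = 0"
  proof (rule multilinear_eq_0[OF _ _ ws])
    show "multilinear CARD('n) C" using C by (simp add: alternating_multilinear_iff)
    fix bs :: "(real^'n::_) list" assume l: "length bs = CARD('n)" and b: "set bs \<subseteq> Basis"
    show "C bs = 0"
    proof (cases "distinct bs")
      case False
      then obtain i j where ij: "i < length bs" "j < length bs" "i \<noteq> j" "bs ! i = bs ! j"
        by (auto simp: distinct_conv_nth)
      then have "min i j < max i j" "max i j < CARD('n)" "bs ! min i j = bs ! max i j"
        using l by (auto simp: min_def max_def)
      moreover have "\<forall>ws i j. length ws = CARD('n) \<and> i < j \<and> j < CARD('n) \<and> ws ! i = ws ! j \<longrightarrow> C ws = 0"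
        using C by (simp add: alternating_multilinear_iff)
      ultimately show ?thesis using l by (metis (no_types))
    next
      case True
      have "card (set bs) = card (Basis :: (real^'n::_) set)"
        using distinct_card[OF True] l by simp
      then have "set bs = set (standard_frame :: (real^'n::_) list)"
        using b card_subset_eq[OF finite_Basis b] set_standard_frame by metis
      then have "mset bs = mset (standard_frame :: (real^'n::_) list)"
        using True distinct_standard_frame set_eq_iff_mset_eq_distinct by blast
      then obtain p where p: "p permutes {..<CARD('n)}" "permute_list p (standard_frame :: (real^'n::_) list) = bs"
        using mset_eq_permutation[of bs standard_frame] by (auto simp: l)
      then have "C bs = of_int (sign p) * C standard_frame"
        using alternating_permute[OF C length_standard_frame p(1)] by (simp add: permute_list_def)
      then show ?thesis using eq by (simp add: C_def)
    qed
  qed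
  then show ?thesis by (simp add: C_def)
qed

text \<open>The determinant is itself an alternating form with value 1 on the frame, so A is its
  multiple by \<open>A standard_frame\<close>; evaluating both on the images of the frame vectors
  gives the factor.\<close>

lemma alternating_det:
  fixes A :: "(real^'n::{finite,wellorder}) list \<Rightarrow> real"
  assumes A: "alternating_multilinear CARD('n) A" and f: "linear f"
  shows "A (map f standard_frame) = det (matrix f) * A standard_frame"
proof -
  define idx where "idx = sorted_list_of_set (UNIV :: 'n set)"
  have len: "length idx = CARD('n)" by (simp add: idx_def)
  have bij: "bij_betw ((!) idx) {..<CARD('n)} UNIV"
    using bij_betw_nth[of idx "{..<CARD('n)}" UNIV] by (simp add: idx_def)
  define pos where "pos = inv_into {..<CARD('n)} ((!) idx)"
  have pos: "pos j < CARD('n)" "idx ! pos j = j" for j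
    using bij_betw_inv_into[OF bij] bij_betw_inv_into_right[OF bij] bij_betwE unfolding pos_def by blast+
  have pos_idx: "pos (idx ! k) = k" if "k < CARD('n)" for k
    using bij_betw_inv_into_left[OF bij] that unfolding pos_def by simp
  \<comment> \<open>The vectors are the rows, ordered by the position of the index in the sorted
    index list. The vectors f(e_j) thus form the transpose of \<open>matrix f\<close>, which has the
    same determinant.\<close>
  define D where "D ws = det (\<chi> j. ws ! pos j)" for ws :: "(real^'n::_) list"
  have "alternating_multilinear CARD('n) D"
    unfolding alternating_multilinear_iff
  proof (intro conjI allI impI)
    show "multilinear CARD('n) D"
    proof (rule multilinearI_update)
      fix ws :: "(real^'n::_) list" and i assume l: "length ws = CARD('n)" "i < CARD('n)"
      have e: "(\<chi> j. ws[i := w] ! pos j) = (\<chi> j. if j = idx ! i then w else ws ! pos j)" for w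
        using pos pos_idx l by (auto simp: vec_eq_iff nth_list_update)
      have a: "det (\<chi> j. if j = idx ! i then v + w else ws ! pos j) = det (\<chi> j. if j = idx ! i then v else ws ! pos j) +
          det (\<chi> j. if j = idx ! i then w else ws ! pos j)" for v w
        using det_row_add[of "idx ! i" "\<lambda>j. v" "\<lambda>j. w" "\<lambda>j. ws ! pos j"] .
      have m: "det (\<chi> j. if j = idx ! i then r *\<^sub>R w else ws ! pos j) = r * det (\<chi> j. if j = idx ! i then w else ws ! pos j)" for r w
        using det_row_mul[of "idx ! i" r "\<lambda>j. w" "\<lambda>j. ws ! pos j"] unfolding scalar_mult_eq_scaleR .
      show "linear (\<lambda>w. D (ws[i := w]))"
        unfolding D_def e by (rule linearI) (simp_all only: a m real_scaleR_def)
    qed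
    fix ws :: "(real^'n::_) list" and i j assume h: "length ws = CARD('n) \<and> i < j \<and> j < CARD('n) \<and> ws ! i = ws ! j"
    then have "idx ! i \<noteq> idx ! j"
      using len by (simp add: idx_def nth_eq_iff_index_eq)
    then show "D ws = 0"
      unfolding D_def using h pos_idx
      by (intro det_identical_rows[of "idx ! i" "idx ! j"]) (auto simp: row_def vec_eq_iff)
  qed
  then have DA: "alternating_multilinear CARD('n) (\<lambda>ws. D ws * A standard_frame)"
    unfolding alternating_multilinear_def by (auto simp: linear_iff algebra_simps)
  have sf: "(standard_frame :: (real^'n::_) list) ! pos j = axis j 1" for j
    using pos len by (simp add: standard_frame_def flip: idx_def)
  have "(\<chi> j. (standard_frame :: (real^'n::_) list) ! pos j) = mat 1"
    by (simp add: sf vec_eq_iff mat_def axis_def)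
  then have "D standard_frame = 1" by (simp add: D_def det_I)
  then have "A (map f standard_frame) = D (map f standard_frame) * A standard_frame"
    using alternating_eq_on_standard_frame[OF A DA, of "map f standard_frame"] by simp
  also have "(\<chi> j. map f (standard_frame :: (real^'n::_) list) ! pos j) = Finite_Cartesian_Product.transpose (matrix f)"
    using pos by (simp add: sf vec_eq_iff matrix_def Finite_Cartesian_Product.transpose_def)
  then have "D (map f standard_frame) = det (matrix f)" by (simp add: D_def det_transpose)
  finally show ?thesis .
qed

section \<open>Charts and forms on manifolds\<close>

text \<open>The common ground of smooth manifolds, oriented manifolds and images of embeddings:
  enough to change charts, while maximality of the atlas and the separation axiom are invoked
  separately where they enter.\<close>

definition smooth_atlas :: "('a, 'e::euclidean_space) manifold \<Rightarrow> bool" where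
  "smooth_atlas M \<longleftrightarrow> (\<forall>c\<in>atlas_of M. is_chart (top_of M) c) \<and> (\<Union>c\<in>atlas_of M. fst c) = points M \<and>
     (\<forall>c\<in>atlas_of M. \<forall>c'\<in>atlas_of M. smoothly_compatible c c')"

lemma smooth_manifold_smooth_atlas: "smooth_manifold M \<Longrightarrow> smooth_atlas M"
  unfolding manifold_with_def smooth_atlas_def by (elim conjE, intro conjI)

lemma oriented_manifold_smooth_atlas: "oriented_manifold M \<Longrightarrow> smooth_atlas M"
  unfolding manifold_with_def smooth_atlas_def orientedly_compatible_def
  by (elim conjE, intro conjI) (assumption | (intro ballI, drule bspec, assumption, drule bspec, assumption, erule conjunct1))+

lemma chart_inv_in: "x \<in> chart_image c \<Longrightarrow> chart_inv c x \<in> fst c"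
  by (auto simp: chart_image_def chart_inv_def inv_into_into)

lemma chart_chart_inv [simp]: "x \<in> chart_image c \<Longrightarrow> snd c (chart_inv c x) = x"
  by (auto simp: chart_image_def chart_inv_def f_inv_into_f)

lemma chart_in_image: "p \<in> fst c \<Longrightarrow> snd c p \<in> chart_image c"
  by (simp add: chart_image_def)

lemma is_chart_inj: "is_chart T c \<Longrightarrow> inj_on (snd c) (fst c)"
  unfolding is_chart_def homeomorphic_map_def
  by (metis inf.absorb_iff2 injective_quotient_map openin_subset topspace_subtopology)

lemma is_chart_homeomorphism:
  assumes "is_chart T c"
  shows "homeomorphic_maps (subtopology T (fst c)) (top_of_set (chart_image c)) (snd c) (chart_inv c)"
proof -
  have t: "topspace (subtopology T (fst c)) = fst c"
    using assms openin_subset unfolding is_chart_def by (auto simp: topspace_subtopology)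
  obtain g where g: "homeomorphic_maps (subtopology T (fst c)) (top_of_set (chart_image c)) (snd c) g"
    using assms homeomorphic_map_maps unfolding is_chart_def by blast
  have "g y = chart_inv c y" if "y \<in> chart_image c" for y
  proof -
    have "g y \<in> fst c" "snd c (g y) = y"
      using g that t unfolding homeomorphic_maps_def continuous_map_def by auto
    then show ?thesis
      using is_chart_inj[OF assms] unfolding chart_inv_def by (metis inv_into_f_f)
  qed
  then show ?thesis
    using g homeomorphic_maps_eq[OF g, of "snd c" "chart_inv c"] by simp
qed

context
  fixes M :: "('a, 'e::euclidean_space) manifold" and c :: "('a, 'e) chart"
  assumes M: "smooth_atlas M" and c: "c \<in> atlas_of M"
begin

lemma chart_is_chart: "is_chart (top_of M) c"
  using M c by (simp add: smooth_atlas_def)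

lemma chart_openin: "openin (top_of M) (fst c)"
  using chart_is_chart by (simp add: is_chart_def)

lemma chart_subset: "fst c \<subseteq> points M"
  using chart_openin by (rule openin_subset)

lemma open_chart_image: "open (chart_image c)"
  using chart_is_chart by (simp add: is_chart_def)

lemma chart_inv_chart [simp]: "p \<in> fst c \<Longrightarrow> chart_inv c (snd c p) = p"
  using is_chart_inj[OF chart_is_chart] by (simp add: chart_inv_def)

lemma chart_image_of_subset:
  assumes "V \<subseteq> fst c" shows "snd c ` V = {x \<in> chart_image c. chart_inv c x \<in> V}"
proof (intro equalityI subsetI)
  fix x assume "x \<in> snd c ` V"
  then show "x \<in> {x \<in> chart_image c. chart_inv c x \<in> V}"
    using assms chart_in_image[of _ c] by auto
next
  fix x assume "x \<in> {x \<in> chart_image c. chart_inv c x \<in> V}"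
  then show "x \<in> snd c ` V" by (metis (mono_tags) chart_chart_inv image_eqI mem_Collect_eq)
qed

lemma continuous_map_chart_inv:
  "continuous_map (top_of_set (chart_image c)) (top_of M) (chart_inv c)"
  using is_chart_homeomorphism[OF chart_is_chart]
  by (simp add: homeomorphic_maps_def continuous_map_in_subtopology)

lemma continuous_map_chart:
  "continuous_map (subtopology (top_of M) (fst c)) euclidean (snd c)"
  using is_chart_homeomorphism[OF chart_is_chart]
  by (simp add: homeomorphic_maps_def continuous_map_in_subtopology)

lemma open_chart_inv_vimage:
  assumes "openin (top_of M) V" shows "open {x \<in> chart_image c. chart_inv c x \<in> V}"
proof -
  have "openin (top_of_set (chart_image c)) {x \<in> chart_image c. chart_inv c x \<in> V}"
    using openin_continuous_map_preimage[OF continuous_map_chart_inv assms] by simp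
  then show ?thesis using open_chart_image openin_open_eq by blast
qed

lemma compact_chart:
  assumes "compactin (top_of M) C" "C \<subseteq> fst c" shows "compact (snd c ` C)"
  using image_compactin[OF _ continuous_map_chart, of C] assms
  by (simp add: compactin_subtopology)

lemma openin_chart_vimage:
  assumes "open V" shows "openin (top_of M) {p \<in> fst c. snd c p \<in> V}"
proof -
  have "openin (subtopology (top_of M) (fst c)) {p \<in> topspace (subtopology (top_of M) (fst c)). snd c p \<in> V}"
    using openin_continuous_map_preimage[OF continuous_map_chart] assms by simp
  moreover have "topspace (subtopology (top_of M) (fst c)) = fst c"
    using chart_subset by (auto simp: topspace_subtopology)
  ultimately have "openin (subtopology (top_of M) (fst c)) {p \<in> fst c. snd c p \<in> V}" by (simp only:)
  then show ?thesis using chart_openin by (rule openin_trans_full)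
qed

lemma compactin_chart_inv:
  assumes "compact C" "C \<subseteq> chart_image c" shows "compactin (top_of M) (chart_inv c ` C)"
  using image_compactin[OF _ continuous_map_chart_inv, of C] assms
  by (simp add: compactin_subtopology)

end

lemma transition_smooth:
  assumes "smooth_atlas M" "c \<in> atlas_of M" "c' \<in> atlas_of M"
  shows "smooth_open (snd c ` (fst c \<inter> fst c')) (\<lambda>x. snd c' (chart_inv c x))"
proof -
  have o: "open (snd c ` (fst c \<inter> fst c'))"
  proof -
    have "open {x \<in> chart_image c. chart_inv c x \<in> fst c'}"
      by (rule open_chart_inv_vimage[OF assms(1,2) chart_openin[OF assms(1,3)]])
    moreover have "snd c ` (fst c \<inter> fst c') = {x \<in> chart_image c. chart_inv c x \<in> fst c'}"
      using chart_image_of_subset[OF assms(1,2), of "fst c \<inter> fst c'"] chart_inv_in[of _ c] by auto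
    ultimately show ?thesis by simp
  qed
  have "smooth_on (snd c ` (fst c \<inter> fst c')) (snd c' \<circ> chart_inv c)"
    using assms by (simp add: smooth_atlas_def smoothly_compatible_def)
  then show ?thesis unfolding smooth_on_iff_smooth_open[OF o] by (simp add: o_def)
qed

text \<open>A pushed vector has a component in every chart, and by the chain rule for transition
  maps all of them are generated by the component in one chart c.\<close>

lemma push_vector_chart:
  assumes M: "smooth_atlas M" and c: "c \<in> atlas_of M" and W: "open W" "x \<in> W" "\<And>y. y \<in> W \<Longrightarrow> g y \<in> fst c"
    and d: "(\<lambda>y. snd c (g y)) differentiable at x"
  shows "push_vector M g x w =
     push_vector M (chart_inv c) (snd c (g x)) (frechet_derivative (\<lambda>y. snd c (g y)) (at x) w)"
proof
  fix c'
  have gx: "g x \<in> fst c" using W by blast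
  show "push_vector M g x w c' =
     push_vector M (chart_inv c) (snd c (g x)) (frechet_derivative (\<lambda>y. snd c (g y)) (at x) w) c'"
  proof (cases "c' \<in> atlas_of M \<and> g x \<in> fst c'")
    case True
    have t: "smooth_open (snd c ` (fst c \<inter> fst c')) (\<lambda>x. snd c' (chart_inv c x))"
      using True by (intro transition_smooth[OF M c]) auto
    have "snd c (g x) \<in> snd c ` (fst c \<inter> fst c')" using True gx by blast
    from diff_chain_at[OF has_derivative_frechet[OF d] smooth_open_has_derivative[OF t this]]
    have "((\<lambda>y. snd c' (chart_inv c (snd c (g y)))) has_derivative
        (\<lambda>w. frechet_derivative (\<lambda>x. snd c' (chart_inv c x)) (at (snd c (g x))) (frechet_derivative (\<lambda>y. snd c (g y)) (at x) w))) (at x)"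
      by (simp add: o_def)
    then have "((\<lambda>y. snd c' (g y)) has_derivative
        (\<lambda>w. frechet_derivative (\<lambda>x. snd c' (chart_inv c x)) (at (snd c (g x))) (frechet_derivative (\<lambda>y. snd c (g y)) (at x) w))) (at x)"
      by (rule has_derivative_transform_within_open[OF _ W(1,2)]) (simp add: W(3) chart_inv_chart[OF M c])
    then show ?thesis
      using True gx by (simp add: push_vector_def chart_inv_chart[OF M c] frechet_derivative_eq)
  qed (auto simp: push_vector_def chart_inv_chart[OF M c gx])
qed

lemma frechet_derivative_chart_inv:
  assumes "smooth_atlas M" "c \<in> atlas_of M" "x \<in> chart_image c"
  shows "frechet_derivative (\<lambda>y. snd c (chart_inv c y)) (at x) w = w"
  by (rule frechet_derivative_eq)
     (rule has_derivative_transform_within_open[OF has_derivative_ident open_chart_image[OF assms(1,2)] assms(3)], simp)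

lemma push_vector_chart_component:
  assumes "smooth_atlas M" "c \<in> atlas_of M" "x \<in> chart_image c"
  shows "push_vector M (chart_inv c) x w c = w"
  using assms chart_inv_in[OF assms(3)] frechet_derivative_chart_inv[OF assms]
  by (simp add: push_vector_def)

lemma push_vector_change_chart:
  assumes M: "smooth_atlas M" and c: "c \<in> atlas_of M" "c' \<in> atlas_of M" and x: "x \<in> chart_image c" "chart_inv c x \<in> fst c'"
  shows "push_vector M (chart_inv c) x w =
    push_vector M (chart_inv c') (snd c' (chart_inv c x)) (frechet_derivative (\<lambda>y. snd c' (chart_inv c y)) (at x) w)"
proof -
  have o: "open {x \<in> chart_image c. chart_inv c x \<in> fst c'}"
    by (rule open_chart_inv_vimage[OF M c(1) chart_openin[OF M c(2)]])
  have "x \<in> snd c ` (fst c \<inter> fst c')" using x chart_inv_in[OF x(1)] by (metis IntI chart_chart_inv image_eqI)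
  then have "(\<lambda>y. snd c' (chart_inv c y)) differentiable at x"
    by (rule smooth_open_differentiable[OF transition_smooth[OF M c]])
  then show ?thesis using x by (intro push_vector_chart[OF M c(2) o]) auto
qed

lemma push_vector_in_tangent_space:
  assumes M: "smooth_atlas M" and c: "c \<in> atlas_of M" and x: "x \<in> chart_image c"
  shows "push_vector M (chart_inv c) x w \<in> tangent_space M (chart_inv c x)"
  unfolding tangent_space_def
proof (intro CollectI ballI impI)
  fix c' assume c': "c' \<in> atlas_of M" "chart_inv c x \<in> fst c'"
  then have "push_vector M (chart_inv c) x w c' = frechet_derivative (\<lambda>y. snd c' (chart_inv c y)) (at x) w"
    by (simp add: push_vector_def)
  then show "push_vector M (chart_inv c) x w =
      push_vector M (chart_inv c') (snd c' (chart_inv c x)) (push_vector M (chart_inv c) x w c')"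
    using push_vector_change_chart[OF M c c'(1) x c'(2)] by simp
qed

lemma chart_at_in:
  assumes "smooth_atlas M" "p \<in> points M" shows "chart_at M p \<in> atlas_of M" "p \<in> fst (chart_at M p)"
proof -
  have "\<exists>c. c \<in> atlas_of M \<and> p \<in> fst c" using assms unfolding smooth_atlas_def by blast
  from someI_ex[OF this] show "chart_at M p \<in> atlas_of M" "p \<in> fst (chart_at M p)"
    unfolding chart_at_def by auto
qed

lemma exterior_derivative_eq_ext_d:
  "exterior_derivative M \<alpha> p vs =
     ext_d (local_form M \<alpha> (chart_at M p)) (snd (chart_at M p) p) (map (\<lambda>v. v (chart_at M p)) vs)"
  by (simp add: exterior_derivative_def ext_d_def Let_def)

lemma smooth_form_local_form:
  assumes "smooth_atlas M" "c \<in> atlas_of M" "differential_form M k \<alpha>"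
  shows "smooth_form (chart_image c) k (local_form M \<alpha> c)"
  using assms(2,3) open_chart_image[OF assms(1,2)]
  unfolding smooth_form_def differential_form_def smooth_on_iff_smooth_open[OF open_chart_image[OF assms(1,2)], symmetric]
  by blast

lemma local_form_change_chart:
  assumes M: "smooth_atlas M" and c: "c \<in> atlas_of M" "c' \<in> atlas_of M" and x: "x \<in> snd c ` (fst c \<inter> fst c')"
  shows "local_form M \<alpha> c x ws = pull (\<lambda>y. snd c' (chart_inv c y)) (local_form M \<alpha> c') x ws"
proof -
  have x': "x \<in> chart_image c" "chart_inv c x \<in> fst c'"
    using x chart_inv_chart[OF M c(1)] by (auto simp: chart_image_def)
  have "push_vector M (chart_inv c) x = (\<lambda>w. push_vector M (chart_inv c') (snd c' (chart_inv c x))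
      (frechet_derivative (\<lambda>y. snd c' (chart_inv c y)) (at x) w))"
    using push_vector_change_chart[OF M c x'] by blast
  then show ?thesis
    using chart_inv_chart[OF M c(2) x'(2)] by (simp add: pull_def local_form_def o_def)
qed

text \<open>\<open>frechet_derivative\<close> selects among the candidate derivatives, and functions
  that agree near x have the same candidates. The equality therefore holds even where no derivative
  exists.\<close>

lemma frechet_derivative_cong_open:
  assumes "open S" "x \<in> S" "\<And>y. y \<in> S \<Longrightarrow> f y = g y"
  shows "frechet_derivative f (at x) = frechet_derivative g (at x)"
proof -
  have "(f has_derivative D) (at x) \<longleftrightarrow> (g has_derivative D) (at x)" for D
    using has_derivative_transform_within_open[OF _ assms(1,2)] assms(3) by metis
  then show ?thesis unfolding frechet_derivative_def by simp
qed

lemma ext_d_cong_open: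
  assumes "open S" "x \<in> S" "length vs = Suc k" "\<And>y ws. y \<in> S \<Longrightarrow> length ws = k \<Longrightarrow> \<alpha> y ws = \<beta> y ws"
  shows "ext_d \<alpha> x vs = ext_d \<beta> x vs"
  unfolding ext_d_def
proof (rule sum.cong[OF refl])
  fix i assume "i \<in> {..<length vs}"
  then have "length (drop_nth i vs) = k" using assms(3) by (simp add: length_drop_nth)
  then have "frechet_derivative (\<lambda>y. \<alpha> y (drop_nth i vs)) (at x) = frechet_derivative (\<lambda>y. \<beta> y (drop_nth i vs)) (at x)"
    using assms(4) by (intro frechet_derivative_cong_open[OF assms(1,2)]) simp
  then show "(-1) ^ i * frechet_derivative (\<lambda>y. \<alpha> y (drop_nth i vs)) (at x) (vs ! i) =
    (-1) ^ i * frechet_derivative (\<lambda>y. \<beta> y (drop_nth i vs)) (at x) (vs ! i)" by simp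
qed

text \<open>\<open>exterior_derivative\<close> is evaluated in the chart picked by
  \<open>chart_at\<close>. Naturality of d under transition maps allows any other chart of the atlas
  to be used instead.\<close>

lemma ext_d_change_chart:
  assumes M: "smooth_atlas M" and c: "c \<in> atlas_of M" "c' \<in> atlas_of M" and \<alpha>: "differential_form M k \<alpha>"
    and x: "x \<in> snd c ` (fst c \<inter> fst c')" and l: "length vs = Suc k"
  shows "ext_d (local_form M \<alpha> c) x vs =
    ext_d (local_form M \<alpha> c') (snd c' (chart_inv c x)) (map (frechet_derivative (\<lambda>y. snd c' (chart_inv c y)) (at x)) vs)"
proof -
  note t = transition_smooth[OF M c]
  have "ext_d (local_form M \<alpha> c) x vs = ext_d (pull (\<lambda>y. snd c' (chart_inv c y)) (local_form M \<alpha> c')) x vs"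
    by (rule ext_d_cong_open[OF smooth_openD(1)[OF t] x l]) (rule local_form_change_chart[OF M c])
  also have "\<dots> = ext_d (local_form M \<alpha> c') (snd c' (chart_inv c x)) (map (frechet_derivative (\<lambda>y. snd c' (chart_inv c y)) (at x)) vs)"
  proof (rule ext_d_pull[OF smooth_form_local_form[OF M c(2) \<alpha>] t _ x l])
    fix y assume "y \<in> snd c ` (fst c \<inter> fst c')"
    then show "snd c' (chart_inv c y) \<in> chart_image c'"
      using chart_inv_chart[OF M c(1)] by (auto simp: chart_image_def)
  qed
  finally show ?thesis .
qed

text \<open>\<open>tangent_map\<close> is computed in the chart picked by \<open>chart_at\<close>;
  the chain rule with the transition map shows that the chart c at hand gives the same vector.
  Differentiability is asked in the picked chart only.\<close>

lemma tangent_map_push_vector: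
  assumes M: "smooth_atlas M" and c: "c \<in> atlas_of M" and x: "x \<in> chart_image c"
    and d: "\<And>e. e \<in> atlas_of N \<Longrightarrow> f (chart_inv c x) \<in> fst e \<Longrightarrow>
      (\<lambda>y. snd e (f (chart_inv (chart_at M (chart_inv c x)) y))) differentiable at (snd (chart_at M (chart_inv c x)) (chart_inv c x))"
  shows "tangent_map M N f (chart_inv c x) (push_vector M (chart_inv c) x w) = push_vector N (\<lambda>y. f (chart_inv c y)) x w"
proof
  fix e
  let ?p = "chart_inv c x"
  let ?k = "chart_at M ?p"
  have p: "?p \<in> fst c" "?p \<in> points M" using chart_inv_in[OF x] chart_subset[OF M c] by auto
  note k = chart_at_in[OF M p(2)]
  have xo: "x \<in> snd c ` (fst c \<inter> fst ?k)" using p k x by (metis IntI chart_chart_inv image_eqI)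
  note t = transition_smooth[OF M c k(1)]
  show "tangent_map M N f ?p (push_vector M (chart_inv c) x w) e = push_vector N (\<lambda>y. f (chart_inv c y)) x w e"
  proof (cases "e \<in> atlas_of N \<and> f ?p \<in> fst e")
    case True
    have "((\<lambda>y. snd e (f (chart_inv ?k (snd ?k (chart_inv c y))))) has_derivative
       (\<lambda>w. frechet_derivative (\<lambda>y. snd e (f (chart_inv ?k y))) (at (snd ?k ?p)) (frechet_derivative (\<lambda>x. snd ?k (chart_inv c x)) (at x) w))) (at x)"
      using diff_chain_at[OF smooth_open_has_derivative[OF t xo] has_derivative_frechet[OF d]] True
      by (simp add: o_def)
    then have "((\<lambda>y. snd e (f (chart_inv c y))) has_derivative
       (\<lambda>w. frechet_derivative (\<lambda>y. snd e (f (chart_inv ?k y))) (at (snd ?k ?p)) (frechet_derivative (\<lambda>x. snd ?k (chart_inv c x)) (at x) w))) (at x)"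
      by (rule has_derivative_transform_within_open[OF _ smooth_openD(1)[OF t] xo])
         (auto simp: chart_inv_chart[OF M c] chart_inv_chart[OF M k(1)])
    then show ?thesis
      using True k by (simp add: tangent_map_def Let_def push_vector_def frechet_derivative_eq chart_inv_chart[OF M k(1)])
  qed (auto simp: tangent_map_def Let_def push_vector_def chart_inv_chart[OF M k(1) k(2)])
qed

section \<open>Integration on Euclidean space\<close>

lemma absolutely_integrable_on_compact:
  fixes f :: "'a::euclidean_space \<Rightarrow> real"
  assumes "compact S" "continuous_on S f" shows "f absolutely_integrable_on S"
proof -
  have "set_integrable lborel S f"
    unfolding set_integrable_def using borel_integrable_compact[OF assms] .
  then show ?thesis
    unfolding set_integrable_def by (intro integrable_completion[THEN iffD2]) (auto dest: borel_measurable_integrable)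
qed

lemma integral_zero_extension:
  fixes f :: "'a::euclidean_space \<Rightarrow> real"
  assumes "S \<subseteq> T" "\<And>x. x \<in> T - S \<Longrightarrow> f x = 0" shows "integral T f = integral S f"
proof -
  have "integral T f = integral T (\<lambda>x. if x \<in> S then f x else 0)"
    using assms by (intro integral_cong) auto
  also have "\<dots> = integral S f" using assms(1) by (simp add: integral_restrict_Int Int_absorb2)
  finally show ?thesis .
qed

lemma integral_change_of_variables_real_valued:
  fixes f :: "real^'n::{finite,wellorder} \<Rightarrow> real" and g :: "real^'n::_ \<Rightarrow> real^'n::_"
  assumes S: "compact S" and der: "\<And>x. x \<in> S \<Longrightarrow> (g has_derivative g' x) (at x)" and inj: "inj_on g S"
    and f: "continuous_on (g ` S) f"
  shows "integral (g ` S) f = integral S (\<lambda>x. \<bar>det (matrix (g' x))\<bar> * f (g x))"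
proof -
  have der': "\<And>x. x \<in> S \<Longrightarrow> (g has_derivative g' x) (at x within S)"
    using der has_derivative_at_withinI by blast
  have "continuous_on S g" using der' has_derivative_continuous_on by blast
  then have "f absolutely_integrable_on g ` S"
    by (intro absolutely_integrable_on_compact compact_continuous_image S f)
  then have "(\<lambda>x. vec (f x) :: real^1) absolutely_integrable_on g ` S"
    by (simp add: absolutely_integrable_on_1_iff)
  then have "integral (g ` S) (\<lambda>x. vec (f x) :: real^1) = integral S (\<lambda>x. \<bar>det (matrix (g' x))\<bar> *\<^sub>R (vec (f (g x)) :: real^1))"
    using S by (intro integral_change_of_variables der' inj) (auto simp: compact_imp_closed lebesgue_closedin intro: lmeasurable_compact fmeasurableD)
  then show ?thesis by (simp add: integral_on_1_eq vec_eq_iff)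
qed

text \<open>The integral of g(x + t v) over x does not depend on t, by translation invariance.
  Differentiating under the integral sign at t = 0 gives the claim, without iterated integrals and
  without singling out a coordinate.\<close>

lemma integral_directional_derivative_eq_0:
  fixes g :: "'a::euclidean_space \<Rightarrow> real"
  assumes g: "smooth_open UNIV g" and Z: "bounded Z" "\<And>x. x \<notin> Z \<Longrightarrow> g x = 0"
  shows "integral UNIV (\<lambda>x. frechet_derivative g (at x) v) = 0"
proof -
  obtain r where r: "0 < r" "Z \<subseteq> ball 0 r" using Z(1) bounded_subset_ballD by blast
  \<comment> \<open>The box holds every translate of the support by t v with t between -1 and 1, so
    one box serves for all t.\<close>
  obtain a where ab: "cball (0::'a) (r + norm v) \<subseteq> cbox (- a) a"
    using bounded_subset_cbox_symmetric[OF bounded_cball] by blast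
  have out: "g (x + t *\<^sub>R v) = 0" if "t \<in> {-1..1}" "x \<notin> cbox (- a) a" for x t
  proof (rule Z(2), rule notI)
    assume "x + t *\<^sub>R v \<in> Z"
    then have "norm (x + t *\<^sub>R v) < r" using r by auto
    moreover have "norm (t *\<^sub>R v) \<le> norm v" using that(1) by (simp add: mult_left_le_one_le abs_le_iff)
    moreover have "norm x \<le> norm (x + t *\<^sub>R v) + norm (t *\<^sub>R v)"
      by (metis add_diff_cancel norm_triangle_ineq4)
    ultimately have "x \<in> cball 0 (r + norm v)" by simp
    then show False using ab that by blast
  qed
  define D where "D x = frechet_derivative g (at x) v" for x
  have Dc: "continuous_on UNIV D"
    unfolding D_def
    by (rule smooth_open_continuous_on[OF smooth_open_frechet_derivative[OF g smooth_open_const[OF open_UNIV]]])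
  have gc: "continuous_on UNIV g" by (rule smooth_open_continuous_on[OF g])
  have lr: "((\<lambda>t. integral (cbox (- a) a) (\<lambda>x. g (x + t *\<^sub>R v))) has_vector_derivative
      integral (cbox (- a) a) (\<lambda>x. D (x + 0 *\<^sub>R v))) (at 0 within {-1..1})"
  proof (rule leibniz_rule_vector_derivative)
    show "((\<lambda>t. g (x + t *\<^sub>R v)) has_vector_derivative D (x + t *\<^sub>R v)) (at t within {-1..1})" for t x
      using has_real_derivative_along_line[OF g, of x t v] unfolding D_def
      by (simp add: has_real_derivative_iff_has_vector_derivative has_vector_derivative_at_within)
    show "(\<lambda>x. g (x + t *\<^sub>R v)) integrable_on cbox (- a) a" for t
      by (intro integrable_continuous continuous_on_compose2[OF gc] continuous_intros) auto
    show "continuous_on ({-1..1} \<times> cbox (- a) a) (\<lambda>(t, x). D (x + t *\<^sub>R v))"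
      unfolding case_prod_unfold by (intro continuous_on_compose2[OF Dc] continuous_intros) auto
  qed auto
  have shift: "integral (cbox (- a) a) (\<lambda>x. g (x + t *\<^sub>R v)) = integral UNIV g" if t: "t \<in> {-1..1}" for t
  proof -
    have "integral (cbox (- a) a) (\<lambda>x. g (x + t *\<^sub>R v)) = integral (cbox (- a + t *\<^sub>R v) (a + t *\<^sub>R v)) g"
      using integral_shift_cbox[of "- a + t *\<^sub>R v" "t *\<^sub>R v" "a + t *\<^sub>R v" g] by simp
    also have "\<dots> = integral UNIV g"
    proof (rule integral_zero_extension[symmetric])
      fix x assume "x \<in> UNIV - cbox (- a + t *\<^sub>R v) (a + t *\<^sub>R v)"
      then have "x - t *\<^sub>R v \<notin> cbox (- a) a" by (auto simp: mem_box algebra_simps)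
      from out[OF t this] show "g x = 0" by simp
    qed simp
    finally show ?thesis .
  qed
  have "((\<lambda>t. integral UNIV g) has_vector_derivative integral (cbox (- a) a) (\<lambda>x. D (x + 0 *\<^sub>R v))) (at 0 within {-1..1::real})"
    by (rule has_vector_derivative_transform[OF _ _ lr]) (auto simp: shift[symmetric] simp del: scaleR_zero_left)
  then have "((\<lambda>t::real. integral UNIV g) has_vector_derivative integral (cbox (- a) a) D) (at 0)"
    using at_within_Icc_at[of "-1" "0::real" 1] by simp
  then have "integral (cbox (- a) a) D = 0"
    by (rule vector_derivative_unique_at) (rule has_vector_derivative_const)
  moreover have "integral UNIV D = integral (cbox (- a) a) D"
  proof (rule integral_zero_extension)
    fix x assume "x \<in> UNIV - cbox (- a) a"
    moreover have "open (- cbox (- a) a)" by (rule open_Compl[OF closed_cbox])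
    ultimately have "(g has_derivative (\<lambda>v. 0)) (at x)"
      using out[of 0] by (intro has_derivative_transform_within_open[OF has_derivative_const[of 0], of "- cbox (- a) a"]) auto
    then show "D x = 0" unfolding D_def by (rule frechet_derivative_eq)
  qed simp
  ultimately show ?thesis unfolding D_def by simp
qed

text \<open>Every summand of d\<beta> is a directional derivative of one coefficient of \<beta>. The
  coefficient extends by 0 to a smooth function on the whole space, because U and the complement of
  the compact set Z are open and cover it.\<close>

lemma integral_ext_d_eq_0:
  assumes \<beta>: "smooth_form U k \<beta>" and Z: "compact Z" "Z \<subseteq> U" and l: "length vs = Suc k"
    and z: "\<And>x ws. x \<in> U - Z \<Longrightarrow> length ws = k \<Longrightarrow> \<beta> x ws = 0"
  shows "integral U (\<lambda>x. ext_d \<beta> x vs) = 0"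
proof -
  have U: "open U" using \<beta> smooth_formD by blast
  have main: "((\<lambda>x. frechet_derivative (\<lambda>y. \<beta> y ws) (at x) v) has_integral 0) U" if ws: "length ws = k" for ws v
  proof -
    define g where "g y = (if y \<in> U then \<beta> y ws else 0)" for y
    have gU: "smooth_open U g"
      by (rule smooth_open_cong[OF smooth_formD(4)[OF \<beta> ws]]) (simp add: g_def)
    have oZ: "open (- Z)" by (rule open_Compl[OF compact_imp_closed[OF Z(1)]])
    have gZ: "smooth_open (- Z) g"
      by (rule smooth_open_cong[OF smooth_open_const[OF oZ, of 0]]) (use z ws in \<open>auto simp: g_def\<close>)
    have g: "smooth_open UNIV g"
    proof (rule smooth_open_local)
      show "\<exists>U. x \<in> U \<and> smooth_open U g" for x
        using gU gZ Z by (cases "x \<in> Z") blast+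
    qed simp
    have g0: "x \<notin> Z \<Longrightarrow> g x = 0" for x using z ws by (auto simp: g_def)
    define D where "D x = frechet_derivative g (at x) v" for x
    have D0: "D x = 0" if "x \<notin> Z" for x
      unfolding D_def
      by (rule frechet_derivative_eq, rule has_derivative_transform_within_open[OF has_derivative_const[of 0] oZ]) (use that g0 in auto)
    have Dc: "continuous_on UNIV D"
      unfolding D_def
      by (rule smooth_open_continuous_on[OF smooth_open_frechet_derivative[OF g smooth_open_const[OF open_UNIV]]])
    have "D integrable_on Z"
      using absolutely_integrable_on_compact[OF Z(1) continuous_on_subset[OF Dc]] set_lebesgue_integral_eq_integral(1) by blast
    then have "D integrable_on U"
      by (rule integrable_on_superset) (use D0 Z in auto)
    moreover have "integral U D = 0"
      using integral_directional_derivative_eq_0[OF g compact_imp_bounded[OF Z(1)] g0, of v]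
        integral_zero_extension[of U UNIV D] D0 Z unfolding D_def by auto
    ultimately have "(D has_integral 0) U" using integrable_integral by fastforce
    moreover have "D x = frechet_derivative (\<lambda>y. \<beta> y ws) (at x) v" if "x \<in> U" for x
      unfolding D_def using frechet_derivative_cong_open[OF U that, of g "\<lambda>y. \<beta> y ws"] by (simp add: g_def)
    ultimately show ?thesis using has_integral_cong by (metis (no_types, lifting))
  qed
  have "((\<lambda>x. \<Sum>i<length vs. (-1) ^ i * frechet_derivative (\<lambda>y. \<beta> y (drop_nth i vs)) (at x) (vs ! i)) has_integral (\<Sum>i<length vs. (-1) ^ i * 0)) U"
    using l by (intro has_integral_sum has_integral_mult_right main) (auto simp: length_drop_nth)
  then show ?thesis unfolding ext_d_def by (simp add: integral_unique)
qed

section \<open>Integration through weighted charts\<close>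

text \<open>The sum behind \<open>form_integral_over\<close> with a free choice of index set and
  weights. The integrand is a family of coefficients, one for each chart, so that expressions such
  as d of a local form can be integrated without being packaged as a form on the manifold.\<close>

definition chart_integral :: "'i set \<Rightarrow> ('i \<Rightarrow> ('a, 'e::euclidean_space) chart) \<Rightarrow> ('i \<Rightarrow> 'a \<Rightarrow> real) \<Rightarrow> 'a set \<Rightarrow>
    (('a, 'e) chart \<Rightarrow> 'e \<Rightarrow> real) \<Rightarrow> real" where
  "chart_integral I C R K D = (\<Sum>i\<in>I. integral (chart_image (C i))
     (\<lambda>x. if chart_inv (C i) x \<in> K then R i (chart_inv (C i) x) * D (C i) x else 0))"

text \<open>Weaker than a partition of unity (continuous, of any sign, summing to \<open>1\<close> on \<open>K\<close> only), so that products of two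
  systems and transports along homeomorphisms are again of this kind.\<close>
definition weights :: "('a, 'e::euclidean_space) manifold \<Rightarrow> 'a set \<Rightarrow> 'i set \<Rightarrow> ('i \<Rightarrow> ('a, 'e) chart) \<Rightarrow>
    ('i \<Rightarrow> 'a \<Rightarrow> real) \<Rightarrow> ('i \<Rightarrow> 'a set) \<Rightarrow> bool" where
  "weights M K I C R Z \<longleftrightarrow> finite I \<and> (\<forall>i\<in>I. C i \<in> atlas_of M \<and> closedin (top_of M) (Z i) \<and> compactin (top_of M) (Z i) \<and>
     Z i \<subseteq> fst (C i) \<and> continuous_map (top_of M) euclidean (R i) \<and> (\<forall>p\<in>K - Z i. R i p = 0)) \<and>
     (\<forall>p\<in>K. (\<Sum>i\<in>I. R i p) = 1)"

text \<open>The transformation rule of the coefficient of a top degree form, with the signed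
  determinant. Both local forms and their exterior derivatives obey it.\<close>

definition density :: "('a, real^'n) manifold \<Rightarrow> (('a, real^'n) chart \<Rightarrow> real^'n \<Rightarrow> real) \<Rightarrow> bool" where
  "density L D \<longleftrightarrow> (\<forall>c\<in>atlas_of L. continuous_on (chart_image c) (D c)) \<and>
     (\<forall>c\<in>atlas_of L. \<forall>c'\<in>atlas_of L. \<forall>x\<in>snd c ` (fst c \<inter> fst c').
        D c x = det (matrix (frechet_derivative (\<lambda>y. snd c' (chart_inv c y)) (at x))) * D c' (snd c' (chart_inv c x)))"

lemma oriented_det_pos:
  assumes "oriented_manifold L" "c \<in> atlas_of L" "c' \<in> atlas_of L" "x \<in> snd c ` (fst c \<inter> fst c')"
  shows "0 < det (matrix (frechet_derivative (\<lambda>y. snd c' (chart_inv c y)) (at x)))"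
proof -
  have "orientedly_compatible c c'" using assms unfolding manifold_with_def by blast
  then show ?thesis using assms(4) unfolding orientedly_compatible_def by (auto simp: o_def)
qed

lemma continuous_on_chart_function:
  assumes M: "smooth_atlas M" "c \<in> atlas_of M" and w: "continuous_map (top_of M) euclidean w"
  shows "continuous_on (chart_image c) (\<lambda>x. w (chart_inv c x))"
  using continuous_map_compose[OF continuous_map_chart_inv[OF M] w] by (simp add: o_def)

text \<open>Orientation is what removes the absolute value: the change of variables formula has the
  modulus of the Jacobian determinant, the transformation rule has the determinant itself, and on an
  oriented atlas it is positive.\<close>

lemma integral_chart_change:
  fixes L :: "('a, real^'n::{finite,wellorder}) manifold"
  assumes L: "oriented_manifold L" and c: "c \<in> atlas_of L" "c' \<in> atlas_of L" and D: "density L D"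
    and Z: "compactin (top_of L) Z" "Z \<subseteq> fst c \<inter> fst c'" and w: "continuous_map (top_of L) euclidean w"
  shows "integral (snd c ` Z) (\<lambda>x. w (chart_inv c x) * D c x) = integral (snd c' ` Z) (\<lambda>y. w (chart_inv c' y) * D c' y)"
proof -
  have M: "smooth_atlas L" using L oriented_manifold_smooth_atlas by blast
  define \<tau> where "\<tau> x = snd c' (chart_inv c x)" for x
  have t: "smooth_open (snd c ` (fst c \<inter> fst c')) \<tau>" unfolding \<tau>_def by (rule transition_smooth[OF M c])
  have ss: "snd c ` Z \<subseteq> snd c ` (fst c \<inter> fst c')" using Z by blast
  have im: "\<tau> ` snd c ` Z = snd c' ` Z"
    using Z chart_inv_chart[OF M c(1)] by (force simp: \<tau>_def image_image)
  have inv: "chart_inv c' (\<tau> x) = chart_inv c x" if xZ: "x \<in> snd c ` Z" for x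
  proof -
    obtain p where p: "p \<in> Z" "x = snd c p" using xZ by blast
    then have "p \<in> fst c" "p \<in> fst c'" using Z by auto
    then show ?thesis by (simp add: \<tau>_def p(2) chart_inv_chart[OF M c(1)] chart_inv_chart[OF M c(2)])
  qed
  have inj: "inj_on \<tau> (snd c ` Z)"
  proof (rule inj_onI)
    fix x y assume h: "x \<in> snd c ` Z" "y \<in> snd c ` Z" "\<tau> x = \<tau> y"
    then have "chart_inv c x = chart_inv c y" using inv by metis
    moreover have "chart_inv c (snd c p) = p" if "p \<in> Z" for p
      using that Z chart_inv_chart[OF M c(1), of p] by blast
    ultimately show "x = y" using h(1,2) by auto
  qed
  have "snd c' ` Z \<subseteq> chart_image c'" using Z by (auto simp: chart_image_def)
  then have cont: "continuous_on (snd c' ` Z) (\<lambda>y. w (chart_inv c' y) * D c' y)"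
    using D c continuous_on_chart_function[OF M c(2) w] unfolding density_def
    by (intro continuous_on_mult) (auto intro: continuous_on_subset)
  have "integral (\<tau> ` snd c ` Z) (\<lambda>y. w (chart_inv c' y) * D c' y)
    = integral (snd c ` Z) (\<lambda>x. \<bar>det (matrix (frechet_derivative \<tau> (at x)))\<bar> * (w (chart_inv c' (\<tau> x)) * D c' (\<tau> x)))"
  proof (rule integral_change_of_variables_real_valued[OF _ _ inj])
    show "compact (snd c ` Z)" by (rule compact_chart[OF M c(1) Z(1)]) (use Z in blast)
    show "continuous_on (\<tau> ` snd c ` Z) (\<lambda>y. w (chart_inv c' y) * D c' y)" unfolding im by (rule cont)
    show "(\<tau> has_derivative frechet_derivative \<tau> (at x)) (at x)" if "x \<in> snd c ` Z" for x
      using smooth_open_has_derivative[OF t] ss that by blast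
  qed
  also have "\<dots> = integral (snd c ` Z) (\<lambda>x. w (chart_inv c x) * D c x)"
  proof (rule integral_cong)
    fix x assume x: "x \<in> snd c ` Z"
    then have x': "x \<in> snd c ` (fst c \<inter> fst c')" using ss by blast
    have "D c x = det (matrix (frechet_derivative \<tau> (at x))) * D c' (\<tau> x)"
      using D c x' unfolding density_def \<tau>_def by blast
    moreover have "0 < det (matrix (frechet_derivative \<tau> (at x)))"
      using oriented_det_pos[OF L c x'] unfolding \<tau>_def .
    ultimately show "\<bar>det (matrix (frechet_derivative \<tau> (at x)))\<bar> * (w (chart_inv c' (\<tau> x)) * D c' (\<tau> x)) = w (chart_inv c x) * D c x"
      using inv[OF x] by simp
  qed
  finally show ?thesis unfolding im by simp
qed

lemma integral_over_chart_restrict: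
  fixes w :: "'a \<Rightarrow> real"
  assumes M: "smooth_atlas M" "c \<in> atlas_of M" and Z: "Z \<subseteq> fst c" and w: "\<And>p. p \<in> K - Z \<Longrightarrow> w p = 0"
  shows "integral (chart_image c) (\<lambda>x. if chart_inv c x \<in> K then w (chart_inv c x) * d x else 0)
    = integral (snd c ` (K \<inter> Z)) (\<lambda>x. w (chart_inv c x) * d x)"
proof -
  have e: "snd c ` (K \<inter> Z) = {x \<in> chart_image c. chart_inv c x \<in> K \<inter> Z}"
    using Z by (intro chart_image_of_subset[OF M]) auto
  have "integral (chart_image c) (\<lambda>x. if chart_inv c x \<in> K then w (chart_inv c x) * d x else 0)
    = integral (snd c ` (K \<inter> Z)) (\<lambda>x. if chart_inv c x \<in> K then w (chart_inv c x) * d x else 0)"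
    unfolding e using w by (intro integral_zero_extension) auto
  also have "\<dots> = integral (snd c ` (K \<inter> Z)) (\<lambda>x. w (chart_inv c x) * d x)"
    unfolding e by (rule integral_cong) auto
  finally show ?thesis .
qed

lemma chart_integral_refine:
  fixes L :: "('a, real^'n::{finite,wellorder}) manifold"
  assumes M: "smooth_atlas L" and K: "closedin (top_of L) K" and P: "weights L K I C R Z" and Q: "weights L K J C' R' Z'"
    and D: "density L D"
  shows "chart_integral I C R K D = (\<Sum>i\<in>I. \<Sum>j\<in>J. integral (snd (C i) ` (K \<inter> Z i \<inter> Z' j))
     (\<lambda>x. R i (chart_inv (C i) x) * R' j (chart_inv (C i) x) * D (C i) x))"
  unfolding chart_integral_def
proof (rule sum.cong[OF refl])
  fix i assume i: "i \<in> I"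
  then have c: "C i \<in> atlas_of L" and Zi: "Z i \<subseteq> fst (C i)" "compactin (top_of L) (Z i)"
    and Ri: "continuous_map (top_of L) euclidean (R i)" "\<And>p. p \<in> K - Z i \<Longrightarrow> R i p = 0"
    using P by (auto simp: weights_def)
  have cpt: "compact (snd (C i) ` (K \<inter> Z i))"
    using closed_Int_compactin[OF K Zi(2)] Zi(1) by (intro compact_chart[OF M c]) auto
  let ?S = "snd (C i) ` (K \<inter> Z i)" and ?q = "chart_inv (C i)"
  have Sin: "?S \<subseteq> chart_image (C i)" "x \<in> ?S \<Longrightarrow> ?q x \<in> K" for x
    using Zi chart_inv_chart[OF M c] by (auto simp: chart_image_def)
  have int: "(\<lambda>x. R i (?q x) * R' j (?q x) * D (C i) x) integrable_on ?S" if j: "j \<in> J" for j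
  proof -
    have "continuous_map (top_of L) euclidean (R' j)" using Q j by (auto simp: weights_def)
    then have "continuous_on ?S (\<lambda>x. R i (?q x) * R' j (?q x) * D (C i) x)"
      using D c continuous_on_chart_function[OF M c Ri(1)] continuous_on_chart_function[OF M c, of "R' j"] Sin(1)
      unfolding density_def by (intro continuous_on_mult) (auto intro: continuous_on_subset)
    then show ?thesis
      using absolutely_integrable_on_compact[OF cpt] set_lebesgue_integral_eq_integral(1) by blast
  qed
  have "integral (chart_image (C i)) (\<lambda>x. if ?q x \<in> K then R i (?q x) * D (C i) x else 0) =
    integral ?S (\<lambda>x. R i (?q x) * D (C i) x)"
    by (rule integral_over_chart_restrict[OF M c Zi(1) Ri(2)])
  also have "\<dots> = integral ?S (\<lambda>x. \<Sum>j\<in>J. R i (?q x) * R' j (?q x) * D (C i) x)"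
  proof (rule integral_cong)
    fix x assume "x \<in> ?S"
    then have "(\<Sum>j\<in>J. R' j (?q x)) = 1" using Sin(2) Q by (auto simp: weights_def)
    then show "R i (?q x) * D (C i) x = (\<Sum>j\<in>J. R i (?q x) * R' j (?q x) * D (C i) x)"
      by (simp flip: sum_distrib_left sum_distrib_right)
  qed
  also have "\<dots> = (\<Sum>j\<in>J. integral ?S (\<lambda>x. R i (?q x) * R' j (?q x) * D (C i) x))"
    using Q int by (intro integral_sum) (auto simp: weights_def)
  also have "\<dots> = (\<Sum>j\<in>J. integral (snd (C i) ` (K \<inter> Z i \<inter> Z' j)) (\<lambda>x. R i (?q x) * R' j (?q x) * D (C i) x))"
  proof (rule sum.cong[OF refl], rule integral_zero_extension)
    fix j x assume j: "j \<in> J" and x: "x \<in> ?S - snd (C i) ` (K \<inter> Z i \<inter> Z' j)"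
    then obtain p where p: "p \<in> K" "p \<in> Z i" "x = snd (C i) p" "p \<notin> Z' j" by blast
    then have "R' j p = 0" using Q j by (auto simp: weights_def)
    then show "R i (?q x) * R' j (?q x) * D (C i) x = 0"
      using p Zi chart_inv_chart[OF M c] by auto
  qed auto
  finally show "integral (chart_image (C i)) (\<lambda>x. if ?q x \<in> K then R i (?q x) * D (C i) x else 0) =
     (\<Sum>j\<in>J. integral (snd (C i) ` (K \<inter> Z i \<inter> Z' j)) (\<lambda>x. R i (?q x) * R' j (?q x) * D (C i) x))" .
qed

text \<open>Both sides are refined by the products R_i R'_j. Such a product only matters on K
  \<inter> Z_i \<inter> Z'_j, a compact set inside the domains of both charts, where one chart can
  be exchanged for the other.\<close>

theorem chart_integral_independent:
  fixes L :: "('a, real^'n::{finite,wellorder}) manifold"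
  assumes L: "oriented_manifold L" and K: "closedin (top_of L) K"
    and P: "weights L K I C R Z" and Q: "weights L K J C' R' Z'" and D: "density L D"
  shows "chart_integral I C R K D = chart_integral J C' R' K D"
proof -
  have M: "smooth_atlas L" using L oriented_manifold_smooth_atlas by blast
  have "chart_integral I C R K D = (\<Sum>i\<in>I. \<Sum>j\<in>J. integral (snd (C' j) ` (K \<inter> Z i \<inter> Z' j))
     (\<lambda>x. R i (chart_inv (C' j) x) * R' j (chart_inv (C' j) x) * D (C' j) x))"
    unfolding chart_integral_refine[OF M K P Q D]
  proof (intro sum.cong refl)
    fix i j assume i: "i \<in> I" and j: "j \<in> J"
    have "compactin (top_of L) (K \<inter> Z i \<inter> Z' j)"
      using P Q i j closed_Int_compactin[OF closedin_Int[OF K, of "Z i"], of "Z' j"] by (auto simp: weights_def)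
    then show "integral (snd (C i) ` (K \<inter> Z i \<inter> Z' j)) (\<lambda>x. R i (chart_inv (C i) x) * R' j (chart_inv (C i) x) * D (C i) x) =
      integral (snd (C' j) ` (K \<inter> Z i \<inter> Z' j)) (\<lambda>x. R i (chart_inv (C' j) x) * R' j (chart_inv (C' j) x) * D (C' j) x)"
      using P Q i j by (intro integral_chart_change[OF L _ _ D, where w = "\<lambda>p. R i p * R' j p"] continuous_map_real_mult)
        (auto simp: weights_def)
  qed
  also have "\<dots> = chart_integral J C' R' K D"
    unfolding chart_integral_refine[OF M K Q P D]
    by (subst sum.swap) (simp add: Int_commute Int_left_commute mult.commute)
  finally show ?thesis .
qed

section \<open>Partitions of unity\<close>

lemma chart_overlapI:
  assumes "x \<in> chart_image c" "chart_inv c x \<in> fst c'" shows "x \<in> snd c ` (fst c \<inter> fst c')"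
  using assms chart_inv_in[OF assms(1)] by (intro image_eqI[where x = "chart_inv c x"]) auto

lemma smooth_function_iff:
  assumes "smooth_atlas M"
  shows "smooth_function M h \<longleftrightarrow> (\<forall>c\<in>atlas_of M. smooth_open (chart_image c) (\<lambda>x. h (chart_inv c x)))"
  unfolding smooth_function_def
  using smooth_on_iff_smooth_open[OF open_chart_image[OF assms]] by (auto simp: o_def)

lemma smooth_function_continuous:
  assumes M: "smooth_atlas M" and h: "smooth_function M h"
  shows "continuous_map (top_of M) euclidean h"
  unfolding continuous_map_def
proof (intro conjI allI impI)
  fix V :: "real set" assume V: "openin euclidean V"
  have "openin (top_of M) {p \<in> fst c. snd c p \<in> {x \<in> chart_image c. h (chart_inv c x) \<in> V}}" if c: "c \<in> atlas_of M" for c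
  proof (rule openin_chart_vimage[OF M c])
    have "continuous_on (chart_image c) (\<lambda>x. h (chart_inv c x))"
      using h c smooth_open_continuous_on unfolding smooth_function_iff[OF M] by blast
    moreover have "open V" using V by simp
    ultimately have "open (chart_image c \<inter> (\<lambda>x. h (chart_inv c x)) -` V)"
      by (rule continuous_open_preimage[OF _ open_chart_image[OF M c]])
    moreover have "chart_image c \<inter> (\<lambda>x. h (chart_inv c x)) -` V = {x \<in> chart_image c. h (chart_inv c x) \<in> V}"
      by auto
    ultimately show "open {x \<in> chart_image c. h (chart_inv c x) \<in> V}" by (simp only:)
  qed
  then have "openin (top_of M) (\<Union>c\<in>atlas_of M. {p \<in> fst c. snd c p \<in> {x \<in> chart_image c. h (chart_inv c x) \<in> V}})"
    by blast
  also have "(\<Union>c\<in>atlas_of M. {p \<in> fst c. snd c p \<in> {x \<in> chart_image c. h (chart_inv c x) \<in> V}}) = {p \<in> points M. h p \<in> V}"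
  proof (intro equalityI subsetI)
    fix p assume "p \<in> {p \<in> points M. h p \<in> V}"
    then obtain c where "c \<in> atlas_of M" "p \<in> fst c" "h p \<in> V" using M unfolding smooth_atlas_def by blast
    then show "p \<in> (\<Union>c\<in>atlas_of M. {p \<in> fst c. snd c p \<in> {x \<in> chart_image c. h (chart_inv c x) \<in> V}})"
      using chart_in_image[of p c] chart_inv_chart[OF M, of c p] by auto
  next
    fix p assume "p \<in> (\<Union>c\<in>atlas_of M. {p \<in> fst c. snd c p \<in> {x \<in> chart_image c. h (chart_inv c x) \<in> V}})"
    then obtain c where c: "c \<in> atlas_of M" "p \<in> fst c" "h (chart_inv c (snd c p)) \<in> V" by blast
    then show "p \<in> {p \<in> points M. h p \<in> V}"
      using chart_inv_chart[OF M, of c p] chart_subset[OF M c(1)] by auto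
  qed
  finally show "openin (top_of M) {p \<in> points M. h p \<in> V}" .
qed simp

lemma smooth_function_const: "smooth_atlas M \<Longrightarrow> smooth_function M (\<lambda>p. a)"
  by (simp add: smooth_function_iff smooth_open_const open_chart_image)

lemma smooth_function_add:
  "smooth_atlas M \<Longrightarrow> smooth_function M f \<Longrightarrow> smooth_function M g \<Longrightarrow> smooth_function M (\<lambda>p. f p + g p)"
  by (simp add: smooth_function_iff smooth_open_add)

lemma smooth_function_mult:
  "smooth_atlas M \<Longrightarrow> smooth_function M f \<Longrightarrow> smooth_function M g \<Longrightarrow> smooth_function M (\<lambda>p. f p * g p)"
  by (simp add: smooth_function_iff smooth_open_mult)

lemma smooth_function_sum:
  "smooth_atlas M \<Longrightarrow> (\<And>i. i \<in> I \<Longrightarrow> smooth_function M (f i)) \<Longrightarrow> smooth_function M (\<lambda>p. \<Sum>i\<in>I. f i p)"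
  by (simp add: smooth_function_iff smooth_open_sum open_chart_image)

lemma closedin_function_support: "closedin (top_of M) (function_support M h)"
  by (simp add: function_support_def)

lemma not_in_function_support: "p \<in> points M \<Longrightarrow> p \<notin> function_support M h \<Longrightarrow> h p = 0"
  unfolding function_support_def using closure_of_subset[of "{p \<in> points M. h p \<noteq> 0}" "top_of M"] by blast

lemma function_support_subset:
  assumes "closedin (top_of M) Z" "\<And>p. p \<in> points M - Z \<Longrightarrow> h p = 0"
  shows "function_support M h \<subseteq> Z"
  unfolding function_support_def using assms by (intro closure_of_minimal) auto

definition chart_supported :: "('a, 'e::euclidean_space) manifold \<Rightarrow> ('a, 'e) chart \<Rightarrow> ('a \<Rightarrow> real) \<Rightarrow> bool" where
  "chart_supported M c \<rho> \<longleftrightarrow> c \<in> atlas_of M \<and> smooth_function M \<rho> \<and> (\<forall>p\<in>points M. 0 \<le> \<rho> p) \<and>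
     compactin (top_of M) (function_support M \<rho>) \<and> function_support M \<rho> \<subseteq> fst c"

lemma chart_supported_mult:
  assumes M: "smooth_atlas M" and \<rho>: "chart_supported M c \<rho>" and s: "smooth_function M s" "\<And>p. p \<in> points M \<Longrightarrow> 0 \<le> s p"
  shows "chart_supported M c (\<lambda>p. \<rho> p * s p)"
proof -
  have "function_support M (\<lambda>p. \<rho> p * s p) \<subseteq> function_support M \<rho>"
    by (rule function_support_subset[OF closedin_function_support]) (auto dest: not_in_function_support[of _ M \<rho>])
  then show ?thesis
    using \<rho> s closed_compactin[of "top_of M" "function_support M \<rho>" "function_support M (\<lambda>p. \<rho> p * s p)"]
    unfolding chart_supported_def by (auto simp: smooth_function_mult[OF M] closedin_function_support)
qed

text \<open>A Euclidean bump in a chart is extended by 0. The extension is smooth because its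
  support lies in Z, which is compact and hence closed in a Hausdorff space: the chart domain and
  the complement of Z are then two open sets that cover the manifold, and \<rho> is smooth on
  each.\<close>

lemma manifold_bump:
  assumes M: "smooth_atlas M" and H: "Hausdorff_space (top_of M)" and p: "p \<in> points M"
  obtains c \<rho> V where "chart_supported M c \<rho>" "\<And>q. \<rho> q \<le> 1" "openin (top_of M) V" "p \<in> V" "\<And>q. q \<in> V \<Longrightarrow> \<rho> q = 1"
proof -
  obtain c where c: "c \<in> atlas_of M" "p \<in> fst c" using M p unfolding smooth_atlas_def by blast
  obtain e where e: "0 < e" "cball (snd c p) e \<subseteq> chart_image c"
    using open_contains_cball open_chart_image[OF M c(1)] chart_in_image[OF c(2)] by blast
  \<comment> \<open>The bump lives on the ball of twice the inner radius, which has to remain inside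
    the chart image.\<close>
  define r where "r = e / 2"
  have r: "0 < r" "2 * r = e" using e by (simp_all add: r_def)
  obtain b :: "'b \<Rightarrow> real" where b: "smooth_open UNIV b" "\<And>x. 0 \<le> b x" "\<And>x. b x \<le> 1"
    "\<And>x. x \<in> cball (snd c p) r \<Longrightarrow> b x = 1" "\<And>x. x \<notin> cball (snd c p) e \<Longrightarrow> b x = 0"
    using smooth_bump[OF r(1), of "snd c p"] unfolding r(2) by metis
  define \<rho> where "\<rho> q = (if q \<in> fst c then b (snd c q) else 0)" for q
  define Z where "Z = chart_inv c ` cball (snd c p) e"
  have Zc: "compactin (top_of M) Z" unfolding Z_def by (rule compactin_chart_inv[OF M c(1) compact_cball e(2)])
  have Zcl: "closedin (top_of M) Z" by (rule compactin_imp_closedin[OF H Zc])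
  have Zs: "Z \<subseteq> fst c" using e(2) chart_inv_in[of _ c] by (auto simp: Z_def)
  have \<rho>0: "\<rho> q = 0" if "q \<notin> Z" for q
  proof (cases "q \<in> fst c")
    case True
    then have "snd c q \<notin> cball (snd c p) e" using that chart_inv_chart[OF M c(1) True] unfolding Z_def by (metis image_eqI)
    then show ?thesis using b(5) by (simp add: \<rho>_def)
  qed (simp add: \<rho>_def)
  have supp: "function_support M \<rho> \<subseteq> Z" by (rule function_support_subset[OF Zcl]) (simp add: \<rho>0)
  have "smooth_open (chart_image c') (\<lambda>x. \<rho> (chart_inv c' x))" if c': "c' \<in> atlas_of M" for c'
  proof (rule smooth_open_local[OF open_chart_image[OF M c']])
    fix x assume x: "x \<in> chart_image c'"
    show "\<exists>U. x \<in> U \<and> smooth_open U (\<lambda>x. \<rho> (chart_inv c' x))"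
    proof (cases "chart_inv c' x \<in> Z")
      case True
      note t = transition_smooth[OF M c' c(1)]
      have "smooth_open (snd c' ` (fst c' \<inter> fst c)) (\<lambda>x. b (snd c (chart_inv c' x)))"
        by (rule smooth_open_compose[OF t b(1)]) simp
      then have "smooth_open (snd c' ` (fst c' \<inter> fst c)) (\<lambda>x. \<rho> (chart_inv c' x))"
        by (rule smooth_open_cong) (auto simp: \<rho>_def chart_inv_chart[OF M c'])
      moreover have "x \<in> snd c' ` (fst c' \<inter> fst c)"
        using True Zs x by (intro chart_overlapI) auto
      ultimately show ?thesis by (intro exI[of _ "snd c' ` (fst c' \<inter> fst c)"] conjI)
    next
      case False
      have "openin (top_of M) (points M - Z)" using Zcl by blast
      from open_chart_inv_vimage[OF M c' this]
      have "smooth_open {x \<in> chart_image c'. chart_inv c' x \<in> points M - Z} (\<lambda>x. \<rho> (chart_inv c' x))"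
        by (intro smooth_open_cong[OF smooth_open_const[of _ 0]]) (auto simp: \<rho>0)
      moreover have "chart_inv c' x \<in> points M" using chart_inv_in[OF x] chart_subset[OF M c'] by blast
      ultimately show ?thesis using False x
        by (intro exI[of _ "{x \<in> chart_image c'. chart_inv c' x \<in> points M - Z}"]) simp
    qed
  qed
  then have "smooth_function M \<rho>" by (simp add: smooth_function_iff[OF M])
  moreover have "compactin (top_of M) (function_support M \<rho>)"
    by (rule closed_compactin[OF Zc supp closedin_function_support])
  ultimately have 1: "chart_supported M c \<rho>"
    using c supp Zs b(2) by (auto simp: chart_supported_def \<rho>_def)
  show thesis
  proof
    show "chart_supported M c \<rho>" by (rule 1)
    show "\<rho> q \<le> 1" for q using b(3) by (simp add: \<rho>_def)
    show "openin (top_of M) {q \<in> fst c. snd c q \<in> ball (snd c p) r}" by (rule openin_chart_vimage[OF M c(1) open_ball])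
    show "p \<in> {q \<in> fst c. snd c q \<in> ball (snd c p) r}" using c r by simp
    show "\<rho> q = 1" if "q \<in> {q \<in> fst c. snd c q \<in> ball (snd c p) r}" for q
      using that b(4)[of "snd c q"] by (auto simp: \<rho>_def)
  qed
qed

text \<open>Each new function is multiplied by what the earlier ones leave of 1, that is by the
  product of the factors 1 - \<rho>_i. No division takes place, and the sum is exactly 1 wherever
  some \<rho>_i equals 1.\<close>

lemma telescoping_partition:
  assumes M: "smooth_atlas M" and F: "finite F"
    and \<rho>: "\<And>i. i \<in> F \<Longrightarrow> chart_supported M (C i) (\<rho> i)" "\<And>i q. i \<in> F \<Longrightarrow> \<rho> i q \<le> (1::real)"
  shows "\<exists>R. (\<forall>i\<in>F. chart_supported M (C i) (R i)) \<and> (\<forall>p\<in>points M. 1 - (\<Sum>i\<in>F. R i p) = (\<Prod>i\<in>F. 1 - \<rho> i p))"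
  using F \<rho>
proof (induction F)
  case empty
  then show ?case by simp
next
  case (insert j F)
  then obtain R where R: "\<forall>i\<in>F. chart_supported M (C i) (R i)" "\<forall>p\<in>points M. 1 - (\<Sum>i\<in>F. R i p) = (\<Prod>i\<in>F. 1 - \<rho> i p)"
    by auto
  define s where "s p = 1 + (- 1) * (\<Sum>i\<in>F. R i p)" for p
  have s: "smooth_function M s"
    unfolding s_def using R(1)
    by (intro smooth_function_add[OF M] smooth_function_mult[OF M] smooth_function_sum[OF M] smooth_function_const[OF M])
       (auto simp: chart_supported_def)
  have s1: "s p = (\<Prod>i\<in>F. 1 - \<rho> i p)" if "p \<in> points M" for p using R(2) that by (simp add: s_def)
  have s0: "0 \<le> s p" if "p \<in> points M" for p
    unfolding s1[OF that] using insert.prems(2) by (intro prod_nonneg) simp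
  define R' where "R' = R(j := \<lambda>p. \<rho> j p * s p)"
  have "chart_supported M (C j) (\<lambda>p. \<rho> j p * s p)"
    by (rule chart_supported_mult[OF M _ s s0]) (use insert.prems in auto)
  then have "\<forall>i\<in>insert j F. chart_supported M (C i) (R' i)" using R(1) by (simp add: R'_def)
  moreover have "1 - (\<Sum>i\<in>insert j F. R' i p) = (\<Prod>i\<in>insert j F. 1 - \<rho> i p)" if p: "p \<in> points M" for p
  proof -
    have "(\<Sum>i\<in>F. R' i p) = (\<Sum>i\<in>F. R i p)" using insert.hyps by (intro sum.cong) (auto simp: R'_def)
    then have "1 - (\<Sum>i\<in>insert j F. R' i p) = s p * (1 - \<rho> j p)"
      using insert.hyps by (simp add: R'_def s_def algebra_simps)
    then show ?thesis using insert.hyps s1[OF p] by simp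
  qed
  ultimately show ?case by blast
qed

text \<open>The open sets on which some bump equals 1 cover K. A finite subcover serves as its own
  index set, whence the type of I; at a point of K one factor of the telescoping product
  vanishes.\<close>

theorem smooth_partition_exists:
  assumes M: "smooth_atlas M" and H: "Hausdorff_space (top_of M)" and K: "compactin (top_of M) K"
  obtains I :: "'a set set" and C R where "finite I" "\<And>i. i \<in> I \<Longrightarrow> chart_supported (M :: ('a, 'e::euclidean_space) manifold) (C i) (R i)" "\<And>p. p \<in> K \<Longrightarrow> (\<Sum>i\<in>I. R i p) = 1"
proof -
  define good where "good V = (\<lambda>(c, \<rho>). chart_supported M c \<rho> \<and> (\<forall>q. \<rho> q \<le> 1) \<and> (\<forall>q\<in>V. \<rho> q = 1))" for V
  define \<V> where "\<V> = {V. openin (top_of M) V \<and> (\<exists>x. good V x)}"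
  have "K \<subseteq> \<Union>\<V>"
  proof
    fix p assume "p \<in> K"
    then have "p \<in> points M" using K compactin_subset_topspace by blast
    from manifold_bump[OF M H this] obtain c \<rho> V where "chart_supported M c \<rho>" "\<And>q. \<rho> q \<le> 1"
      "openin (top_of M) V" "p \<in> V" "\<And>q. q \<in> V \<Longrightarrow> \<rho> q = 1" by metis
    then have "good V (c, \<rho>)" "openin (top_of M) V" by (simp_all add: good_def)
    then have "V \<in> \<V>" unfolding \<V>_def by blast
    with \<open>p \<in> V\<close> show "p \<in> \<Union>\<V>" by blast
  qed
  then obtain F where F: "finite F" "F \<subseteq> \<V>" "K \<subseteq> \<Union>F"
    using K unfolding compactin_def \<V>_def by (metis (no_types, lifting) mem_Collect_eq)
  define pick where "pick V = (SOME x. good V x)" for V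
  have pick: "good V (pick V)" if "V \<in> F" for V
  proof -
    have "\<exists>x. good V x" using that F(2) unfolding \<V>_def by blast
    then show ?thesis unfolding pick_def by (rule someI_ex)
  qed
  obtain R where R: "\<forall>i\<in>F. chart_supported M (fst (pick i)) (R i)"
    "\<forall>p\<in>points M. 1 - (\<Sum>i\<in>F. R i p) = (\<Prod>i\<in>F. 1 - snd (pick i) p)"
    using telescoping_partition[OF M F(1), of "\<lambda>V. fst (pick V)" "\<lambda>V. snd (pick V)"] pick
    unfolding good_def case_prod_unfold by blast
  have "(\<Sum>i\<in>F. R i p) = 1" if p: "p \<in> K" for p
  proof -
    obtain V where V: "V \<in> F" "p \<in> V" using F(3) p by blast
    then have "1 - snd (pick V) p = 0" using pick[OF V(1)] unfolding good_def case_prod_unfold by simp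
    then have "(\<Prod>i\<in>F. 1 - snd (pick i) p) = 0" using V(1) F(1) by (meson prod_zero)
    moreover have "p \<in> points M" using K compactin_subset_topspace p by blast
    then have "1 - (\<Sum>i\<in>F. R i p) = (\<Prod>i\<in>F. 1 - snd (pick i) p)" by (rule R(2)[rule_format])
    ultimately show ?thesis by linarith
  qed
  with F(1) R(1) show thesis by (intro that[of F "\<lambda>V. fst (pick V)" R]) (simp_all only:)
qed

lemma chart_supported_sum:
  assumes M: "smooth_atlas M" and I: "finite I" "I \<noteq> {}" and \<rho>: "\<And>i. i \<in> I \<Longrightarrow> chart_supported M c (R i)"
  shows "chart_supported M c (\<lambda>p. \<Sum>i\<in>I. R i p)"
proof -
  have Zc: "compactin (top_of M) (\<Union>i\<in>I. function_support M (R i))"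
    using \<rho> I by (intro compactin_Union) (auto simp: chart_supported_def)
  have Zcl: "closedin (top_of M) (\<Union>i\<in>I. function_support M (R i))"
    using I by (intro closedin_Union) (auto simp: closedin_function_support)
  have supp: "function_support M (\<lambda>p. \<Sum>i\<in>I. R i p) \<subseteq> (\<Union>i\<in>I. function_support M (R i))"
    by (rule function_support_subset[OF Zcl]) (auto intro!: sum.neutral dest: not_in_function_support[of _ M "R _"])
  have "function_support M (\<lambda>p. \<Sum>i\<in>I. R i p) \<subseteq> fst c"
  proof -
    have "\<forall>i\<in>I. function_support M (R i) \<subseteq> fst c" using \<rho> by (simp add: chart_supported_def)
    with supp show ?thesis by blast
  qed
  moreover have "c \<in> atlas_of M" using I \<rho> unfolding chart_supported_def by blast
  moreover have "smooth_function M (\<lambda>p. \<Sum>i\<in>I. R i p)"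
    using \<rho> by (intro smooth_function_sum[OF M]) (simp add: chart_supported_def)
  moreover have "\<forall>p\<in>points M. 0 \<le> (\<Sum>i\<in>I. R i p)"
    using \<rho> by (intro ballI sum_nonneg) (simp add: chart_supported_def)
  ultimately show ?thesis
    unfolding chart_supported_def using closed_compactin[OF Zc supp closedin_function_support] by (intro conjI)
qed

text \<open>Members of the family that share a chart are added up, because a set of pairs cannot record a
  repetition.\<close>
lemma partition_of_unity_from_family:
  assumes M: "smooth_atlas M" and I: "finite I" and R: "\<And>i. i \<in> I \<Longrightarrow> chart_supported M (C i) (R i)"
    and s: "\<And>p. p \<in> K \<Longrightarrow> (\<Sum>i\<in>I. R i p) = 1"
  shows "\<exists>P. partition_of_unity_on M K P"
proof
  let ?f = "\<lambda>c. (c, \<lambda>p. \<Sum>i\<in>{i \<in> I. C i = c}. R i p)"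
  show "partition_of_unity_on M K (?f ` C ` I)"
    unfolding partition_of_unity_on_def
  proof (intro conjI)
    show "finite (?f ` C ` I)" using I by simp
    have "chart_supported M c (\<lambda>p. \<Sum>i\<in>{i \<in> I. C i = c}. R i p)" if "c \<in> C ` I" for c
    proof (rule chart_supported_sum[OF M])
      show "{i \<in> I. C i = c} \<noteq> {}" using that by blast
      show "chart_supported M c (R i)" if "i \<in> {i \<in> I. C i = c}" for i
        using that R[of i] by auto
    qed (use I in simp)
    then show "\<forall>(c, \<rho>)\<in>?f ` C ` I. c \<in> atlas_of M \<and> smooth_function M \<rho> \<and> (\<forall>p\<in>points M. 0 \<le> \<rho> p) \<and>
        compactin (top_of M) (function_support M \<rho>) \<and> function_support M \<rho> \<subseteq> fst c"
      unfolding chart_supported_def by auto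
    show "\<forall>p\<in>K. (\<Sum>(c, \<rho>)\<in>?f ` C ` I. \<rho> p) = 1"
    proof
      fix p assume "p \<in> K"
      have "inj_on ?f (C ` I)" by (auto simp: inj_on_def)
      then have "(\<Sum>(c, \<rho>)\<in>?f ` C ` I. \<rho> p) = (\<Sum>c\<in>C ` I. \<Sum>i\<in>{i \<in> I. C i = c}. R i p)"
        by (simp add: sum.reindex)
      also have "\<dots> = (\<Sum>i\<in>I. R i p)" using I by (rule sum.image_gen[symmetric])
      finally show "(\<Sum>(c, \<rho>)\<in>?f ` C ` I. \<rho> p) = 1" using s \<open>p \<in> K\<close> by simp
    qed
  qed
qed

lemma weights_of_family:
  assumes M: "smooth_atlas M" and K: "K \<subseteq> points M" and I: "finite I" and R: "\<And>i. i \<in> I \<Longrightarrow> chart_supported M (C i) (R i)"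
    and s: "\<And>p. p \<in> K \<Longrightarrow> (\<Sum>i\<in>I. R i p) = 1"
  shows "weights M K I C R (\<lambda>i. function_support M (R i))"
  unfolding weights_def
proof (intro conjI ballI I)
  fix i assume "i \<in> I"
  note R' = R[OF this, unfolded chart_supported_def]
  show "C i \<in> atlas_of M" "closedin (top_of M) (function_support M (R i))" "compactin (top_of M) (function_support M (R i))"
    "function_support M (R i) \<subseteq> fst (C i)" using R' closedin_function_support by blast+
  show "continuous_map (top_of M) euclidean (R i)" using R' smooth_function_continuous[OF M] by blast
  show "R i p = 0" if "p \<in> K - function_support M (R i)" for p
    using that K by (intro not_in_function_support[of p M]) auto
qed (rule s)

lemma weights_of_partition:
  assumes M: "smooth_atlas M" and K: "K \<subseteq> points M" and P: "partition_of_unity_on M K P"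
  shows "weights M K P fst snd (\<lambda>i. function_support M (snd i))"
  using P by (intro weights_of_family[OF M K]) (auto simp: partition_of_unity_on_def chart_supported_def case_prod_unfold)

section \<open>Densities of forms and linearity of the integral\<close>

lemma density_local_form:
  fixes L :: "('a, real^'n::{finite,wellorder}) manifold"
  assumes M: "smooth_atlas L" and \<theta>: "differential_form L CARD('n) \<theta>"
  shows "density L (\<lambda>c x. local_form L \<theta> c x standard_frame)"
  unfolding density_def
proof (intro conjI ballI)
  fix c assume c: "c \<in> atlas_of L"
  show "continuous_on (chart_image c) (\<lambda>x. local_form L \<theta> c x standard_frame)"
    by (rule smooth_open_continuous_on[OF smooth_formD(4)[OF smooth_form_local_form[OF M c \<theta>]]]) simp
  fix c' x assume c': "c' \<in> atlas_of L" and x: "x \<in> snd c ` (fst c \<inter> fst c')"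
  let ?\<tau> = "\<lambda>y. snd c' (chart_inv c y)"
  have "?\<tau> x \<in> chart_image c'" using x chart_inv_chart[OF M c] by (auto simp: chart_image_def)
  then have A: "alternating_multilinear CARD('n) (local_form L \<theta> c' (?\<tau> x))"
    using smooth_formD(2)[OF smooth_form_local_form[OF M c' \<theta>]] by blast
  have "linear (frechet_derivative ?\<tau> (at x))"
    by (rule linear_frechet_derivative[OF smooth_open_differentiable[OF transition_smooth[OF M c c'] x]])
  from alternating_det[OF A this]
  show "local_form L \<theta> c x standard_frame = det (matrix (frechet_derivative ?\<tau> (at x))) * local_form L \<theta> c' (?\<tau> x) standard_frame"
    using local_form_change_chart[OF M c c' x, of \<theta> standard_frame] by (simp add: pull_def)
qed

lemma density_ext_d:
  fixes L :: "('a, real^'n::{finite,wellorder}) manifold"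
  assumes M: "smooth_atlas L" and \<zeta>: "differential_form L k \<zeta>" and k: "CARD('n) = Suc k"
  shows "density L (\<lambda>c x. ext_d (local_form L \<zeta> c) x standard_frame)"
  unfolding density_def
proof (intro conjI ballI)
  fix c assume c: "c \<in> atlas_of L"
  note sf = smooth_form_local_form[OF M c \<zeta>]
  have "smooth_open (chart_image c) (\<lambda>x. ext_d (local_form L \<zeta> c) x standard_frame)"
    unfolding ext_d_def using open_chart_image[OF M c] k
    by (intro smooth_open_sum smooth_open_mult smooth_open_const smooth_open_frechet_derivative smooth_formD(4)[OF sf])
       (auto simp: length_drop_nth)
  then show "continuous_on (chart_image c) (\<lambda>x. ext_d (local_form L \<zeta> c) x standard_frame)"
    by (rule smooth_open_continuous_on)
  fix c' x assume c': "c' \<in> atlas_of L" and x: "x \<in> snd c ` (fst c \<inter> fst c')"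
  let ?\<tau> = "\<lambda>y. snd c' (chart_inv c y)"
  have "?\<tau> x \<in> chart_image c'" using x chart_inv_chart[OF M c] by (auto simp: chart_image_def)
  then have A: "alternating_multilinear CARD('n) (ext_d (local_form L \<zeta> c') (?\<tau> x))"
    using alternating_ext_d[OF smooth_form_local_form[OF M c' \<zeta>]] k by simp
  have "linear (frechet_derivative ?\<tau> (at x))"
    by (rule linear_frechet_derivative[OF smooth_open_differentiable[OF transition_smooth[OF M c c'] x]])
  from alternating_det[OF A this]
  show "ext_d (local_form L \<zeta> c) x standard_frame = det (matrix (frechet_derivative ?\<tau> (at x))) * ext_d (local_form L \<zeta> c') (?\<tau> x) standard_frame"
    using ext_d_change_chart[OF M c c' \<zeta> x, of standard_frame] k by simp
qed

lemma local_form_scale: "local_form M (scale_form h \<alpha>) c x ws = h (chart_inv c x) * local_form M \<alpha> c x ws"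
  by (simp add: local_form_def)

lemma differential_form_scale:
  assumes M: "smooth_atlas M" and h: "smooth_function M h" and \<alpha>: "differential_form M k \<alpha>"
  shows "differential_form M k (scale_form h \<alpha>)"
  unfolding differential_form_def
proof (intro ballI conjI allI impI)
  fix c assume c: "c \<in> atlas_of M"
  note sf = smooth_form_local_form[OF M c \<alpha>]
  show "alternating_multilinear k (local_form M (scale_form h \<alpha>) c x)" if "x \<in> chart_image c" for x
    using smooth_formD(2)[OF sf that] unfolding local_form_scale alternating_multilinear_def
    by (auto simp: linear_iff algebra_simps local_form_scale)
  fix ws :: "'b list" assume "length ws = k"
  then have "smooth_open (chart_image c) (\<lambda>x. h (chart_inv c x) * local_form M \<alpha> c x ws)"
    using h c by (intro smooth_open_mult smooth_formD(4)[OF sf]) (auto simp: smooth_function_iff[OF M])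
  then show "smooth_on (chart_image c) (\<lambda>x. local_form M (scale_form h \<alpha>) c x ws)"
    unfolding local_form_scale smooth_on_iff_smooth_open[OF open_chart_image[OF M c]] .
qed

lemma chart_integral_cong:
  assumes "\<And>i x. i \<in> I \<Longrightarrow> x \<in> chart_image (C i) \<Longrightarrow> chart_inv (C i) x \<in> K \<Longrightarrow> D (C i) x = D' (C i) x"
  shows "chart_integral I C R K D = chart_integral I C R K D'"
  unfolding chart_integral_def using assms by (intro sum.cong refl integral_cong) auto

lemma chart_integral_shrink:
  assumes "K' \<subseteq> K" "\<And>i x. i \<in> I \<Longrightarrow> x \<in> chart_image (C i) \<Longrightarrow> chart_inv (C i) x \<in> K - K' \<Longrightarrow> D (C i) x = 0"
  shows "chart_integral I C R K D = chart_integral I C R K' D"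
  unfolding chart_integral_def using assms by (intro sum.cong refl integral_cong) auto

lemma chart_integral_sum:
  fixes L :: "('a, real^'n::{finite,wellorder}) manifold"
  assumes M: "smooth_atlas L" and K: "closedin (top_of L) K" and P: "weights L K I C R Z"
    and J: "finite J" and D: "\<And>j. j \<in> J \<Longrightarrow> density L (D j)"
  shows "chart_integral I C R K (\<lambda>c x. \<Sum>j\<in>J. a j * D j c x) = (\<Sum>j\<in>J. a j * chart_integral I C R K (D j))"
proof -
  have int: "(\<lambda>x. if chart_inv (C i) x \<in> K then R i (chart_inv (C i) x) * D j (C i) x else 0) integrable_on chart_image (C i)"
    if i: "i \<in> I" and j: "j \<in> J" for i j
  proof -
    let ?q = "chart_inv (C i)"
    have c: "C i \<in> atlas_of L" and Zi: "Z i \<subseteq> fst (C i)" "compactin (top_of L) (Z i)"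
      and Ri: "continuous_map (top_of L) euclidean (R i)" "\<And>p. p \<in> K - Z i \<Longrightarrow> R i p = 0"
      using P i by (auto simp: weights_def)
    let ?S = "snd (C i) ` (K \<inter> Z i)"
    have cpt: "compact ?S"
      using closed_Int_compactin[OF K Zi(2)] Zi(1) by (intro compact_chart[OF M c]) auto
    have e: "?S = {x \<in> chart_image (C i). ?q x \<in> K \<inter> Z i}"
      using Zi by (intro chart_image_of_subset[OF M c]) auto
    have "continuous_on ?S (\<lambda>x. R i (?q x) * D j (C i) x)"
      using D[OF j] c continuous_on_chart_function[OF M c Ri(1)] e
      unfolding density_def by (intro continuous_on_mult) (auto intro: continuous_on_subset)
    then have "(\<lambda>x. R i (?q x) * D j (C i) x) integrable_on ?S"
      using absolutely_integrable_on_compact[OF cpt] set_lebesgue_integral_eq_integral(1) by blast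
    moreover have "?S \<inter> chart_image (C i) = ?S" unfolding e by blast
    ultimately have "(\<lambda>x. if x \<in> ?S then R i (?q x) * D j (C i) x else 0) integrable_on chart_image (C i)"
      by (simp only: integrable_restrict_Int)
    then show ?thesis
      by (rule integrable_eq) (use Ri(2) in \<open>auto simp: e\<close>)
  qed
  have "chart_integral I C R K (\<lambda>c x. \<Sum>j\<in>J. a j * D j c x) = (\<Sum>i\<in>I. \<Sum>j\<in>J. a j * integral (chart_image (C i))
     (\<lambda>x. if chart_inv (C i) x \<in> K then R i (chart_inv (C i) x) * D j (C i) x else 0))"
    unfolding chart_integral_def
  proof (rule sum.cong[OF refl])
    fix i assume i: "i \<in> I"
    have "integral (chart_image (C i)) (\<lambda>x. if chart_inv (C i) x \<in> K then R i (chart_inv (C i) x) * (\<Sum>j\<in>J. a j * D j (C i) x) else 0) =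
      integral (chart_image (C i)) (\<lambda>x. \<Sum>j\<in>J. a j * (if chart_inv (C i) x \<in> K then R i (chart_inv (C i) x) * D j (C i) x else 0))"
      by (rule integral_cong) (auto simp: sum_distrib_left mult.left_commute)
    also have "\<dots> = (\<Sum>j\<in>J. a j * integral (chart_image (C i)) (\<lambda>x. if chart_inv (C i) x \<in> K then R i (chart_inv (C i) x) * D j (C i) x else 0))"
      using J int[OF i] by (subst integral_sum) (auto intro: integrable_on_mult_right)
    finally show "integral (chart_image (C i)) (\<lambda>x. if chart_inv (C i) x \<in> K then R i (chart_inv (C i) x) * (\<Sum>j\<in>J. a j * D j (C i) x) else 0) =
      (\<Sum>j\<in>J. a j * integral (chart_image (C i)) (\<lambda>x. if chart_inv (C i) x \<in> K then R i (chart_inv (C i) x) * D j (C i) x else 0))" .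
  qed
  also have "\<dots> = (\<Sum>j\<in>J. a j * chart_integral I C R K (D j))"
    unfolding chart_integral_def sum_distrib_left by (rule sum.swap)
  finally show ?thesis .
qed

section \<open>Stokes' theorem for compact support\<close>

lemma ext_d_zero: "ext_d (\<lambda>y ws. 0) x vs = 0"
proof -
  have "frechet_derivative (\<lambda>y::'a. 0::real) (at x) v = 0" for v
    by (rule frechet_derivative_eq[OF has_derivative_const])
  then show ?thesis by (simp add: ext_d_def)
qed

lemma ext_d_sum:
  assumes J: "finite J" and \<alpha>: "\<And>j. j \<in> J \<Longrightarrow> smooth_form S k (\<alpha> j)" and x: "x \<in> S" and l: "length vs = Suc k"
  shows "ext_d (\<lambda>y ws. \<Sum>j\<in>J. \<alpha> j y ws) x vs = (\<Sum>j\<in>J. ext_d (\<alpha> j) x vs)"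
proof -
  have "frechet_derivative (\<lambda>y. \<Sum>j\<in>J. \<alpha> j y ws) (at x) v = (\<Sum>j\<in>J. frechet_derivative (\<lambda>y. \<alpha> j y ws) (at x) v)"
    if "length ws = k" for ws v
    using smooth_formD(5)[OF \<alpha> that x]
    by (intro frechet_derivative_eq has_derivative_sum has_derivative_frechet)
  then show ?thesis
    unfolding ext_d_def using l
    by (subst sum.swap) (auto simp: length_drop_nth sum_distrib_left intro!: sum.cong)
qed

lemma oriented_manifold_Hausdorff: "oriented_manifold L \<Longrightarrow> Hausdorff_space (top_of L)"
  by (simp only: manifold_with_def)

lemma ext_d_local_form_eq_0:
  assumes M: "smooth_atlas L" and K: "closedin (top_of L) K" and c: "c \<in> atlas_of L"
    and x: "x \<in> chart_image c" "chart_inv c x \<notin> K" and l: "length vs = Suc k"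
    and z: "\<And>y ws. y \<in> chart_image c \<Longrightarrow> chart_inv c y \<notin> K \<Longrightarrow> length ws = k \<Longrightarrow> \<alpha> y ws = 0"
  shows "ext_d \<alpha> x vs = 0"
proof -
  have "openin (top_of L) (points L - K)" using K by blast
  from open_chart_inv_vimage[OF M c this]
  have "ext_d \<alpha> x vs = ext_d (\<lambda>y ws. 0) x vs"
    by (rule ext_d_cong_open[OF _ _ l]) (use x z chart_inv_in[OF x(1)] chart_subset[OF M c] in auto)
  then show ?thesis by (simp add: ext_d_zero)
qed

text \<open>The form is cut into pieces R'_j \<zeta>, each supported in one chart, before d is
  applied. Cutting d\<zeta> instead would leave terms that are not exact. Each piece is integrated
  in its own chart, where the Euclidean statement applies.\<close>

theorem chart_integral_ext_d_eq_0:
  fixes L :: "('a, real^'n::{finite,wellorder}) manifold"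
  assumes L: "oriented_manifold L" and K: "compactin (top_of L) K" and \<zeta>: "differential_form L k \<zeta>"
    and n: "CARD('n) = Suc k" and W: "weights L K I C R Z"
    and z: "\<And>c x ws. c \<in> atlas_of L \<Longrightarrow> x \<in> chart_image c \<Longrightarrow> chart_inv c x \<notin> K \<Longrightarrow> length ws = k \<Longrightarrow>
      local_form L \<zeta> c x ws = 0"
  shows "chart_integral I C R K (\<lambda>c x. ext_d (local_form L \<zeta> c) x standard_frame) = 0"
proof -
  note M = oriented_manifold_smooth_atlas[OF L] and H = oriented_manifold_Hausdorff[OF L]
  have Kp: "K \<subseteq> points L" using K compactin_subset_topspace by blast
  have Kcl: "closedin (top_of L) K" by (rule compactin_imp_closedin[OF H K])
  obtain F :: "'a set set" and C' R' where F: "finite F" and cs: "\<And>i. i \<in> F \<Longrightarrow> chart_supported L (C' i) (R' i)"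
    and sum1: "\<And>p. p \<in> K \<Longrightarrow> (\<Sum>i\<in>F. R' i p) = 1"
    using smooth_partition_exists[OF M H K] by metis
  define Z' where "Z' i = function_support L (R' i)" for i
  have W': "weights L K F C' R' Z'" unfolding Z'_def by (rule weights_of_family[OF M Kp F cs sum1])
  define D where "D j c x = ext_d (local_form L (scale_form (R' j) \<zeta>) c) x standard_frame" for j c x
  have df: "differential_form L k (scale_form (R' j) \<zeta>)" if "j \<in> F" for j
    using cs[OF that] by (intro differential_form_scale[OF M _ \<zeta>]) (simp add: chart_supported_def)
  have dens: "density L (D j)" if "j \<in> F" for j
    unfolding D_def by (rule density_ext_d[OF M df[OF that] n])
  have D0: "D j c x = 0" if j: "j \<in> F" and c: "c \<in> atlas_of L" and x: "x \<in> chart_image c" "chart_inv c x \<notin> K \<inter> Z' j" for j c x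
    unfolding D_def
  proof (rule ext_d_local_form_eq_0[OF M _ c x])
    show "closedin (top_of L) (K \<inter> Z' j)" using Kcl closedin_function_support unfolding Z'_def by (rule closedin_Int)
    fix y :: "real^'n::_" and ws :: "(real^'n::_) list" assume y: "y \<in> chart_image c" "chart_inv c y \<notin> K \<inter> Z' j" "length ws = k"
    have "chart_inv c y \<in> points L" using chart_inv_in[OF y(1)] chart_subset[OF M c] by blast
    then have "R' j (chart_inv c y) = 0 \<or> chart_inv c y \<notin> K"
      using y(2) not_in_function_support[of "chart_inv c y" L "R' j"] unfolding Z'_def by blast
    then show "local_form L (scale_form (R' j) \<zeta>) c y ws = 0"
      unfolding local_form_scale using z[OF c y(1) _ y(3)] by auto
  qed (simp add: n)
  have "chart_integral I C R K (\<lambda>c x. ext_d (local_form L \<zeta> c) x standard_frame)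
      = chart_integral F C' R' K (\<lambda>c x. ext_d (local_form L \<zeta> c) x standard_frame)"
    by (rule chart_integral_independent[OF L Kcl W W' density_ext_d[OF M \<zeta> n]])
  also have "\<dots> = chart_integral F C' R' K (\<lambda>c x. \<Sum>j\<in>F. 1 * D j c x)"
  proof (rule chart_integral_cong)
    fix i x assume i: "i \<in> F" and x: "x \<in> chart_image (C' i)"
    have c: "C' i \<in> atlas_of L" using cs[OF i] by (simp add: chart_supported_def)
    have "ext_d (local_form L \<zeta> (C' i)) x standard_frame = ext_d (\<lambda>y ws. \<Sum>j\<in>F. local_form L (scale_form (R' j) \<zeta>) (C' i) y ws) x standard_frame"
    proof (rule ext_d_cong_open[OF open_chart_image[OF M c] x])
      fix y :: "real^'n::_" and ws :: "(real^'n::_) list" assume y: "y \<in> chart_image (C' i)" "length ws = k"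
      \<comment> \<open>The functions R'_j sum to 1 only on K. Off K the equation holds because
        \<zeta> vanishes there, so it is valid on the whole chart image, as differentiation
        requires.\<close>
      show "local_form L \<zeta> (C' i) y ws = (\<Sum>j\<in>F. local_form L (scale_form (R' j) \<zeta>) (C' i) y ws)"
      proof (cases "chart_inv (C' i) y \<in> K")
        case True
        then show ?thesis using sum1 unfolding local_form_scale by (simp flip: sum_distrib_right)
      next
        case False
        then show ?thesis unfolding local_form_scale using z[OF c y(1) False y(2)] by simp
      qed
    qed (simp add: n)
    also have "\<dots> = (\<Sum>j\<in>F. 1 * D j (C' i) x)"
      unfolding D_def by (subst ext_d_sum[OF F smooth_form_local_form[OF M c df] x]) (simp_all add: n)
    finally show "ext_d (local_form L \<zeta> (C' i)) x standard_frame = (\<Sum>j\<in>F. 1 * D j (C' i) x)" .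
  qed
  also have "\<dots> = (\<Sum>j\<in>F. 1 * chart_integral F C' R' K (D j))"
    by (rule chart_integral_sum[OF M Kcl W' F dens])
  also have "\<dots> = 0"
  proof (intro sum.neutral ballI)
    fix j assume j: "j \<in> F"
    define Kj where "Kj = K \<inter> Z' j"
    have c: "C' j \<in> atlas_of L" and Zj: "Z' j \<subseteq> fst (C' j)" "closedin (top_of L) (Z' j)" "compactin (top_of L) (Z' j)"
      using W' j by (auto simp: weights_def)
    have Kjcl: "closedin (top_of L) Kj" unfolding Kj_def by (rule closedin_Int[OF Kcl Zj(2)])
    have "chart_integral F C' R' K (D j) = chart_integral F C' R' Kj (D j)"
      by (rule chart_integral_shrink) (use W' D0[OF j] in \<open>auto simp: Kj_def weights_def\<close>)
    \<comment> \<open>On the closed set Kj, which lies in the domain of the chart C' j, the single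
      chart with weight 1 is a system of weights.\<close>
    also have "\<dots> = chart_integral {j} C' (\<lambda>_ _. 1) Kj (D j)"
    proof (rule chart_integral_independent[OF L Kjcl _ _ dens[OF j]])
      show "weights L Kj F C' R' Z'" using W' unfolding weights_def Kj_def by blast
      show "weights L Kj {j} C' (\<lambda>_ _. 1) Z'" using c Zj by (simp add: weights_def Kj_def)
    qed
    also have "\<dots> = integral (chart_image (C' j)) (D j (C' j))"
      unfolding chart_integral_def using D0[OF j c] by (auto simp: Kj_def intro!: integral_cong)
    also have "\<dots> = 0"
      unfolding D_def
    proof (rule integral_ext_d_eq_0[OF smooth_form_local_form[OF M c df[OF j]]])
      show "compact (snd (C' j) ` Kj)"
        unfolding Kj_def using closed_Int_compactin[OF Kcl Zj(3)] Zj(1) by (intro compact_chart[OF M c]) auto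
      show "snd (C' j) ` Kj \<subseteq> chart_image (C' j)" using Zj by (auto simp: Kj_def chart_image_def)
      fix x :: "real^'n::_" and ws :: "(real^'n::_) list" assume x: "x \<in> chart_image (C' j) - snd (C' j) ` Kj" "length ws = k"
      then have nK: "chart_inv (C' j) x \<notin> Kj" by (metis DiffE chart_chart_inv image_eqI)
      have "chart_inv (C' j) x \<in> points L" using x chart_inv_in[of x "C' j"] chart_subset[OF M c] by blast
      then have "R' j (chart_inv (C' j) x) = 0 \<or> chart_inv (C' j) x \<notin> K"
        using nK not_in_function_support[of "chart_inv (C' j) x" L "R' j"] unfolding Kj_def Z'_def by blast
      then show "local_form L (scale_form (R' j) \<zeta>) (C' j) x ws = 0"
        unfolding local_form_scale using z[OF c _ _ x(2)] x(1) by auto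
    qed (simp add: n)
    finally show "1 * chart_integral F C' R' K (D j) = 0" by simp
  qed
  finally show ?thesis .
qed

section \<open>The image of an embedding\<close>

text \<open>For an embedding \<Phi> this is the chart of the source whose membership in the atlas
  defines the atlas of \<open>image_manifold\<close>.\<close>

definition pull_chart :: "'a topology \<Rightarrow> ('a \<Rightarrow> 'b) \<Rightarrow> ('b, 'e) chart \<Rightarrow> ('a, 'e) chart" where
  "pull_chart T \<Phi> c = ({p \<in> topspace T. \<Phi> p \<in> fst c}, snd c \<circ> \<Phi>)"

lemma pull_chart_simps [simp]:
  "fst (pull_chart T \<Phi> c) = {p \<in> topspace T. \<Phi> p \<in> fst c}" "snd (pull_chart T \<Phi> c) p = snd c (\<Phi> p)"
  by (simp_all add: pull_chart_def)

lemma chart_inv_cong: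
  "fst c = fst c' \<Longrightarrow> (\<And>p. p \<in> fst c \<Longrightarrow> snd c p = snd c' p) \<Longrightarrow> chart_inv c = chart_inv c'"
  by (auto simp: chart_inv_def inv_into_def fun_eq_iff cong: conj_cong)

lemma is_chart_cong:
  assumes "is_chart T c" "fst c' = fst c" "\<And>p. p \<in> fst c \<Longrightarrow> snd c' p = snd c p"
  shows "is_chart T c'"
proof -
  have i: "chart_image c' = chart_image c" using assms by (auto simp: chart_image_def intro!: image_cong)
  have "homeomorphic_map (subtopology T (fst c)) (top_of_set (chart_image c)) (snd c')"
    by (rule homeomorphic_map_eq[of _ _ "snd c"]) (use assms in \<open>auto simp: is_chart_def\<close>)
  then show ?thesis using assms i by (simp add: is_chart_def)
qed

context
  fixes T :: "'a topology" and T' :: "'b topology" and \<Phi> :: "'a \<Rightarrow> 'b" and c :: "('b, 'e::euclidean_space) chart"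
  assumes \<Phi>: "homeomorphic_map T T' \<Phi>" and c: "is_chart T' c"
begin

lemma pull_chart_image: "\<Phi> ` fst (pull_chart T \<Phi> c) = fst c"
proof -
  have "fst c \<subseteq> topspace T'" using c openin_subset unfolding is_chart_def by blast
  then show ?thesis using homeomorphic_imp_surjective_map[OF \<Phi>] by auto
qed

lemma chart_image_pull_chart: "chart_image (pull_chart T \<Phi> c) = chart_image c"
proof -
  have "snd (pull_chart T \<Phi> c) ` fst (pull_chart T \<Phi> c) = snd c ` \<Phi> ` fst (pull_chart T \<Phi> c)"
    by (simp add: image_image)
  then show ?thesis unfolding pull_chart_image by (simp add: chart_image_def)
qed

lemma is_chart_pull_chart: "is_chart T (pull_chart T \<Phi> c)"
  unfolding is_chart_def chart_image_pull_chart
proof (intro conjI)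
  show "open (chart_image c)" using c by (simp add: is_chart_def)
  show "openin T (fst (pull_chart T \<Phi> c))"
    using openin_continuous_map_preimage[OF homeomorphic_imp_continuous_map[OF \<Phi>]] c by (simp add: is_chart_def)
  have "homeomorphic_map (subtopology T (fst (pull_chart T \<Phi> c))) (subtopology T' (fst c)) \<Phi>"
  proof (rule homeomorphic_map_subtopologies[OF \<Phi>])
    have "fst c \<subseteq> topspace T'" using c openin_subset unfolding is_chart_def by blast
    moreover have "fst (pull_chart T \<Phi> c) \<subseteq> topspace T" by auto
    ultimately show "\<Phi> ` (topspace T \<inter> fst (pull_chart T \<Phi> c)) = topspace T' \<inter> fst c"
      using pull_chart_image by (simp only: Int_absorb1)
  qed
  moreover have "homeomorphic_map (subtopology T' (fst c)) (top_of_set (chart_image c)) (snd c)"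
    using c by (simp add: is_chart_def)
  ultimately show "homeomorphic_map (subtopology T (fst (pull_chart T \<Phi> c))) (top_of_set (chart_image c)) (snd (pull_chart T \<Phi> c))"
    unfolding pull_chart_def snd_conv by (rule homeomorphic_map_compose)
qed

lemma chart_inv_pull_chart:
  assumes "x \<in> chart_image c" shows "\<Phi> (chart_inv (pull_chart T \<Phi> c) x) = chart_inv c x"
proof -
  have x: "x \<in> chart_image (pull_chart T \<Phi> c)" using assms chart_image_pull_chart by simp
  have 1: "\<Phi> (chart_inv (pull_chart T \<Phi> c) x) \<in> fst c" using chart_inv_in[OF x] by simp
  have 2: "snd c (\<Phi> (chart_inv (pull_chart T \<Phi> c) x)) = x" using chart_chart_inv[OF x] by simp
  show ?thesis
    using inj_onD[OF is_chart_inj[OF c] _ 1 chart_inv_in[OF assms]] 2 chart_chart_inv[OF assms] by simp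
qed

end

lemma oriented_atlas_maximal:
  assumes L: "oriented_manifold L" and c: "is_chart (top_of L) c"
    and 1: "\<And>c'. c' \<in> atlas_of L \<Longrightarrow> smooth_on (snd c ` (fst c \<inter> fst c')) (snd c' \<circ> chart_inv c)"
    and 2: "\<And>c'. c' \<in> atlas_of L \<Longrightarrow> smooth_on (snd c' ` (fst c \<inter> fst c')) (snd c \<circ> chart_inv c')"
    and 3: "\<And>c' p. c' \<in> atlas_of L \<Longrightarrow> p \<in> fst c \<Longrightarrow> p \<in> fst c' \<Longrightarrow>
      0 < det (matrix (frechet_derivative (snd c' \<circ> chart_inv c) (at (snd c p))))"
  shows "c \<in> atlas_of L"
proof -
  have "\<forall>c'\<in>atlas_of L. orientedly_compatible c c'"
    using 1 2 3 unfolding orientedly_compatible_def smoothly_compatible_def by blast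
  then show ?thesis using L c unfolding manifold_with_def by blast
qed

text \<open>A chart map is a total function, so two versions of the same chart may differ off the
  domain. Maximality of the atlas makes it insensitive to these values.\<close>

lemma oriented_atlas_cong:
  assumes L: "oriented_manifold L" and c: "c \<in> atlas_of L" and e: "fst c' = fst c" "\<And>p. p \<in> fst c \<Longrightarrow> snd c' p = snd c p"
  shows "c' \<in> atlas_of L"
proof (rule oriented_atlas_maximal[OF L])
  note M = oriented_manifold_smooth_atlas[OF L]
  have inv: "chart_inv c' = chart_inv c" by (rule chart_inv_cong) (use e in auto)
  show "is_chart (top_of L) c'" by (rule is_chart_cong[OF chart_is_chart[OF M c] e])
  fix d assume d: "d \<in> atlas_of L"
  have "orientedly_compatible c d" using L c d unfolding manifold_with_def by blast
  note cmp = this[unfolded orientedly_compatible_def smoothly_compatible_def]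
  have im: "snd c' ` (fst c \<inter> fst d) = snd c ` (fst c \<inter> fst d)" using e by (auto intro!: image_cong)
  show "smooth_on (snd c' ` (fst c' \<inter> fst d)) (snd d \<circ> chart_inv c')" unfolding inv e(1) im using cmp by blast
  have "smooth_on (snd d ` (fst c \<inter> fst d)) (snd c \<circ> chart_inv d)" using cmp by blast
  then show "smooth_on (snd d ` (fst c' \<inter> fst d)) (snd c' \<circ> chart_inv d)"
    unfolding e(1) by (rule smooth_on_cong) (auto simp: e chart_inv_chart[OF M d])
  fix p assume p: "p \<in> fst c'" "p \<in> fst d"
  then have "snd c' p = snd c p" using e by auto
  then show "0 < det (matrix (frechet_derivative (snd d \<circ> chart_inv c') (at (snd c' p))))"
    unfolding inv using cmp p e(1) by (metis IntI)
qed

lemma smooth_map_in_charts: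
  assumes M: "smooth_atlas M" and N: "smooth_atlas N" and f: "smooth_map M N f" and c: "c \<in> atlas_of M" and c': "c' \<in> atlas_of N"
  shows "smooth_open {x \<in> chart_image c. f (chart_inv c x) \<in> fst c'} (\<lambda>x. snd c' (f (chart_inv c x)))"
proof -
  have "openin (top_of M) {p \<in> points M. f p \<in> fst c'}"
    using f chart_openin[OF N c'] unfolding smooth_map_def by (blast intro: openin_continuous_map_preimage)
  from open_chart_inv_vimage[OF M c this]
  have "open {x \<in> chart_image c. chart_inv c x \<in> {p \<in> points M. f p \<in> fst c'}}" .
  moreover have "{x \<in> chart_image c. chart_inv c x \<in> {p \<in> points M. f p \<in> fst c'}} = {x \<in> chart_image c. f (chart_inv c x) \<in> fst c'}"
    using chart_inv_in[of _ c] chart_subset[OF M c] by auto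
  ultimately have o: "open {x \<in> chart_image c. f (chart_inv c x) \<in> fst c'}" by (simp only:)
  have e: "snd c ` {p \<in> fst c. f p \<in> fst c'} = {x \<in> chart_image c. f (chart_inv c x) \<in> fst c'}"
    using chart_image_of_subset[OF M c, of "{p \<in> fst c. f p \<in> fst c'}"] chart_inv_in[of _ c] by auto
  have "smooth_on (snd c ` {p \<in> fst c. f p \<in> fst c'}) (snd c' \<circ> f \<circ> chart_inv c)"
    using f c c' unfolding smooth_map_def by blast
  then show ?thesis unfolding e smooth_on_iff_smooth_open[OF o] by (simp add: o_def)
qed

lemma homeomorphic_map_inv_into:
  assumes "homeomorphic_map T T' \<Phi>"
  shows "homeomorphic_map T' T (inv_into (topspace T) \<Phi>)"
proof -
  obtain g where g: "homeomorphic_maps T T' \<Phi> g" using assms homeomorphic_map_maps by blast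
  have "g y = inv_into (topspace T) \<Phi> y" if "y \<in> topspace T'" for y
  proof -
    have "g y \<in> topspace T" "\<Phi> (g y) = y" using g that unfolding homeomorphic_maps_def continuous_map_def by auto
    then show ?thesis using homeomorphic_imp_injective_map[OF assms] by (metis inv_into_f_f)
  qed
  then have "homeomorphic_maps T T' \<Phi> (inv_into (topspace T) \<Phi>)"
    using homeomorphic_maps_eq[OF g, of \<Phi>] by simp
  then show ?thesis using homeomorphic_maps_map by blast
qed

lemma homeomorphic_map_inv_into_simps:
  assumes "homeomorphic_map T T' \<Phi>"
  shows "p \<in> topspace T \<Longrightarrow> \<Phi> p \<in> topspace T'" "p \<in> topspace T \<Longrightarrow> inv_into (topspace T) \<Phi> (\<Phi> p) = p"
    "q \<in> topspace T' \<Longrightarrow> inv_into (topspace T) \<Phi> q \<in> topspace T" "q \<in> topspace T' \<Longrightarrow> \<Phi> (inv_into (topspace T) \<Phi> q) = q"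
  using homeomorphic_imp_surjective_map[OF assms] homeomorphic_imp_injective_map[OF assms]
  by (auto simp: inv_into_into f_inv_into_f)

lemma is_chart_from_pull_chart:
  assumes \<Phi>: "homeomorphic_map T T' \<Phi>" and c: "is_chart T (pull_chart T \<Phi> c)" and s: "fst c \<subseteq> topspace T'"
  shows "is_chart T' c"
proof (rule is_chart_cong[OF is_chart_pull_chart[OF homeomorphic_map_inv_into[OF \<Phi>] c]])
  note h = homeomorphic_map_inv_into_simps[OF \<Phi>]
  show "fst c = fst (pull_chart T' (inv_into (topspace T) \<Phi>) (pull_chart T \<Phi> c))"
    using s h by auto
  fix p assume "p \<in> fst (pull_chart T' (inv_into (topspace T) \<Phi>) (pull_chart T \<Phi> c))"
  then show "snd c p = snd (pull_chart T' (inv_into (topspace T) \<Phi>) (pull_chart T \<Phi> c)) p"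
    using h(4)[of p] by simp
qed

lemma smooth_on_open_subset: "smooth_open S f \<Longrightarrow> T \<subseteq> S \<Longrightarrow> smooth_on T f"
  using smooth_on_iff_smooth_open smooth_on_subset smooth_openD(1) by blast

section \<open>Reparametrisations and the choice of a representative\<close>

lemma reparametrizationD:
  assumes "\<psi> \<in> reparametrizations L"
  shows "homeomorphic_map (top_of L) (top_of L) \<psi>" "smooth_map L L \<psi>" "smooth_map L L (inv_into (points L) \<psi>)"
    "c \<in> atlas_of L \<Longrightarrow> c' \<in> atlas_of L \<Longrightarrow> p \<in> fst c \<Longrightarrow> \<psi> p \<in> fst c' \<Longrightarrow>
       0 < det (matrix (frechet_derivative (\<lambda>x. snd c' (\<psi> (chart_inv c x))) (at (snd c p))))"
  using assms unfolding reparametrizations_def by (auto simp: o_def)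

text \<open>The transition from the pulled chart to c' is \<open>?B\<close>, through the inverse of
  \<psi>, while orientation preservation is given for \<psi> itself, that is for \<open>?A\<close>.
  The two are mutually inverse, so their Jacobian determinants multiply to 1 and share the
  sign.\<close>

lemma pull_chart_reparametrization:
  fixes L :: "('a, real^'n) manifold"
  assumes L: "oriented_manifold L" and \<psi>: "\<psi> \<in> reparametrizations L" and c: "c \<in> atlas_of L"
  shows "pull_chart (top_of L) \<psi> c \<in> atlas_of L"
proof (rule oriented_atlas_maximal[OF L])
  note M = oriented_manifold_smooth_atlas[OF L] and r = reparametrizationD[OF \<psi>]
  note h = homeomorphic_map_inv_into_simps[OF r(1)]
  let ?c = "pull_chart (top_of L) \<psi> c" and ?\<chi> = "inv_into (points L) \<psi>"
  note cc = chart_is_chart[OF M c]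
  show isc: "is_chart (top_of L) ?c" by (rule is_chart_pull_chart[OF r(1) cc])
  have inv: "chart_inv ?c x = ?\<chi> (chart_inv c x)" if "x \<in> chart_image c" for x
  proof -
    have "chart_inv ?c x \<in> points L"
      using chart_inv_in[of x ?c] that chart_image_pull_chart[OF r(1) cc] by simp
    then show ?thesis using chart_inv_pull_chart[OF r(1) cc that] h(2)[of "chart_inv ?c x"] by simp
  qed
  fix c' assume c': "c' \<in> atlas_of L"
  let ?S = "{x \<in> chart_image c. ?\<chi> (chart_inv c x) \<in> fst c'}"
  let ?B = "\<lambda>x. snd c' (?\<chi> (chart_inv c x))" and ?A = "\<lambda>y. snd c (\<psi> (chart_inv c' y))"
  note B = smooth_map_in_charts[OF M M r(3) c c']
  note A = smooth_map_in_charts[OF M M r(2) c' c]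
  have sub: "snd ?c ` (fst ?c \<inter> fst c') \<subseteq> ?S"
  proof
    fix x assume "x \<in> snd ?c ` (fst ?c \<inter> fst c')"
    then obtain p where p: "p \<in> points L" "\<psi> p \<in> fst c" "p \<in> fst c'" "x = snd c (\<psi> p)" by auto
    then show "x \<in> ?S" using h(2)[OF p(1)] chart_inv_chart[OF M c p(2)] by (simp add: chart_in_image)
  qed
  show "smooth_on (snd ?c ` (fst ?c \<inter> fst c')) (snd c' \<circ> chart_inv ?c)"
    by (rule smooth_on_cong[OF smooth_on_open_subset[OF B sub]]) (use sub inv in auto)
  have sub2: "snd c' ` (fst ?c \<inter> fst c') \<subseteq> {y \<in> chart_image c'. \<psi> (chart_inv c' y) \<in> fst c}"
    using chart_inv_chart[OF M c'] by (auto simp: chart_in_image)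
  show "smooth_on (snd c' ` (fst ?c \<inter> fst c')) (snd ?c \<circ> chart_inv c')"
    by (rule smooth_on_cong[OF smooth_on_open_subset[OF A sub2]]) simp
  fix p assume p: "p \<in> fst ?c" "p \<in> fst c'"
  let ?y = "snd c' p" and ?x = "snd ?c p"
  have x: "?x \<in> ?S" using sub p by blast
  have y: "?y \<in> {y \<in> chart_image c'. \<psi> (chart_inv c' y) \<in> fst c}" using sub2 p by blast
  have Ay: "?A ?y = ?x" using chart_inv_chart[OF M c' p(2)] by simp
  have e: "frechet_derivative (snd c' \<circ> chart_inv ?c) (at ?x) = frechet_derivative ?B (at ?x)"
    by (rule frechet_derivative_cong_open[OF smooth_openD(1)[OF B] x]) (simp add: inv)
  have dA: "(?A has_derivative frechet_derivative ?A (at ?y)) (at ?y)" by (rule smooth_open_has_derivative[OF A y])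
  have dB: "(?B has_derivative frechet_derivative ?B (at ?x)) (at ?x)" by (rule smooth_open_has_derivative[OF B x])
  have "(?B \<circ> ?A has_derivative frechet_derivative ?B (at ?x) \<circ> frechet_derivative ?A (at ?y)) (at ?y)"
    by (rule diff_chain_at[OF dA]) (use dB Ay in simp)
  then have "((\<lambda>y. y) has_derivative frechet_derivative ?B (at ?x) \<circ> frechet_derivative ?A (at ?y)) (at ?y)"
  proof (rule has_derivative_transform_within_open[OF _ smooth_openD(1)[OF A] y])
    fix y assume y': "y \<in> {y \<in> chart_image c'. \<psi> (chart_inv c' y) \<in> fst c}"
    then have "chart_inv c' y \<in> points L" using chart_inv_in[of y c'] chart_subset[OF M c'] by auto
    then show "(?B \<circ> ?A) y = y" using y' h(2) chart_inv_chart[OF M c, of "\<psi> (chart_inv c' y)"] by simp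
  qed
  then have id: "frechet_derivative ?B (at ?x) \<circ> frechet_derivative ?A (at ?y) = id"
    using has_derivative_unique[OF _ has_derivative_ident] unfolding id_def by blast
  have "matrix (frechet_derivative ?B (at ?x)) ** matrix (frechet_derivative ?A (at ?y)) = mat 1"
    using matrix_compose[OF has_derivative_linear[OF dA] has_derivative_linear[OF dB]] unfolding id by (simp add: matrix_id_mat_1)
  then have "det (matrix (frechet_derivative ?B (at ?x))) * det (matrix (frechet_derivative ?A (at ?y))) = 1"
    unfolding det_mul[symmetric] by (simp only: det_I)
  moreover have "0 < det (matrix (frechet_derivative ?A (at ?y)))"
    using r(4)[OF c' c p(2)] p by simp
  ultimately show "0 < det (matrix (frechet_derivative (snd c' \<circ> chart_inv ?c) (at ?x)))"
    unfolding e by (intro zero_less_mult_pos2[of "det (matrix (frechet_derivative ?B (at ?x)))"]) simp_all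
qed

lemma pull_chart_reparametrizationD:
  fixes L :: "('a, real^'n) manifold"
  assumes L: "oriented_manifold L" and \<psi>: "\<psi> \<in> reparametrizations L" and s: "fst c \<subseteq> points L"
    and c: "pull_chart (top_of L) \<psi> c \<in> atlas_of L"
  shows "c \<in> atlas_of L"
proof (rule oriented_atlas_maximal[OF L])
  note M = oriented_manifold_smooth_atlas[OF L] and r = reparametrizationD[OF \<psi>]
  note h = homeomorphic_map_inv_into_simps[OF r(1)]
  let ?c = "pull_chart (top_of L) \<psi> c" and ?\<chi> = "inv_into (points L) \<psi>"
  show cc: "is_chart (top_of L) c" by (rule is_chart_from_pull_chart[OF r(1) chart_is_chart[OF M c] s])
  have im: "chart_image ?c = chart_image c" by (rule chart_image_pull_chart[OF r(1) cc])
  have inv: "chart_inv c x = \<psi> (chart_inv ?c x)" if "x \<in> chart_image c" for x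
    using chart_inv_pull_chart[OF r(1) cc that] by simp
  have ci: "chart_inv c (snd c q) = q" if "q \<in> fst c" for q
    using is_chart_inj[OF cc] that by (simp add: chart_inv_def)
  fix c' assume c': "c' \<in> atlas_of L"
  let ?S = "{x \<in> chart_image ?c. \<psi> (chart_inv ?c x) \<in> fst c'}"
  note B = smooth_map_in_charts[OF M M r(2) c c']
  note A = smooth_map_in_charts[OF M M r(3) c' c]
  have sub: "snd c ` (fst c \<inter> fst c') \<subseteq> ?S"
    using ci inv chart_in_image[of _ c] unfolding im by auto
  have sub2: "snd c' ` (fst c \<inter> fst c') \<subseteq> {y \<in> chart_image c'. ?\<chi> (chart_inv c' y) \<in> fst ?c}"
    using chart_inv_chart[OF M c'] h s by (auto simp: chart_in_image)
  show "smooth_on (snd c ` (fst c \<inter> fst c')) (snd c' \<circ> chart_inv c)"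
    by (rule smooth_on_cong[OF smooth_on_open_subset[OF B sub]]) (use sub inv im in auto)
  show "smooth_on (snd c' ` (fst c \<inter> fst c')) (snd c \<circ> chart_inv c')"
  proof (rule smooth_on_cong[OF smooth_on_open_subset[OF A sub2]])
    fix y assume "y \<in> snd c' ` (fst c \<inter> fst c')"
    then obtain q where q: "q \<in> fst c" "q \<in> fst c'" "y = snd c' q" by auto
    then have "q \<in> points L" using s by blast
    then show "snd ?c (?\<chi> (chart_inv c' y)) = (snd c \<circ> chart_inv c') y"
      using h(4) chart_inv_chart[OF M c' q(2)] q(3) by simp
  qed
  fix q assume q: "q \<in> fst c" "q \<in> fst c'"
  have x: "snd c q \<in> ?S" using sub q by blast
  have qp: "q \<in> points L" using q s by blast
  have e: "frechet_derivative (snd c' \<circ> chart_inv c) (at (snd c q)) = frechet_derivative (\<lambda>x. snd c' (\<psi> (chart_inv ?c x))) (at (snd c q))"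
    by (rule frechet_derivative_cong_open[OF smooth_openD(1)[OF B] x]) (simp add: inv im)
  show "0 < det (matrix (frechet_derivative (snd c' \<circ> chart_inv c) (at (snd c q))))"
    unfolding e using r(4)[OF c c', of "?\<chi> q"] q h(3,4)[OF qp] by simp
qed

lemma image_manifold_reparametrize:
  fixes L :: "('l, real^'n) manifold"
  assumes L: "oriented_manifold L" and \<psi>: "\<psi> \<in> reparametrizations L" and g: "\<And>p. p \<in> points L \<Longrightarrow> g p = f (\<psi> p)"
  shows "image_manifold X L g = image_manifold X L f"
proof -
  note h = homeomorphic_map_inv_into_simps[OF reparametrizationD(1)[OF \<psi>]]
  have im: "g ` points L = f ` points L"
  proof -
    have "g ` points L = f ` \<psi> ` points L" unfolding image_image using g by (rule image_cong[OF refl])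
    then show ?thesis using homeomorphic_imp_surjective_map[OF reparametrizationD(1)[OF \<psi>]] by simp
  qed
  have "pull_chart (top_of L) g c \<in> atlas_of L \<longleftrightarrow> pull_chart (top_of L) f c \<in> atlas_of L" for c
  proof -
    let ?f = "pull_chart (top_of L) f c"
    have fe: "fst (pull_chart (top_of L) g c) = fst (pull_chart (top_of L) \<psi> ?f)"
      using g h(1) by auto
    have se: "snd (pull_chart (top_of L) g c) p = snd (pull_chart (top_of L) \<psi> ?f) p" if "p \<in> points L" for p
      using g that by simp
    have "pull_chart (top_of L) g c \<in> atlas_of L \<longleftrightarrow> pull_chart (top_of L) \<psi> ?f \<in> atlas_of L"
    proof
      assume "pull_chart (top_of L) g c \<in> atlas_of L"
      then show "pull_chart (top_of L) \<psi> ?f \<in> atlas_of L"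
        by (rule oriented_atlas_cong[OF L _ fe[symmetric]]) (rule se[symmetric], simp)
    next
      assume "pull_chart (top_of L) \<psi> ?f \<in> atlas_of L"
      then show "pull_chart (top_of L) g c \<in> atlas_of L"
        by (rule oriented_atlas_cong[OF L _ fe]) (rule se, simp)
    qed
    also have "\<dots> \<longleftrightarrow> ?f \<in> atlas_of L"
      using pull_chart_reparametrization[OF L \<psi>, of ?f] pull_chart_reparametrizationD[OF L \<psi>, of ?f] by auto
    finally show ?thesis .
  qed
  then show ?thesis unfolding image_manifold_def im pull_chart_def by simp
qed

lemma lagrangian_class_embedding:
  assumes "A \<in> lagrangian_space X \<omega> L d f0" "f \<in> A"
  shows "f \<in> lagrangian_embeddings X \<omega> L d f0"
  using assms by (auto simp: lagrangian_space_def quotient_def)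

text \<open>This replaces the representative picked by \<open>SOME\<close> in
  \<open>submanifold_of_class\<close> by any convenient member of the class.\<close>

lemma submanifold_of_class_eq:
  fixes L :: "('l, real^'n::{finite,wellorder}) manifold"
  assumes L: "oriented_manifold L" and A: "A \<in> lagrangian_space X \<omega> L d f0" and f: "f \<in> A"
  shows "submanifold_of_class X L A = image_manifold X L f"
proof -
  obtain f1 where f1: "\<And>g. g \<in> A \<Longrightarrow> \<exists>\<psi>\<in>reparametrizations L. \<forall>p\<in>points L. g p = f1 (\<psi> p)"
    using A unfolding lagrangian_space_def quotient_def by blast
  have "image_manifold X L g = image_manifold X L f1" if "g \<in> A" for g
    using f1[OF that] image_manifold_reparametrize[OF L] by blast
  moreover have "(SOME f. f \<in> A) \<in> A" by (rule someI[of "\<lambda>f. f \<in> A", OF f])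
  ultimately show ?thesis using f by (simp add: submanifold_of_class_def)
qed

section \<open>The atlas of the image\<close>

lemma image_manifold_homeomorphic:
  assumes f: "smooth_embedding L X f"
  shows "homeomorphic_map (top_of L) (top_of (image_manifold X L f)) f"
  using f by (simp add: smooth_embedding_def embedding_map_def image_manifold_def)

lemma points_image_manifold:
  assumes f: "smooth_embedding L X f"
  shows "points (image_manifold X L f) = f ` points L"
  using homeomorphic_imp_surjective_map[OF image_manifold_homeomorphic[OF f]] by simp

lemma image_manifold_atlas:
  "c \<in> atlas_of (image_manifold X L f) \<longleftrightarrow> fst c \<subseteq> f ` points L \<and> pull_chart (top_of L) f c \<in> atlas_of L"
  by (simp add: image_manifold_def pull_chart_def)

lemma image_manifold_is_chart:
  assumes M: "smooth_atlas L" and f: "smooth_embedding L X f" and c: "c \<in> atlas_of (image_manifold X L f)"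
  shows "is_chart (top_of (image_manifold X L f)) c"
  using c unfolding image_manifold_atlas
  by (intro is_chart_from_pull_chart[OF image_manifold_homeomorphic[OF f] chart_is_chart[OF M]])
     (auto simp: points_image_manifold[OF f])

definition push_chart :: "('l, 'e) manifold \<Rightarrow> ('l \<Rightarrow> 'x) \<Rightarrow> ('l, 'e) chart \<Rightarrow> ('x, 'e) chart" where
  "push_chart L f c = (f ` fst c, snd c \<circ> inv_into (points L) f)"

text \<open>Pulling the pushed chart back returns c only up to values off the domain. The comparison
  is therefore made for \<open>chart_inv\<close> and \<open>chart_image\<close>, which do not see
  those values.\<close>

lemma push_chart:
  assumes L: "oriented_manifold L" and f: "smooth_embedding L X f" and c: "c \<in> atlas_of L"
  shows "push_chart L f c \<in> atlas_of (image_manifold X L f)" "p \<in> fst c \<Longrightarrow> f p \<in> fst (push_chart L f c)"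
    "chart_inv (pull_chart (top_of L) f (push_chart L f c)) = chart_inv c" "chart_image (push_chart L f c) = chart_image c"
proof -
  note M = oriented_manifold_smooth_atlas[OF L] and h = homeomorphic_map_inv_into_simps[OF image_manifold_homeomorphic[OF f]]
  have cs: "fst c \<subseteq> points L" by (rule chart_subset[OF M c])
  have fe: "fst (pull_chart (top_of L) f (push_chart L f c)) = fst c"
  proof (intro equalityI subsetI)
    fix p assume "p \<in> fst (pull_chart (top_of L) f (push_chart L f c))"
    then obtain q where q: "p \<in> points L" "q \<in> fst c" "f p = f q" by (auto simp: push_chart_def)
    then have "q \<in> points L" using cs by blast
    then have "p = q" by (rule inj_onD[OF homeomorphic_imp_injective_map[OF image_manifold_homeomorphic[OF f]] q(3) q(1)])
    then show "p \<in> fst c" using q(2) by simp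
  qed (use cs in \<open>auto simp: push_chart_def\<close>)
  have se: "snd (pull_chart (top_of L) f (push_chart L f c)) p = snd c p" if "p \<in> fst c" for p
  proof -
    have "p \<in> points L" using that cs by blast
    from h(2)[OF this] show ?thesis by (simp add: push_chart_def)
  qed
  show 1: "push_chart L f c \<in> atlas_of (image_manifold X L f)"
    unfolding image_manifold_atlas using oriented_atlas_cong[OF L c fe se] cs by (auto simp: push_chart_def)
  show "p \<in> fst c \<Longrightarrow> f p \<in> fst (push_chart L f c)" by (simp add: push_chart_def)
  show "chart_inv (pull_chart (top_of L) f (push_chart L f c)) = chart_inv c"
  proof (rule chart_inv_cong[OF fe])
    fix p assume "p \<in> fst (pull_chart (top_of L) f (push_chart L f c))"
    then show "snd (pull_chart (top_of L) f (push_chart L f c)) p = snd c p" unfolding fe by (rule se)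
  qed
  have "chart_image (push_chart L f c) = chart_image (pull_chart (top_of L) f (push_chart L f c))"
    by (rule chart_image_pull_chart[symmetric, OF image_manifold_homeomorphic[OF f] image_manifold_is_chart[OF M f 1]])
  also have "\<dots> = chart_image c"
    unfolding chart_image_def fe by (intro image_cong refl) (rule se)
  finally show "chart_image (push_chart L f c) = chart_image c" .
qed

lemma image_manifold_smooth_atlas:
  assumes L: "oriented_manifold L" and f: "smooth_embedding L X f"
  shows "smooth_atlas (image_manifold X L f)"
  unfolding smooth_atlas_def
proof (intro conjI ballI)
  let ?N = "image_manifold X L f"
  note M = oriented_manifold_smooth_atlas[OF L] and hm = image_manifold_homeomorphic[OF f]
  show ic: "is_chart (top_of ?N) c" if "c \<in> atlas_of ?N" for c by (rule image_manifold_is_chart[OF M f that])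
  show "\<Union> (fst ` atlas_of ?N) = points ?N"
  proof (intro equalityI subsetI)
    fix q assume "q \<in> \<Union> (fst ` atlas_of ?N)"
    then show "q \<in> points ?N" unfolding points_image_manifold[OF f] using image_manifold_atlas[of _ X L f] by blast
  next
    fix q assume "q \<in> points ?N"
    then obtain p where p: "p \<in> points L" "q = f p" unfolding points_image_manifold[OF f] by blast
    then obtain c where c: "c \<in> atlas_of L" "p \<in> fst c" using M unfolding smooth_atlas_def by blast
    from push_chart(1)[OF L f c(1)] push_chart(2)[OF L f c]
    show "q \<in> \<Union> (fst ` atlas_of ?N)" unfolding p(2) by blast
  qed
  have *: "smooth_on (snd c ` (fst c \<inter> fst c')) (snd c' \<circ> chart_inv c)" if c: "c \<in> atlas_of ?N" and c': "c' \<in> atlas_of ?N" for c c'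
  proof -
    let ?c = "pull_chart (top_of L) f c" and ?c' = "pull_chart (top_of L) f c'"
    have t: "smooth_open (snd ?c ` (fst ?c \<inter> fst ?c')) (\<lambda>x. snd ?c' (chart_inv ?c x))"
      using c c' unfolding image_manifold_atlas by (intro transition_smooth[OF M]) auto
    have sub: "snd c ` (fst c \<inter> fst c') \<subseteq> snd ?c ` (fst ?c \<inter> fst ?c')"
    proof
      fix x assume "x \<in> snd c ` (fst c \<inter> fst c')"
      then obtain q where q: "q \<in> fst c" "q \<in> fst c'" "x = snd c q" by blast
      moreover obtain p where "p \<in> points L" "q = f p" using c q(1) unfolding image_manifold_atlas by blast
      ultimately show "x \<in> snd ?c ` (fst ?c \<inter> fst ?c')" by (intro image_eqI[of _ _ p]) auto
    qed
    show ?thesis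
    proof (rule smooth_on_cong[OF smooth_on_open_subset[OF t sub]])
      fix x assume "x \<in> snd c ` (fst c \<inter> fst c')"
      then have "x \<in> chart_image c" by (auto simp: chart_image_def)
      from chart_inv_pull_chart[OF hm ic[OF c] this]
      show "snd ?c' (chart_inv ?c x) = (snd c' \<circ> chart_inv c) x" by simp
    qed
  qed
  show "smoothly_compatible c c'" if "c \<in> atlas_of ?N" "c' \<in> atlas_of ?N" for c c'
    unfolding smoothly_compatible_def using *[OF that] *[OF that(2,1)] by (simp add: Int_commute)
qed

section \<open>Pullbacks in charts\<close>

lemma push_vector_cong:
  fixes M :: "('b, 'c::euclidean_space) manifold"
  assumes "open S" "x \<in> S" "\<And>y. y \<in> S \<Longrightarrow> g y = g' y"
  shows "push_vector M g x w = push_vector M g' x w"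
proof -
  have "frechet_derivative (\<lambda>y. snd c (g y)) (at x) = frechet_derivative (\<lambda>y. snd c (g' y)) (at x)" for c :: "('b, 'c) chart"
    by (rule frechet_derivative_cong_open[OF assms(1,2)]) (simp add: assms(3))
  then show ?thesis unfolding push_vector_def by (simp only: assms(3)[OF assms(2)])
qed

lemma tangent_map_smooth:
  assumes M: "smooth_atlas M" and N: "smooth_atlas N" and f: "smooth_map M N f" and c: "c \<in> atlas_of M" and x: "x \<in> chart_image c"
  shows "tangent_map M N f (chart_inv c x) (push_vector M (chart_inv c) x w) = push_vector N (\<lambda>y. f (chart_inv c y)) x w"
proof (rule tangent_map_push_vector[OF M c x])
  fix e assume e: "e \<in> atlas_of N" "f (chart_inv c x) \<in> fst e"
  let ?k = "chart_at M (chart_inv c x)"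
  have "chart_inv c x \<in> points M" using chart_inv_in[OF x] chart_subset[OF M c] by blast
  note k = chart_at_in[OF M this]
  show "(\<lambda>y. snd e (f (chart_inv ?k y))) differentiable at (snd ?k (chart_inv c x))"
    by (rule smooth_open_differentiable[OF smooth_map_in_charts[OF M N f k(1) e(1)]])
       (use e k in \<open>simp add: chart_in_image chart_inv_chart[OF M k]\<close>)
qed

lemma local_form_pullback_push_vector:
  assumes "smooth_atlas M" "smooth_atlas N" "smooth_map M N f" "c \<in> atlas_of M" "x \<in> chart_image c"
  shows "local_form M (pullback M N f \<alpha>) c x ws = \<alpha> (f (chart_inv c x)) (map (push_vector N (\<lambda>y. f (chart_inv c y)) x) ws)"
proof -
  have "tangent_map M N f (chart_inv c x) \<circ> push_vector M (chart_inv c) x = push_vector N (\<lambda>y. f (chart_inv c y)) x"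
    using tangent_map_smooth[OF assms] by (auto simp: o_def)
  then show ?thesis by (simp add: local_form_def pullback_def)
qed

lemma local_form_pullback:
  assumes M: "smooth_atlas M" and N: "smooth_atlas N" and f: "smooth_map M N f" and c: "c \<in> atlas_of M" and e: "e \<in> atlas_of N"
    and x: "x \<in> chart_image c" "f (chart_inv c x) \<in> fst e"
  shows "local_form M (pullback M N f \<alpha>) c x ws = pull (\<lambda>y. snd e (f (chart_inv c y))) (local_form N \<alpha> e) x ws"
proof -
  note s = smooth_map_in_charts[OF M N f c e]
  have xs: "x \<in> {x \<in> chart_image c. f (chart_inv c x) \<in> fst e}" using x by simp
  have "push_vector N (\<lambda>y. f (chart_inv c y)) x = (\<lambda>w. push_vector N (chart_inv e) (snd e (f (chart_inv c x)))
      (frechet_derivative (\<lambda>y. snd e (f (chart_inv c y))) (at x) w))"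
    by (rule ext, rule push_vector_chart[OF N e smooth_openD(1)[OF s] xs _ smooth_open_differentiable[OF s xs]]) simp
  then show ?thesis
    unfolding local_form_pullback_push_vector[OF M N f c x(1)]
    using chart_inv_chart[OF N e x(2)] by (simp add: pull_def local_form_def o_def)
qed

lemma differential_form_local:
  assumes M: "smooth_atlas M"
    and loc: "\<And>c x. c \<in> atlas_of M \<Longrightarrow> x \<in> chart_image c \<Longrightarrow> \<exists>S \<beta>. x \<in> S \<and> smooth_form S k \<beta> \<and>
       (\<forall>y\<in>S. y \<in> chart_image c \<longrightarrow> (\<forall>ws. length ws = k \<longrightarrow> local_form M \<alpha> c y ws = \<beta> y ws))"
  shows "differential_form M k \<alpha>"
  unfolding differential_form_def
proof (intro ballI conjI allI impI)
  fix c x assume c: "c \<in> atlas_of M" and x: "x \<in> chart_image c"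
  obtain S \<beta> where S: "x \<in> S" "smooth_form S k \<beta>" "\<forall>y\<in>S. y \<in> chart_image c \<longrightarrow> (\<forall>ws. length ws = k \<longrightarrow> local_form M \<alpha> c y ws = \<beta> y ws)"
    using loc[OF c x] by (elim exE conjE) (rule that)
  have "alternating_multilinear k (\<beta> x)" by (rule smooth_formD(2)[OF S(2,1)])
  then show "alternating_multilinear k (local_form M \<alpha> c x)"
    using S(1,3) x by (subst alternating_cong[of k _ "\<beta> x"]) auto
next
  fix c and ws :: "'b list" assume c: "c \<in> atlas_of M" and l: "length ws = k"
  have "smooth_open (chart_image c) (\<lambda>x. local_form M \<alpha> c x ws)"
  proof (rule smooth_open_local[OF open_chart_image[OF M c]])
    fix x assume x: "x \<in> chart_image c"
    obtain S \<beta> where S: "x \<in> S" "smooth_form S k \<beta>" "\<forall>y\<in>S. y \<in> chart_image c \<longrightarrow> (\<forall>ws. length ws = k \<longrightarrow> local_form M \<alpha> c y ws = \<beta> y ws)"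
      using loc[OF c x] by (elim exE conjE) (rule that)
    have o: "open (S \<inter> chart_image c)" using smooth_formD(1)[OF S(2)] open_chart_image[OF M c] by (rule open_Int)
    have "smooth_open (S \<inter> chart_image c) (\<lambda>x. \<beta> x ws)"
      by (rule smooth_open_subset[OF smooth_formD(4)[OF S(2) l] _ o]) simp
    then have "smooth_open (S \<inter> chart_image c) (\<lambda>x. local_form M \<alpha> c x ws)"
      by (rule smooth_open_cong) (use S(3) l in auto)
    then show "\<exists>U. x \<in> U \<and> smooth_open U (\<lambda>x. local_form M \<alpha> c x ws)"
      using S(1) x by (intro exI[of _ "S \<inter> chart_image c"]) simp
  qed
  then show "smooth_on (chart_image c) (\<lambda>x. local_form M \<alpha> c x ws)"
    unfolding smooth_on_iff_smooth_open[OF open_chart_image[OF M c]] .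
qed

lemma differential_form_pullback:
  assumes M: "smooth_atlas M" and N: "smooth_atlas N" and f: "smooth_map M N f" and \<alpha>: "differential_form N k \<alpha>"
  shows "differential_form M k (pullback M N f \<alpha>)"
proof (rule differential_form_local[OF M])
  fix c x assume c: "c \<in> atlas_of M" and x: "x \<in> chart_image c"
  have "chart_inv c x \<in> points M" using chart_inv_in[OF x] chart_subset[OF M c] by blast
  then have "f (chart_inv c x) \<in> points N" using f unfolding smooth_map_def continuous_map_def by blast
  then obtain e where e: "e \<in> atlas_of N" "f (chart_inv c x) \<in> fst e" using N unfolding smooth_atlas_def by blast
  let ?S = "{x \<in> chart_image c. f (chart_inv c x) \<in> fst e}" and ?g = "\<lambda>y. snd e (f (chart_inv c y))"
  have "smooth_form ?S k (pull ?g (local_form N \<alpha> e))"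
    by (rule smooth_form_pull[OF smooth_form_local_form[OF N e(1) \<alpha>] smooth_map_in_charts[OF M N f c e(1)]])
       (simp add: chart_in_image)
  then show "\<exists>S \<beta>. x \<in> S \<and> smooth_form S k \<beta> \<and>
       (\<forall>y\<in>S. y \<in> chart_image c \<longrightarrow> (\<forall>ws. length ws = k \<longrightarrow> local_form M (pullback M N f \<alpha>) c y ws = \<beta> y ws))"
    using x e local_form_pullback[OF M N f c e(1)]
    by (intro exI[of _ ?S] exI[of _ "pull ?g (local_form N \<alpha> e)"]) simp
qed

section \<open>Integration over the image of an embedding\<close>

lemma transport_weights:
  assumes \<Phi>: "homeomorphic_map (top_of L) (top_of N) \<Phi>" and W: "weights N K I C R Z"
    and p: "\<And>i. i \<in> I \<Longrightarrow> pull_chart (top_of L) \<Phi> (C i) \<in> atlas_of L"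
  shows "weights L {p \<in> points L. \<Phi> p \<in> K} I (\<lambda>i. pull_chart (top_of L) \<Phi> (C i)) (\<lambda>i p. R i (\<Phi> p)) (\<lambda>i. {p \<in> points L. \<Phi> p \<in> Z i})"
proof -
  note h = homeomorphic_map_inv_into_simps[OF \<Phi>] and c = homeomorphic_imp_continuous_map[OF \<Phi>]
  have "compactin (top_of L) {p \<in> points L. \<Phi> p \<in> Z i}" if i: "i \<in> I" for i
  proof -
    have Zi: "compactin (top_of N) (Z i)" using W i by (simp add: weights_def)
    have "{p \<in> points L. \<Phi> p \<in> Z i} = inv_into (points L) \<Phi> ` Z i"
    proof (intro equalityI subsetI)
      fix p assume "p \<in> {p \<in> points L. \<Phi> p \<in> Z i}"
      then show "p \<in> inv_into (points L) \<Phi> ` Z i" using h(2)[of p] by (intro image_eqI[of _ _ "\<Phi> p"]) auto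
    next
      fix p assume "p \<in> inv_into (points L) \<Phi> ` Z i"
      then show "p \<in> {p \<in> points L. \<Phi> p \<in> Z i}" using h(3,4) compactin_subset_topspace[OF Zi] by auto
    qed
    then show ?thesis
      using image_compactin[OF Zi homeomorphic_imp_continuous_map[OF homeomorphic_map_inv_into[OF \<Phi>]]] by simp
  qed
  moreover have "continuous_map (top_of L) euclidean (\<lambda>p. R i (\<Phi> p))" if "i \<in> I" for i
    using continuous_map_compose[OF c, of euclidean "R i"] W that by (simp add: weights_def o_def)
  moreover have "closedin (top_of L) {p \<in> points L. \<Phi> p \<in> Z i}" if "i \<in> I" for i
    using closedin_continuous_map_preimage[OF c] W that by (simp add: weights_def)
  ultimately show ?thesis using W p unfolding weights_def by (auto simp del: pull_chart_simps(2))
qed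

lemma transport_chart_integral:
  assumes \<Phi>: "homeomorphic_map (top_of L) (top_of N) \<Phi>" and c: "\<And>i. i \<in> I \<Longrightarrow> is_chart (top_of N) (C i)"
    and D: "\<And>i x. i \<in> I \<Longrightarrow> x \<in> chart_image (C i) \<Longrightarrow> D (C i) x = D' (pull_chart (top_of L) \<Phi> (C i)) x"
  shows "chart_integral I C R K D =
    chart_integral I (\<lambda>i. pull_chart (top_of L) \<Phi> (C i)) (\<lambda>i p. R i (\<Phi> p)) {p \<in> points L. \<Phi> p \<in> K} D'"
  unfolding chart_integral_def
proof (rule sum.cong[OF refl])
  fix i assume i: "i \<in> I"
  let ?c = "pull_chart (top_of L) \<Phi> (C i)"
  have im: "chart_image ?c = chart_image (C i)" by (rule chart_image_pull_chart[OF \<Phi> c[OF i]])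
  show "integral (chart_image (C i)) (\<lambda>x. if chart_inv (C i) x \<in> K then R i (chart_inv (C i) x) * D (C i) x else 0) =
    integral (chart_image ?c) (\<lambda>x. if chart_inv ?c x \<in> {p \<in> points L. \<Phi> p \<in> K} then R i (\<Phi> (chart_inv ?c x)) * D' ?c x else 0)"
    unfolding im
  proof (rule integral_cong)
    fix x assume x: "x \<in> chart_image (C i)"
    have "chart_inv ?c x \<in> points L" using chart_inv_in[of x ?c] x im by simp
    then show "(if chart_inv (C i) x \<in> K then R i (chart_inv (C i) x) * D (C i) x else 0) =
      (if chart_inv ?c x \<in> {p \<in> points L. \<Phi> p \<in> K} then R i (\<Phi> (chart_inv ?c x)) * D' ?c x else 0)"
      using chart_inv_pull_chart[OF \<Phi> c[OF i] x] D[OF i x] by simp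
  qed
qed

lemma some_partition_weights:
  fixes M :: "('a, 'e::euclidean_space) manifold"
  assumes M: "smooth_atlas M" and H: "Hausdorff_space (top_of M)" and K: "compactin (top_of M) K"
  shows "weights M K (SOME P. partition_of_unity_on M K P) fst snd (\<lambda>i. function_support M (snd i))"
proof -
  obtain I :: "'a set set" and C R where "finite I" "\<And>i. i \<in> I \<Longrightarrow> chart_supported M (C i) (R i)" "\<And>p. p \<in> K \<Longrightarrow> (\<Sum>i\<in>I. R i p) = 1"
    using smooth_partition_exists[OF M H K] by metis
  from partition_of_unity_from_family[OF M this] have "\<exists>P. partition_of_unity_on M K P" .
  then have "partition_of_unity_on M K (SOME P. partition_of_unity_on M K P)" by (rule someI_ex)
  then show ?thesis by (rule weights_of_partition[OF M compactin_subset_topspace[OF K]])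
qed

lemma form_integral_over_chart_integral:
  fixes L :: "('a, real^'n::{finite,wellorder}) manifold"
  shows "form_integral_over L K \<theta> = chart_integral (SOME P. partition_of_unity_on L K P) fst snd K (\<lambda>c x. local_form L \<theta> c x standard_frame)"
  unfolding form_integral_over_def chart_integral_def Let_def case_prod_unfold ..

lemma form_integral_over_eq:
  fixes L :: "('a, real^'n::{finite,wellorder}) manifold"
  assumes L: "oriented_manifold L" and K: "compactin (top_of L) K" and \<theta>: "differential_form L CARD('n) \<theta>"
    and W: "weights L K I C R Z"
  shows "form_integral_over L K \<theta> = chart_integral I C R K (\<lambda>c x. local_form L \<theta> c x standard_frame)"
  unfolding form_integral_over_chart_integral
  using oriented_manifold_smooth_atlas[OF L] oriented_manifold_Hausdorff[OF L] K
  by (intro chart_integral_independent[OF L _ some_partition_weights W density_local_form[OF _ \<theta>]] compactin_imp_closedin)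

lemma smooth_map_image_inclusion:
  assumes L: "oriented_manifold L" and X: "smooth_manifold X" and f: "smooth_embedding L X f"
  shows "smooth_map (image_manifold X L f) X (\<lambda>q. q)"
  unfolding smooth_map_def
proof (intro conjI ballI)
  let ?N = "image_manifold X L f"
  note M = oriented_manifold_smooth_atlas[OF L] and MX = smooth_manifold_smooth_atlas[OF X]
  note hm = image_manifold_homeomorphic[OF f]
  have fs: "smooth_map L X f" using f by (simp add: smooth_embedding_def)
  show "continuous_map (top_of ?N) (top_of X) (\<lambda>q. q)"
    using continuous_map_from_subtopology[OF continuous_map_id, of "top_of X" "f ` points L"] by (simp add: image_manifold_def id_def)
  fix c e assume c: "c \<in> atlas_of ?N" and e: "e \<in> atlas_of X"
  let ?c = "pull_chart (top_of L) f c"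
  have pc: "?c \<in> atlas_of L" using c unfolding image_manifold_atlas by blast
  have ic: "is_chart (top_of ?N) c" by (rule image_manifold_is_chart[OF M f c])
  have im: "chart_image ?c = chart_image c" by (rule chart_image_pull_chart[OF hm ic])
  have sub: "snd c ` {p \<in> fst c. p \<in> fst e} \<subseteq> {x \<in> chart_image ?c. f (chart_inv ?c x) \<in> fst e}"
  proof
    fix x assume "x \<in> snd c ` {p \<in> fst c. p \<in> fst e}"
    then obtain q where q: "q \<in> fst c" "q \<in> fst e" "x = snd c q" by blast
    have "chart_inv c x = q" using is_chart_inj[OF ic] q by (simp add: chart_inv_def)
    then show "x \<in> {x \<in> chart_image ?c. f (chart_inv ?c x) \<in> fst e}"
      using q chart_inv_pull_chart[OF hm ic, of x] chart_in_image[OF q(1)] im by simp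
  qed
  show "smooth_on (snd c ` {p \<in> fst c. p \<in> fst e}) (snd e \<circ> (\<lambda>q. q) \<circ> chart_inv c)"
    by (rule smooth_on_cong[OF smooth_on_open_subset[OF smooth_map_in_charts[OF M MX fs pc e] sub]])
       (use sub im chart_inv_pull_chart[OF hm ic] in auto)
qed

lemma local_form_image_manifold:
  assumes L: "oriented_manifold L" and X: "smooth_manifold X" and f: "smooth_embedding L X f"
    and c: "c \<in> atlas_of (image_manifold X L f)" and x: "x \<in> chart_image c"
  shows "local_form (image_manifold X L f) (pullback (image_manifold X L f) X (\<lambda>q. q) \<alpha>) c x ws
     = local_form L (pullback L X f \<alpha>) (pull_chart (top_of L) f c) x ws"
proof -
  let ?N = "image_manifold X L f" and ?c = "pull_chart (top_of L) f c"
  note M = oriented_manifold_smooth_atlas[OF L] and MX = smooth_manifold_smooth_atlas[OF X]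
  note MN = image_manifold_smooth_atlas[OF L f]
  note hm = image_manifold_homeomorphic[OF f]
  have fs: "smooth_map L X f" using f by (simp add: smooth_embedding_def)
  have pc: "?c \<in> atlas_of L" using c unfolding image_manifold_atlas by blast
  have ic: "is_chart (top_of ?N) c" by (rule image_manifold_is_chart[OF M f c])
  have x': "x \<in> chart_image ?c" using x chart_image_pull_chart[OF hm ic] by simp
  have "push_vector X (chart_inv c) x = push_vector X (\<lambda>y. f (chart_inv ?c y)) x"
    by (rule ext, rule push_vector_cong[OF open_chart_image[OF MN c] x]) (simp add: chart_inv_pull_chart[OF hm ic])
  then show ?thesis
    unfolding local_form_pullback_push_vector[OF MN MX smooth_map_image_inclusion[OF L X f] c x]
      local_form_pullback_push_vector[OF M MX fs pc x'] chart_inv_pull_chart[OF hm ic x]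
    by simp
qed

lemma smooth_function_image_manifold:
  assumes L: "oriented_manifold L" and f: "smooth_embedding L X f" and u: "smooth_function (image_manifold X L f) u"
  shows "smooth_function L (\<lambda>p. u (f p))"
  unfolding smooth_function_iff[OF oriented_manifold_smooth_atlas[OF L]]
proof
  fix c assume c: "c \<in> atlas_of L"
  note M = oriented_manifold_smooth_atlas[OF L] and hm = image_manifold_homeomorphic[OF f]
  note p = push_chart[OF L f c]
  have "smooth_open (chart_image (push_chart L f c)) (\<lambda>x. u (chart_inv (push_chart L f c) x))"
    using u p(1) unfolding smooth_function_iff[OF image_manifold_smooth_atlas[OF L f]] by blast
  then have "smooth_open (chart_image c) (\<lambda>x. u (chart_inv (push_chart L f c) x))" unfolding p(4) .
  then show "smooth_open (chart_image c) (\<lambda>x. u (f (chart_inv c x)))"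
  proof (rule smooth_open_cong)
    fix x assume "x \<in> chart_image c"
    then show "u (chart_inv (push_chart L f c) x) = u (f (chart_inv c x))"
      using chart_inv_pull_chart[OF hm image_manifold_is_chart[OF M f p(1)], of x] p(3,4) by simp
  qed
qed

lemma image_manifold_Hausdorff: "smooth_manifold X \<Longrightarrow> Hausdorff_space (top_of (image_manifold X L f))"
  unfolding manifold_with_def image_manifold_def by (auto intro: Hausdorff_space_subtopology)

lemma compactin_image_manifold_vimage:
  assumes f: "smooth_embedding L X f" and K: "compactin (top_of (image_manifold X L f)) K"
  shows "compactin (top_of L) {p \<in> points L. f p \<in> K}"
proof -
  note hm = image_manifold_homeomorphic[OF f]
  note h = homeomorphic_map_inv_into_simps[OF hm]
  have "{p \<in> points L. f p \<in> K} = inv_into (points L) f ` K"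
  proof (intro equalityI subsetI)
    fix p assume "p \<in> {p \<in> points L. f p \<in> K}"
    then show "p \<in> inv_into (points L) f ` K" using h(2)[of p] by (intro image_eqI[of _ _ "f p"]) auto
  next
    fix p assume "p \<in> inv_into (points L) f ` K"
    then show "p \<in> {p \<in> points L. f p \<in> K}" using h(3,4) compactin_subset_topspace[OF K] by auto
  qed
  then show ?thesis
    using image_compactin[OF K homeomorphic_imp_continuous_map[OF homeomorphic_map_inv_into[OF hm]]] by simp
qed

text \<open>The partition picked on the image is carried back along the homeomorphism f, where it
  becomes a system of weights for the preimage of K, and the coefficients agree chart by chart.
  Independence of the weights then leads to the partition picked on L.\<close>

lemma form_integral_over_image:
  fixes L :: "('l, real^'n::{finite,wellorder}) manifold"
  assumes L: "oriented_manifold L" and X: "smooth_manifold X" and f: "smooth_embedding L X f"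
    and u: "smooth_function (image_manifold X L f) u" and \<alpha>: "differential_form X CARD('n) \<alpha>"
    and K: "compactin (top_of (image_manifold X L f)) K"
  shows "form_integral_over (image_manifold X L f) K (scale_form u (pullback (image_manifold X L f) X (\<lambda>q. q) \<alpha>)) =
    form_integral_over L {p \<in> points L. f p \<in> K} (scale_form (\<lambda>p. u (f p)) (pullback L X f \<alpha>))"
proof -
  let ?N = "image_manifold X L f"
  note M = oriented_manifold_smooth_atlas[OF L] and MX = smooth_manifold_smooth_atlas[OF X]
  note MN = image_manifold_smooth_atlas[OF L f] and hm = image_manifold_homeomorphic[OF f]
  have fs: "smooth_map L X f" using f by (simp add: smooth_embedding_def)
  define P where "P = (SOME P. partition_of_unity_on ?N K P)"
  have W: "weights ?N K P fst snd (\<lambda>i. function_support ?N (snd i))"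
    unfolding P_def by (rule some_partition_weights[OF MN image_manifold_Hausdorff[OF X] K])
  then have at: "fst i \<in> atlas_of ?N" if "i \<in> P" for i using that by (simp add: weights_def)
  have pc: "pull_chart (top_of L) f (fst i) \<in> atlas_of L" if "i \<in> P" for i
    using at[OF that] unfolding image_manifold_atlas by blast
  have ic: "is_chart (top_of ?N) (fst i)" if "i \<in> P" for i by (rule image_manifold_is_chart[OF M f at[OF that]])
  have "form_integral_over ?N K (scale_form u (pullback ?N X (\<lambda>q. q) \<alpha>)) =
    chart_integral P fst snd K (\<lambda>c x. local_form ?N (scale_form u (pullback ?N X (\<lambda>q. q) \<alpha>)) c x standard_frame)"
    unfolding form_integral_over_chart_integral P_def ..
  also have "\<dots> = chart_integral P (\<lambda>i. pull_chart (top_of L) f (fst i)) (\<lambda>i p. snd i (f p)) {p \<in> points L. f p \<in> K}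
     (\<lambda>c x. local_form L (scale_form (\<lambda>p. u (f p)) (pullback L X f \<alpha>)) c x standard_frame)"
  proof (rule transport_chart_integral[OF hm ic], assumption)
    fix i x assume i: "i \<in> P" and x: "x \<in> chart_image (fst i)"
    show "local_form ?N (scale_form u (pullback ?N X (\<lambda>q. q) \<alpha>)) (fst i) x standard_frame =
      local_form L (scale_form (\<lambda>p. u (f p)) (pullback L X f \<alpha>)) (pull_chart (top_of L) f (fst i)) x standard_frame"
      unfolding local_form_scale local_form_image_manifold[OF L X f at[OF i] x]
      using chart_inv_pull_chart[OF hm ic[OF i] x] by simp
  qed
  also have "\<dots> = form_integral_over L {p \<in> points L. f p \<in> K} (scale_form (\<lambda>p. u (f p)) (pullback L X f \<alpha>))"
    by (rule form_integral_over_eq[symmetric, OF L compactin_image_manifold_vimage[OF f K]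
        differential_form_scale[OF M smooth_function_image_manifold[OF L f u] differential_form_pullback[OF M MX fs \<alpha>]]
        transport_weights[OF hm W pc]])
  finally show ?thesis .
qed

text \<open>No change of variables is made: both sides are the integral over f
  \<open>K in the common image. The preimage of f\<close> K under g is again K, since f and g are
  injective with the same image and agree off K.\<close>

lemma form_integral_over_reparametrize:
  fixes L :: "('l, real^'n::{finite,wellorder}) manifold"
  assumes L: "oriented_manifold L" and X: "smooth_manifold X" and f: "smooth_embedding L X f" and g: "smooth_embedding L X g"
    and e: "image_manifold X L f = image_manifold X L g" and \<alpha>: "differential_form X CARD('n) \<alpha>"
    and K: "compactin (top_of L) K" and off: "\<And>p. p \<in> points L - K \<Longrightarrow> f p = g p"
  shows "form_integral_over L K (pullback L X f \<alpha>) = form_integral_over L K (pullback L X g \<alpha>)"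
proof -
  note hf = homeomorphic_map_inv_into_simps[OF image_manifold_homeomorphic[OF f]]
  note hg = homeomorphic_map_inv_into_simps[OF image_manifold_homeomorphic[OF g]]
  have Kp: "K \<subseteq> points L" by (rule compactin_subset_topspace[OF K])
  have Kc: "compactin (top_of (image_manifold X L f)) (f ` K)"
    by (rule image_compactin[OF K homeomorphic_imp_continuous_map[OF image_manifold_homeomorphic[OF f]]])
  have im: "f ` points L = g ` points L"
    using points_image_manifold[OF f] points_image_manifold[OF g] e by simp
  have injf: "inj_on f (points L)" and injg: "inj_on g (points L)"
    using homeomorphic_imp_injective_map[OF image_manifold_homeomorphic[OF f]]
      homeomorphic_imp_injective_map[OF image_manifold_homeomorphic[OF g]] by auto
  have 1: "{p \<in> points L. f p \<in> f ` K} = K"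
    using injf Kp by (auto dest: inj_onD)
  have 2: "{p \<in> points L. g p \<in> f ` K} = K"
  proof (intro equalityI subsetI)
    fix p assume p: "p \<in> {p \<in> points L. g p \<in> f ` K}"
    then obtain q where q: "q \<in> K" "g p = f q" by auto
    show "p \<in> K"
    proof (rule ccontr)
      assume "p \<notin> K"
      with off[of p] p q have "f p = f q" by simp
      then have "p = q" using inj_onD[OF injf] p q Kp by blast
      then show False using \<open>p \<notin> K\<close> q by simp
    qed
  next
    fix p assume p: "p \<in> K"
    then have "g p \<in> f ` points L" using im Kp by blast
    then obtain q where q: "q \<in> points L" "g p = f q" by auto
    have "q \<in> K"
    proof (rule ccontr)
      assume "q \<notin> K"
      with off[of q] q have "g p = g q" by simp
      then have "p = q" using inj_onD[OF injg] p q Kp by blast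
      then show False using \<open>q \<notin> K\<close> p by simp
    qed
    then show "p \<in> {p \<in> points L. g p \<in> f ` K}" using q p Kp by auto
  qed
  have "form_integral_over L K (pullback L X f \<alpha>) =
     form_integral_over (image_manifold X L f) (f ` K) (scale_form (\<lambda>_. 1) (pullback (image_manifold X L f) X (\<lambda>q. q) \<alpha>))"
    unfolding form_integral_over_image[OF L X f smooth_function_const[OF image_manifold_smooth_atlas[OF L f]] \<alpha> Kc] 1 by simp
  also have "\<dots> = form_integral_over L K (pullback L X g \<alpha>)"
    unfolding e form_integral_over_image[OF L X g smooth_function_const[OF image_manifold_smooth_atlas[OF L g]] \<alpha> Kc[unfolded e]] 2 by simp
  finally show ?thesis .
qed

section \<open>Differences of integrals\<close>

lemma chart_integral_diff:
  fixes L :: "('a, real^'n::{finite,wellorder}) manifold"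
  assumes "smooth_atlas L" "closedin (top_of L) K" "weights L K I C R Z" "density L D" "density L D'"
  shows "chart_integral I C R K (\<lambda>c x. D c x + a * D' c x) = chart_integral I C R K D + a * chart_integral I C R K D'"
proof -
  have "chart_integral I C R K (\<lambda>c x. \<Sum>j\<in>{True, False}. (if j then 1 else a) * (if j then D else D') c x) =
    (\<Sum>j\<in>{True, False}. (if j then 1 else a) * chart_integral I C R K (if j then D else D'))"
    by (rule chart_integral_sum[OF assms(1-3)]) (use assms(4,5) in auto)
  then show ?thesis by simp
qed

lemma local_form_pullback_cong:
  assumes M: "smooth_atlas L" and N: "smooth_atlas N" and f: "smooth_map L N f" and g: "smooth_map L N g"
    and K: "closedin (top_of L) K" and off: "\<And>p. p \<in> points L - K \<Longrightarrow> f p = g p"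
    and c: "c \<in> atlas_of L" and x: "x \<in> chart_image c" "chart_inv c x \<notin> K"
  shows "local_form L (pullback L N f \<alpha>) c x ws = local_form L (pullback L N g \<alpha>) c x ws"
proof -
  have "openin (top_of L) (points L - K)" using K by blast
  note o = open_chart_inv_vimage[OF M c this]
  have xp: "chart_inv c x \<in> points L - K" using x chart_inv_in[OF x(1)] chart_subset[OF M c] by blast
  have "push_vector N (\<lambda>y. f (chart_inv c y)) x = push_vector N (\<lambda>y. g (chart_inv c y)) x"
    by (rule ext, rule push_vector_cong[OF o]) (use x xp off in auto)
  then show ?thesis
    unfolding local_form_pullback_push_vector[OF M N f c x(1)] local_form_pullback_push_vector[OF M N g c x(1)]
    using off[OF xp] by simp
qed

text \<open>The two integrals change separately when K grows. Their difference has the density of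
  the difference of the pullbacks, which is 0 off K because f and g agree on the open complement of
  K.\<close>

lemma form_integral_over_difference_enlarge:
  fixes L :: "('l, real^'n::{finite,wellorder}) manifold"
  assumes L: "oriented_manifold L" and N: "smooth_atlas N" and f: "smooth_map L N f" and g: "smooth_map L N g"
    and \<alpha>: "differential_form N CARD('n) \<alpha>"
    and K: "compactin (top_of L) K" "compactin (top_of L) K'" "K \<subseteq> K'" and off: "\<And>p. p \<in> points L - K \<Longrightarrow> f p = g p"
  shows "form_integral_over L K' (pullback L N f \<alpha>) - form_integral_over L K' (pullback L N g \<alpha>) =
     form_integral_over L K (pullback L N f \<alpha>) - form_integral_over L K (pullback L N g \<alpha>)"
proof -
  note M = oriented_manifold_smooth_atlas[OF L] and H = oriented_manifold_Hausdorff[OF L]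
  note cl = compactin_imp_closedin[OF H K(1)] compactin_imp_closedin[OF H K(2)]
  note W' = some_partition_weights[OF M H K(2)]
  define P where "P = (SOME P. partition_of_unity_on L K' P)"
  define Z where "Z i = function_support L (snd i)" for i :: "('l, real^'n::_) chart \<times> ('l \<Rightarrow> real)"
  have W': "weights L K' P fst snd Z" unfolding P_def Z_def by (rule some_partition_weights[OF M H K(2)])
  then have W: "weights L K P fst snd Z" using K(3) unfolding weights_def by blast
  note pf = differential_form_pullback[OF M N f \<alpha>] and pg = differential_form_pullback[OF M N g \<alpha>]
  let ?D = "\<lambda>f c x. local_form L (pullback L N f \<alpha>) c x standard_frame"
  have "chart_integral P fst snd K' (\<lambda>c x. ?D f c x + (-1) * ?D g c x) = chart_integral P fst snd K (\<lambda>c x. ?D f c x + (-1) * ?D g c x)"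
  proof (rule chart_integral_shrink[OF K(3)])
    fix i x assume i: "i \<in> P" and x: "x \<in> chart_image (fst i)" "chart_inv (fst i) x \<in> K' - K"
    have "fst i \<in> atlas_of L" using W i by (simp add: weights_def)
    then show "?D f (fst i) x + (-1) * ?D g (fst i) x = 0"
      using local_form_pullback_cong[OF M N f g cl(1) off, of "fst i" x \<alpha> standard_frame] x by simp
  qed
  then show ?thesis
    unfolding chart_integral_diff[OF M cl(2) W' density_local_form[OF M pf] density_local_form[OF M pg]]
      chart_integral_diff[OF M cl(1) W density_local_form[OF M pf] density_local_form[OF M pg]]
      form_integral_over_eq[OF L K(2) pf W'] form_integral_over_eq[OF L K(2) pg W']
      form_integral_over_eq[OF L K(1) pf W] form_integral_over_eq[OF L K(1) pg W] by simp
qed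

lemma lagrangian_class_agree:
  assumes A: "A \<in> lagrangian_space X \<omega> L d f0" and f: "f \<in> A" "g \<in> A"
  shows "\<exists>K. compactin (top_of L) K \<and> (\<forall>p\<in>points L - K. f p = g p)"
proof -
  obtain f1 where f1: "\<And>g. g \<in> A \<Longrightarrow> \<exists>\<psi>\<in>reparametrizations L. \<forall>p\<in>points L. g p = f1 (\<psi> p)"
    using A unfolding lagrangian_space_def quotient_def by blast
  have *: "\<exists>K. compactin (top_of L) K \<and> (\<forall>p\<in>points L - K. g p = f1 p)" if gA: "g \<in> A" for g
  proof -
    obtain \<psi> where \<psi>: "\<psi> \<in> reparametrizations L" "\<forall>p\<in>points L. g p = f1 (\<psi> p)" using f1[OF gA] by blast
    then obtain K where "compactin (top_of L) K" "\<forall>p\<in>points L - K. \<psi> p = p"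
      unfolding reparametrizations_def agree_off_compact_def by auto
    then show ?thesis using \<psi>(2) by (intro exI[of _ K]) auto
  qed
  obtain K where K: "compactin (top_of L) K" "\<forall>p\<in>points L - K. f p = f1 p" using *[OF f(1)] by blast
  obtain K' where K': "compactin (top_of L) K'" "\<forall>p\<in>points L - K'. g p = f1 p" using *[OF f(2)] by blast
  show ?thesis using K K' by (intro exI[of _ "K \<union> K'"]) (auto intro: compactin_Un)
qed

text \<open>The description by \<open>THE\<close> is resolved by comparing two admissible triples.
  On a compact set that contains K, K' and the sets where members of the same class differ, the
  difference is unchanged by enlargement, and each integral is unchanged by the choice of
  representative.\<close>

theorem integral_difference_eq:
  fixes L :: "('l, real^'n::{finite,wellorder}) manifold"
  assumes L: "oriented_manifold L" and X: "smooth_manifold X" and \<alpha>: "differential_form X CARD('n) \<alpha>"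
    and A: "A \<in> lagrangian_space X \<omega> L d f0" and B: "B \<in> lagrangian_space X \<omega> L d f0"
    and f: "f \<in> A" and g: "g \<in> B" and K: "compactin (top_of L) K" and off: "\<And>p. p \<in> points L - K \<Longrightarrow> f p = g p"
  shows "integral_difference X L \<alpha> A B = form_integral_over L K (pullback L X f \<alpha>) - form_integral_over L K (pullback L X g \<alpha>)"
  unfolding integral_difference_def
proof (rule the_equality)
  show "\<exists>fa\<in>A. \<exists>ga\<in>B. \<exists>Ka. compactin (top_of L) Ka \<and> (\<forall>p\<in>points L - Ka. fa p = ga p) \<and>
      form_integral_over L K (pullback L X f \<alpha>) - form_integral_over L K (pullback L X g \<alpha>) =
      form_integral_over L Ka (pullback L X fa \<alpha>) - form_integral_over L Ka (pullback L X ga \<alpha>)"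
    using f g K off by blast
next
  fix r assume "\<exists>f\<in>A. \<exists>g\<in>B. \<exists>K. compactin (top_of L) K \<and> (\<forall>p\<in>points L - K. f p = g p) \<and>
      r = form_integral_over L K (pullback L X f \<alpha>) - form_integral_over L K (pullback L X g \<alpha>)"
  then obtain f' g' K' where f': "f' \<in> A" and g': "g' \<in> B" and K': "compactin (top_of L) K'" and off': "\<And>p. p \<in> points L - K' \<Longrightarrow> f' p = g' p"
    and r: "r = form_integral_over L K' (pullback L X f' \<alpha>) - form_integral_over L K' (pullback L X g' \<alpha>)" by blast
  note MX = smooth_manifold_smooth_atlas[OF X]
  obtain KA where KA: "compactin (top_of L) KA" "\<forall>p\<in>points L - KA. f p = f' p" using lagrangian_class_agree[OF A f f'] by blast
  obtain KB where KB: "compactin (top_of L) KB" "\<forall>p\<in>points L - KB. g p = g' p" using lagrangian_class_agree[OF B g g'] by blast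
  define K2 where "K2 = K \<union> K' \<union> KA \<union> KB"
  have K2: "compactin (top_of L) K2" unfolding K2_def by (intro compactin_Un K K' KA(1) KB(1))
  have se: "smooth_embedding L X h" if "h \<in> A \<or> h \<in> B" for h
    using that lagrangian_class_embedding[OF A] lagrangian_class_embedding[OF B] by (auto simp: lagrangian_embeddings_def)
  have sm: "smooth_map L X h" if "h \<in> A \<or> h \<in> B" for h using se[OF that] by (simp add: smooth_embedding_def)
  have "form_integral_over L K2 (pullback L X f \<alpha>) - form_integral_over L K2 (pullback L X g \<alpha>) =
     form_integral_over L K (pullback L X f \<alpha>) - form_integral_over L K (pullback L X g \<alpha>)"
    using f g by (intro form_integral_over_difference_enlarge[OF L MX sm sm \<alpha> K K2 _ off]) (auto simp: K2_def)
  moreover have "form_integral_over L K2 (pullback L X f' \<alpha>) - form_integral_over L K2 (pullback L X g' \<alpha>) = r"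
    unfolding r using f' g' by (intro form_integral_over_difference_enlarge[OF L MX sm sm \<alpha> K' K2 _ off']) (auto simp: K2_def)
  moreover have "form_integral_over L K2 (pullback L X f \<alpha>) = form_integral_over L K2 (pullback L X f' \<alpha>)"
    using f f' KA submanifold_of_class_eq[OF L A f] submanifold_of_class_eq[OF L A f'] by (intro form_integral_over_reparametrize[OF L X se se _ \<alpha> K2]) (auto simp: K2_def)
  moreover have "form_integral_over L K2 (pullback L X g \<alpha>) = form_integral_over L K2 (pullback L X g' \<alpha>)"
    using g g' KB submanifold_of_class_eq[OF L B g] submanifold_of_class_eq[OF L B g'] by (intro form_integral_over_reparametrize[OF L X se se _ \<alpha> K2]) (auto simp: K2_def)
  ultimately show "r = form_integral_over L K (pullback L X f \<alpha>) - form_integral_over L K (pullback L X g \<alpha>)" by simp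
qed

section \<open>Paths of maps in charts\<close>

text \<open>The lifting is given for t in the closed interval, so smoothness means a local extension
  g to an open set. Continuity of the lifting, jointly in t and the point, yields V, which keeps f_t
  in the chart domain for nearby parameters.\<close>

lemma path_local_extension:
  fixes X :: "('x, 'm::euclidean_space) manifold" and L :: "('l, 'e::euclidean_space) manifold"
  assumes M: "smooth_atlas L" and MX: "smooth_atlas X" and f: "smooth_lifting X L \<Lambda> f"
    and t: "t0 \<in> {0..1}" and c: "c \<in> atlas_of L" and x: "x0 \<in> chart_image c" and e: "e \<in> atlas_of X" "f t0 (chart_inv c x0) \<in> fst e"
  obtains W g where "(t0, x0) \<in> W" "smooth_open W g" "\<And>t x. (t, x) \<in> W \<Longrightarrow> x \<in> chart_image c"
    "\<And>z. z \<in> W \<Longrightarrow> g z \<in> chart_image e" "\<And>t x. (t, x) \<in> W \<Longrightarrow> t \<in> {0..1} \<Longrightarrow> f t (chart_inv c x) \<in> fst e"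
    "\<And>t x. (t, x) \<in> W \<Longrightarrow> t \<in> {0..1} \<Longrightarrow> snd e (f t (chart_inv c x)) = g (t, x)"
proof -
  let ?S = "{(t, x). t \<in> {0..1} \<and> x \<in> chart_image c \<and> f t (chart_inv c x) \<in> fst e}"
  have "smooth_on ?S (\<lambda>(t, x). snd e (f t (chart_inv c x)))"
    using f c e(1) unfolding smooth_lifting_def by blast
  moreover have "(t0, x0) \<in> ?S" using t x e by simp
  ultimately obtain U g where U: "(t0, x0) \<in> U" "smooth_open U g" "\<And>z. z \<in> ?S \<Longrightarrow> z \<in> U \<Longrightarrow> g z = (\<lambda>(t, x). snd e (f t (chart_inv c x))) z"
    by (rule smooth_onE) (rule that)
  have "continuous_map (prod_topology (top_of_set {0..1}) (top_of_set (chart_image c))) (prod_topology (top_of_set {0..1}) (top_of L)) (\<lambda>(t, x). (t, chart_inv c x))"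
    unfolding case_prod_unfold
    by (intro continuous_map_pairedI continuous_map_fst continuous_map_compose[OF continuous_map_snd continuous_map_chart_inv[OF M c], unfolded o_def])
  from continuous_map_compose[OF this, of "top_of X" "\<lambda>(t, p). f t p"]
  have "continuous_map (prod_topology (top_of_set {0..1}) (top_of_set (chart_image c))) (top_of X) (\<lambda>(t, x). f t (chart_inv c x))"
    using f unfolding smooth_lifting_def by (simp add: o_def case_prod_unfold)
  from openin_continuous_map_preimage[OF this chart_openin[OF MX e(1)]]
  have "openin (top_of_set ({0..1} \<times> chart_image c)) {z \<in> {0..1} \<times> chart_image c. (\<lambda>(t, x). f t (chart_inv c x)) z \<in> fst e}"
    by (simp add: prod_topology_subtopology_eu)
  then obtain V where V: "open V" "{z \<in> {0..1} \<times> chart_image c. (\<lambda>(t, x). f t (chart_inv c x)) z \<in> fst e} = ({0..1} \<times> chart_image c) \<inter> V"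
    unfolding openin_open by blast
  have VS: "t \<in> {0..1} \<and> f t (chart_inv c x) \<in> fst e" if "t \<in> {0..1}" "x \<in> chart_image c" "(t, x) \<in> V" for t x
  proof -
    have "(t, x) \<in> ({0..1} \<times> chart_image c) \<inter> V" using that by blast
    then show ?thesis unfolding V(2)[symmetric] by simp
  qed
  have SV: "(t0, x0) \<in> V"
  proof -
    have "(t0, x0) \<in> {z \<in> {0..1} \<times> chart_image c. (\<lambda>(t, x). f t (chart_inv c x)) z \<in> fst e}" using t x e by simp
    then show ?thesis unfolding V(2) by blast
  qed
  define W0 where "W0 = U \<inter> V \<inter> (UNIV \<times> chart_image c)"
  have W0: "open W0"
    unfolding W0_def using smooth_openD(1)[OF U(2)] V(1) open_chart_image[OF M c] by (intro open_Int open_Times open_UNIV)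
  have gW0: "smooth_open W0 g" by (rule smooth_open_subset[OF U(2) _ W0]) (auto simp: W0_def)
  \<comment> \<open>For t outside the interval the values of g have nothing to do with f, so they
    have to be kept inside the image of the chart e by shrinking the domain; forms on X can then be
    pulled back along g on all of W.\<close>
  define W where "W = W0 \<inter> g -` chart_image e"
  have W: "open W"
    unfolding W_def by (rule continuous_open_preimage[OF smooth_open_continuous_on[OF gW0] W0 open_chart_image[OF MX e(1)]])
  have g_eq: "snd e (f t (chart_inv c x)) = g (t, x)" if "(t, x) \<in> W0" "t \<in> {0..1}" for t x
    using U(3)[of "(t, x)"] that VS[of t x] by (auto simp: W0_def)
  have in0: "(t0, x0) \<in> W0" using U(1) SV x by (simp add: W0_def)
  show thesis
  proof (rule that[of W g])
    show "(t0, x0) \<in> W"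
      unfolding W_def using in0 g_eq[OF in0 t] chart_in_image[OF e(2)] by simp
    show "smooth_open W g" by (rule smooth_open_subset[OF gW0 _ W]) (simp add: W_def)
    show "x \<in> chart_image c" if "(t, x) \<in> W" for t x using that by (simp add: W_def W0_def)
    show "g z \<in> chart_image e" if "z \<in> W" for z using that by (simp add: W_def)
    show "f t (chart_inv c x) \<in> fst e" if "(t, x) \<in> W" "t \<in> {0..1}" for t x
      using that VS[of t x] by (simp add: W_def W0_def)
    show "snd e (f t (chart_inv c x)) = g (t, x)" if "(t, x) \<in> W" "t \<in> {0..1}" for t x
      using that g_eq by (simp add: W_def)
  qed
qed

text \<open>The lifting in one pair of charts. The map g is defined on an open set and thus has
  two-sided derivatives at t = 0 and t = 1 as well; only for t in the interval does it describe
  f.\<close>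

locale path_chart =
  fixes X :: "('x, 'm::euclidean_space) manifold" and L :: "('l, 'e::euclidean_space) manifold"
    and f :: "real \<Rightarrow> 'l \<Rightarrow> 'x" and c :: "('l, 'e) chart" and e :: "('x, 'm) chart"
    and W :: "(real \<times> 'e) set" and g :: "real \<times> 'e \<Rightarrow> 'm"
  assumes M: "smooth_atlas L" and MX: "smooth_atlas X" and c: "c \<in> atlas_of L" and e: "e \<in> atlas_of X"
    and sm: "\<And>t. t \<in> {0..1} \<Longrightarrow> smooth_map L X (f t)"
    and g: "smooth_open W g" and Wc: "\<And>t x. (t, x) \<in> W \<Longrightarrow> x \<in> chart_image c" and We: "\<And>z. z \<in> W \<Longrightarrow> g z \<in> chart_image e"
    and Wf: "\<And>t x. (t, x) \<in> W \<Longrightarrow> t \<in> {0..1} \<Longrightarrow> f t (chart_inv c x) \<in> fst e"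
    and g_eq: "\<And>t x. (t, x) \<in> W \<Longrightarrow> t \<in> {0..1} \<Longrightarrow> snd e (f t (chart_inv c x)) = g (t, x)"
begin

lemma W_open: "open W" using g by (rule smooth_openD)

lemma open_slice: "open {x. (t, x) \<in> W}"
proof -
  have "continuous_on UNIV (\<lambda>x. (t, x))" by (intro continuous_intros)
  from open_vimage[OF W_open this] show ?thesis by (simp add: vimage_def)
qed

lemma open_time_slice: "open {t. (t, x) \<in> W}"
proof -
  have "continuous_on UNIV (\<lambda>t. (t, x))" by (intro continuous_intros)
  from open_vimage[OF W_open this] show ?thesis by (simp add: vimage_def)
qed

abbreviation Dg where "Dg z \<equiv> frechet_derivative g (at z)"

lemma chart_inv_g: "(t, x) \<in> W \<Longrightarrow> t \<in> {0..1} \<Longrightarrow> chart_inv e (g (t, x)) = f t (chart_inv c x)"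
  using chart_inv_chart[OF MX e Wf] g_eq by metis

lemma linear_Dg: "z \<in> W \<Longrightarrow> linear (Dg z)"
  by (rule linear_frechet_derivative[OF smooth_open_differentiable[OF g]])

lemma push_vector_path:
  assumes z: "(t, x) \<in> W" and t: "t \<in> {0..1}"
  shows "push_vector X (\<lambda>y. f t (chart_inv c y)) x w = push_vector X (chart_inv e) (g (t, x)) (Dg (t, x) (0, w))"
proof -
  have "(Pair t has_derivative Pair 0) (at x)"
    by (auto intro!: derivative_eq_intros)
  from diff_chain_at[OF this smooth_open_has_derivative[OF g z]]
  have "((\<lambda>y. g (t, y)) has_derivative (\<lambda>w. Dg (t, x) (0, w))) (at x)" by (simp add: o_def)
  then have d: "((\<lambda>y. snd e (f t (chart_inv c y))) has_derivative (\<lambda>w. Dg (t, x) (0, w))) (at x)"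
    by (rule has_derivative_transform_within_open[OF _ open_slice[of t]]) (use z g_eq t in auto)
  have xs: "x \<in> {x. (t, x) \<in> W}" using z by simp
  have "push_vector X (\<lambda>y. f t (chart_inv c y)) x w =
    push_vector X (chart_inv e) (snd e (f t (chart_inv c x))) (frechet_derivative (\<lambda>y. snd e (f t (chart_inv c y))) (at x) w)"
    by (rule push_vector_chart[OF MX e open_slice[of t] xs]) (use Wf t d in \<open>auto intro: differentiableI\<close>)
  then show ?thesis using frechet_derivative_eq[OF d] g_eq[OF z t] by simp
qed

text \<open>The velocity is defined one-sidedly at the ends of the interval. The two-sided time
  derivative of g restricts to a derivative within the interval, where derivatives are unique, and
  transition maps carry it from e to every other chart.\<close>

lemma velocity_path:
  assumes z: "(t, x) \<in> W" and t: "t \<in> {0..1}"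
  shows "velocity X f t (chart_inv c x) = push_vector X (chart_inv e) (g (t, x)) (Dg (t, x) (1, 0))"
proof
  fix e'
  show "velocity X f t (chart_inv c x) e' = push_vector X (chart_inv e) (g (t, x)) (Dg (t, x) (1, 0)) e'"
  proof (cases "e' \<in> atlas_of X \<and> f t (chart_inv c x) \<in> fst e'")
    case True
    let ?\<tau> = "\<lambda>y. snd e' (chart_inv e y)"
    have tr: "smooth_open (snd e ` (fst e \<inter> fst e')) ?\<tau>" using True by (intro transition_smooth[OF MX e]) auto
    have go: "g (t, x) \<in> snd e ` (fst e \<inter> fst e')"
      using True Wf[OF z t] g_eq[OF z t] by (metis IntI image_eqI)
    have "((\<lambda>s. (s, x)) has_derivative (\<lambda>h. (h, 0))) (at t)" by (auto intro!: derivative_eq_intros)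
    from diff_chain_at[OF this smooth_open_has_derivative[OF g z]]
    have "((\<lambda>s. g (s, x)) has_derivative (\<lambda>h. Dg (t, x) (h, 0))) (at t)" by (simp add: o_def)
    from diff_chain_at[OF this smooth_open_has_derivative[OF tr go]]
    have D1: "((\<lambda>s. ?\<tau> (g (s, x))) has_derivative (\<lambda>h. frechet_derivative ?\<tau> (at (g (t, x))) (Dg (t, x) (h, 0)))) (at t)" by (simp add: o_def)
    have L1: "frechet_derivative ?\<tau> (at (g (t, x))) (Dg (t, x) (h, 0)) = h *\<^sub>R frechet_derivative ?\<tau> (at (g (t, x))) (Dg (t, x) (1, 0))" for h
    proof -
      have "Dg (t, x) (h, 0) = h *\<^sub>R Dg (t, x) (1, 0)"
        using linear_scale[OF linear_Dg[OF z], of h "(1, 0)"] by simp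
      then show ?thesis
        using linear_scale[OF linear_frechet_derivative[OF smooth_open_differentiable[OF tr go]]] by simp
    qed
    have "(\<lambda>h. frechet_derivative ?\<tau> (at (g (t, x))) (Dg (t, x) (h, 0))) = (\<lambda>h. h *\<^sub>R frechet_derivative ?\<tau> (at (g (t, x))) (Dg (t, x) (1, 0)))"
      by (rule ext) (rule L1)
    from this[symmetric] have "((\<lambda>s. ?\<tau> (g (s, x))) has_vector_derivative frechet_derivative ?\<tau> (at (g (t, x))) (Dg (t, x) (1, 0))) (at t within {0..1})"
      unfolding has_vector_derivative_def by (rule ssubst) (rule has_derivative_at_withinI[OF D1])
    then have "((\<lambda>s. snd e' (f s (chart_inv c x))) has_vector_derivative frechet_derivative ?\<tau> (at (g (t, x))) (Dg (t, x) (1, 0))) (at t within {0..1})"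
    proof -
      assume D: "((\<lambda>s. ?\<tau> (g (s, x))) has_vector_derivative frechet_derivative ?\<tau> (at (g (t, x))) (Dg (t, x) (1, 0))) (at t within {0..1})"
      obtain d where d: "0 < d" "ball t d \<subseteq> {t. (t, x) \<in> W}"
        using open_contains_ball[of "{t. (t, x) \<in> W}"] open_time_slice[of x] z by auto
      show ?thesis
      proof (rule has_vector_derivative_transform_within[OF D d(1) t])
        fix s assume s: "s \<in> {0..1}" "dist s t < d"
        then have "s \<in> ball t d" by (simp add: dist_commute)
        then have "(s, x) \<in> W" using d(2) by blast
        then show "?\<tau> (g (s, x)) = snd e' (f s (chart_inv c x))" using chart_inv_g s(1) by simp
      qed
    qed
    then have "vector_derivative (\<lambda>s. snd e' (f s (chart_inv c x))) (at t within {0..1}) = frechet_derivative ?\<tau> (at (g (t, x))) (Dg (t, x) (1, 0))"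
      using vector_derivative_within_cbox[of 0 1 t] t by simp
    then show ?thesis using True chart_inv_g[OF z t] by (simp add: velocity_def push_vector_def)
  next
    case False
    then show ?thesis using chart_inv_g[OF z t] by (auto simp: velocity_def push_vector_def)
  qed
qed

lemma local_form_pullback_path:
  assumes z: "(t, x) \<in> W" and t: "t \<in> {0..1}"
  shows "local_form L (pullback L X (f t) \<alpha>) c x ws = pull g (local_form X \<alpha> e) (t, x) (map (Pair 0) ws)"
proof -
  have "push_vector X (\<lambda>y. f t (chart_inv c y)) x = (\<lambda>w. push_vector X (chart_inv e) (g (t, x)) (Dg (t, x) (0, w)))"
    using push_vector_path[OF z t] by blast
  then show ?thesis
    unfolding local_form_pullback_push_vector[OF M MX sm[OF t] c Wc[OF z]]
    by (simp add: pull_def local_form_def chart_inv_g[OF z t] o_def)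
qed

text \<open>The same form on (t, x)-space gives both objects: restricted to spatial vectors it is
  the pullback by f_t, contracted with the time direction (1, 0) it is the velocity form.\<close>

lemma local_form_velocity_path:
  assumes z: "(t, x) \<in> W" and t: "t \<in> {0..1}"
  shows "local_form L (velocity_form X \<alpha> L f t) c x ws = pull g (local_form X \<alpha> e) (t, x) ((1, 0) # map (Pair 0) ws)"
proof -
  have "tangent_map L X (f t) (chart_inv c x) \<circ> push_vector L (chart_inv c) x = (\<lambda>w. push_vector X (chart_inv e) (g (t, x)) (Dg (t, x) (0, w)))"
    using push_vector_path[OF z t] tangent_map_smooth[OF M MX sm[OF t] c Wc[OF z]] by (auto simp: o_def)
  then show ?thesis
    by (simp add: local_form_def velocity_form_def velocity_path[OF z t] pull_def chart_inv_g[OF z t] o_def)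
qed

lemma smooth_form_pull_g:
  assumes "differential_form X k \<alpha>" shows "smooth_form W k (pull g (local_form X \<alpha> e))"
  by (rule smooth_form_pull[OF smooth_form_local_form[OF MX e assms] g We])

end

lemma alternating_Cons:
  assumes A: "alternating_multilinear (Suc k) A" and f: "linear f"
  shows "alternating_multilinear k (\<lambda>ws. A (v # map f ws))"
proof (rule alternating_map[OF _ f])
  show "alternating_multilinear k (\<lambda>ws. A (v # ws))"
    unfolding alternating_multilinear_def
  proof (intro conjI allI impI)
    fix us vs :: "'a list" assume "length us + length vs + 1 = k"
    moreover have "multilinear (Suc k) A" using A by (simp add: alternating_multilinear_iff)
    ultimately show "linear (\<lambda>w. A (v # us @ w # vs))" using multilinearD[of "Suc k" A "v # us" vs] by simp
  next
    fix ws :: "'a list" and i j assume h: "length ws = k \<and> i < j \<and> j < k \<and> ws ! i = ws ! j"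
    then have "length (v # ws) = Suc k \<and> Suc i < Suc j \<and> Suc j < Suc k \<and> (v # ws) ! Suc i = (v # ws) ! Suc j" by simp
    then show "A (v # ws) = 0" using A unfolding alternating_multilinear_def by blast
  qed
qed

lemma linear_Pair_0: "linear (Pair 0)"
  by (rule linearI) auto

lemma smooth_open_slice:
  fixes W :: "('a::euclidean_space \<times> 'e::euclidean_space) set"
  assumes "smooth_open W F" "open {x. (t, x) \<in> W}" shows "smooth_open {x. (t, x) \<in> W} (\<lambda>x. F (t, x))"
proof (rule smooth_open_compose[OF _ assms(1)])
  show "smooth_open {x. (t, x) \<in> W} (\<lambda>x. (t, x))"
    by (intro smooth_open_Pair smooth_open_const smooth_open_bounded_linear[OF bounded_linear_ident] assms(2))
qed simp

lemma smooth_form_slice_Cons: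
  fixes W :: "('a::euclidean_space \<times> 'e::euclidean_space) set"
  assumes \<Gamma>: "smooth_form W (Suc k) \<Gamma>" and o: "open {x. (t, x) \<in> W}"
  shows "smooth_form {x. (t, x) \<in> W} k (\<lambda>x ws. \<Gamma> (t, x) (v # map (Pair 0) ws))"
  unfolding smooth_form_def
  using o alternating_Cons[OF smooth_formD(2)[OF \<Gamma>] linear_Pair_0] smooth_open_slice[OF smooth_formD(4)[OF \<Gamma>] o]
  by simp

lemma frechet_derivative_slice:
  fixes F :: "'a::euclidean_space \<times> 'e::euclidean_space \<Rightarrow> real"
  assumes "F differentiable at (t, x)"
  shows "frechet_derivative F (at (t, x)) (0, u) = frechet_derivative (\<lambda>y. F (t, y)) (at x) u"
proof -
  have "(Pair t has_derivative Pair 0) (at x)" by (auto intro!: derivative_eq_intros)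
  from diff_chain_at[OF this has_derivative_frechet[OF assms]]
  have "((\<lambda>y. F (t, y)) has_derivative (\<lambda>u. frechet_derivative F (at (t, x)) (0, u))) (at x)" by (simp add: o_def)
  then show ?thesis by (rule frechet_derivative_eq[symmetric])
qed

text \<open>Cartan's formula for a constant field v: the summand that removes v is the derivative of
  \<Gamma> along v, and the remaining summands, which keep v as first argument, form minus the
  spatial d of the contraction.\<close>

lemma ext_d_split_first:
  fixes W :: "('a::euclidean_space \<times> 'e::euclidean_space) set"
  assumes \<Gamma>: "smooth_form W (Suc k) \<Gamma>" and z: "(t, x) \<in> W" and us: "length us = Suc k"
  shows "ext_d \<Gamma> (t, x) (v # map (Pair 0) us) =
    frechet_derivative (\<lambda>z. \<Gamma> z (map (Pair 0) us)) (at (t, x)) v - ext_d (\<lambda>y ws. \<Gamma> (t, y) (v # map (Pair 0) ws)) x us"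
proof -
  have "ext_d \<Gamma> (t, x) (v # map (Pair 0) us) = frechet_derivative (\<lambda>z. \<Gamma> z (map (Pair 0) us)) (at (t, x)) v +
     (\<Sum>i<Suc k. (-1) ^ Suc i * frechet_derivative (\<lambda>z. \<Gamma> z (v # drop_nth i (map (Pair 0) us))) (at (t, x)) (map (Pair 0) us ! i))"
    unfolding ext_d_def using us
    by (simp add: drop_nth_Cons sum.lessThan_Suc_shift del: sum.lessThan_Suc)
  also have "(\<Sum>i<Suc k. (-1) ^ Suc i * frechet_derivative (\<lambda>z. \<Gamma> z (v # drop_nth i (map (Pair 0) us))) (at (t, x)) (map (Pair 0) us ! i))
     = - ext_d (\<lambda>y ws. \<Gamma> (t, y) (v # map (Pair 0) ws)) x us"
    unfolding ext_d_def us sum_negf[symmetric]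
  proof (rule sum.cong[OF refl])
    fix i assume "i \<in> {..<Suc k}"
    then have i: "i < length us" using us by simp
    have "(\<lambda>z. \<Gamma> z (v # drop_nth i (map (Pair 0) us))) differentiable at (t, x)"
      using i us by (intro smooth_formD(5)[OF \<Gamma> _ z]) (simp add: length_drop_nth)
    from frechet_derivative_slice[OF this, of "us ! i"] i
    show "(-1) ^ Suc i * frechet_derivative (\<lambda>z. \<Gamma> z (v # drop_nth i (map (Pair 0) us))) (at (t, x)) (map (Pair 0) us ! i) =
      - ((-1) ^ i * frechet_derivative (\<lambda>y. \<Gamma> (t, y) (v # map (Pair 0) (drop_nth i us))) (at x) (us ! i))"
      by (simp add: map_drop_nth)
  qed
  finally show ?thesis by simp
qed

section \<open>Wedge products and Hamiltonians at a point\<close>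

lemma list_wedge_cong:
  assumes "\<And>us. length us = k \<Longrightarrow> a us = a' us" "\<And>us. length us = l \<Longrightarrow> b us = b' us" "length vs = k + l"
  shows "list_wedge k l a b vs = list_wedge k l a' b' vs"
  unfolding list_wedge_def
  by (subst alternate_cong[of "k + l" vs _ "\<lambda>us. a' (take k us) * b' (drop k us)"]) (use assms in auto)

lemma list_wedge_map:
  assumes "length vs = k + l"
  shows "list_wedge k l a b (map f vs) = list_wedge k l (\<lambda>us. a (map f us)) (\<lambda>us. b (map f us)) vs"
  unfolding list_wedge_def alternate_map[OF assms] by (simp add: take_map drop_map)

lemma wedge_eq_list_wedge: "wedge k l \<alpha> \<beta> p vs = list_wedge k l (\<alpha> p) (\<beta> p) vs"
  by (simp add: wedge_eq_alternate list_wedge_def)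

lemma local_form_wedge:
  assumes "length ws = k + l"
  shows "local_form M (wedge k l \<alpha> \<beta>) c x ws = list_wedge k l (local_form M \<alpha> c x) (local_form M \<beta> c x) ws"
  unfolding local_form_def wedge_eq_list_wedge list_wedge_map[OF assms] ..

lemma differential_form_wedge:
  assumes M: "smooth_atlas M" and a: "differential_form M k \<alpha>" and b: "differential_form M l \<beta>"
  shows "differential_form M (k + l) (wedge k l \<alpha> \<beta>)"
proof (rule differential_form_local[OF M])
  fix c x assume c: "c \<in> atlas_of M" and x: "x \<in> chart_image c"
  have "smooth_form (chart_image c) (k + l) (\<lambda>y. list_wedge k l (local_form M \<alpha> c y) (local_form M \<beta> c y))"
    by (rule smooth_form_list_wedge[OF smooth_form_local_form[OF M c a] smooth_form_local_form[OF M c b]])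
  then show "\<exists>S \<gamma>. x \<in> S \<and> smooth_form S (k + l) \<gamma> \<and>
       (\<forall>y\<in>S. y \<in> chart_image c \<longrightarrow> (\<forall>ws. length ws = k + l \<longrightarrow> local_form M (wedge k l \<alpha> \<beta>) c y ws = \<gamma> y ws))"
    using x by (intro exI[of _ "chart_image c"] exI[of _ "\<lambda>y. list_wedge k l (local_form M \<alpha> c y) (local_form M \<beta> c y)"])
      (simp add: local_form_wedge)
qed

context
  fixes M :: "('a, 'e::euclidean_space) manifold" and q :: 'a
  assumes M: "smooth_atlas M" and q: "q \<in> points M"
begin

lemma chart_at_point [simp]:
  "chart_inv (chart_at M q) (snd (chart_at M q) q) = q" "snd (chart_at M q) q \<in> chart_image (chart_at M q)"
  using chart_at_in[OF M q] chart_inv_chart[OF M] by (auto simp: chart_in_image)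

text \<open>In the chart picked at q every list of coordinate vectors comes from tangent vectors at
  q. This allows \<open>form_eq\<close> and \<open>exterior_derivative\<close> to be read as
  identities between coordinate expressions at that point.\<close>

lemma frame_at_point:
  defines "k \<equiv> chart_at M q"
  shows "set (map (push_vector M (chart_inv k) (snd k q)) ws) \<subseteq> tangent_space M q"
    "map (\<lambda>v. v k) (map (push_vector M (chart_inv k) (snd k q)) ws) = ws"
proof -
  note k = chart_at_in[OF M q, folded k_def]
  have y: "snd k q \<in> chart_image k" using k by (simp add: chart_in_image)
  show "set (map (push_vector M (chart_inv k) (snd k q)) ws) \<subseteq> tangent_space M q"
    using push_vector_in_tangent_space[OF M k(1) y] chart_inv_chart[OF M k] by auto
  show "map (\<lambda>v. v k) (map (push_vector M (chart_inv k) (snd k q)) ws) = ws"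
    using push_vector_chart_component[OF M k(1) y] by (simp add: o_def)
qed

lemma form_eq_at_point:
  assumes "form_eq M j \<alpha> \<beta>" "length ws = j"
  shows "local_form M \<alpha> (chart_at M q) (snd (chart_at M q) q) ws = local_form M \<beta> (chart_at M q) (snd (chart_at M q) q) ws"
  using assms frame_at_point(1)[of ws] q unfolding form_eq_def local_form_def by simp

lemma exterior_derivative_at_point:
  assumes "form_eq M j (exterior_derivative M \<alpha>) \<beta>" "length ws = j"
  shows "ext_d (local_form M \<alpha> (chart_at M q)) (snd (chart_at M q) q) ws = local_form M \<beta> (chart_at M q) (snd (chart_at M q) q) ws"
  unfolding form_eq_at_point[OF assms, symmetric]
  unfolding local_form_def[of M "exterior_derivative M \<alpha>"] exterior_derivative_eq_ext_d
  by (simp only: chart_at_point frame_at_point(2))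

end

text \<open>The factor arises from d(\<lambda> \<and> \<gamma>) = \<omega> \<and> \<gamma> -
  \<lambda> \<and> \<beta>, where the last product is - a \<omega> \<and> \<gamma> by
  hypothesis.\<close>

lemma ext_d_wedge_at_point:
  assumes M: "smooth_atlas X" and q: "q \<in> points X"
    and lam: "differential_form X 1 lam" and gam: "differential_form X l gam"
    and dlam: "form_eq X 2 (exterior_derivative X lam) \<omega>" and dgam: "form_eq X (Suc l) (exterior_derivative X gam) \<beta>"
    and rel: "form_eq X (1 + Suc l) (wedge 1 (Suc l) lam \<beta>) (scale_form (\<lambda>p. - a) (wedge 2 l \<omega> gam))"
    and ws: "length ws = Suc (Suc l)"
  defines "k \<equiv> chart_at X q"
  shows "ext_d (local_form X (wedge 1 l lam gam) k) (snd k q) ws =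
    (1 + a) * list_wedge 2 l (local_form X \<omega> k (snd k q)) (local_form X gam k (snd k q)) ws"
proof -
  let ?y = "snd k q"
  note k = chart_at_in[OF M q, folded k_def]
  have y: "?y \<in> chart_image k" using k by (simp add: chart_in_image)
  have "ext_d (local_form X (wedge 1 l lam gam) k) ?y ws =
    ext_d (\<lambda>y. list_wedge 1 l (local_form X lam k y) (local_form X gam k y)) ?y ws"
    by (rule ext_d_cong_open[OF open_chart_image[OF M k(1)] y ws]) (simp add: local_form_wedge)
  also have "\<dots> = list_wedge 2 l (ext_d (local_form X lam k) ?y) (local_form X gam k ?y) ws -
      list_wedge 1 (Suc l) (local_form X lam k ?y) (ext_d (local_form X gam k) ?y) ws"
    by (rule ext_d_list_wedge[OF smooth_form_local_form[OF M k(1) lam] smooth_form_local_form[OF M k(1) gam] y ws])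
  also have "list_wedge 2 l (ext_d (local_form X lam k) ?y) (local_form X gam k ?y) ws =
      list_wedge 2 l (local_form X \<omega> k ?y) (local_form X gam k ?y) ws"
    using exterior_derivative_at_point[OF M q dlam] ws unfolding k_def by (intro list_wedge_cong) simp_all
  also have "list_wedge 1 (Suc l) (local_form X lam k ?y) (ext_d (local_form X gam k) ?y) ws =
      list_wedge 1 (Suc l) (local_form X lam k ?y) (local_form X \<beta> k ?y) ws"
    using exterior_derivative_at_point[OF M q dgam] ws unfolding k_def by (intro list_wedge_cong) simp_all
  also have "\<dots> = - a * list_wedge 2 l (local_form X \<omega> k ?y) (local_form X gam k ?y) ws"
    using form_eq_at_point[OF M q rel, of ws] ws
    unfolding local_form_scale k_def[symmetric] by (simp add: local_form_wedge)
  finally show ?thesis by (simp add: algebra_simps)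
qed

lemma image_manifold_inverse_differentiable:
  assumes L: "oriented_manifold L" and f: "smooth_embedding L X f" and k: "k \<in> atlas_of (image_manifold X L f)"
    and e: "e \<in> atlas_of L" and q: "q \<in> fst k" "inv_into (points L) f q \<in> fst e"
  shows "(\<lambda>y. snd e (inv_into (points L) f (chart_inv k y))) differentiable at (snd k q)"
proof -
  let ?N = "image_manifold X L f" and ?k = "pull_chart (top_of L) f k"
  note M = oriented_manifold_smooth_atlas[OF L] and hm = image_manifold_homeomorphic[OF f]
  note h = homeomorphic_map_inv_into_simps[OF hm]
  have pk: "?k \<in> atlas_of L" using k unfolding image_manifold_atlas by blast
  note ik = image_manifold_is_chart[OF M f k]
  have im: "chart_image ?k = chart_image k" by (rule chart_image_pull_chart[OF hm ik])
  have inv: "inv_into (points L) f (chart_inv k y) = chart_inv ?k y" if "y \<in> chart_image k" for y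
    using chart_inv_pull_chart[OF hm ik that] h(2)[of "chart_inv ?k y"] chart_inv_in[of y ?k] that im by simp
  have y: "snd k q \<in> chart_image k" using q by (simp add: chart_in_image)
  have "chart_inv k (snd k q) = q" using is_chart_inj[OF ik] q by (simp add: chart_inv_def)
  then have "chart_inv ?k (snd k q) \<in> fst e" using inv[OF y] q(2) by simp
  then have "snd k q \<in> snd ?k ` (fst ?k \<inter> fst e)" using y im by (intro chart_overlapI) auto
  then have "((\<lambda>y. snd e (chart_inv ?k y)) has_derivative frechet_derivative (\<lambda>y. snd e (chart_inv ?k y)) (at (snd k q))) (at (snd k q))"
    by (rule smooth_open_has_derivative[OF transition_smooth[OF M pk e]])
  then have "((\<lambda>y. snd e (inv_into (points L) f (chart_inv k y))) has_derivative frechet_derivative (\<lambda>y. snd e (chart_inv ?k y)) (at (snd k q))) (at (snd k q))"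
    by (rule has_derivative_transform_within_open[OF _ open_chart_image[OF image_manifold_smooth_atlas[OF L f] k] y]) (simp add: inv)
  then show ?thesis by (rule differentiableI)
qed

lemma differential_form_function:
  assumes M: "smooth_atlas M" and h: "smooth_function M h"
  shows "differential_form M 0 (function_form h)"
  using h unfolding smooth_function_def differential_form_def
  by (simp add: local_form_def alternating_multilinear_def o_def)

text \<open>The Hamiltonian equation is posed on the image submanifold, with the velocity form moved
  there by the inverse of f_t. Evaluated on the image of a coordinate vector, the inverse cancels
  and the equation reads i_v \<omega> = dH on L. The lifting has to be the one picked in
  \<open>path_derivative\<close>, hence \<open>fdef\<close>.\<close>

lemma velocity_form_hamiltonian:
  fixes L :: "('l, real^'n::{finite,wellorder}) manifold"
  assumes L: "oriented_manifold L" and X: "smooth_manifold X"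
    and lag: "\<And>t. t \<in> {0..1} \<Longrightarrow> \<Lambda> t \<in> lagrangian_space X \<omega> L d f0"
    and fdef: "f = (SOME f. smooth_lifting X L \<Lambda> f)" and f: "smooth_lifting X L \<Lambda> f"
    and h: "associated_hamiltonians X \<omega> L \<Lambda> h" and t: "t \<in> {0..1}"
    and c: "c \<in> atlas_of L" and x: "x \<in> chart_image c"
  shows "local_form L (velocity_form X \<omega> L f t) c x [u] = frechet_derivative (\<lambda>y. h t (f t (chart_inv c y))) (at x) u"
proof -
  let ?N = "image_manifold X L (f t)" and ?fi = "inv_into (points L) (f t)"
  have ft: "f t \<in> \<Lambda> t" using f t by (simp add: smooth_lifting_def)
  have se: "smooth_embedding L X (f t)" using lagrangian_class_embedding[OF lag[OF t] ft] by (simp add: lagrangian_embeddings_def)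
  have Neq: "submanifold_of_class X L (\<Lambda> t) = ?N" by (rule submanifold_of_class_eq[OF L lag[OF t] ft])
  note M = oriented_manifold_smooth_atlas[OF L] and MN = image_manifold_smooth_atlas[OF L se]
  note hm = image_manifold_homeomorphic[OF se]
  note hi = homeomorphic_map_inv_into_simps[OF hm]
  have hs: "smooth_function ?N (h t)" and he: "form_eq ?N 1 (path_derivative X \<omega> L \<Lambda> t) (exterior_derivative ?N (function_form (h t)))"
    using h t unfolding associated_hamiltonians_def Let_def Neq[symmetric] by auto
  have pd: "path_derivative X \<omega> L \<Lambda> t = pullback ?N L ?fi (velocity_form X \<omega> L f t)"
    unfolding path_derivative_def Let_def Neq fdef[symmetric] ..
  define c' where "c' = push_chart L (f t) c"
  note pc = push_chart[OF L se c, folded c'_def]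
  note ic = image_manifold_is_chart[OF M se pc(1)]
  have x': "x \<in> chart_image c'" using x pc(4) by simp
  have ci: "chart_inv c' y = f t (chart_inv c y)" if "y \<in> chart_image c" for y
    using chart_inv_pull_chart[OF hm ic, of y] that pc(3,4) by simp
  have pL: "chart_inv c y \<in> points L" if "y \<in> chart_image c" for y using chart_inv_in[OF that] chart_subset[OF M c] by blast
  let ?q = "f t (chart_inv c x)"
  have q: "?q \<in> points ?N" by (rule hi(1)[OF pL[OF x]])
  have fi: "?fi ?q = chart_inv c x" by (rule hi(2)[OF pL[OF x]])
  define v where "v = push_vector ?N (chart_inv c') x u"
  have v: "v \<in> tangent_space ?N ?q" using push_vector_in_tangent_space[OF MN pc(1) x'] ci[OF x] by (simp add: v_def)
  have "path_derivative X \<omega> L \<Lambda> t ?q [v] = exterior_derivative ?N (function_form (h t)) ?q [v]"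
    using he q v unfolding form_eq_def by simp
  moreover have "path_derivative X \<omega> L \<Lambda> t ?q [v] = local_form L (velocity_form X \<omega> L f t) c x [u]"
  proof -
    have "tangent_map ?N L ?fi (chart_inv c' x) v = push_vector L (\<lambda>y. ?fi (chart_inv c' y)) x u"
      unfolding v_def
    proof (rule tangent_map_push_vector[OF MN pc(1) x'])
      fix e assume e: "e \<in> atlas_of L" "?fi (chart_inv c' x) \<in> fst e"
      have "chart_inv c' x \<in> points ?N" using q ci[OF x] by simp
      from chart_at_in[OF MN this]
      show "(\<lambda>y. snd e (?fi (chart_inv (chart_at ?N (chart_inv c' x)) y))) differentiable at (snd (chart_at ?N (chart_inv c' x)) (chart_inv c' x))"
        by (intro image_manifold_inverse_differentiable[OF L se _ e(1) _ e(2)])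
    qed
    also have "\<dots> = push_vector L (chart_inv c) x u"
      by (rule push_vector_cong[OF open_chart_image[OF M c] x]) (simp add: ci hi(2)[OF pL])
    finally have "tangent_map ?N L ?fi ?q v = push_vector L (chart_inv c) x u" using ci[OF x] by simp
    then show ?thesis unfolding pd pullback_def by (simp add: fi local_form_def)
  qed
  moreover have "exterior_derivative ?N (function_form (h t)) ?q [v] = frechet_derivative (\<lambda>y. h t (f t (chart_inv c y))) (at x) u"
  proof -
    let ?k = "chart_at ?N ?q"
    note k = chart_at_in[OF MN q]
    have xo: "x \<in> snd c' ` (fst c' \<inter> fst ?k)" using x' k ci[OF x] by (intro chart_overlapI) auto
    have "v ?k = frechet_derivative (\<lambda>y. snd ?k (chart_inv c' y)) (at x) u"
      using k ci[OF x] by (simp add: v_def push_vector_def)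
    then have "exterior_derivative ?N (function_form (h t)) ?q [v] =
      ext_d (local_form ?N (function_form (h t)) ?k) (snd ?k (chart_inv c' x)) (map (frechet_derivative (\<lambda>y. snd ?k (chart_inv c' y)) (at x)) [u])"
      unfolding exterior_derivative_eq_ext_d using ci[OF x] by simp
    also have "\<dots> = ext_d (local_form ?N (function_form (h t)) c') x [u]"
      by (rule ext_d_change_chart[symmetric, OF MN pc(1) k(1) differential_form_function[OF MN hs] xo]) simp
    also have "\<dots> = frechet_derivative (\<lambda>y. h t (chart_inv c' y)) (at x) u"
      by (simp add: ext_d_def local_form_def)
    also have "frechet_derivative (\<lambda>y. h t (chart_inv c' y)) (at x) = frechet_derivative (\<lambda>y. h t (f t (chart_inv c y))) (at x)"
      by (rule frechet_derivative_cong_open[OF open_chart_image[OF M c] x]) (simp add: ci)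
    finally show ?thesis .
  qed
  ultimately show ?thesis by simp
qed

section \<open>The time derivative of the pulled back form\<close>

context path_chart
begin

lemma has_vector_derivative_pullback_path:
  assumes \<alpha>: "differential_form X j \<alpha>" and ws: "length ws = j" and z: "(t, x) \<in> W" and t: "t \<in> {0..1}"
  shows "((\<lambda>s. local_form L (pullback L X (f s) \<alpha>) c x ws) has_vector_derivative
     frechet_derivative (\<lambda>z. pull g (local_form X \<alpha> e) z (map (Pair 0) ws)) (at (t, x)) (1, 0)) (at t within {0..1})"
proof -
  let ?G = "\<lambda>z. pull g (local_form X \<alpha> e) z (map (Pair 0) ws)"
  have G: "smooth_open W ?G" by (rule smooth_formD(4)[OF smooth_form_pull_g[OF \<alpha>]]) (simp add: ws)
  have "((\<lambda>s. (s, x)) has_derivative (\<lambda>h. (h, 0))) (at t)" by (auto intro!: derivative_eq_intros)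
  from diff_chain_at[OF this smooth_open_has_derivative[OF G z]]
  have D: "((\<lambda>s. ?G (s, x)) has_derivative (\<lambda>h. frechet_derivative ?G (at (t, x)) (h, 0))) (at t)" by (simp add: o_def)
  have lin: "linear (frechet_derivative ?G (at (t, x)))"
    by (rule linear_frechet_derivative[OF smooth_open_differentiable[OF G z]])
  have "(\<lambda>h. frechet_derivative ?G (at (t, x)) (h, 0)) = (\<lambda>h. h *\<^sub>R frechet_derivative ?G (at (t, x)) (1, 0))"
  proof
    fix h :: real
    have "frechet_derivative ?G (at (t, x)) (h *\<^sub>R (1, 0)) = h *\<^sub>R frechet_derivative ?G (at (t, x)) (1, 0)"
      by (rule linear_scale[OF lin])
    then show "frechet_derivative ?G (at (t, x)) (h, 0) = h *\<^sub>R frechet_derivative ?G (at (t, x)) (1, 0)" by simp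
  qed
  from this[symmetric] have D': "((\<lambda>s. ?G (s, x)) has_vector_derivative frechet_derivative ?G (at (t, x)) (1, 0)) (at t within {0..1})"
    unfolding has_vector_derivative_def by (rule ssubst) (rule has_derivative_at_withinI[OF D])
  obtain r where r: "0 < r" "ball t r \<subseteq> {t. (t, x) \<in> W}"
    using open_contains_ball[of "{t. (t, x) \<in> W}"] open_time_slice[of x] z by auto
  show ?thesis
  proof (rule has_vector_derivative_transform_within[OF D' r(1) t])
    fix s assume s: "s \<in> {0..1}" "dist s t < r"
    then have "s \<in> ball t r" by (simp add: dist_commute)
    then have "(s, x) \<in> W" using r(2) by blast
    then show "?G (s, x) = local_form L (pullback L X (f s) \<alpha>) c x ws" using local_form_pullback_path s(1) by simp
  qed
qed

end

lemma smooth_lifting_path_chart: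
  assumes M: "smooth_atlas L" and MX: "smooth_atlas X" and f: "smooth_lifting X L \<Lambda> f"
    and sm: "\<And>t. t \<in> {0..1} \<Longrightarrow> smooth_map L X (f t)"
    and t: "t \<in> {0..1}" and c: "c \<in> atlas_of L" and x: "x \<in> chart_image c"
    and e: "e \<in> atlas_of X" "f t (chart_inv c x) \<in> fst e"
  shows "\<exists>W g. (t, x) \<in> W \<and> path_chart X L f c e W g"
proof -
  obtain W g where "(t, x) \<in> W" "smooth_open W g" "\<And>t x. (t, x) \<in> W \<Longrightarrow> x \<in> chart_image c"
    "\<And>z. z \<in> W \<Longrightarrow> g z \<in> chart_image e" "\<And>t x. (t, x) \<in> W \<Longrightarrow> t \<in> {0..1} \<Longrightarrow> f t (chart_inv c x) \<in> fst e"
    "\<And>t x. (t, x) \<in> W \<Longrightarrow> t \<in> {0..1} \<Longrightarrow> snd e (f t (chart_inv c x)) = g (t, x)"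
    by (rule path_local_extension[OF M MX f t c x e]) (rule that)
  then have "path_chart X L f c e W g" using M MX c e(1) sm by (intro path_chart.intro)
  then show ?thesis using \<open>(t, x) \<in> W\<close> by (intro exI conjI)
qed

lemma points_of_path:
  assumes "smooth_atlas L" "smooth_map L X f" "c \<in> atlas_of L" "x \<in> chart_image c"
  shows "f (chart_inv c x) \<in> points X"
proof -
  have "chart_inv c x \<in> points L" using chart_inv_in[OF assms(4)] chart_subset[OF assms(1,3)] by blast
  then show ?thesis using assms(2) unfolding smooth_map_def continuous_map_def by blast
qed

lemma differential_form_velocity:
  assumes M: "smooth_atlas L" and MX: "smooth_atlas X" and f: "smooth_lifting X L \<Lambda> f"
    and sm: "\<And>t. t \<in> {0..1} \<Longrightarrow> smooth_map L X (f t)" and t: "t \<in> {0..1}" and \<alpha>: "differential_form X (Suc l) \<alpha>"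
  shows "differential_form L l (velocity_form X \<alpha> L f t)"
proof (rule differential_form_local[OF M])
  fix c x assume c: "c \<in> atlas_of L" and x: "x \<in> chart_image c"
  note e = chart_at_in[OF MX points_of_path[OF M sm[OF t] c x]]
  obtain W g where z: "(t, x) \<in> W" and pc: "path_chart X L f c (chart_at X (f t (chart_inv c x))) W g"
    using smooth_lifting_path_chart[OF M MX f sm t c x e] by blast
  interpret path_chart X L f c "chart_at X (f t (chart_inv c x))" W g by (rule pc)
  show "\<exists>S \<beta>. x \<in> S \<and> smooth_form S l \<beta> \<and> (\<forall>y\<in>S. y \<in> chart_image c \<longrightarrow>
      (\<forall>ws. length ws = l \<longrightarrow> local_form L (velocity_form X \<alpha> L f t) c y ws = \<beta> y ws))"
    using z local_form_velocity_path[OF _ t] smooth_form_slice_Cons[OF smooth_form_pull_g[OF \<alpha>] open_slice]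
    by (intro exI[of _ "{y. (t, y) \<in> W}"] exI[of _ "\<lambda>y ws. pull g (local_form X \<alpha> (chart_at X (f t (chart_inv c x)))) (t, y) ((1, 0) # map (Pair 0) ws)"]) simp
qed

lemma ext_d_pullback_at_point:
  assumes M: "smooth_atlas L" and MX: "smooth_atlas X" and f: "smooth_map L X f" and c: "c \<in> atlas_of L" and x: "x \<in> chart_image c"
    and gam: "differential_form X l gam" and dgam: "form_eq X (Suc l) (exterior_derivative X gam) \<beta>" and us: "length us = Suc l"
  shows "ext_d (local_form L (pullback L X f gam) c) x us = local_form L (pullback L X f \<beta>) c x us"
proof -
  have q: "f (chart_inv c x) \<in> points X" by (rule points_of_path[OF M f c x])
  let ?e = "chart_at X (f (chart_inv c x))"
  note e = chart_at_in[OF MX q]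
  let ?g = "\<lambda>y. snd ?e (f (chart_inv c y))"
  note s = smooth_map_in_charts[OF M MX f c e(1)]
  have xs: "x \<in> {x \<in> chart_image c. f (chart_inv c x) \<in> fst ?e}" using x e by simp
  have "ext_d (local_form L (pullback L X f gam) c) x us = ext_d (pull ?g (local_form X gam ?e)) x us"
    by (rule ext_d_cong_open[OF smooth_openD(1)[OF s] xs us]) (use local_form_pullback[OF M MX f c e(1)] in auto)
  also have "\<dots> = ext_d (local_form X gam ?e) (?g x) (map (frechet_derivative ?g (at x)) us)"
    by (rule ext_d_pull[OF smooth_form_local_form[OF MX e(1) gam] s _ xs us]) (simp add: chart_in_image)
  also have "\<dots> = local_form X \<beta> ?e (?g x) (map (frechet_derivative ?g (at x)) us)"
    by (rule exterior_derivative_at_point[OF MX q dgam]) (simp add: us)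
  also have "\<dots> = local_form L (pullback L X f \<beta>) c x us"
    unfolding local_form_pullback[OF M MX f c e(1) x e(2)] pull_def ..
  finally show ?thesis .
qed

text \<open>The expansion of d(g* \<eta>) along (1, 0) leaves (1 + a) times the contraction of
  \<omega> \<and> \<gamma> with the velocity. The Lagrangian condition reduces it to (i_v \<omega>)
  \<and> \<gamma>, that is dH \<and> \<gamma>, and this is d(H \<gamma>) - H \<beta>. The chart e is
  the one picked at the point, since there the hypotheses on X are available in coordinates.\<close>

lemma (in path_chart) path_derivative_identity:
  assumes e_def: "e = chart_at X (f t (chart_inv c x))" and z: "(t, x) \<in> W" and t: "t \<in> {0..1}" and us: "length us = Suc l"
    and \<omega>: "differential_form X 2 \<omega>" and lam: "differential_form X 1 lam" and gam: "differential_form X l gam"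
    and dlam: "form_eq X 2 (exterior_derivative X lam) \<omega>" and dgam: "form_eq X (Suc l) (exterior_derivative X gam) \<beta>"
    and rel: "form_eq X (1 + Suc l) (wedge 1 (Suc l) lam \<beta>) (scale_form (\<lambda>p. - a) (wedge 2 l \<omega> gam))"
    and lagr: "form_eq L 2 (pullback L X (f t) \<omega>) zero_form"
    and H: "smooth_function L H"
    and ham: "\<And>u. local_form L (velocity_form X \<omega> L f t) c x [u] = frechet_derivative (\<lambda>y. H (chart_inv c y)) (at x) u"
  shows "frechet_derivative (\<lambda>z. pull g (local_form X (wedge 1 l lam gam) e) z (map (Pair 0) us)) (at (t, x)) (1, 0) =
     ext_d (local_form L (velocity_form X (wedge 1 l lam gam) L f t) c) x us +
     (1 + a) * (ext_d (local_form L (scale_form H (pullback L X (f t) gam)) c) x us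
        - H (chart_inv c x) * local_form L (pullback L X (f t) \<beta>) c x us)"
proof -
  let ?\<eta> = "wedge 1 l lam gam" and ?y = "g (t, x)" and ?D = "\<lambda>u. Dg (t, x) (0, u)" and ?v = "Dg (t, x) (1, 0)"
  have x: "x \<in> chart_image c" by (rule Wc[OF z])
  have q: "f t (chart_inv c x) \<in> points X" by (rule points_of_path[OF M sm[OF t] c x])
  have yq: "?y = snd e (f t (chart_inv c x))" using g_eq[OF z t] by simp
  have \<eta>: "differential_form X (Suc l) ?\<eta>" using differential_form_wedge[OF MX lam gam] by simp
  have S1: "ext_d (\<lambda>y ws. pull g (local_form X ?\<eta> e) (t, y) ((1, 0) # map (Pair 0) ws)) x us
     = ext_d (local_form L (velocity_form X ?\<eta> L f t) c) x us"
    by (rule ext_d_cong_open[OF open_slice[of t] _ us]) (use z local_form_velocity_path[OF _ t] in auto)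
  have l2: "length (((1::real), (0::'e)) # map (Pair 0) us) = Suc (Suc l)" using us by simp
  have w: "alternating_multilinear 2 (local_form X \<omega> e ?y)"
    using smooth_formD(2)[OF smooth_form_local_form[OF MX e \<omega>] We[OF z]] .
  have "ext_d (pull g (local_form X ?\<eta> e)) (t, x) ((1, 0) # map (Pair 0) us) =
     ext_d (local_form X ?\<eta> e) ?y (map (Dg (t, x)) ((1, 0) # map (Pair 0) us))"
    by (rule ext_d_pull[OF smooth_form_local_form[OF MX e \<eta>] g We z l2])
  also have "map (Dg (t, x)) ((1, 0) # map (Pair 0) us) = ?v # map ?D us" by simp
  also have "ext_d (local_form X ?\<eta> e) ?y (?v # map ?D us) =
      (1 + a) * list_wedge 2 l (local_form X \<omega> e ?y) (local_form X gam e ?y) (?v # map ?D us)"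
    using ext_d_wedge_at_point[OF MX q lam gam dlam dgam rel, folded e_def yq, of "?v # map ?D us"] us by simp
  also have "list_wedge 2 l (local_form X \<omega> e ?y) (local_form X gam e ?y) (?v # map ?D us) =
      list_wedge 1 l (\<lambda>ws. local_form X \<omega> e ?y (?v # ws)) (local_form X gam e ?y) (map ?D us)"
  proof (rule list_wedge_2_contract)
    show "length (map ?D us) = Suc l" using us by simp
    show "local_form X \<omega> e ?y [b, d] = - local_form X \<omega> e ?y [d, b]" for b d
      using alternating_swap[OF w, of "[d, b]" 0 1] by simp
    fix b d assume "b \<in> set (map ?D us)" "d \<in> set (map ?D us)"
    then obtain u u' where u: "b = ?D u" "d = ?D u'" by auto
    have "local_form X \<omega> e ?y [b, d] = local_form L (pullback L X (f t) \<omega>) c x [u, u']"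
      unfolding local_form_pullback_path[OF z t] u by (simp add: pull_def)
    also have "\<dots> = 0"
      using lagr push_vector_in_tangent_space[OF M c x] chart_inv_in[OF x] chart_subset[OF M c]
      unfolding form_eq_def local_form_def by (auto simp: subset_iff)
    finally show "local_form X \<omega> e ?y [b, d] = 0" .
  qed
  also have "\<dots> = list_wedge 1 l (\<lambda>ws. local_form X \<omega> e ?y (?v # map ?D ws)) (\<lambda>ws. local_form X gam e ?y (map ?D ws)) us"
    by (rule list_wedge_map) (simp add: us)
  also have "\<dots> = list_wedge 1 l (\<lambda>ws. frechet_derivative (\<lambda>y. H (chart_inv c y)) (at x) (hd ws)) (local_form L (pullback L X (f t) gam) c x) us"
  proof (rule list_wedge_cong)
    fix ws :: "'e list" assume "length ws = 1"
    then obtain u where ws: "ws = [u]" by (cases ws) auto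
    show "local_form X \<omega> e ?y (?v # map ?D ws) = frechet_derivative (\<lambda>y. H (chart_inv c y)) (at x) (hd ws)"
      using ham[of u] unfolding local_form_velocity_path[OF z t] ws by (simp add: pull_def)
  next
    fix ws :: "'e list"
    show "local_form X gam e ?y (map ?D ws) = local_form L (pullback L X (f t) gam) c x ws"
      unfolding local_form_pullback_path[OF z t] by (simp add: pull_def o_def)
  qed (simp add: us)
  also have "\<dots> = ext_d (local_form L (scale_form H (pullback L X (f t) gam)) c) x us
        - H (chart_inv c x) * ext_d (local_form L (pullback L X (f t) gam) c) x us"
  proof -
    have Hc: "smooth_open (chart_image c) (\<lambda>y. H (chart_inv c y))" using H c unfolding smooth_function_iff[OF M] by blast
    note sf = smooth_form_local_form[OF M c differential_form_pullback[OF M MX sm[OF t] gam]]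
    have "local_form L (scale_form H (pullback L X (f t) gam)) c = (\<lambda>y ws. H (chart_inv c y) * local_form L (pullback L X (f t) gam) c y ws)"
      by (intro ext local_form_scale)
    then show ?thesis using ext_d_scale[OF sf Hc x us] by simp
  qed
  also have "ext_d (local_form L (pullback L X (f t) gam) c) x us = local_form L (pullback L X (f t) \<beta>) c x us"
    by (rule ext_d_pullback_at_point[OF M MX sm[OF t] c x gam dgam us])
  finally show ?thesis
    using ext_d_split_first[OF smooth_form_pull_g[OF \<eta>] z us, of "(1, 0)"] S1 by simp
qed

section \<open>Differentiation under the integral sign\<close>

lemma continuous_on_local:
  fixes \<psi> :: "'a::t2_space \<Rightarrow> 'b::topological_space"
  assumes "\<And>z. z \<in> S \<Longrightarrow> \<exists>W \<phi>. open W \<and> z \<in> W \<and> continuous_on W \<phi> \<and> (\<forall>w\<in>S \<inter> W. \<phi> w = \<psi> w)"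
  shows "continuous_on S \<psi>"
  unfolding continuous_on_def
proof
  fix z assume z: "z \<in> S"
  obtain W \<phi> where W: "open W" "z \<in> W" "continuous_on W \<phi>" "\<forall>w\<in>S \<inter> W. \<phi> w = \<psi> w"
    using assms[OF z] by (elim exE conjE) (rule that)
  have "isCont \<phi> z" using W(2,3) by (simp add: continuous_on_eq_continuous_at[OF W(1)])
  then have 1: "(\<phi> \<longlongrightarrow> \<phi> z) (at z within S)"
    unfolding isCont_def by (rule tendsto_within_subset[OF _ subset_UNIV])
  have 2: "\<forall>\<^sub>F w in at z within S. \<phi> w = \<psi> w"
    unfolding eventually_at_topological using W by (intro exI[of _ W]) auto
  have 3: "\<phi> z = \<psi> z" using W z by auto
  show "(\<psi> \<longlongrightarrow> \<psi> z) (at z within S)" using Lim_transform_eventually[OF 1 2] unfolding 3 .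
qed

text \<open>The Leibniz rule works over a box, so \<phi> and \<phi>' are extended by 0. A single
  compact S contains the supports for all t; since \<phi> vanishes off S at all times, so does its
  time derivative.\<close>

lemma has_vector_derivative_integral_compact_support:
  fixes \<phi> \<phi>' :: "real \<Rightarrow> 'a::euclidean_space \<Rightarrow> real"
  assumes U: "open U" and S: "compact S" "S \<subseteq> U"
    and d: "\<And>t x. t \<in> {0..1} \<Longrightarrow> x \<in> U \<Longrightarrow> ((\<lambda>s. \<phi> s x) has_vector_derivative \<phi>' t x) (at t within {0..1})"
    and c': "continuous_on ({0..1} \<times> U) (\<lambda>(t, x). \<phi>' t x)" and c: "\<And>t. t \<in> {0..1} \<Longrightarrow> continuous_on U (\<phi> t)"
    and z: "\<And>t x. t \<in> {0..1} \<Longrightarrow> x \<in> U - S \<Longrightarrow> \<phi> t x = 0" and t: "t \<in> {0..1}"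
  shows "((\<lambda>t. integral U (\<phi> t)) has_vector_derivative integral U (\<phi>' t)) (at t within {0..1})"
proof -
  have z': "\<phi>' t x = 0" if "t \<in> {0..1}" "x \<in> U - S" for t x
  proof -
    have "((\<lambda>s. \<phi> s x) has_vector_derivative 0) (at t within {0..1})"
      by (rule has_vector_derivative_transform[OF that(1) _ has_vector_derivative_const[of 0]]) (use z that in auto)
    then show ?thesis
      using vector_derivative_within_cbox[of 0 1 t "\<lambda>s. \<phi> s x" 0]
        vector_derivative_within_cbox[of 0 1 t "\<lambda>s. \<phi> s x" "\<phi>' t x"] d[OF that(1), of x] that by simp
  qed
  obtain b where b: "S \<subseteq> cbox (- b) b" using bounded_subset_cbox_symmetric[OF compact_imp_bounded[OF S(1)]] by blast
  have oS: "open (- S)" by (rule open_Compl[OF compact_imp_closed[OF S(1)]])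
  define \<psi> where "\<psi> t x = (if x \<in> U then \<phi> t x else 0)" for t x
  define \<psi>' where "\<psi>' t x = (if x \<in> U then \<phi>' t x else 0)" for t x
  \<comment> \<open>The set T is the whole interval when applied to \<phi>', which is jointly
    continuous, and a single time when applied to \<phi>, where continuity is given for each t
    separately.\<close>
  have ext: "continuous_on (T \<times> UNIV) (\<lambda>(t, x). if x \<in> U then h t x else 0)"
    if hc: "continuous_on (T \<times> U) (\<lambda>(t, x). h t x)" and h0: "\<And>t x. t \<in> T \<Longrightarrow> x \<in> U - S \<Longrightarrow> h t x = 0" for T and h :: "real \<Rightarrow> 'a \<Rightarrow> real"
    unfolding continuous_on_def
  proof
    fix w assume w: "w \<in> T \<times> (UNIV :: 'a set)"
    let ?h = "\<lambda>(t, x). if x \<in> U then h t x else 0"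
    obtain t x where wx: "w = (t, x)" "t \<in> T" using w by auto
    show "(?h \<longlongrightarrow> ?h w) (at w within T \<times> UNIV)"
    proof (cases "x \<in> U")
      case True
      have "((\<lambda>(t, x). h t x) \<longlongrightarrow> (\<lambda>(t, x). h t x) w) (at w within T \<times> U)"
        using hc wx True unfolding continuous_on_def by blast
      moreover have "at w within T \<times> U = at w within T \<times> UNIV"
        by (rule at_within_nhd[of _ "UNIV \<times> U"]) (use wx True U in \<open>auto intro: open_Times\<close>)
      ultimately have "((\<lambda>(t, x). h t x) \<longlongrightarrow> ?h w) (at w within T \<times> UNIV)" using wx True by simp
      moreover have "\<forall>\<^sub>F w in at w within T \<times> UNIV. (\<lambda>(t, x). h t x) w = ?h w"
        unfolding eventually_at_topological using wx True U by (intro exI[of _ "UNIV \<times> U"]) (auto intro: open_Times)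
      ultimately show ?thesis by (rule Lim_transform_eventually)
    next
      case False
      then have "x \<in> - S" using S(2) by blast
      then have ev: "\<forall>\<^sub>F w in at w within T \<times> UNIV. 0 = ?h w"
        unfolding eventually_at_topological using wx oS h0 by (intro exI[of _ "UNIV \<times> (- S)"]) (auto intro: open_Times)
      have "?h w = 0" using wx False by simp
      then show ?thesis using Lim_transform_eventually[OF tendsto_const ev] by (simp only:)
    qed
  qed
  have ic: "integral U (\<phi> t) = integral (cbox (- b) b) (\<psi> t)" if "t \<in> {0..1}" for t
  proof -
    have "integral U (\<phi> t) = integral S (\<phi> t)" by (rule integral_zero_extension[OF S(2)]) (use z that in auto)
    also have "\<dots> = integral S (\<psi> t)" using S(2) by (intro integral_cong) (auto simp: \<psi>_def)
    also have "\<dots> = integral (cbox (- b) b) (\<psi> t)"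
      by (rule integral_zero_extension[symmetric, OF b]) (use z that in \<open>auto simp: \<psi>_def\<close>)
    finally show ?thesis .
  qed
  have ic': "integral U (\<phi>' t) = integral (cbox (- b) b) (\<psi>' t)" if "t \<in> {0..1}" for t
  proof -
    have "integral U (\<phi>' t) = integral S (\<phi>' t)" by (rule integral_zero_extension[OF S(2)]) (use z' that in auto)
    also have "\<dots> = integral S (\<psi>' t)" using S(2) by (intro integral_cong) (auto simp: \<psi>'_def)
    also have "\<dots> = integral (cbox (- b) b) (\<psi>' t)"
      by (rule integral_zero_extension[symmetric, OF b]) (use z' that in \<open>auto simp: \<psi>'_def\<close>)
    finally show ?thesis .
  qed
  have "((\<lambda>t. integral (cbox (- b) b) (\<psi> t)) has_vector_derivative integral (cbox (- b) b) (\<psi>' t)) (at t within {0..1})"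
  proof (rule leibniz_rule_vector_derivative[OF _ _ _ t])
    show "((\<lambda>s. \<psi> s x) has_vector_derivative \<psi>' t x) (at t within {0..1})" if "t \<in> {0..1}" for t x
      using d[OF that, of x] by (cases "x \<in> U") (simp_all add: \<psi>_def \<psi>'_def)
    show "continuous_on ({0..1} \<times> cbox (- b) b) (\<lambda>(t, x). \<psi>' t x)"
      unfolding \<psi>'_def by (rule continuous_on_subset[OF ext[OF c' z']]) auto
    show "\<psi> t integrable_on cbox (- b) b" if t: "t \<in> {0..1}" for t
    proof (rule integrable_continuous)
      have "continuous_on ({t} \<times> U) (\<lambda>(s, x). \<phi> t x)"
        unfolding case_prod_unfold by (rule continuous_on_compose2[OF c[OF t] continuous_on_snd]) (auto intro: continuous_intros)
      from ext[of "{t}" "\<lambda>s. \<phi> t", OF this] z[OF t]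
      have "continuous_on ({t} \<times> UNIV) (\<lambda>(s, x). if x \<in> U then \<phi> t x else 0)" by blast
      moreover have "continuous_on UNIV (\<lambda>x::'a. (t, x))" by (intro continuous_intros)
      ultimately have "continuous_on UNIV (\<lambda>x. (\<lambda>(s, x). if x \<in> U then \<phi> t x else 0) (t, x))"
        by (rule continuous_on_compose2) auto
      then have "continuous_on UNIV (\<psi> t)" unfolding \<psi>_def by simp
      then show "continuous_on (cbox (- b) b) (\<psi> t)" by (rule continuous_on_subset) simp
    qed
  qed simp
  then show ?thesis
    unfolding ic'[OF t] using ic
    by (intro has_vector_derivative_transform[OF t, of "\<lambda>t. integral U (\<phi> t)"]) auto
qed

lemma density_add:
  assumes "density L D" "density L D'" shows "density L (\<lambda>c x. D c x + a * D' c x)"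
  using assms unfolding density_def
  by (auto intro!: continuous_intros simp: algebra_simps)

lemma not_in_form_support:
  assumes "p \<in> points M" "p \<notin> form_support M k \<theta>" "length vs = k" "set vs \<subseteq> tangent_space M p"
  shows "\<theta> p vs = 0"
proof (rule ccontr)
  assume "\<theta> p vs \<noteq> 0"
  then have "p \<in> {p \<in> points M. \<exists>vs. length vs = k \<and> set vs \<subseteq> tangent_space M p \<and> \<theta> p vs \<noteq> 0}" using assms by blast
  moreover have "{p \<in> points M. \<exists>vs. length vs = k \<and> set vs \<subseteq> tangent_space M p \<and> \<theta> p vs \<noteq> 0} \<subseteq> form_support M k \<theta>"
    unfolding form_support_def by (rule closure_of_subset) blast
  ultimately show False using assms(2) by blast
qed

lemma form_support_scale_subset: "form_support M k (scale_form u \<theta>) \<subseteq> function_support M u"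
  unfolding form_support_def function_support_def by (rule closure_of_mono) auto

lemma closedin_form_support: "closedin (top_of M) (form_support M k \<theta>)"
  by (simp add: form_support_def)

lemma vector_derivative_unit_interval:
  "t \<in> {0..1} \<Longrightarrow> (f has_vector_derivative f') (at t within {0..1::real}) \<Longrightarrow> vector_derivative f (at t within {0..1}) = f'"
  using vector_derivative_within_cbox[of 0 1 t f f'] by simp

lemma local_form_chart_inv_cong: "chart_inv c = chart_inv c' \<Longrightarrow> local_form M \<alpha> c = local_form M \<alpha> c'"
  unfolding local_form_def by simp

section \<open>The Calabi invariant of an exact path\<close>

text \<open>Here l stands for n - 1 and a for the constant of the relation. The lifting f is tied to
  the choice made in \<open>path_derivative\<close>, and K0 is a compact set off which it is
  stationary at all times.\<close>

locale calabi_path =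
  fixes X :: "('x, 'm::euclidean_space) manifold" and L :: "('l, real^'n::{finite,wellorder}) manifold"
    and \<omega> \<beta> lam gam :: "('x, 'm) form" and d :: "'x chain set" and f0 :: "'l \<Rightarrow> 'x" and a :: real
    and \<Lambda> :: "real \<Rightarrow> ('l \<Rightarrow> 'x) set" and h :: "real \<Rightarrow> 'x \<Rightarrow> real" and l :: nat and f :: "real \<Rightarrow> 'l \<Rightarrow> 'x" and K0 :: "'l set"
  assumes X: "smooth_manifold X" and L: "oriented_manifold L" and n: "CARD('n) = Suc l"
    and \<omega>: "differential_form X 2 \<omega>" and \<beta>: "differential_form X (Suc l) \<beta>"
    and lam: "differential_form X 1 lam" and gam: "differential_form X l gam"
    and dlam: "form_eq X 2 (exterior_derivative X lam) \<omega>" and dgam: "form_eq X (Suc l) (exterior_derivative X gam) \<beta>"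
    and rel: "form_eq X (1 + Suc l) (wedge 1 (Suc l) lam \<beta>) (scale_form (\<lambda>p. - a) (wedge 2 l \<omega> gam))"
    and lag: "\<And>t. t \<in> {0..1} \<Longrightarrow> \<Lambda> t \<in> lagrangian_space X \<omega> L d f0"
    and f_def: "f = (SOME f. smooth_lifting X L \<Lambda> f)" and f: "smooth_lifting X L \<Lambda> f"
    and ham: "associated_hamiltonians X \<omega> L \<Lambda> h"
    and K0: "compactin (top_of L) K0" and off: "\<And>t p. t \<in> {0..1} \<Longrightarrow> p \<in> points L - K0 \<Longrightarrow> f t p = f 0 p"
begin

lemma M: "smooth_atlas L" by (rule oriented_manifold_smooth_atlas[OF L])
lemma MX: "smooth_atlas X" by (rule smooth_manifold_smooth_atlas[OF X])
lemma HL: "Hausdorff_space (top_of L)" by (rule oriented_manifold_Hausdorff[OF L])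

lemma in_class: "t \<in> {0..1} \<Longrightarrow> f t \<in> \<Lambda> t"
  using f unfolding smooth_lifting_def by blast

lemma embedding: "t \<in> {0..1} \<Longrightarrow> smooth_embedding L X (f t)"
  and lagrangian: "t \<in> {0..1} \<Longrightarrow> form_eq L 2 (pullback L X (f t) \<omega>) zero_form"
  using lagrangian_class_embedding[OF lag in_class] unfolding lagrangian_embeddings_def by auto

lemma smooth_f: "t \<in> {0..1} \<Longrightarrow> smooth_map L X (f t)"
  using embedding unfolding smooth_embedding_def by blast

abbreviation \<eta> where "\<eta> \<equiv> wedge 1 l lam gam"
abbreviation Nt where "Nt t \<equiv> image_manifold X L (f t)"
abbreviation Ht where "Ht t \<equiv> \<lambda>p. h t (f t p)"
abbreviation At where "At t \<equiv> \<lambda>c x. local_form L (pullback L X (f t) \<eta>) c x standard_frame"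

text \<open>The time derivative of the coefficient of the pulled back \<eta>, defined without
  reference to the local extension g, which depends on the point.\<close>

definition dA :: "real \<Rightarrow> ('l, real^'n::_) chart \<Rightarrow> real^'n::_ \<Rightarrow> real" where
  "dA t c x = vector_derivative (\<lambda>s. At s c x) (at t within {0..1})"

abbreviation D1 where "D1 t \<equiv> \<lambda>c x. ext_d (local_form L (velocity_form X \<eta> L f t) c) x standard_frame"
abbreviation D2 where "D2 t \<equiv> \<lambda>c x. ext_d (local_form L (scale_form (Ht t) (pullback L X (f t) gam)) c) x standard_frame"
abbreviation D3 where "D3 t \<equiv> \<lambda>c x. local_form L (scale_form (Ht t) (pullback L X (f t) \<beta>)) c x standard_frame"

lemma \<eta>_form: "differential_form X (Suc l) \<eta>"
  using differential_form_wedge[OF MX lam gam] by simp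

lemma submanifold: "t \<in> {0..1} \<Longrightarrow> submanifold_of_class X L (\<Lambda> t) = Nt t"
  by (rule submanifold_of_class_eq[OF L lag in_class])

lemma hamiltonian: "t \<in> {0..1} \<Longrightarrow> smooth_function (Nt t) (h t)"
  and hamiltonian_support: "t \<in> {0..1} \<Longrightarrow> compactin (top_of (Nt t)) (function_support (Nt t) (h t))"
  using ham submanifold unfolding associated_hamiltonians_def Let_def by auto

lemma smooth_Ht: "t \<in> {0..1} \<Longrightarrow> smooth_function L (Ht t)"
  by (rule smooth_function_image_manifold[OF L embedding hamiltonian])

lemma local_path_chart:
  assumes t: "t \<in> {0..1}" and c: "c \<in> atlas_of L" and x: "x \<in> chart_image c"
  obtains W g where "(t, x) \<in> W" "path_chart X L f c (chart_at X (f t (chart_inv c x))) W g"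
  using smooth_lifting_path_chart[OF M MX f smooth_f t c x chart_at_in[OF MX points_of_path[OF M smooth_f[OF t] c x]]] by blast

lemma dA_derivative:
  assumes t: "t \<in> {0..1}" and c: "c \<in> atlas_of L" and x: "x \<in> chart_image c"
  shows "((\<lambda>s. At s c x) has_vector_derivative dA t c x) (at t within {0..1})"
    "dA t c x = D1 t c x + (1 + a) * (D2 t c x + (-1) * D3 t c x)"
proof -
  obtain W g where z: "(t, x) \<in> W" and pc: "path_chart X L f c (chart_at X (f t (chart_inv c x))) W g"
    by (rule local_path_chart[OF t c x])
  note v = path_chart.has_vector_derivative_pullback_path[OF pc \<eta>_form _ z t, of standard_frame]
  have e: "dA t c x = frechet_derivative (\<lambda>z. pull g (local_form X \<eta> (chart_at X (f t (chart_inv c x)))) z (map (Pair 0) standard_frame)) (at (t, x)) (1, 0)"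
    unfolding dA_def by (rule vector_derivative_unit_interval[OF t v]) (simp add: n)
  show "((\<lambda>s. At s c x) has_vector_derivative dA t c x) (at t within {0..1})"
    unfolding e by (rule v) (simp add: n)
  have "length (standard_frame :: (real^'n::_) list) = Suc l" by (simp add: n)
  from path_chart.path_derivative_identity[OF pc refl z t this \<omega> lam gam dlam dgam rel lagrangian[OF t] smooth_Ht[OF t]
      velocity_form_hamiltonian[OF L X lag f_def f ham t c x]]
  show "dA t c x = D1 t c x + (1 + a) * (D2 t c x + (-1) * D3 t c x)"
    unfolding e by (simp add: local_form_scale)
qed

text \<open>Joint continuity is read off from the local extensions, one near each point. It could
  not come from the three terms of the identity for \<open>dA\<close>, since nothing is known about
  the dependence of H_t on t.\<close>

lemma dA_continuous:
  assumes c: "c \<in> atlas_of L"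
  shows "continuous_on ({0..1} \<times> chart_image c) (\<lambda>(t, x). dA t c x)"
proof (rule continuous_on_local)
  fix z :: "real \<times> (real^'n::_)" assume "z \<in> {0..1} \<times> chart_image c"
  then obtain t x where z: "z = (t, x)" and t: "t \<in> {0..1}" and x: "x \<in> chart_image c" by auto
  let ?e = "chart_at X (f t (chart_inv c x))"
  obtain W g where zW: "(t, x) \<in> W" and pc: "path_chart X L f c ?e W g"
    by (rule local_path_chart[OF t c x])
  interpret path_chart X L f c ?e W g by (rule pc)
  let ?G = "\<lambda>z. pull g (local_form X \<eta> ?e) z (map (Pair 0) standard_frame)"
  have G: "smooth_open W ?G" by (rule smooth_formD(4)[OF smooth_form_pull_g[OF \<eta>_form]]) (simp add: n)
  have "continuous_on W (\<lambda>z. frechet_derivative ?G (at z) (1, 0))"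
    by (rule smooth_open_continuous_on[OF smooth_open_frechet_derivative[OF G smooth_open_const[OF W_open]]])
  moreover have "frechet_derivative ?G (at w) (1, 0) = (\<lambda>(t, x). dA t c x) w" if w: "w \<in> {0..1} \<times> chart_image c \<inter> W" for w
  proof -
    obtain s y where sy: "w = (s, y)" "s \<in> {0..1}" "(s, y) \<in> W" using w by auto
    have "vector_derivative (\<lambda>s. At s c y) (at s within {0..1}) = frechet_derivative ?G (at (s, y)) (1, 0)"
      by (rule vector_derivative_unit_interval[OF sy(2) has_vector_derivative_pullback_path[OF \<eta>_form _ sy(3,2)]]) (simp add: n)
    then show ?thesis unfolding dA_def sy(1) by simp
  qed
  ultimately show "\<exists>W \<phi>. open W \<and> z \<in> W \<and> continuous_on W \<phi> \<and> (\<forall>w\<in>{0..1} \<times> chart_image c \<inter> W. \<phi> w = (\<lambda>(t, x). dA t c x) w)"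
    using zW W_open unfolding z by (intro exI[of _ W] exI[of _ "\<lambda>z. frechet_derivative ?G (at z) (1, 0)"] conjI ballI)
qed

lemma At_off:
  assumes t: "t \<in> {0..1}" and c: "c \<in> atlas_of L" and x: "x \<in> chart_image c" "chart_inv c x \<notin> K0"
  shows "At t c x = At 0 c x"
  by (rule local_form_pullback_cong[OF M MX smooth_f[OF t] smooth_f compactin_imp_closedin[OF HL K0] off[OF t] c x]) auto

lemma dA_off:
  assumes t: "t \<in> {0..1}" and c: "c \<in> atlas_of L" and x: "x \<in> chart_image c" "chart_inv c x \<notin> K0"
  shows "dA t c x = 0"
  unfolding dA_def
proof (rule vector_derivative_unit_interval[OF t])
  show "((\<lambda>s. At s c x) has_vector_derivative 0) (at t within {0..1})"
    by (rule has_vector_derivative_transform[OF t _ has_vector_derivative_const[of "At 0 c x"]]) (rule At_off[OF _ c x])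
qed

text \<open>Off K0 the lifting is stationary, so its velocity is 0, and a form is linear in the slot
  into which the velocity is inserted.\<close>

lemma velocity_off:
  assumes t: "t \<in> {0..1}" and c: "c \<in> atlas_of L" and x: "x \<in> chart_image c" "chart_inv c x \<notin> K0" and ws: "length ws = l"
  shows "local_form L (velocity_form X \<eta> L f t) c x ws = 0"
proof -
  let ?e = "chart_at X (f t (chart_inv c x))"
  obtain W g where z: "(t, x) \<in> W" and pc: "path_chart X L f c ?e W g"
    by (rule local_path_chart[OF t c x(1)])
  interpret path_chart X L f c ?e W g by (rule pc)
  have p: "chart_inv c x \<in> points L - K0" using x chart_inv_in[OF x(1)] chart_subset[OF M c] by blast
  have "Dg (t, x) (1, 0) = velocity X f t (chart_inv c x) ?e"
    unfolding velocity_path[OF z t] by (rule push_vector_chart_component[OF MX e We[OF z], symmetric])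
  also have "\<dots> = vector_derivative (\<lambda>s. snd ?e (f s (chart_inv c x))) (at t within {0..1})"
    unfolding velocity_def by (rule if_P[OF conjI[OF e Wf[OF z t]]])
  also have "\<dots> = 0"
  proof (rule vector_derivative_unit_interval[OF t])
    show "((\<lambda>s. snd ?e (f s (chart_inv c x))) has_vector_derivative 0) (at t within {0..1})"
      by (rule has_vector_derivative_transform[OF t _ has_vector_derivative_const[of "snd ?e (f 0 (chart_inv c x))"]])
         (rule arg_cong[OF off[OF _ p]])
  qed
  finally have D0: "Dg (t, x) (1, 0) = 0" .
  have "multilinear (Suc l) (local_form X \<eta> ?e (g (t, x)))"
    by (rule smooth_formD(3)[OF smooth_form_local_form[OF MX e \<eta>_form] We[OF z]])
  from multilinearD[OF this, of "[]"] have "linear (\<lambda>w. local_form X \<eta> ?e (g (t, x)) (w # map (\<lambda>u. Dg (t, x) (0, u)) ws))"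
    using ws by simp
  from linear_0[OF this] show ?thesis
    unfolding local_form_velocity_path[OF z t] by (simp add: pull_def D0 o_def)
qed

lemma density_At: "t \<in> {0..1} \<Longrightarrow> density L (At t)"
  using differential_form_pullback[OF M MX smooth_f \<eta>_form] by (intro density_local_form[OF M]) (simp add: n)

lemma form_velocity: "t \<in> {0..1} \<Longrightarrow> differential_form L l (velocity_form X \<eta> L f t)"
  by (rule differential_form_velocity[OF M MX f smooth_f _ \<eta>_form])

lemma form_H_gam: "t \<in> {0..1} \<Longrightarrow> differential_form L l (scale_form (Ht t) (pullback L X (f t) gam))"
  by (rule differential_form_scale[OF M smooth_Ht differential_form_pullback[OF M MX smooth_f gam]])

lemma form_H_beta: "t \<in> {0..1} \<Longrightarrow> differential_form L CARD('n) (scale_form (Ht t) (pullback L X (f t) \<beta>))"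
  unfolding n by (rule differential_form_scale[OF M smooth_Ht differential_form_pullback[OF M MX smooth_f \<beta>]])

text \<open>For fixed t the domain is enlarged so that it contains the support of H_t too; there
  Stokes' theorem removes \<open>D1\<close> and \<open>D2\<close>. The surviving \<open>D3\<close>
  is carried to the submanifold, where \<open>form_integral\<close> lives.\<close>

lemma chart_integral_dA:
  assumes t: "t \<in> {0..1}" and W: "weights L K0 I C R Z"
  shows "chart_integral I C R K0 (dA t) =
    - (1 + a) * form_integral (Nt t) (scale_form (h t) (pullback (Nt t) X (\<lambda>q. q) \<beta>))"
proof -
  note se = embedding[OF t] and hm = image_manifold_homeomorphic[OF embedding[OF t]]
  note MN = image_manifold_smooth_atlas[OF L embedding[OF t]]
  define K1 where "K1 = {p \<in> points L. f t p \<in> function_support (Nt t) (h t)}"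
  have K1: "compactin (top_of L) K1"
    unfolding K1_def by (rule compactin_image_manifold_vimage[OF se hamiltonian_support[OF t]])
  \<comment> \<open>Off K0 the lifting stands still but H_t may still be nonzero, so K0 alone need
    not contain the support of H_t \<gamma>.\<close>
  define K2 where "K2 = K0 \<union> K1"
  have K2: "compactin (top_of L) K2" unfolding K2_def by (rule compactin_Un[OF K0 K1])
  note cl0 = compactin_imp_closedin[OF HL K0] and cl2 = compactin_imp_closedin[OF HL K2]
  define Q where "Q = (SOME P. partition_of_unity_on L K2 P)"
  define ZQ where "ZQ i = function_support L (snd i)" for i :: "('l, real^'n::_) chart \<times> ('l \<Rightarrow> real)"
  have WQ: "weights L K2 Q fst snd ZQ" unfolding Q_def ZQ_def by (rule some_partition_weights[OF M HL K2])
  have WQ': "weights L K Q fst snd ZQ" if "K \<subseteq> K2" for K using WQ that unfolding weights_def by blast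
  have cQ: "fst i \<in> atlas_of L" if "i \<in> Q" for i using WQ that by (simp add: weights_def)
  note d1 = density_ext_d[OF M form_velocity[OF t] n] and d2 = density_ext_d[OF M form_H_gam[OF t] n]
    and d3 = density_local_form[OF M form_H_beta[OF t]]
  let ?E = "\<lambda>c x. D2 t c x + (-1) * D3 t c x"
  let ?D = "\<lambda>c x. D1 t c x + (1 + a) * ?E c x"
  note dE = density_add[OF d2 d3, of "-1"]
  note dD = density_add[OF d1 dE, of "1 + a"]
  have Hoff: "Ht t p = 0" if p: "p \<in> points L" "p \<notin> K1" for p
  proof (rule not_in_function_support[of "f t p" "Nt t" "h t"])
    show "f t p \<in> points (Nt t)" by (rule homeomorphic_map_inv_into_simps(1)[OF hm p(1)])
    show "f t p \<notin> function_support (Nt t) (h t)" using p by (simp add: K1_def)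
  qed
  have "chart_integral I C R K0 (dA t) = chart_integral I C R K0 ?D"
    by (rule chart_integral_cong) (use W dA_derivative(2)[OF t] in \<open>simp add: weights_def\<close>)
  also have "\<dots> = chart_integral Q fst snd K0 ?D"
    by (rule chart_integral_independent[OF L cl0 W WQ' dD]) (simp add: K2_def)
  \<comment> \<open>Shrinking is used backwards: the sum of the three terms is the time derivative
    and vanishes off K0, although the single terms need not.\<close>
  also have "\<dots> = chart_integral Q fst snd K2 ?D"
  proof (rule chart_integral_shrink[symmetric])
    fix i x assume i: "i \<in> Q" and x: "x \<in> chart_image (fst i)" "chart_inv (fst i) x \<in> K2 - K0"
    show "?D (fst i) x = 0" using dA_off[OF t cQ[OF i] x(1)] dA_derivative(2)[OF t cQ[OF i] x(1)] x(2) by simp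
  qed (simp add: K2_def)
  also have "\<dots> = chart_integral Q fst snd K2 (D1 t) + (1 + a) * chart_integral Q fst snd K2 ?E"
    by (rule chart_integral_diff[OF M cl2 WQ d1 dE])
  also have "chart_integral Q fst snd K2 ?E = chart_integral Q fst snd K2 (D2 t) + (-1) * chart_integral Q fst snd K2 (D3 t)"
    by (rule chart_integral_diff[OF M cl2 WQ d2 d3])
  also have "chart_integral Q fst snd K2 (D1 t) = 0"
    by (rule chart_integral_ext_d_eq_0[OF L K2 form_velocity[OF t] n WQ]) (rule velocity_off[OF t], auto simp: K2_def)
  also have "chart_integral Q fst snd K2 (D2 t) = 0"
  proof (rule chart_integral_ext_d_eq_0[OF L K2 form_H_gam[OF t] n WQ])
    fix c x and ws :: "(real^'n::_) list" assume c: "c \<in> atlas_of L" "x \<in> chart_image c" "chart_inv c x \<notin> K2"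
    then have "chart_inv c x \<in> points L" "chart_inv c x \<notin> K1"
      using chart_inv_in[OF c(2)] chart_subset[OF M c(1)] by (auto simp: K2_def)
    then show "local_form L (scale_form (Ht t) (pullback L X (f t) gam)) c x ws = 0"
      unfolding local_form_scale using Hoff by simp
  qed
  also have "chart_integral Q fst snd K2 (D3 t) = form_integral (Nt t) (scale_form (h t) (pullback (Nt t) X (\<lambda>q. q) \<beta>))"
  proof -
    let ?\<theta> = "scale_form (h t) (pullback (Nt t) X (\<lambda>q. q) \<beta>)"
    let ?S = "form_support (Nt t) CARD('n) ?\<theta>"
    have S: "compactin (top_of (Nt t)) ?S"
      by (rule closed_compactin[OF hamiltonian_support[OF t] form_support_scale_subset closedin_form_support])
    define K3 where "K3 = {p \<in> points L. f t p \<in> ?S}"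
    have K3: "compactin (top_of L) K3" unfolding K3_def by (rule compactin_image_manifold_vimage[OF se S])
    \<comment> \<open>\<open>form_integral\<close> runs over the support of the form H_t \<beta>,
      which can be smaller than that of H_t. On K2 outside its preimage K3 the coefficient is 0, so
      both domains give the same value.\<close>
    have K32: "K3 \<subseteq> K2" using form_support_scale_subset[of "Nt t"] unfolding K3_def K2_def K1_def by (intro subsetI UnI2) auto
    have "form_integral (Nt t) ?\<theta> = form_integral_over L K3 (scale_form (Ht t) (pullback L X (f t) \<beta>))"
      unfolding form_integral_def K3_def
      by (rule form_integral_over_image[OF L X se hamiltonian[OF t] _ S]) (simp add: n \<beta>)
    also have "\<dots> = chart_integral Q fst snd K3 (D3 t)"
      by (rule form_integral_over_eq[OF L K3 form_H_beta[OF t] WQ'[OF K32]])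
    also have "\<dots> = chart_integral Q fst snd K2 (D3 t)"
    proof (rule chart_integral_shrink[OF K32, symmetric])
      fix i x assume i: "i \<in> Q" and x: "x \<in> chart_image (fst i)" "chart_inv (fst i) x \<in> K2 - K3"
      note pc = push_chart[OF L se cQ[OF i]]
      let ?c = "push_chart L (f t) (fst i)"
      have x': "x \<in> chart_image ?c" using x pc(4) by simp
      have ci: "chart_inv ?c x = f t (chart_inv (fst i) x)"
        using chart_inv_pull_chart[OF hm image_manifold_is_chart[OF M se pc(1)] x'] pc(3) by simp
      have p: "chart_inv (fst i) x \<in> points L" using chart_inv_in[OF x(1)] chart_subset[OF M cQ[OF i]] by blast
      have "D3 t (fst i) x = local_form (Nt t) ?\<theta> ?c x standard_frame"
        unfolding local_form_scale local_form_image_manifold[OF L X se pc(1) x']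
          local_form_chart_inv_cong[OF pc(3)] ci ..
      also have "\<dots> = 0"
        unfolding local_form_def
      proof (rule not_in_form_support[where \<theta> = ?\<theta> and M = "Nt t" and k = "CARD('n)"])
        show "chart_inv ?c x \<in> points (Nt t)" unfolding ci by (rule homeomorphic_map_inv_into_simps(1)[OF hm p])
        show "chart_inv ?c x \<notin> ?S" unfolding ci using x(2) p by (simp add: K3_def)
        show "length (map (push_vector (Nt t) (chart_inv ?c) x) (standard_frame :: (real^'n::_) list)) = CARD('n)" by simp
        show "set (map (push_vector (Nt t) (chart_inv ?c) x) standard_frame) \<subseteq> tangent_space (Nt t) (chart_inv ?c x)"
          using push_vector_in_tangent_space[OF MN pc(1) x'] by auto
      qed
      finally show "D3 t (fst i) x = 0" .
    qed
    finally show ?thesis by simp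
  qed
  finally show ?thesis by (simp add: algebra_simps)
qed

text \<open>The integral is differentiated chart by chart and the fundamental theorem of calculus is
  applied in t.\<close>

lemma chart_integral_dA_has_integral:
  assumes W: "weights L K0 I C R Z"
  shows "((\<lambda>t. chart_integral I C R K0 (dA t)) has_integral
     (chart_integral I C R K0 (At 1) - chart_integral I C R K0 (At 0))) {0..1}"
proof -
  note cl0 = compactin_imp_closedin[OF HL K0]
  \<comment> \<open>Subtracting the value at time 0 makes the integrand vanish off K0. The cut-off
    at K0, which is discontinuous in general, can then be dropped, and the integrand is continuous
    with support in a fixed compact set.\<close>
  define J where "J t = chart_integral I C R K0 (\<lambda>c x. At t c x + (-1) * At 0 c x)" for t
  have fin: "finite I" using W by (simp add: weights_def)
  have J: "(J has_vector_derivative chart_integral I C R K0 (dA t)) (at t within {0..1})" if t: "t \<in> {0..1}" for t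
  proof -
    let ?\<phi> = "\<lambda>i t x. R i (chart_inv (C i) x) * (At t (C i) x + (-1) * At 0 (C i) x)"
    let ?\<phi>' = "\<lambda>i t x. R i (chart_inv (C i) x) * dA t (C i) x"
    have "((\<lambda>t. integral (chart_image (C i)) (?\<phi> i t)) has_vector_derivative integral (chart_image (C i)) (?\<phi>' i t)) (at t within {0..1})"
      if i: "i \<in> I" for i
    proof -
      have c: "C i \<in> atlas_of L" and Zi: "Z i \<subseteq> fst (C i)" "compactin (top_of L) (Z i)"
        and Ri: "continuous_map (top_of L) euclidean (R i)" "\<And>p. p \<in> K0 - Z i \<Longrightarrow> R i p = 0"
        using W i by (auto simp: weights_def)
      let ?S = "snd (C i) ` (K0 \<inter> Z i)"
      have Rc: "continuous_on (chart_image (C i)) (\<lambda>x. R i (chart_inv (C i) x))"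
        by (rule continuous_on_chart_function[OF M c Ri(1)])
      show ?thesis
      proof (rule has_vector_derivative_integral_compact_support[OF open_chart_image[OF M c], of ?S, OF _ _ _ _ _ _ t])
        show "compact ?S"
          using closed_Int_compactin[OF cl0 Zi(2)] Zi(1) by (intro compact_chart[OF M c]) auto
        show "?S \<subseteq> chart_image (C i)" using Zi by (auto simp: chart_image_def)
        show "((\<lambda>s. ?\<phi> i s x) has_vector_derivative ?\<phi>' i t x) (at t within {0..1})"
          if t: "t \<in> {0..1}" and x: "x \<in> chart_image (C i)" for t x
        proof -
          have "((\<lambda>s. At s (C i) x + (-1) * At 0 (C i) x) has_vector_derivative dA t (C i) x + 0) (at t within {0..1})"
            by (rule has_vector_derivative_add[OF dA_derivative(1)[OF t c x] has_vector_derivative_const])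
          then show ?thesis by (intro has_vector_derivative_mult_right) simp
        qed
        have "continuous_on ({0..1} \<times> chart_image (C i)) (\<lambda>z. R i (chart_inv (C i) (snd z)) * (\<lambda>(t, x). dA t (C i) x) z)"
          by (intro continuous_on_mult dA_continuous[OF c] continuous_on_compose2[OF Rc continuous_on_snd]) (auto intro: continuous_on_id)
        then show "continuous_on ({0..1} \<times> chart_image (C i)) (\<lambda>(t, x). ?\<phi>' i t x)"
          by (simp add: case_prod_unfold)
        show "continuous_on (chart_image (C i)) (?\<phi> i t)" if t: "t \<in> {0..1}" for t
          using density_At[OF t] density_At[of 0] c unfolding density_def
          by (intro continuous_on_mult Rc continuous_on_add continuous_on_const) auto
        show "?\<phi> i t x = 0" if t: "t \<in> {0..1}" and x: "x \<in> chart_image (C i) - ?S" for t x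
        proof (cases "chart_inv (C i) x \<in> K0")
          case True
          have "x \<in> chart_image (C i)" using x by blast
          then have "chart_inv (C i) x \<notin> K0 \<inter> Z i" using x chart_chart_inv[of x "C i"] by (metis DiffD2 image_eqI)
          then show ?thesis using True Ri(2) by simp
        next
          case False
          then show ?thesis using At_off[OF t c _ False] x by simp
        qed
      qed
    qed
    then have "((\<lambda>t. \<Sum>i\<in>I. integral (chart_image (C i)) (?\<phi> i t)) has_vector_derivative (\<Sum>i\<in>I. integral (chart_image (C i)) (?\<phi>' i t))) (at t within {0..1})"
      by (rule has_vector_derivative_sum)
    moreover have "J t = (\<Sum>i\<in>I. integral (chart_image (C i)) (?\<phi> i t))" if t: "t \<in> {0..1}" for t
      unfolding J_def chart_integral_def
      using W At_off[OF t] by (intro sum.cong refl integral_cong) (auto simp: weights_def)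
    moreover have "chart_integral I C R K0 (dA t) = (\<Sum>i\<in>I. integral (chart_image (C i)) (?\<phi>' i t))"
      unfolding chart_integral_def
      using W dA_off[OF t] by (intro sum.cong refl integral_cong) (auto simp: weights_def)
    ultimately show ?thesis
      using has_vector_derivative_transform[OF t, of J "\<lambda>t. \<Sum>i\<in>I. integral (chart_image (C i)) (?\<phi> i t)"] by simp
  qed
  have "((\<lambda>t. chart_integral I C R K0 (dA t)) has_integral (J 1 - J 0)) {0..1}"
    by (rule fundamental_theorem_of_calculus) (use J in auto)
  moreover have "J t = chart_integral I C R K0 (At t) + (-1) * chart_integral I C R K0 (At 0)" if t: "t \<in> {0..1}" for t
    unfolding J_def by (rule chart_integral_diff[OF M cl0 W density_At[OF t] density_At]) simp
  ultimately show ?thesis by simp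
qed

text \<open>The time derivative integrates to -(1 + a) times the inner integral of the Calabi
  functional; this sign is why the value at time 1 is subtracted from the value at time 0.\<close>

theorem calabi_eq:
  assumes a: "a \<noteq> -1"
  shows "calabi X L \<beta> \<Lambda> h = 1 / (a + 1) * integral_difference X L \<eta> (\<Lambda> 0) (\<Lambda> 1)"
proof -
  define P where "P = (SOME P. partition_of_unity_on L K0 P)"
  define Z where "Z i = function_support L (snd i)" for i :: "('l, real^'n::_) chart \<times> ('l \<Rightarrow> real)"
  have W: "weights L K0 P fst snd Z" unfolding P_def Z_def by (rule some_partition_weights[OF M HL K0])
  let ?F = "\<lambda>t. form_integral_over L K0 (pullback L X (f t) \<eta>)"
  let ?I = "\<lambda>t. form_integral (Nt t) (scale_form (h t) (pullback (Nt t) X (\<lambda>q. q) \<beta>))"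
  have F: "?F t = chart_integral P fst snd K0 (At t)" if "t \<in> {0..1}" for t
    using differential_form_pullback[OF M MX smooth_f[OF that] \<eta>_form]
    by (intro form_integral_over_eq[OF L K0 _ W]) (simp add: n)
  have "((\<lambda>t. (- 1 / (a + 1)) * chart_integral P fst snd K0 (dA t)) has_integral (- 1 / (a + 1)) * (?F 1 - ?F 0)) {0..1}"
    using chart_integral_dA_has_integral[OF W] F by (intro has_integral_mult_right) simp
  \<comment> \<open>Integrability in t of the inner integral is a conclusion here: it equals a
    multiple of the derivative of an integral that involves no Hamiltonian.\<close>
  then have "(?I has_integral (- 1 / (a + 1)) * (?F 1 - ?F 0)) {0..1}"
  proof (rule has_integral_eq[rotated])
    fix t :: real assume t: "t \<in> {0..1}"
    have "a + 1 \<noteq> 0" using a by linarith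
    then show "(- 1 / (a + 1)) * chart_integral P fst snd K0 (dA t) = ?I t"
      unfolding chart_integral_dA[OF t W] by (simp add: field_simps)
  qed
  then have "integral {0..1} ?I = (- 1 / (a + 1)) * (?F 1 - ?F 0)" by (rule integral_unique)
  moreover have "calabi X L \<beta> \<Lambda> h = integral {0..1} ?I"
    unfolding calabi_def Let_def by (rule integral_cong) (simp add: submanifold)
  moreover have "integral_difference X L \<eta> (\<Lambda> 0) (\<Lambda> 1) = ?F 0 - ?F 1"
    using \<eta>_form off[of 1]
    by (intro integral_difference_eq[OF L X _ lag lag in_class in_class K0]) (simp_all add: n)
  moreover have "- 1 / (a + 1) * (u - v) = 1 / (a + 1) * (v - u)" for u v :: real
    by (simp add: diff_divide_distrib)
  ultimately show ?thesis by (simp only:)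
qed

end

theorem theorem1p3:
  fixes X :: "('x, 'm::euclidean_space) manifold"
    and L :: "('l, real^'n::{finite,wellorder}) manifold"
    and \<omega> \<beta> lam gam :: "('x, 'm) form"
    and d :: "'x chain set"
    and f0 :: "'l \<Rightarrow> 'x"
    and c :: real
    and \<Lambda> :: "real \<Rightarrow> ('l \<Rightarrow> 'x) set"
    and h :: "real \<Rightarrow> 'x \<Rightarrow> real"
  assumes "symplectic_manifold X \<omega>"
    and "DIM('m) = 2 * CARD('n)"
    and "oriented_manifold L"
    and "d \<in> carrier (homology_group (int CARD('n)) (top_of X))"
    and "closed_form X CARD('n) \<beta>"
    and "form_eq X (2 + CARD('n)) (wedge 2 CARD('n) \<omega> \<beta>) zero_form"
    and "compact_space (top_of L) \<Longrightarrow> class_integral TYPE('n) X d \<beta> = 0"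
    and "differential_form X 1 lam"
    and "differential_form X (CARD('n) - 1) gam"
    and "c \<noteq> - 1"
    and "form_eq X 2 (exterior_derivative X lam) \<omega>"
    and "form_eq X CARD('n) (exterior_derivative X gam) \<beta>"
    and "form_eq X (1 + CARD('n)) (wedge 1 CARD('n) lam \<beta>)
           (scale_form (\<lambda>p. - c) (wedge 2 (CARD('n) - 1) \<omega> gam))"
    and "lagrangian_path X \<omega> L d f0 \<Lambda>"
    and "associated_hamiltonians X \<omega> L \<Lambda> h"
  shows "calabi X L \<beta> \<Lambda> h =
           1 / (c + 1) * integral_difference X L (wedge 1 (CARD('n) - 1) lam gam) (\<Lambda> 0) (\<Lambda> 1)
       \<and> (\<forall>\<Lambda>' h'. lagrangian_path X \<omega> L d f0 \<Lambda>' \<and> associated_hamiltonians X \<omega> L \<Lambda>' h' \<and>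
             \<Lambda>' 0 = \<Lambda> 0 \<and> \<Lambda>' 1 = \<Lambda> 1 \<longrightarrow> calabi X L \<beta> \<Lambda>' h' = calabi X L \<beta> \<Lambda> h)"
proof -
  have n: "CARD('n) = Suc (CARD('n) - 1)" by simp
  have X: "smooth_manifold X" and \<omega>: "differential_form X 2 \<omega>"
    using assms(1) unfolding symplectic_manifold_def closed_form_def by blast+
  have \<beta>: "differential_form X CARD('n) \<beta>" using assms(5) unfolding closed_form_def by blast
  \<comment> \<open>The formula is proved for an arbitrary path, because the second conjunct applies
    it to two paths with the same end points.\<close>
  have main: "calabi X L \<beta> \<Lambda> h =
      1 / (c + 1) * integral_difference X L (wedge 1 (CARD('n) - 1) lam gam) (\<Lambda> 0) (\<Lambda> 1)"
    if path: "lagrangian_path X \<omega> L d f0 \<Lambda>" and ham: "associated_hamiltonians X \<omega> L \<Lambda> h" for \<Lambda> h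
  proof -
    \<comment> \<open>The same \<open>SOME\<close> term as in \<open>path_derivative\<close>, so
      that the Hamiltonian equation speaks about this lifting.\<close>
    define f where "f = (SOME f. smooth_lifting X L \<Lambda> f)"
    have "\<exists>f. smooth_lifting X L \<Lambda> f" using path unfolding lagrangian_path_def by blast
    then have f: "smooth_lifting X L \<Lambda> f" unfolding f_def by (rule someI_ex)
    then obtain K0 where K0: "compactin (top_of L) K0" "\<forall>t\<in>{0..1}. \<forall>p\<in>points L - K0. f t p = f 0 p"
      unfolding smooth_lifting_def by blast
    have lag: "\<And>t. t \<in> {0..1} \<Longrightarrow> \<Lambda> t \<in> lagrangian_space X \<omega> L d f0"
      using path unfolding lagrangian_path_def by blast
    have "calabi_path X L \<omega> \<beta> lam gam d f0 c \<Lambda> h (CARD('n) - 1) f K0"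
    proof (rule calabi_path.intro[OF X assms(3) n \<omega> _ assms(8,9,11) _ _ lag f_def f ham K0(1)])
      show "differential_form X (Suc (CARD('n) - 1)) \<beta>" using \<beta> by simp
      show "form_eq X (Suc (CARD('n) - 1)) (exterior_derivative X gam) \<beta>" using assms(12) by simp
      show "form_eq X (1 + Suc (CARD('n) - 1)) (wedge 1 (Suc (CARD('n) - 1)) lam \<beta>)
          (scale_form (\<lambda>p. - c) (wedge 2 (CARD('n) - 1) \<omega> gam))" using assms(13) by simp
      show "f t p = f 0 p" if "t \<in> {0..1}" "p \<in> points L - K0" for t p using K0(2) that by blast
    qed
    from calabi_path.calabi_eq[OF this assms(10)] show ?thesis .
  qed
  show ?thesis
  proof (intro conjI allI impI, goal_cases)
    case 1
    show ?case by (rule main[OF assms(14,15)])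
  next
    case (2 \<Lambda>' h')
    note e = 2[THEN conjunct2, THEN conjunct2]
    show ?case
      unfolding main[OF 2[THEN conjunct1] 2[THEN conjunct2, THEN conjunct1]] main[OF assms(14,15)]
        e[THEN conjunct1] e[THEN conjunct2] ..
  qed
qed

end
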